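(* Let ${}_2Q$ be the queue length process of a fast renewal Mittag-Leffler queue with orders $\alpha,\beta\in(0,1)$ and rates $\lambda,\mu>0$. For $\delta>0$ let ${}_2\mathbf{Q}_n(t)=n^{-\delta}\,{}_2Q(nm_nt)$, where, with $\gamma=\max\{1,(\alpha+\beta)^{-1}\}$, $$m_n=\begin{cases}n^{\gamma-1}&\alpha+\beta\ne1,\\ \dfrac{n\sin(\pi\alpha)}{2\lambda\mu}\,\mathbb{E}\left[\sin\left(\dfrac{2\lambda\mu Y_1}{n\sin(\pi\alpha)}\right)\right]&\alpha+\beta=1.\end{cases}$$ Let $\mathbf{W}$ be a standard Brownian motion, and let $L_{\alpha+\beta}$ be an independent inverse $(\alpha+\beta)$-stable subordinator if $\alpha+\beta<1$, while $L_{\alpha+\beta}\equiv\iota$ if $\alpha+\beta\ge1$. Define $$\mathcal{K}=\begin{cases}\left(\dfrac{\lambda\mu\Gamma(1-\alpha)\Gamma(1-\beta)}{\Gamma(1-\alpha-\beta)}\right)^{\frac1{\alpha+\beta}}&\alpha+\beta<1,\\ 1&\alpha+\beta=1,\\ \dfrac{1}{\mathbb{E}[Y_1]}&\alpha+\beta>1.\end{cases}$$ Then, as $n\to+\infty$: (i) if $p>\frac12$, then for $\delta=1$ it holds ${}_2\mathbf{Q}_n\overset{\mathsf U}{\Rightarrow}(2p-1)L_{\alpha+\beta}\circ\iota_{\mathcal K}$; (ii) if $p=\frac12$, then for $\delta=\frac12$ it holds ${}_2\mathbf{Q}_n\overset{\mathsf U}{\Rightarrow}\Phi(\mathbf{W})\circ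 L_{\alpha+\beta}\circ\iota_{\mathcal K}$; (iii) if $p<\frac12$, then for any $\delta>0$ it holds $\lim_{n\to+\infty}\sup_{t\ge0}{}_2\mathbf{Q}_n(t)=0$ almost surely.
   Context: $E_\alpha(x)=\sum_{k\ge0} x^k/\Gamma(\alpha k+1)$ is the Mittag-Leffler function; $X\sim\mathsf{ML}_\alpha(\lambda)$ means $X\ge0$ and $\mathbb{P}(X>t)=E_\alpha(-\lambda t^\alpha)$ for $t\ge 0$. Let $p=\mathbb{P}(X^{(1)}<X^{(2)})$ with $X^{(1)}\sim \mathsf{ML}_\alpha(\lambda)$ and $X^{(2)}\sim\mathsf{ML}_\beta(\mu)$ independent. The fast renewal Mittag-Leffler queue: let $q=(q_k)_{k\ge0}$ be the Markov chain on the non-negative integers with $q_0=0$ and transition probabilities $0\to1$ with probability $1$, and, for $i\ge1$, $i\to i+1$ with probability $p$ and $i\to i-1$ with probability $1-p$. Let $(Y_k)_{k\ge1}$ be i.i.d. with $\mathbb{P}(Y_k>t)=E_\alpha(-\lambda t^\alpha)E_\beta(-\mu t^\beta)$, independent of $q$, and $\widetilde N(t)=\max\{k\ge0:\sum_{j=1}^kY_j\le t\}$. The queue length process is ${}_2Q(t)=q_{\widetilde N(t)}$. An $a$-stable subordinator $\sigma_a$ ($a\in(0,1)$) is the L\'evy process with $\mathbb{E}[e^{-z\sigma_a(t)}]=e^{-tz^a}$; its inverse is $L_a(t)=\min\{s\ge0:\sigma_a(s)\ge t\}$. $\iota_c(t)=ct$ and $\iota=\iota_1$. $\Phi(f)(t)=f(t)+\sup_{0\le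 s\le t}\max\{-f(s),0\}$ is the Skorokhod reflection map. $\overset{\mathsf U}{\Rightarrow}$ denotes convergence in distribution of processes in the space $\mathbb{D}$ of c\`adl\`ag functions $[0,+\infty)\to\mathbb{R}$ with the topology of uniform convergence on compact sets.
   Formalization: In (iii) the supremum over all t≥0 is replaced by the supremum over [0,T] for every T≥0 (almost surely for all T at once); over the whole half-line it is infinite, since for 0<p<1/2 the recurrent chain q is unbounded almost surely. *)

theory Defs
  imports "HOL-Probability.Probability"
begin

section \<open>Mittag-Leffler distributions and the fast renewal queue\<close>

definition mittag_leffler :: "real \<Rightarrow> real \<Rightarrow> real" where
  "mittag_leffler a x = (\<Sum>k. x ^ k / Gamma (a * real k + 1))"

definition mittag_leffler_distributed :: "'a measure \<Rightarrow> ('a \<Rightarrow> real) \<Rightarrow> real \<Rightarrow> real \<Rightarrow> bool" where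
  "mittag_leffler_distributed M X a r \<longleftrightarrow>
     X \<in> borel_measurable M \<and> (AE \<omega> in M. 0 \<le> X \<omega>) \<and>
     (\<forall>t\<ge>0. \<P>(\<omega> in M. X \<omega> > t) = mittag_leffler a (- r * t powr a))"

definition markov_chain :: "'a measure \<Rightarrow> (nat \<Rightarrow> 'a \<Rightarrow> nat) \<Rightarrow> (nat \<Rightarrow> nat \<Rightarrow> real) \<Rightarrow> bool" where
  "markov_chain M q P \<longleftrightarrow>
     (\<forall>k. q k \<in> measurable M (count_space UNIV)) \<and>
     (\<forall>k x y. \<P>(\<omega> in M. \<forall>j\<le>k. q j \<omega> = x j) > 0 \<longrightarrow>
        \<P>(\<omega> in M. q (Suc k) \<omega> = y \<bar> \<forall>j\<le>k. q j \<omega> = x j) = P (x k) y)"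

definition queue_transition :: "real \<Rightarrow> nat \<Rightarrow> nat \<Rightarrow> real" where
  "queue_transition p i j =
     (if i = 0 then (if j = 1 then 1 else 0)
      else if j = i + 1 then p
      else if j = i - 1 then 1 - p
      else 0)"

definition fast_renewal_ML_queue ::
  "'a measure \<Rightarrow> real \<Rightarrow> real \<Rightarrow> real \<Rightarrow> real \<Rightarrow> real \<Rightarrow>
   (nat \<Rightarrow> 'a \<Rightarrow> nat) \<Rightarrow> (nat \<Rightarrow> 'a \<Rightarrow> real) \<Rightarrow> bool" where
  "fast_renewal_ML_queue M \<alpha> \<beta> lam mu p q Y \<longleftrightarrow>
     markov_chain M q (queue_transition p) \<and> (AE \<omega> in M. q 0 \<omega> = 0) \<and>
     prob_space.indep_vars M (\<lambda>_. borel) Y {1..} \<and>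
     (\<forall>k\<ge>1. \<forall>t\<ge>0. \<P>(\<omega> in M. Y k \<omega> > t) =
        mittag_leffler \<alpha> (- lam * t powr \<alpha>) * mittag_leffler \<beta> (- mu * t powr \<beta>)) \<and>
     prob_space.indep_var M
       (Pi\<^sub>M UNIV (\<lambda>_. count_space UNIV)) (\<lambda>\<omega> k. q k \<omega>)
       (Pi\<^sub>M {1..} (\<lambda>_. borel)) (\<lambda>\<omega>. \<lambda>k\<in>{1..}. Y k \<omega>)"

definition renewal_count :: "(nat \<Rightarrow> 'a \<Rightarrow> real) \<Rightarrow> real \<Rightarrow> 'a \<Rightarrow> nat" where
  "renewal_count Y t \<omega> = Max {k. (\<Sum>j=1..k. Y j \<omega>) \<le> t}"

definition queue_length ::
  "(nat \<Rightarrow> 'a \<Rightarrow> nat) \<Rightarrow> (nat \<Rightarrow> 'a \<Rightarrow> real) \<Rightarrow> real \<Rightarrow> 'a \<Rightarrow> nat" where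
  "queue_length q Y t \<omega> = q (renewal_count Y t \<omega>) \<omega>"

definition time_scale ::
  "'a measure \<Rightarrow> real \<Rightarrow> real \<Rightarrow> real \<Rightarrow> real \<Rightarrow> (nat \<Rightarrow> 'a \<Rightarrow> real) \<Rightarrow> nat \<Rightarrow> real" where
  "time_scale M \<alpha> \<beta> lam mu Y n =
     (if \<alpha> + \<beta> \<noteq> 1 then real n powr (max 1 (1 / (\<alpha> + \<beta>)) - 1)
      else real n * sin (pi * \<alpha>) / (2 * lam * mu) *
           (\<integral>\<omega>. sin (2 * lam * mu * Y 1 \<omega> / (real n * sin (pi * \<alpha>))) \<partial>M))"

definition scaled_queue ::
  "'a measure \<Rightarrow> real \<Rightarrow> real \<Rightarrow> real \<Rightarrow> real \<Rightarrow> (nat \<Rightarrow> 'a \<Rightarrow> nat) \<Rightarrow> (nat \<Rightarrow> 'a \<Rightarrow> real) \<Rightarrow>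
   real \<Rightarrow> nat \<Rightarrow> real \<Rightarrow> 'a \<Rightarrow> real" where
  "scaled_queue M \<alpha> \<beta> lam mu q Y \<delta> n t \<omega> =
     real n powr (- \<delta>) *
     real (queue_length q Y (real n * time_scale M \<alpha> \<beta> lam mu Y n * t) \<omega>)"

definition limit_rate ::
  "'a measure \<Rightarrow> real \<Rightarrow> real \<Rightarrow> real \<Rightarrow> real \<Rightarrow> (nat \<Rightarrow> 'a \<Rightarrow> real) \<Rightarrow> real" where
  "limit_rate M \<alpha> \<beta> lam mu Y =
     (if \<alpha> + \<beta> < 1 then
        (lam * mu * Gamma (1 - \<alpha>) * Gamma (1 - \<beta>) / Gamma (1 - \<alpha> - \<beta>)) powr (1 / (\<alpha> + \<beta>))
      else if \<alpha> + \<beta> = 1 then 1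
      else 1 / (\<integral>\<omega>. Y 1 \<omega> \<partial>M))"


section \<open>The space \<open>\<D>\<close> with uniform convergence on compact sets\<close>

text \<open>A function on \<open>[0,\<infinity>)\<close> is encoded as a member of \<open>extensional {0..}\<close>.\<close>

definition cadlag_space :: "(real \<Rightarrow> real) set" where
  "cadlag_space = {x \<in> extensional {0..}. \<forall>t\<ge>0.
     (x \<longlongrightarrow> x t) (at_right t) \<and> (0 < t \<longrightarrow> (\<exists>l. (x \<longlongrightarrow> l) (at_left t)))}"

definition uc_open :: "(real \<Rightarrow> real) set \<Rightarrow> bool" where
  "uc_open U \<longleftrightarrow> U \<subseteq> cadlag_space \<and>
     (\<forall>x\<in>U. \<exists>T\<ge>0. \<exists>e>0. \<forall>y\<in>cadlag_space. (\<forall>t\<in>{0..T}. \<bar>y t - x t\<bar> < e) \<longrightarrow> y \<in> U)"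

definition U_topology :: "(real \<Rightarrow> real) topology" where
  "U_topology = topology uc_open"

lemma istopology_uc_open: "istopology uc_open"
  unfolding istopology_def
proof (intro conjI allI impI)
  fix S T assume S: "uc_open S" and T: "uc_open T"
  show "uc_open (S \<inter> T)"
    unfolding uc_open_def
  proof (intro conjI ballI)
    show "S \<inter> T \<subseteq> cadlag_space" using S by (auto simp: uc_open_def)
    fix x assume x: "x \<in> S \<inter> T"
    obtain A e where A: "A \<ge> 0" "e > 0"
      "\<forall>y\<in>cadlag_space. (\<forall>t\<in>{0..A}. \<bar>y t - x t\<bar> < e) \<longrightarrow> y \<in> S"
      using S x unfolding uc_open_def by blast
    obtain B d where B: "B \<ge> 0" "d > 0"
      "\<forall>y\<in>cadlag_space. (\<forall>t\<in>{0..B}. \<bar>y t - x t\<bar> < d) \<longrightarrow> y \<in> T"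
      using T x unfolding uc_open_def by blast
    have "\<forall>y\<in>cadlag_space. (\<forall>t\<in>{0..max A B}. \<bar>y t - x t\<bar> < min e d) \<longrightarrow> y \<in> S \<inter> T"
    proof (intro ballI impI)
      fix y assume y: "y \<in> cadlag_space"
        and "\<forall>t\<in>{0..max A B}. \<bar>y t - x t\<bar> < min e d"
      hence "\<forall>t\<in>{0..A}. \<bar>y t - x t\<bar> < e" "\<forall>t\<in>{0..B}. \<bar>y t - x t\<bar> < d" by auto
      thus "y \<in> S \<inter> T" using A(3) B(3) y by blast
    qed
    thus "\<exists>T'\<ge>0. \<exists>e>0. \<forall>y\<in>cadlag_space. (\<forall>t\<in>{0..T'}. \<bar>y t - x t\<bar> < e) \<longrightarrow> y \<in> S \<inter> T"
      using A(1,2) B(1,2) by (intro exI[of _ "max A B"] conjI exI[of _ "min e d"]) auto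
  qed
next
  fix K assume K: "\<forall>S\<in>K. uc_open S"
  show "uc_open (\<Union>K)"
    unfolding uc_open_def
  proof (intro conjI ballI)
    show "\<Union>K \<subseteq> cadlag_space" using K by (auto simp: uc_open_def)
    fix x assume "x \<in> \<Union>K"
    then obtain S where S: "S \<in> K" "x \<in> S" by blast
    then obtain A e where "A \<ge> 0" "e > 0"
      "\<forall>y\<in>cadlag_space. (\<forall>t\<in>{0..A}. \<bar>y t - x t\<bar> < e) \<longrightarrow> y \<in> S"
      using K unfolding uc_open_def by blast
    thus "\<exists>T\<ge>0. \<exists>e>0. \<forall>y\<in>cadlag_space. (\<forall>t\<in>{0..T}. \<bar>y t - x t\<bar> < e) \<longrightarrow> y \<in> \<Union>K"
      using S by blast
  qed
qed

lemma openin_U_topology: "openin U_topology U \<longleftrightarrow> uc_open U"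
  by (simp add: U_topology_def istopology_uc_open topology_inverse')

lemma topspace_U_topology: "topspace U_topology = cadlag_space"
proof -
  have "uc_open cadlag_space" by (auto simp: uc_open_def intro!: exI[of _ 1])
  moreover have "uc_open U \<Longrightarrow> U \<subseteq> cadlag_space" for U by (simp add: uc_open_def)
  ultimately show ?thesis unfolding topspace_def openin_U_topology by blast
qed

lemma limitin_U_topology:
  "limitin U_topology f x F \<longleftrightarrow>
     x \<in> cadlag_space \<and> (\<forall>\<^sub>F i in F. f i \<in> cadlag_space) \<and>
     (\<forall>T\<ge>0. uniform_limit {0..T} f x F)"
proof (intro iffI conjI allI impI)
  assume L: "limitin U_topology f x F"
  show x: "x \<in> cadlag_space" using L by (simp add: limitin_def topspace_U_topology)
  show "\<forall>\<^sub>F i in F. f i \<in> cadlag_space"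
    using L openin_topspace[of U_topology] by (simp add: limitin_def topspace_U_topology)
  fix T :: real assume T: "T \<ge> 0"
  show "uniform_limit {0..T} f x F"
  proof (rule uniform_limitI)
    fix e :: real assume e: "e > 0"
    define V where "V = {y \<in> cadlag_space. \<exists>r<e. \<forall>t\<in>{0..T}. \<bar>y t - x t\<bar> \<le> r}"
    have "uc_open V"
      unfolding uc_open_def
    proof (intro conjI ballI)
      show "V \<subseteq> cadlag_space" by (auto simp: V_def)
      fix y assume "y \<in> V"
      then obtain r where r: "r < e" "\<forall>t\<in>{0..T}. \<bar>y t - x t\<bar> \<le> r" by (auto simp: V_def)
      show "\<exists>T'\<ge>0. \<exists>d>0. \<forall>z\<in>cadlag_space. (\<forall>t\<in>{0..T'}. \<bar>z t - y t\<bar> < d) \<longrightarrow> z \<in> V"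
      proof (rule exI[of _ T], rule conjI[OF T], rule exI[of _ "(e - r) / 2"],
          intro conjI ballI impI)
        fix z assume z: "z \<in> cadlag_space" "\<forall>t\<in>{0..T}. \<bar>z t - y t\<bar> < (e - r) / 2"
        have "\<bar>z t - x t\<bar> \<le> (e + r) / 2" if "t \<in> {0..T}" for t
        proof -
          have "\<bar>z t - y t\<bar> < (e - r) / 2" "\<bar>y t - x t\<bar> \<le> r" using that z r by auto
          moreover have "\<bar>z t - x t\<bar> \<le> \<bar>z t - y t\<bar> + \<bar>y t - x t\<bar>"
            using abs_triangle_ineq[of "z t - y t" "y t - x t"] by simp
          ultimately show ?thesis by argo
        qed
        thus "z \<in> V" using z(1) r(1) by (auto simp: V_def intro!: exI[of _ "(e + r) / 2"])
      qed (use r in auto)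
    qed
    moreover have "x \<in> V" using x e by (auto simp: V_def intro!: exI[of _ 0])
    ultimately have "\<forall>\<^sub>F i in F. f i \<in> V"
      using L by (simp add: limitin_def openin_U_topology)
    thus "\<forall>\<^sub>F i in F. \<forall>t\<in>{0..T}. dist (f i t) (x t) < e"
      by eventually_elim (force simp: V_def dist_real_def)
  qed
next
  assume *: "x \<in> cadlag_space \<and> (\<forall>\<^sub>F i in F. f i \<in> cadlag_space) \<and>
    (\<forall>T\<ge>0. uniform_limit {0..T} f x F)"
  show "limitin U_topology f x F"
    unfolding limitin_def topspace_U_topology openin_U_topology
  proof (intro conjI allI impI)
    show "x \<in> cadlag_space" using * by simp
    fix U assume U: "uc_open U \<and> x \<in> U"
    then obtain T e where T: "T \<ge> 0" "e > 0"
      "\<forall>y\<in>cadlag_space. (\<forall>t\<in>{0..T}. \<bar>y t - x t\<bar> < e) \<longrightarrow> y \<in> U"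
      unfolding uc_open_def by blast
    have "\<forall>\<^sub>F i in F. \<forall>t\<in>{0..T}. dist (f i t) (x t) < e"
      using * T by (auto dest!: spec[of _ T] uniform_limitD)
    moreover have "\<forall>\<^sub>F i in F. f i \<in> cadlag_space" using * by simp
    ultimately show "\<forall>\<^sub>F i in F. f i \<in> U"
      by eventually_elim (use T(3) in \<open>auto simp: dist_real_def\<close>)
  qed
qed

definition sample_path :: "(real \<Rightarrow> 'a \<Rightarrow> real) \<Rightarrow> 'a \<Rightarrow> real \<Rightarrow> real" where
  "sample_path X \<omega> = (\<lambda>t\<in>{0..}. X t \<omega>)"

text \<open>\<open>\<D>\<close> carries the \<open>\<sigma>\<close>-algebra generated by the coordinate projections.  The Borel
  \<open>\<sigma>\<close>-algebra of the (non-separable) uniform topology is strictly larger, and a process that jumps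
  at random times is in general not measurable with respect to it.\<close>

definition cadlag_measure :: "(real \<Rightarrow> real) measure" where
  "cadlag_measure = restrict_space (Pi\<^sub>M {0..} (\<lambda>_. borel)) cadlag_space"

text \<open>Paths are only required to be cadlag almost surely; the completion keeps events and
  integrands measurable whatever happens on the exceptional null set.\<close>

definition cadlag_process :: "'a measure \<Rightarrow> (real \<Rightarrow> 'a \<Rightarrow> real) \<Rightarrow> bool" where
  "cadlag_process M X \<longleftrightarrow>
     (\<forall>t\<ge>0. X t \<in> borel_measurable (completion M)) \<and> (AE \<omega> in M. sample_path X \<omega> \<in> cadlag_space)"

text \<open>Convergence in distribution for the topology of uniform convergence on compact sets, tested
  on bounded continuous functionals that are measurable for the projection \<open>\<sigma>\<close>-algebra.
  Only the tail of the sequence has to consist of cadlag processes.\<close>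

definition converges_in_distribution_U ::
  "'a measure \<Rightarrow> (nat \<Rightarrow> real \<Rightarrow> 'a \<Rightarrow> real) \<Rightarrow> 'b measure \<Rightarrow> (real \<Rightarrow> 'b \<Rightarrow> real) \<Rightarrow> bool" where
  "converges_in_distribution_U M X N Z \<longleftrightarrow>
     (\<forall>\<^sub>F n in sequentially. cadlag_process M (X n)) \<and> cadlag_process N Z \<and>
     (\<forall>f. continuous_map U_topology euclideanreal f \<longrightarrow> f \<in> borel_measurable cadlag_measure \<longrightarrow>
        bounded (f ` cadlag_space) \<longrightarrow>
        (\<lambda>n. \<integral>\<omega>. f (sample_path (X n) \<omega>) \<partial>completion M)
          \<longlonglongrightarrow> (\<integral>\<omega>. f (sample_path Z \<omega>) \<partial>completion N))"


section \<open>Limit processes\<close>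

definition independent_increments :: "'a measure \<Rightarrow> (real \<Rightarrow> 'a \<Rightarrow> real) \<Rightarrow> bool" where
  "independent_increments M X \<longleftrightarrow>
     (\<forall>(m::nat) (t::nat \<Rightarrow> real). 0 \<le> t 0 \<longrightarrow> mono t \<longrightarrow>
        prob_space.indep_vars M (\<lambda>_. borel) (\<lambda>i \<omega>. X (t (Suc i)) \<omega> - X (t i) \<omega>) {..<m})"

definition standard_brownian_motion :: "'a measure \<Rightarrow> (real \<Rightarrow> 'a \<Rightarrow> real) \<Rightarrow> bool" where
  "standard_brownian_motion M W \<longleftrightarrow>
     (\<forall>t\<ge>0. W t \<in> borel_measurable M) \<and> (AE \<omega> in M. W 0 \<omega> = 0) \<and>
     independent_increments M W \<and>
     (\<forall>s t. 0 \<le> s \<longrightarrow> s < t \<longrightarrow>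
        distributed M lborel (\<lambda>\<omega>. W t \<omega> - W s \<omega>) (normal_density 0 (sqrt (t - s)))) \<and>
     (AE \<omega> in M. continuous_on {0..} (\<lambda>t. W t \<omega>))"

definition levy_process :: "'a measure \<Rightarrow> (real \<Rightarrow> 'a \<Rightarrow> real) \<Rightarrow> bool" where
  "levy_process M X \<longleftrightarrow>
     (\<forall>t\<ge>0. X t \<in> borel_measurable M) \<and> (AE \<omega> in M. X 0 \<omega> = 0) \<and>
     independent_increments M X \<and>
     (\<forall>s\<ge>0. \<forall>t\<ge>0. distr M borel (\<lambda>\<omega>. X (s + t) \<omega> - X s \<omega>) = distr M borel (X t)) \<and>
     (AE \<omega> in M. sample_path X \<omega> \<in> cadlag_space)"

definition stable_subordinator :: "'a measure \<Rightarrow> real \<Rightarrow> (real \<Rightarrow> 'a \<Rightarrow> real) \<Rightarrow> bool" where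
  "stable_subordinator M a S \<longleftrightarrow>
     levy_process M S \<and>
     (\<forall>t\<ge>0. \<forall>z\<ge>0. integrable M (\<lambda>\<omega>. exp (- z * S t \<omega>)) \<and>
        (\<integral>\<omega>. exp (- z * S t \<omega>) \<partial>M) = exp (- t * z powr a))"

definition inverse_stable_subordinator :: "'a measure \<Rightarrow> real \<Rightarrow> (real \<Rightarrow> 'a \<Rightarrow> real) \<Rightarrow> bool" where
  "inverse_stable_subordinator M a L \<longleftrightarrow>
     (\<exists>S. stable_subordinator M a S \<and>
        (AE \<omega> in M. \<forall>t\<ge>0. L t \<omega> = (LEAST s. 0 \<le> s \<and> t \<le> S s \<omega>)))"

definition independent_processes ::
  "'a measure \<Rightarrow> (real \<Rightarrow> 'a \<Rightarrow> real) \<Rightarrow> (real \<Rightarrow> 'a \<Rightarrow> real) \<Rightarrow> bool" where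
  "independent_processes M X Z \<longleftrightarrow>
     prob_space.indep_var M (Pi\<^sub>M {0..} (\<lambda>_. borel)) (sample_path X) (Pi\<^sub>M {0..} (\<lambda>_. borel)) (sample_path Z)"

definition skorokhod_reflection :: "(real \<Rightarrow> real) \<Rightarrow> real \<Rightarrow> real" where
  "skorokhod_reflection f t = f t + (SUP s\<in>{0..t}. max (- f s) 0)"

end

theory Submission
  imports Defs "HOL-Real_Asymp.Real_Asymp"
begin

text \<open>With \<open>c\<^sub>n = n m\<^sub>n\<close>, everything about the interarrival times enters through the limit
  \<open>n (1 - E exp (- z Y\<^sub>1 / c\<^sub>n)) \<rightarrow> (z / K) powr min 1 (\<alpha> + \<beta>)\<close>. The tail of a Mittag-Leffler law is
  regularly varying by a Karamata argument on its Laplace transform, hence so is the product tail of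
  \<open>Y\<^sub>1\<close>; for \<open>\<alpha> + \<beta> = 1\<close> the sine in \<open>m\<^sub>n\<close> acts as a truncated mean.

  Up to a bounded error the embedded chain is a simple random walk reflected at 0. Cut the steps into
  blocks of about \<open>n / m\<close>. Over each block the walk and the renewal epochs have independent increments
  which converge in law, as \<open>n \<rightarrow> \<infinity>\<close>, to those of the drift or Brownian motion and of the subordinator.
  With high probability the rescaled queue is uniformly close to the polygon that has the reflected
  walk at the block ends as heights and the corresponding renewal epochs as knots. Such a polygon is a
  continuous function of its heights and knots, so for fixed \<open>m\<close> a Skorokhod representation of
  the increments handles the limit in \<open>n\<close>; as \<open>m \<rightarrow> \<infinity>\<close> the limiting polygons converge
  almost surely to the claimed process, because the inverse of a strictly increasing subordinator is
  continuous.

  For \<open>p < 1/2\<close> the chain has bounded exponential moments while only polynomially many steps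
  occur up to time \<open>c\<^sub>n T\<close>, and the Borel-Cantelli lemma applies.\<close>

section \<open>Weak convergence from Laplace transforms\<close>

text \<open>The uniform topology on the path space is not separable and the test functionals are
  measurable only for the projections, so neither a portmanteau theorem nor a Skorokhod
  representation is at hand for the paths themselves. Polygons evade this: they are parametrised by
  pairs of real sequences, where product and Borel sigma-algebras agree, and a representation of
  single increments, copied independently over the blocks, suffices. The three ranges of \<alpha> +
  \<beta> merge in the exponent (z / K)^\<kappa> with \<kappa> = min 1 (\<alpha> + \<beta>).
  Independence is granted for W and L, not for the subordinator S behind L, so S is rebuilt from L
  path by path. The queue lives on an arbitrary probability space, but the assertions depend only on
  the joint law of chain and interarrival times; hence the work is done on a product of coin tosses
  and an i.i.d. sequence. Positivity and monotonicity of the Mittag-Leffler tails are read off from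
  the variables that have these tails, which spares the theory of completely monotone
  functions.\<close>

lemma tendsto_uniform_approx:
  fixes a :: "nat \<Rightarrow> real"
  assumes "\<And>e. e > 0 \<Longrightarrow> \<exists>b l'. (\<forall>n. \<bar>a n - b n\<bar> \<le> e) \<and> \<bar>l - l'\<bar> \<le> e \<and> b \<longlonglongrightarrow> l'"
  shows "a \<longlonglongrightarrow> l"
proof (rule tendstoI)
  fix e :: real assume e: "e > 0"
  obtain b l' where b: "\<And>n. \<bar>a n - b n\<bar> \<le> e/4" "\<bar>l - l'\<bar> \<le> e/4" "b \<longlonglongrightarrow> l'"
    using assms[of "e/4"] e by auto
  have "\<forall>\<^sub>F n in sequentially. dist (b n) l' < e/4" using b(3) e by (intro tendstoD) auto
  thus "\<forall>\<^sub>F n in sequentially. dist (a n) l < e"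
  proof eventually_elim
    case (elim n) thus ?case using b(1)[of n] b(2) unfolding dist_real_def by linarith
  qed
qed

text \<open>Weierstrass approximation: on [0,1] a continuous test function is uniformly close to a
  polynomial, whose integral is a finite combination of moments. Closeness is uniform over all laws
  on [0,1], so the limits in n and in the degree can be exchanged.\<close>

lemma moments_weak_conv_unit_interval:
  fixes \<mu> :: "nat \<Rightarrow> real measure" and \<nu> :: "real measure"
  assumes \<mu>: "\<And>n. real_distribution (\<mu> n)" and \<nu>: "real_distribution \<nu>"
    and s\<mu>: "\<And>n. AE x in \<mu> n. x \<in> {0..1}" and s\<nu>: "AE x in \<nu>. x \<in> {0..1}"
    and mom: "\<And>k::nat. (\<lambda>n. \<integral>x. x ^ k \<partial>\<mu> n) \<longlonglongrightarrow> (\<integral>x. x ^ k \<partial>\<nu>)"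
  shows "weak_conv_m \<mu> \<nu>"
proof (rule integral_bdd_continuous_conv_imp_weak_conv[OF \<mu> \<nu>])
  fix f :: "real \<Rightarrow> real"
  assume cf: "\<And>x. isCont f x" and bf: "\<And>x. \<bar>f x\<bar> \<le> 1"
  have f_meas[measurable]: "f \<in> borel_measurable borel"
    using cf by (intro borel_measurable_continuous_onI continuous_at_imp_continuous_on) auto
  show "(\<lambda>n. integral\<^sup>L (\<mu> n) f) \<longlonglongrightarrow> integral\<^sup>L \<nu> f"
  proof (rule tendsto_uniform_approx)
    fix e :: real assume e: "e > 0"
    have "continuous_on {0..1} f" using cf by (intro continuous_at_imp_continuous_on) auto
    then obtain g where g: "real_polynomial_function g" "\<And>x. x \<in> {0..1} \<Longrightarrow> \<bar>f x - g x\<bar> < e"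
      using Stone_Weierstrass_real_polynomial_function[of "{0..1::real}" f e] e by auto
    obtain a d where ad: "g = (\<lambda>x. \<Sum>i\<le>d. a i * x ^ i)"
      using g(1) by (auto simp: real_polynomial_function_iff_sum)
    have int_pow: "integrable m (\<lambda>x. x ^ i)" if "real_distribution m" "AE x in m. x \<in> {0..1}" for m i
    proof -
      interpret m: real_distribution m by fact
      show ?thesis using that(2)
        by (intro m.integrable_const_bound[where B=1]) (auto simp: power_le_one)
    qed
    have close: "\<bar>integral\<^sup>L m f - integral\<^sup>L m g\<bar> \<le> e"
      if m: "real_distribution m" "AE x in m. x \<in> {0..1}" for m
    proof -
      interpret m: real_distribution m by fact
      have ig: "integrable m g" unfolding ad using int_pow[OF m] by auto
      have if': "integrable m f" using bf by (intro m.integrable_const_bound[where B=1]) auto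
      have "\<bar>integral\<^sup>L m f - integral\<^sup>L m g\<bar> = \<bar>\<integral>x. f x - g x \<partial>m\<bar>"
        using if' ig by simp
      also have "\<dots> \<le> (\<integral>x. \<bar>f x - g x\<bar> \<partial>m)" by (rule integral_abs_bound)
      also have "\<dots> \<le> (\<integral>x. e \<partial>m)"
      proof (rule integral_mono_AE)
        show "AE x in m. \<bar>f x - g x\<bar> \<le> e" using m(2)
          by eventually_elim (use g(2) in \<open>auto simp: less_imp_le\<close>)
      qed (use if' ig in auto)
      also have "\<dots> = e" using m.prob_space by (simp add: m.prob_space)
      finally show ?thesis .
    qed
    have intg: "integral\<^sup>L m g = (\<Sum>i\<le>d. a i * (\<integral>x. x ^ i \<partial>m))"
      if m: "real_distribution m" "AE x in m. x \<in> {0..1}" for m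
      unfolding ad using int_pow[OF m] by (simp add: integral_sum)
    have "(\<lambda>n. integral\<^sup>L (\<mu> n) g) \<longlonglongrightarrow> integral\<^sup>L \<nu> g"
      unfolding intg[OF \<mu> s\<mu>] intg[OF \<nu> s\<nu>] by (intro tendsto_intros mom)
    thus "\<exists>b l'. (\<forall>n. \<bar>integral\<^sup>L (\<mu> n) f - b n\<bar> \<le> e) \<and> \<bar>integral\<^sup>L \<nu> f - l'\<bar> \<le> e \<and> b \<longlonglongrightarrow> l'"
      using close[OF \<mu> s\<mu>] close[OF \<nu> s\<nu>]
      by (intro exI[of _ "\<lambda>n. integral\<^sup>L (\<mu> n) g"] exI[of _ "integral\<^sup>L \<nu> g"]) auto
  qed
qed

text \<open>The map x -> exp (-x) sends the half-line into [0,1] and turns Laplace transforms at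
  natural numbers into moments, so the moment criterion applies to the images.\<close>

lemma laplace_weak_conv:
  fixes \<mu> :: "nat \<Rightarrow> real measure" and \<nu> :: "real measure"
  assumes \<mu>: "\<And>n. real_distribution (\<mu> n)" and \<nu>: "real_distribution \<nu>"
    and s\<mu>: "\<And>n. AE x in \<mu> n. 0 \<le> x" and s\<nu>: "AE x in \<nu>. 0 \<le> x"
    and lap: "\<And>k::nat. (\<lambda>n. \<integral>x. exp (- real k * x) \<partial>\<mu> n) \<longlonglongrightarrow> (\<integral>x. exp (- real k * x) \<partial>\<nu>)"
  shows "weak_conv_m \<mu> \<nu>"
proof (rule integral_bdd_continuous_conv_imp_weak_conv[OF \<mu> \<nu>])
  fix f :: "real \<Rightarrow> real"
  assume cf: "\<And>x. isCont f x" and bf: "\<And>x. \<bar>f x\<bar> \<le> 1"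
  have f_meas[measurable]: "f \<in> borel_measurable borel"
    using cf by (intro borel_measurable_continuous_onI continuous_at_imp_continuous_on) auto
  define E where "E m = distr m borel (\<lambda>x::real. exp (-x))" for m
  have rd: "real_distribution (E m)" if "real_distribution m" for m
  proof -
    interpret m: real_distribution m by fact
    show ?thesis unfolding E_def by (rule m.real_distribution_distr) auto
  qed
  have sE: "AE x in E m. x \<in> {0..1}" if "real_distribution m" "AE x in m. 0 \<le> x" for m
  proof -
    interpret m: real_distribution m by fact
    show ?thesis unfolding E_def using that(2) by (subst AE_distr_iff) auto
  qed
  have iE: "(\<integral>x. h x \<partial>E m) = (\<integral>x. h (exp (-x)) \<partial>m)"
    if "real_distribution m" "h \<in> borel_measurable borel" for m and h :: "real \<Rightarrow> real"
  proof -
    interpret m: real_distribution m by fact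
    show ?thesis unfolding E_def using that(2) by (subst integral_distr) auto
  qed
  have wc: "weak_conv_m (\<lambda>n. E (\<mu> n)) (E \<nu>)"
  proof (rule moments_weak_conv_unit_interval)
    fix k :: nat
    show "(\<lambda>n. \<integral>x. x ^ k \<partial>E (\<mu> n)) \<longlonglongrightarrow> (\<integral>x. x ^ k \<partial>E \<nu>)"
      using lap[of k] by (subst iE[OF \<mu>], simp, subst iE[OF \<nu>], simp)
        (simp add: exp_of_nat_mult[symmetric])
  qed (use rd sE \<mu> \<nu> s\<mu> s\<nu> in auto)
  \<comment> \<open>Transport back by y -> - ln y. This map is discontinuous only on
    \<open>{..0}\<close>, which the image of \<nu> does not charge because exp (-x) > 0.\<close>
  have "(\<lambda>n. \<integral>y. f (- ln y) \<partial>E (\<mu> n)) \<longlonglongrightarrow> (\<integral>y. f (- ln y) \<partial>E \<nu>)"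
  proof (rule weak_conv_imp_bdd_ae_continuous_conv[OF rd[OF \<mu>] rd[OF \<nu>] wc, where B=1])
    interpret n: real_distribution \<nu> by (rule \<nu>)
    have sub: "{y. \<not> isCont (\<lambda>y. f (- ln y)) y} \<subseteq> {..0}"
    proof (rule subsetI, rule ccontr)
      fix y :: real assume y: "y \<in> {y. \<not> isCont (\<lambda>y. f (- ln y)) y}" "y \<notin> {..0}"
      hence "y > 0" by auto
      hence "isCont (\<lambda>y. f (- ln y)) y"
        by (intro isCont_o2[where g=f and f="\<lambda>y. - ln y"] cf continuous_intros) auto
      thus False using y by auto
    qed
    have "emeasure (E \<nu>) {y. \<not> isCont (\<lambda>y. f (- ln y)) y} \<le> emeasure (E \<nu>) {..0}"
      by (rule emeasure_mono[OF sub]) (auto simp: E_def)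
    also have "\<dots> = 0" unfolding E_def by (subst emeasure_distr) (auto simp: vimage_def not_le)
    finally show "emeasure (E \<nu>) {y. \<not> isCont (\<lambda>y. f (- ln y)) y} = 0" by simp
  qed (use bf in auto)
  thus "(\<lambda>n. integral\<^sup>L (\<mu> n) f) \<longlonglongrightarrow> integral\<^sup>L \<nu> f"
    using iE[OF \<mu>, of "\<lambda>y. f (- ln y)"] iE[OF \<nu>, of "\<lambda>y. f (- ln y)"] by simp
qed

section \<open>The Mittag-Leffler function\<close>

text \<open>Log-convexity of Gamma: x + 1 is the convex combination of x + a and x + a + 1 with
  weights a and 1 - a. Together with the functional equation this is a Wendel-type bound.\<close>

lemma Gamma_quotient_le:
  fixes x a :: real
  assumes "0 < a" "a < 1" "0 < x"
  shows "Gamma x / Gamma (x + a) \<le> (x + a) powr (1 - a) / x"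
proof -
  have pos: "Gamma (x + a) > 0" "Gamma x > 0" "Gamma (x + a + 1) > 0" "Gamma (x + 1) > 0"
    using assms by (auto intro!: Gamma_real_pos)
  have "(ln \<circ> Gamma) ((1 - (1 - a)) *\<^sub>R (x + a) + (1 - a) *\<^sub>R (x + a + 1)) \<le>
      (1 - (1 - a)) * (ln \<circ> Gamma) (x + a) + (1 - a) * (ln \<circ> Gamma) (x + a + 1)"
    by (rule convex_onD[OF log_convex_Gamma_real]) (use assms in auto)
  moreover have "(1 - (1 - a)) *\<^sub>R (x + a) + (1 - a) *\<^sub>R (x + a + 1) = x + 1"
    by (simp add: algebra_simps)
  ultimately have 1: "ln (Gamma (x + 1)) \<le> a * ln (Gamma (x + a)) + (1 - a) * ln (Gamma (x + a + 1))"
    by simp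
  have "Gamma (x + a + 1) = (x + a) * Gamma (x + a)"
    using assms by (intro Gamma_plus1) auto
  hence "ln (Gamma (x + a + 1)) = ln (x + a) + ln (Gamma (x + a))"
    using ln_mult_pos[of "x + a" "Gamma (x + a)"] assms pos by simp
  with 1 have "ln (Gamma (x + 1)) \<le> ln (Gamma (x + a)) + (1 - a) * ln (x + a)"
    by (simp add: algebra_simps)
  also have "\<dots> = ln (Gamma (x + a) * (x + a) powr (1 - a))"
    using ln_mult_pos[of "Gamma (x + a)" "(x + a) powr (1 - a)"] assms pos by (simp add: ln_powr)
  finally have "Gamma (x + 1) \<le> Gamma (x + a) * (x + a) powr (1 - a)"
    using assms pos by (subst (asm) ln_le_cancel_iff) auto
  moreover have "Gamma (x + 1) = x * Gamma x" using assms by (intro Gamma_plus1) auto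
  ultimately show ?thesis using assms pos by (simp add: field_simps)
qed

text \<open>The quotient is that of successive coefficients of the Mittag-Leffler series and decays
  like k^(-a), so the ratio test works for every argument.\<close>

lemma mittag_leffler_coeff_ratio:
  fixes a :: real
  assumes "0 < a" "a < 1"
  shows "(\<lambda>k. Gamma (a * real k + 1) / Gamma (a * real (Suc k) + 1)) \<longlonglongrightarrow> 0"
proof (rule tendsto_sandwich[where f="\<lambda>_. 0" and h="\<lambda>k. (a * real k + 1 + a) powr (1 - a) / (a * real k + 1)"])
  show "\<forall>\<^sub>F k in sequentially. 0 \<le> Gamma (a * real k + 1) / Gamma (a * real (Suc k) + 1)"
    using assms by (intro always_eventually allI divide_nonneg_nonneg less_imp_le[OF Gamma_real_pos] add_nonneg_pos) auto
  show "\<forall>\<^sub>F k in sequentially. Gamma (a * real k + 1) / Gamma (a * real (Suc k) + 1)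
      \<le> (a * real k + 1 + a) powr (1 - a) / (a * real k + 1)"
  proof (intro always_eventually allI)
    fix k :: nat
    have "a * real (Suc k) + 1 = (a * real k + 1) + a" by (simp add: algebra_simps)
    thus "Gamma (a * real k + 1) / Gamma (a * real (Suc k) + 1)
      \<le> (a * real k + 1 + a) powr (1 - a) / (a * real k + 1)"
      using Gamma_quotient_le[of a "a * real k + 1"] assms by (simp only:) (simp add: add_nonneg_pos)
  qed
  show "(\<lambda>k. (a * real k + 1 + a) powr (1 - a) / (a * real k + 1)) \<longlonglongrightarrow> 0"
    using assms by real_asymp
qed simp

lemma Gamma_coeff_pos: "0 < a \<Longrightarrow> Gamma (a * real k + 1 :: real) > 0"
  by (intro Gamma_real_pos add_nonneg_pos) auto

lemma summable_mittag_leffler: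
  fixes a x :: real
  assumes a: "0 < a" "a < 1"
  shows "summable (\<lambda>k. norm (x ^ k / Gamma (a * real k + 1)))"
proof -
  have pos: "Gamma (a * real k + 1) > 0" for k using Gamma_coeff_pos[OF a(1)] .
  have "(\<lambda>k. \<bar>x\<bar> * (Gamma (a * real k + 1) / Gamma (a * real (Suc k) + 1))) \<longlonglongrightarrow> \<bar>x\<bar> * 0"
    by (intro tendsto_mult tendsto_const mittag_leffler_coeff_ratio a)
  hence "\<forall>\<^sub>F k in sequentially. \<bar>x\<bar> * (Gamma (a * real k + 1) / Gamma (a * real (Suc k) + 1)) < 1/2"
    by (intro order_tendstoD) auto
  then obtain N where N: "\<And>k. k \<ge> N \<Longrightarrow>
      \<bar>x\<bar> * (Gamma (a * real k + 1) / Gamma (a * real (Suc k) + 1)) < 1/2"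
    by (auto simp: eventually_sequentially)
  show ?thesis
  proof (rule summable_ratio_test[of "1/2" N])
    fix k assume k: "k \<ge> N"
    have eq: "norm (x ^ Suc k / Gamma (a * real (Suc k) + 1)) =
       (\<bar>x\<bar> * (Gamma (a * real k + 1) / Gamma (a * real (Suc k) + 1))) *
        norm (x ^ k / Gamma (a * real k + 1))"
      using pos[of k] pos[of "Suc k"] by (simp add: abs_mult power_abs)
    have nn: "norm (norm y) = norm y" for y :: real by simp
    show "norm (norm (x ^ Suc k / Gamma (a * real (Suc k) + 1))) \<le>
        1/2 * norm (norm (x ^ k / Gamma (a * real k + 1)))"
      unfolding nn unfolding eq using N[OF k] by (intro mult_right_mono) auto
  qed simp
qed

section \<open>Fractional integral equation and Laplace transform of the Mittag-Leffler
  function\<close>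

lemma has_bochner_integral_Beta:
  fixes a b :: real
  assumes "a > 0" "b > 0"
  shows "has_bochner_integral lborel
    (\<lambda>s. indicator {0<..<1} s * (s powr (a - 1) * (1 - s) powr (b - 1))) (Beta a b)"
proof (rule has_bochner_integral_nn_integral)
  have pos: "Beta a b > 0" unfolding Beta_def using assms
    by (intro divide_pos_pos mult_pos_pos Gamma_real_pos) auto
  thus "0 \<le> Beta a b" by simp
  have "((\<lambda>t. t powr (a - 1) * (1 - t) powr (b - 1)) has_integral Beta a b) {0<..<1}"
    using has_integral_Beta_real[OF assms] by (simp add: has_integral_Icc_iff_Ioo)
  from nn_integral_has_integral_lebesgue[OF _ this]
  show "(\<integral>\<^sup>+ x. ennreal (indicator {0<..<1} x * (x powr (a - 1) * (1 - x) powr (b - 1))) \<partial>lborel)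
      = ennreal (Beta a b)" by auto
qed auto

text \<open>Termwise integration. Each power gives a Beta value, and Beta (a k + 1) a / Gamma (a k +
  1) = Gamma a / Gamma (a (k + 1) + 1) raises the index by one; the factor x completes the shift.
  With x = - r t^a this is the fractional integral equation for t -> E_a (- r t^a), rescaled to the
  unit interval.\<close>

lemma mittag_leffler_fractional_integral:
  fixes a x :: real
  assumes a: "0 < a" "a < 1"
  defines "g \<equiv> \<lambda>s. indicator {0<..<1} s * ((1 - s) powr (a - 1) * mittag_leffler a (x * s powr a))"
  shows "integrable lborel g" "x * integral\<^sup>L lborel g = Gamma a * (mittag_leffler a x - 1)"
proof -
  define f where "f k s = (x ^ k / Gamma (a * real k + 1)) *
     (indicator {0<..<1} s * (s powr ((a * real k + 1) - 1) * (1 - s) powr (a - 1)))" for k :: nat and s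
  have pos: "Gamma (a * real k + 1) > 0" for k using Gamma_coeff_pos[OF a(1)] .
  have Ga: "Gamma a > 0" using a by (simp add: Gamma_real_pos)
  have bf: "has_bochner_integral lborel (f k)
      ((x ^ k / Gamma (a * real k + 1)) * Beta (a * real k + 1) a)" for k
    unfolding f_def using a
    by (intro has_bochner_integral_mult_right has_bochner_integral_Beta add_nonneg_pos) auto
  have val: "(x ^ k / Gamma (a * real k + 1)) * Beta (a * real k + 1) a =
      Gamma a * (x ^ k / Gamma (a * real (Suc k) + 1))" for k
    using pos[of k] by (simp add: Beta_def field_simps)
  have fsum: "(\<lambda>k. f k s) sums g s" for s
  proof (cases "s \<in> {0<..<1}")
    case True
    have "(\<lambda>k. (x * s powr a) ^ k / Gamma (a * real k + 1)) sums mittag_leffler a (x * s powr a)"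
      unfolding mittag_leffler_def
      by (rule summable_sums[OF summable_norm_cancel[OF summable_mittag_leffler[OF a]]])
    from sums_mult[OF this, of "(1 - s) powr (a - 1)"]
    show ?thesis using True unfolding f_def g_def
      by (simp add: power_mult_distrib powr_powr mult_ac flip: powr_realpow[of "s powr a"])
  next
    case False thus ?thesis by (simp add: f_def g_def)
  qed
  have nf: "norm (f k s) = (\<bar>x\<bar> ^ k / Gamma (a * real k + 1)) *
     (indicator {0<..<1} s * (s powr ((a * real k + 1) - 1) * (1 - s) powr (a - 1)))" for k s
    unfolding f_def using pos[of k] by (simp add: abs_mult power_abs)
  have nint: "(\<integral>s. norm (f k s) \<partial>lborel) = Gamma a * (\<bar>x\<bar> ^ k / Gamma (a * real (Suc k) + 1))" for k
  proof -
    have "has_bochner_integral lborel (\<lambda>s. norm (f k s))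
        ((\<bar>x\<bar> ^ k / Gamma (a * real k + 1)) * Beta (a * real k + 1) a)"
      unfolding nf using a
      by (intro has_bochner_integral_mult_right has_bochner_integral_Beta add_nonneg_pos) auto
    thus ?thesis using pos[of k] by (simp add: has_bochner_integral_iff Beta_def field_simps)
  qed
  have S1: "summable (\<lambda>k. x ^ Suc k / Gamma (a * real (Suc k) + 1))" for x :: real
    using summable_norm_cancel[OF summable_mittag_leffler[OF a, of x]]
    by (subst summable_Suc_iff)
  have sumn: "summable (\<lambda>k. \<integral>s. norm (f k s) \<partial>lborel)"
  \<comment> \<open>The shifted series known to converge carries one more factor
    \<open>\<bar>x\<bar>\<close>, which can be divided out only if x is nonzero.\<close>
  proof (cases "x = 0")
    case True thus ?thesis unfolding nint
      by (intro summable_finite[of "{0}"]) auto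
  next
    case False
    have "summable (\<lambda>k. (Gamma a / \<bar>x\<bar>) * (\<bar>x\<bar> ^ Suc k / Gamma (a * real (Suc k) + 1)))"
      by (intro summable_mult S1)
    thus ?thesis unfolding nint using False by (simp add: field_simps)
  qed
  have abs: "AE s in lborel. summable (\<lambda>k. norm (f k s))"
  proof (intro AE_I2)
    fix s
    show "summable (\<lambda>k. norm (f k s))"
    proof (cases "s \<in> {0<..<1}")
      case True
      have "summable (\<lambda>k. norm ((x * s powr a) ^ k / Gamma (a * real k + 1)) * (1 - s) powr (a - 1))"
        by (intro summable_mult2 summable_mittag_leffler a)
      thus ?thesis using True unfolding nf
        by (simp add: power_mult_distrib powr_powr mult_ac abs_mult power_abs pos[THEN less_imp_le]
          flip: powr_realpow[of "s powr a"])
    qed (simp add: f_def)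
  qed
  have geq: "g = (\<lambda>s. \<Sum>k. f k s)" using fsum by (auto simp: sums_iff)
  have fi: "integrable lborel (f k)" for k using bf[of k] by (simp add: has_bochner_integral_iff)
  show "integrable lborel g"
    unfolding geq by (rule integrable_suminf[OF fi abs sumn])
  have "integral\<^sup>L lborel g = (\<Sum>k. Gamma a * (x ^ k / Gamma (a * real (Suc k) + 1)))"
    unfolding geq integral_suminf[OF fi abs sumn]
    using bf val by (simp add: has_bochner_integral_iff)
  hence "x * integral\<^sup>L lborel g = x * (\<Sum>k. Gamma a * (x ^ k / Gamma (a * real (Suc k) + 1)))" by simp
  also have "\<dots> = (\<Sum>k. x * (Gamma a * (x ^ k / Gamma (a * real (Suc k) + 1))))"
  proof (rule suminf_mult[symmetric], rule summable_norm_cancel)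
    have "norm (Gamma a * (x ^ k / Gamma (a * real (Suc k) + 1))) =
        Gamma a * (\<bar>x\<bar> ^ k / Gamma (a * real (Suc k) + 1))" for k
      using Ga pos[of "Suc k"] by (simp only: real_norm_def abs_mult abs_divide power_abs abs_of_pos)
    thus "summable (\<lambda>k. norm (Gamma a * (x ^ k / Gamma (a * real (Suc k) + 1))))"
      using sumn unfolding nint by (simp only:)
  qed
  also have "\<dots> = (\<Sum>k. Gamma a * (x ^ Suc k / Gamma (a * real (Suc k) + 1)))"
    by (simp add: mult_ac)
  also have "\<dots> = Gamma a * (\<Sum>k. x ^ Suc k / Gamma (a * real (Suc k) + 1))"
    by (rule suminf_mult[OF S1])
  also have "(\<Sum>k. x ^ Suc k / Gamma (a * real (Suc k) + 1)) = mittag_leffler a x - 1"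
    unfolding mittag_leffler_def
    by (subst suminf_split_head[OF summable_norm_cancel[OF summable_mittag_leffler[OF a]]]) simp
  finally show "x * integral\<^sup>L lborel g = Gamma a * (mittag_leffler a x - 1)" .
qed

lemma borel_measurable_mittag_leffler[measurable]:
  assumes [measurable]: "f \<in> borel_measurable M"
  shows "(\<lambda>x. mittag_leffler a (f x)) \<in> borel_measurable M"
  unfolding mittag_leffler_def by measurable

lemma mittag_leffler_0: "mittag_leffler a 0 = 1"
proof -
  have "mittag_leffler a 0 = (\<Sum>k\<in>{0}. 0 ^ k / Gamma (a * real k + 1))"
    unfolding mittag_leffler_def by (rule suminf_finite) (auto simp: power_0_left)
  thus ?thesis by simp
qed

lemma nn_integral_Gamma_scaled:
  fixes a z :: real
  assumes a: "a > 0" and z: "z > 0"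
  shows "(\<integral>\<^sup>+t. ennreal (indicator {0<..} t * (t powr (a - 1) * exp (- z * t))) \<partial>lborel)
    = ennreal (Gamma a * z powr (- a))"
proof -
  have Ga: "Gamma a > 0" using a by (simp add: Gamma_real_pos)
  have "ennreal (Gamma a) = (\<integral>\<^sup>+t. ennreal (indicator {0..} t * (t powr (a - 1) / exp t)) \<partial>lborel)"
    using nn_integral_has_integral_lebesgue[OF _ Gamma_integral_real[OF a]] by simp
  also have "\<dots> = (\<integral>\<^sup>+t. ennreal (indicator {0<..} t * (t powr (a - 1) / exp t)) \<partial>lborel)"
    by (intro nn_integral_cong) (auto simp: indicator_def less_le)
  also have "\<dots> = ennreal \<bar>z\<bar> * (\<integral>\<^sup>+t. ennreal (indicator {0<..} (0 + z * t) * ((0 + z * t) powr (a - 1) / exp (0 + z * t))) \<partial>lborel)"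
    using z by (intro nn_integral_real_affine) auto
  also have "(\<lambda>t. ennreal (indicator {0<..} (0 + z * t) * ((0 + z * t) powr (a - 1) / exp (0 + z * t)))) =
     (\<lambda>t. ennreal (z powr (a - 1)) * ennreal (indicator {0<..} t * (t powr (a - 1) * exp (- z * t))))"
  proof
    fix t
    have "indicator {0<..} (0 + z * t) * ((0 + z * t) powr (a - 1) / exp (0 + z * t)) =
      z powr (a - 1) * (indicator {0<..} t * (t powr (a - 1) * exp (- z * t)))"
      using z by (cases "t > 0") (simp_all add: indicator_def powr_mult exp_minus divide_inverse zero_less_mult_iff)
    thus "ennreal (indicator {0<..} (0 + z * t) * ((0 + z * t) powr (a - 1) / exp (0 + z * t))) =
      ennreal (z powr (a - 1)) * ennreal (indicator {0<..} t * (t powr (a - 1) * exp (- z * t)))"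
      by (simp only: ennreal_mult'[symmetric] powr_ge_zero)
  qed
  also have "ennreal \<bar>z\<bar> * (\<integral>\<^sup>+t. ennreal (z powr (a - 1)) * ennreal (indicator {0<..} t * (t powr (a - 1) * exp (- z * t))) \<partial>lborel) =
     ennreal (z powr a) * (\<integral>\<^sup>+t. ennreal (indicator {0<..} t * (t powr (a - 1) * exp (- z * t))) \<partial>lborel)"
    using z by (subst nn_integral_cmult) (auto simp: mult.assoc[symmetric] powr_diff simp flip: ennreal_mult)
  finally have "ennreal (z powr (-a)) * ennreal (Gamma a) = ennreal (z powr (-a)) * ennreal (z powr a) *
     (\<integral>\<^sup>+t. ennreal (indicator {0<..} t * (t powr (a - 1) * exp (- z * t))) \<partial>lborel)"
    by (simp add: mult.assoc)
  also have "ennreal (z powr (-a)) * ennreal (z powr a) = 1"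
    using z by (simp flip: ennreal_mult powr_add)
  finally show ?thesis using Ga by (simp add: ennreal_mult mult.commute)
qed

lemma nn_integral_exp_scaled:
  fixes z :: real
  assumes z: "z > 0"
  shows "(\<integral>\<^sup>+t. ennreal (indicator {0<..} t * exp (- z * t)) \<partial>lborel) = ennreal (1 / z)"
proof -
  have "(\<integral>\<^sup>+t. ennreal (indicator {0<..} t * exp (- z * t)) \<partial>lborel) =
    (\<integral>\<^sup>+t. ennreal (indicator {0<..} t * (t powr (1 - 1) * exp (- z * t))) \<partial>lborel)"
    by (intro nn_integral_cong) (auto simp: indicator_def)
  also have "\<dots> = ennreal (1 / z)"
    using z by (subst nn_integral_Gamma_scaled) (auto simp: powr_minus_divide)
  finally show ?thesis .
qed

text \<open>The Laplace transform comes from the Volterra equation \<open>F = 1 - \<lambda> I\<^sup>a F\<close>,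
  which avoids continuing the termwise transform, convergent only for large \<open>z\<close>.\<close>

lemma mittag_leffler_laplace:
  fixes a r z :: real
  assumes a: "0 < a" "a < 1" and r: "r > 0" and z: "z > 0"
    and bounds: "\<And>t. t \<ge> 0 \<Longrightarrow> 0 \<le> mittag_leffler a (- r * t powr a)"
      "\<And>t. t \<ge> 0 \<Longrightarrow> mittag_leffler a (- r * t powr a) \<le> 1"
  shows "(\<integral>\<^sup>+t. ennreal (indicator {0<..} t * (exp (- z * t) * mittag_leffler a (- r * t powr a))) \<partial>lborel)
    = ennreal (z powr (a - 1) / (z powr a + r))"
proof -
  define F where "F t = mittag_leffler a (- r * t powr a)" for t
  have [measurable]: "F \<in> borel_measurable borel" unfolding F_def by measurable
  have F: "0 \<le> F t" "F t \<le> 1" if "t \<ge> 0" for t using bounds that by (auto simp: F_def)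
  have Ga: "Gamma a > 0" using a by (simp add: Gamma_real_pos)
  define N where "N = (\<integral>\<^sup>+t. ennreal (indicator {0<..} t * (exp (- z * t) * F t)) \<partial>lborel)"
  \<comment> \<open>The transform will satisfy a linear equation in the extended nonnegative reals;
    it can be solved for N only once N is known to be finite.\<close>
  have N_le: "N \<le> ennreal (1 / z)"
    unfolding N_def nn_integral_exp_scaled[OF z, symmetric]
    by (intro nn_integral_mono ennreal_leI) (auto simp: indicator_def F)
  hence N_fin: "N < \<infinity>" by (auto intro: le_less_trans)
  \<comment> \<open>The integral equation at x = - r t^a, pulled from the unit interval to {0<..<t}
    by u = t s. The powers of t combine to the convolution kernel (t - u)^(a - 1).\<close>
  have volt: "ennreal (1 - F t) = ennreal (r / Gamma a) *
     (\<integral>\<^sup>+u. ennreal (indicator {0<..<t} u * ((t - u) powr (a - 1) * F u)) \<partial>lborel)" if t: "t > 0" for t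
  proof -
    define g where "g s = indicator {0<..<1} s * ((1 - s) powr (a - 1) * mittag_leffler a ((- r * t powr a) * s powr a))" for s
    have geq: "g s = indicator {0<..<1} s * ((1 - s) powr (a - 1) * F (t * s))" for s
      using t by (auto simp: g_def F_def indicator_def powr_mult mult_ac)
    have gi: "integrable lborel g" and
      gv: "- r * t powr a * integral\<^sup>L lborel g = Gamma a * (mittag_leffler a (- r * t powr a) - 1)"
      unfolding g_def using mittag_leffler_fractional_integral[OF a] by blast+
    have "1 - F t = (r * t powr a / Gamma a) * integral\<^sup>L lborel g"
      using gv Ga by (simp add: F_def field_simps)
    hence "1 - F t = (r / Gamma a) * (t powr a * integral\<^sup>L lborel g)" by simp
    moreover have "0 \<le> r / Gamma a" "0 \<le> t powr a" using r Ga by auto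
    ultimately have "ennreal (1 - F t) = ennreal (r / Gamma a) * (ennreal (t powr a) * ennreal (integral\<^sup>L lborel g))"
      by (simp only: ennreal_mult'[symmetric])
    also have "ennreal (integral\<^sup>L lborel g) = (\<integral>\<^sup>+s. ennreal (g s) \<partial>lborel)"
      by (rule nn_integral_eq_integral[symmetric, OF gi])
        (use t in \<open>auto simp: geq indicator_def F\<close>)
    also have "ennreal (t powr a) * (\<integral>\<^sup>+s. ennreal (g s) \<partial>lborel) =
        ennreal \<bar>t\<bar> * (\<integral>\<^sup>+s. ennreal (t powr (a - 1)) * ennreal (g s) \<partial>lborel)"
    proof -
      have "ennreal \<bar>t\<bar> * ennreal (t powr (a - 1)) = ennreal (t powr a)"
        using t by (simp add: powr_diff flip: ennreal_mult)
      moreover have "(\<lambda>s. ennreal (g s)) \<in> borel_measurable lborel" using gi by auto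
      ultimately show ?thesis by (simp add: nn_integral_cmult mult.assoc[symmetric])
    qed
    also have "(\<integral>\<^sup>+s. ennreal (t powr (a - 1)) * ennreal (g s) \<partial>lborel) =
       (\<integral>\<^sup>+s. ennreal (indicator {0<..<t} (0 + t * s) * ((t - (0 + t * s)) powr (a - 1) * F (0 + t * s))) \<partial>lborel)"
    proof (intro nn_integral_cong)
      fix s
      have "(t - t * s) powr (a - 1) = t powr (a - 1) * (1 - s) powr (a - 1)" if "s \<in> {0<..<1}"
      proof -
        have "t - t * s = t * (1 - s)" by (simp add: algebra_simps)
        thus ?thesis using t that by (simp add: powr_mult)
      qed
      thus "ennreal (t powr (a - 1)) * ennreal (g s) = ennreal (indicator {0<..<t} (0 + t * s) * ((t - (0 + t * s)) powr (a - 1) * F (0 + t * s)))"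
        using t unfolding geq by (auto simp: indicator_def zero_less_mult_iff mult.assoc simp flip: ennreal_mult')
    qed
    also have "ennreal \<bar>t\<bar> * \<dots> = (\<integral>\<^sup>+u. ennreal (indicator {0<..<t} u * ((t - u) powr (a - 1) * F u)) \<partial>lborel)"
      using t by (intro nn_integral_real_affine[symmetric]) auto
    finally show ?thesis .
  qed
  have "(\<integral>\<^sup>+t. ennreal (indicator {0<..} t * (exp (- z * t) * (1 - F t))) \<partial>lborel) =
     (\<integral>\<^sup>+t. \<integral>\<^sup>+u. ennreal (r / Gamma a) * ennreal (indicator {0<..} t * exp (- z * t) *
        (indicator {0<..<t} u * ((t - u) powr (a - 1) * F u))) \<partial>lborel \<partial>lborel)"
  proof (intro nn_integral_cong)
    fix t :: real
    show "ennreal (indicator {0<..} t * (exp (- z * t) * (1 - F t))) =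
      (\<integral>\<^sup>+u. ennreal (r / Gamma a) * ennreal (indicator {0<..} t * exp (- z * t) *
        (indicator {0<..<t} u * ((t - u) powr (a - 1) * F u))) \<partial>lborel)"
    proof (cases "t > 0")
      case True
      have "ennreal (indicator {0<..} t * (exp (- z * t) * (1 - F t))) = ennreal (exp (- z * t)) * ennreal (1 - F t)"
        using True by (simp add: ennreal_mult')
      also have "\<dots> = ennreal (r / Gamma a) * (\<integral>\<^sup>+u. ennreal (exp (- z * t)) *
        ennreal (indicator {0<..<t} u * ((t - u) powr (a - 1) * F u)) \<partial>lborel)"
        unfolding volt[OF True] by (subst nn_integral_cmult) (auto simp: mult_ac)
      also have "\<dots> = (\<integral>\<^sup>+u. ennreal (r / Gamma a) * ennreal (indicator {0<..} t * exp (- z * t) *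
        (indicator {0<..<t} u * ((t - u) powr (a - 1) * F u))) \<partial>lborel)"
        using True by (subst nn_integral_cmult) (auto simp: ennreal_mult' intro!: arg_cong2[where f="(*)"] nn_integral_cong)
      finally show ?thesis .
    qed simp
  qed
  \<comment> \<open>Tonelli; after the shift of t by u the inner integral is the transform of the
    kernel, Gamma a * z^(-a), and a multiple of N remains.\<close>
  also have "\<dots> = (\<integral>\<^sup>+u. \<integral>\<^sup>+t. ennreal (r / Gamma a) * ennreal (indicator {0<..} t * exp (- z * t) *
        (indicator {0<..<t} u * ((t - u) powr (a - 1) * F u))) \<partial>lborel \<partial>lborel)"
    by (rule lborel_pair.Fubini') (simp add: greaterThanLessThan_def greaterThan_def lessThan_def)
  also have "\<dots> = (\<integral>\<^sup>+u. ennreal (r * z powr (- a)) * ennreal (indicator {0<..} u * (exp (- z * u) * F u)) \<partial>lborel)"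
  proof (intro nn_integral_cong)
    fix u :: real
    show "(\<integral>\<^sup>+t. ennreal (r / Gamma a) * ennreal (indicator {0<..} t * exp (- z * t) *
        (indicator {0<..<t} u * ((t - u) powr (a - 1) * F u))) \<partial>lborel) =
        ennreal (r * z powr (- a)) * ennreal (indicator {0<..} u * (exp (- z * u) * F u))"
    proof (cases "u > 0")
      case True
      have "(\<integral>\<^sup>+t. ennreal (r / Gamma a) * ennreal (indicator {0<..} t * exp (- z * t) *
        (indicator {0<..<t} u * ((t - u) powr (a - 1) * F u))) \<partial>lborel) =
        ennreal \<bar>1\<bar> * (\<integral>\<^sup>+t. ennreal (r / Gamma a) * ennreal (indicator {0<..} (u + 1 * t) * exp (- z * (u + 1 * t)) *
        (indicator {0<..<u + 1 * t} u * ((u + 1 * t - u) powr (a - 1) * F u))) \<partial>lborel)"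
        by (rule nn_integral_real_affine) (auto simp: greaterThanLessThan_def greaterThan_def lessThan_def)
      also have "\<dots> = (\<integral>\<^sup>+t. ennreal (r / Gamma a * (exp (- z * u) * F u)) *
         ennreal (indicator {0<..} t * (t powr (a - 1) * exp (- z * t))) \<partial>lborel)"
        unfolding abs_one ennreal_1 mult_1
      proof (intro nn_integral_cong)
        fix t :: real
        have "exp (- z * (u + t)) = exp (- z * u) * exp (- z * t)"
          by (simp add: algebra_simps flip: exp_add)
        hence "(r / Gamma a) * (indicator {0<..} (u + t) * exp (- z * (u + t)) *
            (indicator {0<..<u + t} u * ((u + t - u) powr (a - 1) * F u))) =
          r / Gamma a * (exp (- z * u) * F u) * (indicator {0<..} t * (t powr (a - 1) * exp (- z * t)))"
          using True by (cases "t > 0") (simp_all add: indicator_def)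
        moreover have "0 \<le> r / Gamma a" "0 \<le> r / Gamma a * (exp (- z * u) * F u)"
          using True F[of u] r Ga by auto
        ultimately show "ennreal (r / Gamma a) * ennreal (indicator {0<..} (u + t) * exp (- z * (u + t)) *
            (indicator {0<..<u + t} u * ((u + t - u) powr (a - 1) * F u))) =
          ennreal (r / Gamma a * (exp (- z * u) * F u)) * ennreal (indicator {0<..} t * (t powr (a - 1) * exp (- z * t)))"
          by (simp only: ennreal_mult'[symmetric])
      qed
      also have "\<dots> = ennreal (r / Gamma a * (exp (- z * u) * F u)) * ennreal (Gamma a * z powr (- a))"
      proof -
        have meas: "(\<lambda>t. ennreal (indicator {0<..} t * (t powr (a - 1) * exp (- z * t)))) \<in> borel_measurable lborel"
          by measurable
        show ?thesis by (simp only: nn_integral_cmult[OF meas] nn_integral_Gamma_scaled[OF a(1) z])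
      qed
      also have "\<dots> = ennreal (r * z powr (- a)) * ennreal (indicator {0<..} u * (exp (- z * u) * F u))"
      proof -
        have "r / Gamma a * (exp (- z * u) * F u) * (Gamma a * z powr (- a)) =
          r * z powr (- a) * (indicator {0<..} u * (exp (- z * u) * F u))"
          using True Ga by simp
        moreover have "0 \<le> r / Gamma a * (exp (- z * u) * F u)" "0 \<le> r * z powr (- a)"
          using True F[of u] r Ga by auto
        ultimately show ?thesis by (simp only: ennreal_mult'[symmetric])
      qed
      finally show ?thesis .
    qed (auto simp: indicator_def)
  qed
  also have "\<dots> = ennreal (r * z powr (- a)) * N"
    unfolding N_def by (rule nn_integral_cmult) measurable
  finally have A: "(\<integral>\<^sup>+t. ennreal (indicator {0<..} t * (exp (- z * t) * (1 - F t))) \<partial>lborel) =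
    ennreal (r * z powr (- a)) * N" .
  have "ennreal (1 / z) = (\<integral>\<^sup>+t. ennreal (indicator {0<..} t * exp (- z * t)) \<partial>lborel)"
    using nn_integral_exp_scaled[OF z] by simp
  also have "\<dots> = (\<integral>\<^sup>+t. ennreal (indicator {0<..} t * (exp (- z * t) * (1 - F t))) +
      ennreal (indicator {0<..} t * (exp (- z * t) * F t)) \<partial>lborel)"
    by (intro nn_integral_cong) (auto simp: indicator_def F algebra_simps simp flip: ennreal_plus)
  also have "\<dots> = ennreal (r * z powr (- a)) * N + N"
    unfolding A[symmetric] unfolding N_def by (rule nn_integral_add) measurable
  finally have B: "ennreal (1 / z) = ennreal (r * z powr (- a)) * N + N" .
  obtain n where n: "N = ennreal n" "n \<ge> 0" using N_fin by (cases N) auto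
  have "1 / z = r * z powr (- a) * n + n"
    using B n r z by (simp flip: ennreal_mult' ennreal_plus)
  hence "n * (z powr a + r) = z powr (a - 1)"
    using z by (simp add: powr_minus powr_diff field_simps)
  moreover have "z powr a + r > 0" using r by (simp add: add_nonneg_pos)
  ultimately have "n = z powr (a - 1) / (z powr a + r)" by (simp add: field_simps)
  thus ?thesis using n unfolding N_def F_def by simp
qed

text \<open>Karamata's Tauberian argument. The normalised measures with density proportional to
  e^(-s) T^a F (T s) have Laplace transforms converging to (x + 1)^(a - 1), so they converge weakly
  to the Gamma law of shape 1 - a. Monotonicity of F then turns the masses of short intervals
  adjacent to 1 into bounds for T^a F T.\<close>

lemma karamata_monotone:
  fixes F :: "real \<Rightarrow> real" and N :: "real \<Rightarrow> real" and a c :: real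
  assumes a: "0 < a" "a < 1" and c: "c > 0"
    and F_meas[measurable]: "F \<in> borel_measurable borel"
    and F_nonneg: "\<And>t. t > 0 \<Longrightarrow> 0 \<le> F t"
    and F_mono: "\<And>s t. 0 < s \<Longrightarrow> s \<le> t \<Longrightarrow> F t \<le> F s"
    and N_pos: "\<And>z. z > 0 \<Longrightarrow> N z > 0"
    and N: "\<And>z. z > 0 \<Longrightarrow> (\<integral>\<^sup>+t. ennreal (indicator {0<..} t * (exp (- z * t) * F t)) \<partial>lborel) = ennreal (N z)"
    and N_lim: "\<And>x. x > 0 \<Longrightarrow> ((\<lambda>T. T powr (a - 1) * N (x / T)) \<longlongrightarrow> c * x powr (a - 1)) at_top"
  shows "((\<lambda>T. T powr a * F T) \<longlongrightarrow> c / Gamma (1 - a)) at_top"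
proof (rule tendsto_at_topI_sequentially)
  fix X :: "nat \<Rightarrow> real" assume X: "filterlim X at_top sequentially"
  \<comment> \<open>X is only eventually positive; T agrees with it from some index on and is at
    least 1 throughout.\<close>
  define T where "T n = max 1 (X n)" for n
  have T1: "T n \<ge> 1" for n by (simp add: T_def)
  have XT: "\<forall>\<^sub>F n in sequentially. X n = T n"
    using X unfolding filterlim_at_top by (rule allE[of _ 1]) (auto elim: eventually_mono simp: T_def)
  have Tlim: "filterlim T at_top sequentially"
    using X XT by (rule filterlim_cong[THEN iffD1, OF refl refl, rotated])
  have Gp: "Gamma (1 - a) > 0" using a by (simp add: Gamma_real_pos)
  define mass where "mass n = T n powr (a - 1) * N (1 / T n)" for n
  have mass_pos: "mass n > 0" for n unfolding mass_def using T1[of n] N_pos[of "1 / T n"] by simp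
  have mass_lim: "mass \<longlonglongrightarrow> c"
    using filterlim_compose[OF N_lim[of 1] Tlim] by (simp add: mass_def[abs_def])
  \<comment> \<open>The tilt exp (- s) makes F (T s) ds a finite measure, of total mass
    \<open>mass n\<close> after scaling. The density \<open>d0\<close> of the limit is s^(-a) e^(-s)
    / Gamma (1 - a).\<close>
  define d where "d n s = indicator {0<..} s * (exp (- s) * (T n powr a * F (T n * s))) / mass n" for n s
  define d0 where "d0 s = indicator {0<..} s * (s powr ((1 - a) - 1) * exp (- s)) / Gamma (1 - a)" for s :: real
  define \<mu> where "\<mu> n = density lborel (\<lambda>s. ennreal (d n s))" for n
  define \<nu> where "\<nu> = density lborel (\<lambda>s. ennreal (d0 s))"
  have [measurable]: "d n \<in> borel_measurable borel" for n unfolding d_def by measurable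
  have [measurable]: "d0 \<in> borel_measurable borel" unfolding d0_def by measurable
  have d_nn: "d n s \<ge> 0" for n s
    using T1[of n] mass_pos[of n] F_nonneg[of "T n * s"] by (cases "s > 0") (auto simp: d_def zero_less_mult_iff)
  have d0_nn: "d0 s \<ge> 0" for s using Gp by (auto simp: d0_def)
  have lap: "(\<integral>\<^sup>+s. ennreal (exp (- x * s) * d n s) \<partial>lborel) =
      ennreal (T n powr (a - 1) * N ((x + 1) / T n) / mass n)" if x: "x \<ge> 0" for x n
  proof -
    have Tn: "T n > 0" using T1[of n] by linarith
    have "ennreal (T n powr (a - 1) / mass n) * ennreal (N ((x + 1) / T n)) =
      ennreal (T n powr (a - 1) / mass n) *
        (\<integral>\<^sup>+t. ennreal (indicator {0<..} t * (exp (- ((x + 1) / T n) * t) * F t)) \<partial>lborel)"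
      using x Tn by (subst N) auto
    also have "(\<integral>\<^sup>+t. ennreal (indicator {0<..} t * (exp (- ((x + 1) / T n) * t) * F t)) \<partial>lborel) =
       ennreal \<bar>T n\<bar> * (\<integral>\<^sup>+s. ennreal (indicator {0<..} (0 + T n * s) * (exp (- ((x + 1) / T n) * (0 + T n * s)) * F (0 + T n * s))) \<partial>lborel)"
      using Tn by (intro nn_integral_real_affine) auto
    also have "ennreal (T n powr (a - 1) / mass n) * \<dots> =
       (\<integral>\<^sup>+s. ennreal (T n powr (a - 1) / mass n * T n) * ennreal (indicator {0<..} (0 + T n * s) * (exp (- ((x + 1) / T n) * (0 + T n * s)) * F (0 + T n * s))) \<partial>lborel)"
    proof -
      define I where "I = (\<integral>\<^sup>+s. ennreal (indicator {0<..} (0 + T n * s) * (exp (- ((x + 1) / T n) * (0 + T n * s)) * F (0 + T n * s))) \<partial>lborel)"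
      have "ennreal (T n powr (a - 1) / mass n) * (ennreal \<bar>T n\<bar> * I) = ennreal (T n powr (a - 1) / mass n * T n) * I"
        using Tn mass_pos[of n]
        by (simp only: abs_of_pos mult.assoc[symmetric] ennreal_mult'[of _ "T n"] powr_ge_zero divide_nonneg_pos)
      also have "\<dots> = (\<integral>\<^sup>+s. ennreal (T n powr (a - 1) / mass n * T n) * ennreal (indicator {0<..} (0 + T n * s) * (exp (- ((x + 1) / T n) * (0 + T n * s)) * F (0 + T n * s))) \<partial>lborel)"
        unfolding I_def by (rule nn_integral_cmult[symmetric]) measurable
      finally show ?thesis unfolding I_def .
    qed
    also have "\<dots> = (\<integral>\<^sup>+s. ennreal (exp (- x * s) * d n s) \<partial>lborel)"
    proof (intro nn_integral_cong)
      fix s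
      have e: "exp (- ((x + 1) / T n) * (0 + T n * s)) = exp (- x * s) * exp (- s)"
      proof -
        have "- ((x + 1) / T n) * (0 + T n * s) = - x * s + - s" using Tn by (simp add: field_simps)
        thus ?thesis by (simp only: exp_add)
      qed
      have p: "T n powr (a - 1) * T n = T n powr a" using Tn by (simp add: powr_diff)
      have "(T n powr (a - 1) / mass n * T n) * (indicator {0<..} (0 + T n * s) * (exp (- ((x + 1) / T n) * (0 + T n * s)) * F (0 + T n * s)))
         = exp (- x * s) * d n s"
        unfolding e d_def p[symmetric] using Tn by (cases "s > 0") (simp_all add: indicator_def zero_less_mult_iff)
      thus "ennreal (T n powr (a - 1) / mass n * T n) * ennreal (indicator {0<..} (0 + T n * s) * (exp (- ((x + 1) / T n) * (0 + T n * s)) * F (0 + T n * s))) = ennreal (exp (- x * s) * d n s)"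
        using Tn mass_pos[of n] by (simp only: ennreal_mult'[symmetric] powr_ge_zero divide_nonneg_pos mult_nonneg_nonneg less_imp_le)
    qed
    finally have "(\<integral>\<^sup>+s. ennreal (exp (- x * s) * d n s) \<partial>lborel) =
        ennreal (T n powr (a - 1) / mass n) * ennreal (N ((x + 1) / T n))" by simp
    also have "\<dots> = ennreal (T n powr (a - 1) / mass n * N ((x + 1) / T n))"
      using mass_pos[of n] by (simp only: ennreal_mult'[symmetric] powr_ge_zero divide_nonneg_pos)
    finally show ?thesis by simp
  qed
  have lap0: "(\<integral>\<^sup>+s. ennreal (exp (- x * s) * d0 s) \<partial>lborel) = ennreal ((x + 1) powr (a - 1))" if x: "x \<ge> 0" for x
  proof -
    have "(\<integral>\<^sup>+s. ennreal (exp (- x * s) * d0 s) \<partial>lborel) =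
      (\<integral>\<^sup>+s. ennreal (1 / Gamma (1 - a)) * ennreal (indicator {0<..} s * (s powr ((1 - a) - 1) * exp (- (x + 1) * s))) \<partial>lborel)"
    proof (intro nn_integral_cong)
      fix s :: real
      have "exp (- (x + 1) * s) = exp (- x * s) * exp (- s)" by (simp add: algebra_simps flip: exp_add)
      hence "exp (- x * s) * d0 s = 1 / Gamma (1 - a) * (indicator {0<..} s * (s powr ((1 - a) - 1) * exp (- (x + 1) * s)))"
        by (simp add: d0_def)
      thus "ennreal (exp (- x * s) * d0 s) = ennreal (1 / Gamma (1 - a)) * ennreal (indicator {0<..} s * (s powr ((1 - a) - 1) * exp (- (x + 1) * s)))"
        using Gp by (simp only: ennreal_mult'[symmetric] divide_nonneg_pos zero_le_one)
    qed
    also have "\<dots> = ennreal (1 / Gamma (1 - a)) * ennreal (Gamma (1 - a) * (x + 1) powr (- (1 - a)))"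
      using a x by (subst nn_integral_cmult) (auto simp only: nn_integral_Gamma_scaled, auto)
    also have "\<dots> = ennreal ((x + 1) powr (a - 1))"
      using Gp by (simp flip: ennreal_mult')
    finally show ?thesis .
  qed
  have rd\<mu>: "real_distribution (\<mu> n)" for n
    unfolding \<mu>_def by (intro real_distribution.intro real_distribution_axioms.intro prob_spaceI)
      (use lap[of 0 n] mass_pos[of n] in \<open>auto simp: emeasure_density mass_def\<close>)
  have rd\<nu>: "real_distribution \<nu>"
    unfolding \<nu>_def by (intro real_distribution.intro real_distribution_axioms.intro prob_spaceI)
      (use lap0[of 0] in \<open>auto simp: emeasure_density\<close>)
  have int\<mu>: "(\<integral>s. exp (- x * s) \<partial>\<mu> n) = T n powr (a - 1) * N ((x + 1) / T n) / mass n" if "x \<ge> 0" for x n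
  proof -
    have "(\<integral>s. exp (- x * s) \<partial>\<mu> n) = (\<integral>s. d n s * exp (- x * s) \<partial>lborel)"
      unfolding \<mu>_def by (subst integral_density) (auto simp: d_nn)
    also have "\<dots> = T n powr (a - 1) * N ((x + 1) / T n) / mass n"
      by (rule integral_eq_nn_integral[THEN trans])
         (use lap[OF that, of n] d_nn mass_pos[of n] N_pos[of "(x + 1) / T n"] T1[of n] that in \<open>auto simp: mult.commute\<close>)
    finally show ?thesis .
  qed
  have int\<nu>: "(\<integral>s. exp (- x * s) \<partial>\<nu>) = (x + 1) powr (a - 1)" if "x \<ge> 0" for x
  proof -
    have "(\<integral>s. exp (- x * s) \<partial>\<nu>) = (\<integral>s. d0 s * exp (- x * s) \<partial>lborel)"
      unfolding \<nu>_def by (subst integral_density) (auto simp: d0_nn)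
    also have "\<dots> = (x + 1) powr (a - 1)"
      by (rule integral_eq_nn_integral[THEN trans])
         (use lap0[OF that] d0_nn in \<open>auto simp: mult.commute\<close>)
    finally show ?thesis .
  qed
  have wc: "weak_conv_m \<mu> \<nu>"
  proof (rule laplace_weak_conv[OF rd\<mu> rd\<nu>])
    show "AE x in \<mu> n. 0 \<le> x" for n unfolding \<mu>_def by (subst AE_density) (auto simp: d_def indicator_def)
    show "AE x in \<nu>. 0 \<le> x" unfolding \<nu>_def by (subst AE_density) (auto simp: d0_def indicator_def)
    fix k :: nat
    have "(\<lambda>n. T n powr (a - 1) * N ((real k + 1) / T n) / mass n) \<longlonglongrightarrow> c * (real k + 1) powr (a - 1) / c"
      using c by (intro tendsto_divide filterlim_compose[OF N_lim Tlim] mass_lim) auto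
    thus "(\<lambda>n. \<integral>x. exp (- real k * x) \<partial>\<mu> n) \<longlonglongrightarrow> (\<integral>x. exp (- real k * x) \<partial>\<nu>)"
      using c int\<mu>[of "real k"] int\<nu>[of "real k"] by simp
  qed
  interpret \<nu>: real_distribution \<nu> by (rule rd\<nu>)
  interpret \<mu>: real_distribution "\<mu> n" for n by (rule rd\<mu>)
  \<comment> \<open>The limit law has a density, so the endpoints of an interval carry no mass and
    the interval is a continuity set.\<close>
  have lim_Ioc: "(\<lambda>n. measure (\<mu> n) {u<..v}) \<longlonglongrightarrow> measure \<nu> {u<..v}" if "u \<le> v" for u v
  proof (rule weak_conv_imp_continuity_set_conv[OF rd\<mu> rd\<nu> wc])
    have "emeasure \<nu> {u, v} = 0" unfolding \<nu>_def
      by (subst emeasure_density) (auto intro!: nn_integral_null_set simp: null_sets_def emeasure_lborel_countable)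
    moreover have "frontier {u<..v} \<subseteq> {u, v}"
      using that by (cases "u = v") (auto simp: frontier_def)
    ultimately have "emeasure \<nu> (frontier {u<..v}) = 0"
      by (metis emeasure_mono le_zero_eq \<nu>.events_eq_borel borel_closed finite_imp_closed finite.emptyI finite.insertI)
    thus "emeasure \<nu> (frontier {u<..v}) = 0" .
  qed auto
  have upper_gen: "measure m {u<..v} \<le> B * (v - u)"
    if m: "m = density lborel (\<lambda>s. ennreal (g s))" "real_distribution m" "g \<in> borel_measurable borel"
      and g: "\<And>s. s \<in> {u<..v} \<Longrightarrow> g s \<le> B" and uv: "u \<le> v" "B \<ge> 0" for m g B u v
  proof -
    interpret m: real_distribution m by (rule m)
    have "emeasure m {u<..v} = (\<integral>\<^sup>+s. ennreal (g s) * indicator {u<..v} s \<partial>lborel)"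
      unfolding m(1) using m(3) by (subst emeasure_density) auto
    also have "\<dots> \<le> (\<integral>\<^sup>+s. ennreal B * indicator {u<..v} s \<partial>lborel)"
      using g by (intro nn_integral_mono) (auto simp: indicator_def ennreal_leI)
    also have "\<dots> = ennreal (B * (v - u))"
      using uv by (simp add: nn_integral_cmult ennreal_mult)
    finally show ?thesis using uv by (simp add: m.emeasure_eq_measure)
  qed
  have lower_gen: "B * (v - u) \<le> measure m {u<..v}"
    if m: "m = density lborel (\<lambda>s. ennreal (g s))" "real_distribution m" "g \<in> borel_measurable borel"
      and g: "\<And>s. s \<in> {u<..v} \<Longrightarrow> B \<le> g s" and uv: "u \<le> v" "B \<ge> 0" for m g B u v
  proof -
    interpret m: real_distribution m by (rule m)
    have "ennreal (B * (v - u)) = (\<integral>\<^sup>+s. ennreal B * indicator {u<..v} s \<partial>lborel)"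
      using uv by (simp add: nn_integral_cmult ennreal_mult)
    also have "\<dots> \<le> (\<integral>\<^sup>+s. ennreal (g s) * indicator {u<..v} s \<partial>lborel)"
      using g by (intro nn_integral_mono) (auto simp: indicator_def ennreal_leI)
    also have "\<dots> = emeasure m {u<..v}"
      unfolding m(1) using m(3) by (subst emeasure_density) auto
    finally show ?thesis by (simp add: m.emeasure_eq_measure)
  qed
  define G where "G n = T n powr a * F (T n)" for n
  have G_nn: "G n \<ge> 0" for n unfolding G_def using T1[of n] F_nonneg[of "T n"] by simp
  \<comment> \<open>The bounds for the limit of \<open>G\<close> obtained from the intervals {1<..1
    + h} and {1 - h<..1}; as h decreases to 0 both tend to c / Gamma (1 - a).\<close>
  define l where "l h = exp (-h) * (1 + h) powr (- a) * (c / Gamma (1 - a))" for h :: real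
  define u where "u h = exp h * (1 - h) powr (- a) * (c / Gamma (1 - a))" for h :: real
  have G_lower: "\<forall>\<^sub>F n in sequentially. x < G n" if h: "h > 0" "x < l h" for h x
  proof -
    have 1: "measure (\<mu> n) {1<..1+h} \<le> exp (-1) * G n / mass n * (1 + h - 1)" for n
    proof (rule upper_gen[OF \<mu>_def rd\<mu>])
      fix s assume s: "s \<in> {1<..1+h}"
      have "F (T n * s) \<le> F (T n)" using T1[of n] s by (intro F_mono) auto
      hence "exp (- s) * (T n powr a * F (T n * s)) \<le> exp (- 1) * (T n powr a * F (T n))"
        using s T1[of n] F_nonneg[of "T n * s"] by (intro mult_mono) (auto intro!: mult_nonneg_nonneg)
      thus "d n s \<le> exp (-1) * G n / mass n"
        using s mass_pos[of n] by (auto simp: d_def G_def indicator_def intro!: divide_right_mono)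
    qed (use h rd\<mu> G_nn[of n] mass_pos[of n] in \<open>auto simp: \<mu>_def\<close>)
    have 2: "exp (-(1 + h)) * (1 + h) powr (- a) / Gamma (1 - a) * (1 + h - 1) \<le> measure \<nu> {1<..1+h}"
    proof (rule lower_gen[OF \<nu>_def rd\<nu>])
      fix s assume s: "s \<in> {1<..1+h}"
      show "exp (-(1 + h)) * (1 + h) powr (- a) / Gamma (1 - a) \<le> d0 s"
        using s Gp a by (auto simp: d0_def indicator_def mult.commute intro!: divide_right_mono mult_mono powr_mono2')
    qed (use h rd\<nu> Gp in \<open>auto simp: \<nu>_def\<close>)
    have "(\<lambda>n. measure (\<mu> n) {1<..1+h} * mass n / (exp (-1) * h)) \<longlonglongrightarrow> measure \<nu> {1<..1+h} * c / (exp (-1) * h)"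
      using h by (intro tendsto_intros lim_Ioc mass_lim) auto
    moreover have "x < measure \<nu> {1<..1+h} * c / (exp (-1) * h)"
    proof -
      have "l h = (exp (-(1 + h)) * (1 + h) powr (- a) / Gamma (1 - a) * h) * c / (exp (-1) * h)"
      proof -
        have "exp (-(1 + h)) = exp (-1) * exp (-h)" by (simp flip: exp_add)
        thus ?thesis using h by (simp add: l_def)
      qed
      also have "\<dots> \<le> measure \<nu> {1<..1+h} * c / (exp (-1) * h)"
        using h c 2 by (intro divide_right_mono mult_right_mono) auto
      finally show ?thesis using h by linarith
    qed
    ultimately have "\<forall>\<^sub>F n in sequentially. x < measure (\<mu> n) {1<..1+h} * mass n / (exp (-1) * h)"
      by (rule order_tendstoD)
    thus ?thesis
    proof eventually_elim
      case (elim n)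
      have "measure (\<mu> n) {1<..1+h} * mass n / (exp (-1) * h) \<le> G n"
        using 1[of n] mass_pos[of n] h by (simp add: field_simps)
      thus ?case using elim by linarith
    qed
  qed
  have G_upper: "\<forall>\<^sub>F n in sequentially. G n < x" if h: "h > 0" "h < 1" "u h < x" for h x
  proof -
    have 1: "exp (-1) * G n / mass n * (1 - (1 - h)) \<le> measure (\<mu> n) {1-h<..1}" for n
    proof (rule lower_gen[OF \<mu>_def rd\<mu>])
      fix s assume s: "s \<in> {1-h<..1}"
      have s0: "s > 0" using s h by auto
      have "F (T n) \<le> F (T n * s)" using T1[of n] s s0 by (intro F_mono) (auto simp: mult_le_cancel_left1)
      hence "exp (- 1) * (T n powr a * F (T n)) \<le> exp (- s) * (T n powr a * F (T n * s))"
        using s T1[of n] F_nonneg[of "T n"] by (intro mult_mono) (auto intro!: mult_nonneg_nonneg)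
      thus "exp (-1) * G n / mass n \<le> d n s"
        using s0 mass_pos[of n] by (auto simp: d_def G_def indicator_def intro!: divide_right_mono)
    qed (use h rd\<mu> G_nn[of n] mass_pos[of n] in \<open>auto simp: \<mu>_def\<close>)
    have 2: "measure \<nu> {1-h<..1} \<le> exp (-(1 - h)) * (1 - h) powr (- a) / Gamma (1 - a) * (1 - (1 - h))"
    proof (rule upper_gen[OF \<nu>_def rd\<nu>])
      fix s assume s: "s \<in> {1-h<..1}"
      show "d0 s \<le> exp (-(1 - h)) * (1 - h) powr (- a) / Gamma (1 - a)"
        using s Gp a h by (auto simp: d0_def indicator_def mult.commute intro!: divide_right_mono mult_mono powr_mono2')
    qed (use h rd\<nu> Gp in \<open>auto simp: \<nu>_def\<close>)
    have "(\<lambda>n. measure (\<mu> n) {1-h<..1} * mass n / (exp (-1) * h)) \<longlonglongrightarrow> measure \<nu> {1-h<..1} * c / (exp (-1) * h)"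
      using h by (intro tendsto_intros lim_Ioc mass_lim) auto
    moreover have "measure \<nu> {1-h<..1} * c / (exp (-1) * h) < x"
    proof -
      have "measure \<nu> {1-h<..1} * c / (exp (-1) * h) \<le> (exp (-(1 - h)) * (1 - h) powr (- a) / Gamma (1 - a) * h) * c / (exp (-1) * h)"
        using h c 2 by (intro divide_right_mono mult_right_mono) auto
      also have "\<dots> = u h"
      proof -
        have "exp (-(1 - h)) = exp (-1) * exp h" by (simp flip: exp_add)
        thus ?thesis using h by (simp add: u_def)
      qed
      finally show ?thesis using h by linarith
    qed
    ultimately have "\<forall>\<^sub>F n in sequentially. measure (\<mu> n) {1-h<..1} * mass n / (exp (-1) * h) < x"
      by (rule order_tendstoD)
    thus ?thesis
    proof eventually_elim
      case (elim n)
      have "G n \<le> measure (\<mu> n) {1-h<..1} * mass n / (exp (-1) * h)"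
        using 1[of n] mass_pos[of n] h by (simp add: field_simps)
      thus ?case using elim by linarith
    qed
  qed
  have "G \<longlonglongrightarrow> c / Gamma (1 - a)"
  proof (rule order_tendstoI)
    fix x assume x: "x < c / Gamma (1 - a)"
    have "(l \<longlongrightarrow> exp (-0) * (1 + 0) powr (- a) * (c / Gamma (1 - a))) (at_right 0)"
      unfolding l_def by (intro tendsto_intros) auto
    hence "\<forall>\<^sub>F h in at_right 0. x < l h" using x by (intro order_tendstoD) auto
    hence "\<exists>h. 0 < h \<and> x < l h"
      using eventually_happens[OF eventually_conj[OF eventually_at_right_less[of "0::real"]]] by fastforce
    thus "\<forall>\<^sub>F n in sequentially. x < G n" using G_lower by blast
  next
    fix x assume x: "c / Gamma (1 - a) < x"
    have "(u \<longlongrightarrow> exp 0 * (1 - 0) powr (- a) * (c / Gamma (1 - a))) (at_right 0)"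
      unfolding u_def by (intro tendsto_intros) auto
    hence "\<forall>\<^sub>F h in at_right 0. u h < x" using x by (intro order_tendstoD) auto
    moreover have "\<forall>\<^sub>F h in at_right (0::real). 0 < h \<and> h < 1"
      by (auto simp: eventually_at_right_field intro!: exI[of _ 1])
    ultimately have "\<exists>h. u h < x \<and> (0 < h \<and> h < 1)"
      using eventually_happens[OF eventually_conj] by fastforce
    thus "\<forall>\<^sub>F n in sequentially. G n < x" using G_upper by blast
  qed
  thus "(\<lambda>n. X n powr a * F (X n)) \<longlonglongrightarrow> c / Gamma (1 - a)"
    by (rule Lim_transform_eventually) (use XT in \<open>eventually_elim, simp add: G_def\<close>)
qed

text \<open>The Laplace transform is z^(a - 1) / (z^a + r), so T^(a - 1) times its value at x / T
  tends to x^(a - 1) / r, and the Tauberian theorem applies with c = 1 / r.\<close>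

lemma mittag_leffler_asymp:
  fixes a r :: real
  assumes a: "0 < a" "a < 1" and r: "r > 0"
    and bounds: "\<And>t. t \<ge> 0 \<Longrightarrow> 0 \<le> mittag_leffler a (- r * t powr a)"
      "\<And>t. t \<ge> 0 \<Longrightarrow> mittag_leffler a (- r * t powr a) \<le> 1"
    and mono: "\<And>s t. 0 \<le> s \<Longrightarrow> s \<le> t \<Longrightarrow> mittag_leffler a (- r * t powr a) \<le> mittag_leffler a (- r * s powr a)"
  shows "((\<lambda>T. T powr a * mittag_leffler a (- r * T powr a)) \<longlongrightarrow> 1 / (r * Gamma (1 - a))) at_top"
proof -
  have "((\<lambda>T. T powr a * mittag_leffler a (- r * T powr a)) \<longlongrightarrow> (1 / r) / Gamma (1 - a)) at_top"
  proof (rule karamata_monotone[OF a, where N="\<lambda>z. z powr (a - 1) / (z powr a + r)"])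
    fix z :: real assume "z > 0"
    thus "z powr (a - 1) / (z powr a + r) > 0" using r by (auto intro!: divide_pos_pos add_nonneg_pos)
  next
    fix x :: real assume x: "x > 0"
    show "((\<lambda>T. T powr (a - 1) * ((x / T) powr (a - 1) / ((x / T) powr a + r))) \<longlongrightarrow> 1 / r * x powr (a - 1)) at_top"
    proof (rule Lim_transform_eventually)
      have "((\<lambda>T. x powr (a - 1) / (x powr a * T powr (-a) + r)) \<longlongrightarrow> x powr (a - 1) / (x powr a * 0 + r)) at_top"
        using r a by (intro tendsto_intros tendsto_neg_powr filterlim_ident) auto
      thus "((\<lambda>T. x powr (a - 1) / (x powr a * T powr (-a) + r)) \<longlongrightarrow> 1 / r * x powr (a - 1)) at_top" by simp
      show "\<forall>\<^sub>F T in at_top. x powr (a - 1) / (x powr a * T powr (-a) + r) =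
          T powr (a - 1) * ((x / T) powr (a - 1) / ((x / T) powr a + r))"
        using eventually_gt_at_top[of 0]
      proof eventually_elim
        case (elim T)
        have "(x / T) powr a = x powr a * T powr (-a)" for a
          using elim x powr_mult[of x "inverse T" a] by (simp add: powr_minus divide_inverse inverse_powr)
        moreover have "T powr (a - 1) * T powr - (a - 1) = 1"
          using elim by (simp flip: powr_add)
        ultimately show ?case by (simp add: mult_ac)
      qed
    qed
  qed (use r bounds mono mittag_leffler_laplace[OF a r _ bounds] in auto)
  thus ?thesis by simp
qed

section \<open>Laplace exponent of the interarrival times\<close>

text \<open>Tonelli. The inner integral on the left is the primitive of g at Y, so expectations of
  functions of Y become integrals of the tail; all moment estimates of Y start here.\<close>

lemma (in prob_space) layer_cake:
  fixes Y :: "'a \<Rightarrow> real" and g :: "real \<Rightarrow> real"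
  assumes [measurable]: "Y \<in> borel_measurable M" "g \<in> borel_measurable borel"
  shows "(\<integral>\<^sup>+\<omega>. (\<integral>\<^sup>+x. ennreal (g x) * indicator {0<..<Y \<omega>} x \<partial>lborel) \<partial>M) =
    (\<integral>\<^sup>+x. ennreal (g x) * indicator {0<..} x * ennreal (\<P>(\<omega> in M. Y \<omega> > x)) \<partial>lborel)"
proof -
  interpret P: pair_sigma_finite M lborel ..
  have "(\<integral>\<^sup>+\<omega>. (\<integral>\<^sup>+x. ennreal (g x) * indicator {0<..<Y \<omega>} x \<partial>lborel) \<partial>M) =
    (\<integral>\<^sup>+x. (\<integral>\<^sup>+\<omega>. ennreal (g x) * indicator {0<..<Y \<omega>} x \<partial>M) \<partial>lborel)"
    by (rule P.Fubini'[symmetric]) (simp add: greaterThanLessThan_def greaterThan_def lessThan_def)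
  also have "\<dots> = (\<integral>\<^sup>+x. ennreal (g x) * indicator {0<..} x * ennreal (\<P>(\<omega> in M. Y \<omega> > x)) \<partial>lborel)"
  proof (intro nn_integral_cong)
    fix x
    have "(\<integral>\<^sup>+\<omega>. ennreal (g x) * indicator {0<..<Y \<omega>} x \<partial>M) =
      (\<integral>\<^sup>+\<omega>. (ennreal (g x) * indicator {0<..} x) * indicator {\<omega>\<in>space M. Y \<omega> > x} \<omega> \<partial>M)"
      by (intro nn_integral_cong) (auto simp: indicator_def)
    also have "\<dots> = ennreal (g x) * indicator {0<..} x * ennreal (\<P>(\<omega> in M. Y \<omega> > x))"
      by (subst nn_integral_cmult) (auto simp: emeasure_eq_measure)
    finally show "(\<integral>\<^sup>+\<omega>. ennreal (g x) * indicator {0<..<Y \<omega>} x \<partial>M) =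
      ennreal (g x) * indicator {0<..} x * ennreal (\<P>(\<omega> in M. Y \<omega> > x))" .
  qed
  finally show ?thesis .
qed

lemma nn_integral_Ioo_FTC:
  fixes F f :: "real \<Rightarrow> real"
  assumes "a \<le> b" "\<And>x. a \<le> x \<Longrightarrow> x \<le> b \<Longrightarrow> (F has_real_derivative f x) (at x)"
    "\<And>x. a \<le> x \<Longrightarrow> x \<le> b \<Longrightarrow> 0 \<le> f x" "f \<in> borel_measurable borel"
  shows "(\<integral>\<^sup>+x. ennreal (f x) * indicator {a<..<b} x \<partial>lborel) = ennreal (F b - F a)"
proof -
  have "(\<integral>\<^sup>+x. ennreal (f x) * indicator {a<..<b} x \<partial>lborel) = (\<integral>\<^sup>+x. ennreal (f x) * indicator {a..b} x \<partial>lborel)"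
  proof (rule nn_integral_cong_AE)
    show "AE x in lborel. ennreal (f x) * indicator {a<..<b} x = ennreal (f x) * indicator {a..b} x"
      using AE_lborel_singleton[of a] AE_lborel_singleton[of b]
      by eventually_elim (auto simp: indicator_def)
  qed
  also have "\<dots> = ennreal (F b - F a)"
    by (rule nn_integral_FTC_Icc) (use assms in \<open>auto intro: has_field_derivative_at_within\<close>)
  finally show ?thesis .
qed

text \<open>The regularly varying tail is integrated against \<open>e\<^sup>-\<^sup>s\<close> after the substitution \<open>s = u x\<close>.\<close>

lemma (in prob_space) laplace_exponent_regularly_varying:
  fixes Y :: "'a \<Rightarrow> real" and u :: "nat \<Rightarrow> real"
  assumes Y[measurable]: "Y \<in> borel_measurable M" and pos: "AE \<omega> in M. Y \<omega> > 0"
    and a: "0 < a" "a < 1" and C: "C \<ge> 0"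
    and tail: "((\<lambda>x. x powr a * \<P>(\<omega> in M. Y \<omega> > x)) \<longlongrightarrow> C) at_top"
    and B: "\<And>x. x > 0 \<Longrightarrow> x powr a * \<P>(\<omega> in M. Y \<omega> > x) \<le> B"
    and u: "\<And>n. u n > 0" "u \<longlonglongrightarrow> 0"
  shows "(\<lambda>n. u n powr (-a) * (1 - expectation (\<lambda>\<omega>. exp (- u n * Y \<omega>)))) \<longlonglongrightarrow> C * Gamma (1 - a)"
proof -
  define T where "T x = \<P>(\<omega> in M. Y \<omega> > x)" for x
  have T_mono: "mono (\<lambda>x. - T x)"
    unfolding T_def by (intro monoI le_imp_neg_le finite_measure_mono) auto
  have [measurable]: "T \<in> borel_measurable borel"
    using borel_measurable_uminus[OF borel_measurable_mono[OF T_mono]] by simp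
  have T_nn: "T x \<ge> 0" for x by (simp add: T_def)
  have B0: "B \<ge> 0" using B[of 1] by (auto intro: order_trans[rotated])
  \<comment> \<open>In this form the last bracket is bounded by B and tends to C for each s, so
    \<open>B * f0\<close> dominates and \<open>C * f0\<close> is the limit, with integral C * Gamma
    (1 - a).\<close>
  define f where "f n s = indicator {0<..} s * (s powr ((1 - a) - 1) * exp (- s) * ((s / u n) powr a * T (s / u n)))" for n s
  define f0 where "f0 s = indicator {0<..} s * (s powr ((1 - a) - 1) * exp (- 1 * s))" for s :: real
  have [measurable]: "f n \<in> borel_measurable borel" for n unfolding f_def by measurable
  have [measurable]: "f0 \<in> borel_measurable borel" unfolding f0_def by measurable
  have hb: "has_bochner_integral lborel f0 (Gamma (1 - a))"
  proof (rule has_bochner_integral_nn_integral)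
    show "(\<integral>\<^sup>+x. ennreal (f0 x) \<partial>lborel) = ennreal (Gamma (1 - a))"
      unfolding f0_def using a by (subst nn_integral_Gamma_scaled) auto
    show "0 \<le> Gamma (1 - a)" using a by (intro less_imp_le Gamma_real_pos) auto
  qed (auto simp: f0_def)
  have ee: "expectation (\<lambda>\<omega>. 1 - exp (- u n * Y \<omega>)) = 1 - expectation (\<lambda>\<omega>. exp (- u n * Y \<omega>))" for n
  proof -
    have "integrable M (\<lambda>\<omega>. exp (- u n * Y \<omega>))"
      by (rule integrable_const_bound[where B=1]) (use pos u(1)[of n] in \<open>auto elim!: eventually_mono\<close>)
    thus ?thesis by (simp add: prob_space)
  qed
  have eq: "u n powr (-a) * (1 - expectation (\<lambda>\<omega>. exp (- u n * Y \<omega>))) = integral\<^sup>L lborel (f n)" for n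
  proof -
    have un: "u n > 0" using u by auto
    have f_nn: "f n s \<ge> 0" for s using T_nn by (auto simp: f_def indicator_def)
    have "(\<integral>\<^sup>+\<omega>. ennreal (1 - exp (- u n * Y \<omega>)) \<partial>M) =
       (\<integral>\<^sup>+\<omega>. (\<integral>\<^sup>+x. ennreal (u n * exp (- u n * x)) * indicator {0<..<Y \<omega>} x \<partial>lborel) \<partial>M)"
    proof (rule nn_integral_cong_AE)
      show "AE \<omega> in M. ennreal (1 - exp (- u n * Y \<omega>)) = (\<integral>\<^sup>+x. ennreal (u n * exp (- u n * x)) * indicator {0<..<Y \<omega>} x \<partial>lborel)"
        using pos
      proof eventually_elim
        case (elim \<omega>)
        have "(\<integral>\<^sup>+x. ennreal (u n * exp (- u n * x)) * indicator {0<..<Y \<omega>} x \<partial>lborel) =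
           ennreal (- exp (- u n * Y \<omega>) - - exp (- u n * 0))"
          using elim un by (intro nn_integral_Ioo_FTC) (auto intro!: derivative_eq_intros)
        thus ?case by simp
      qed
    qed
    also have "\<dots> = (\<integral>\<^sup>+x. ennreal (u n * exp (- u n * x)) * indicator {0<..} x * ennreal (T x) \<partial>lborel)"
      unfolding T_def by (rule layer_cake) auto
    also have "\<dots> = ennreal \<bar>1 / u n\<bar> * (\<integral>\<^sup>+s. ennreal (u n * exp (- u n * (0 + 1 / u n * s))) * indicator {0<..} (0 + 1 / u n * s) * ennreal (T (0 + 1 / u n * s)) \<partial>lborel)"
      using un by (intro nn_integral_real_affine) auto
    also have "\<dots> = (\<integral>\<^sup>+s. ennreal \<bar>1 / u n\<bar> * (ennreal (u n * exp (- u n * (0 + 1 / u n * s))) * indicator {0<..} (0 + 1 / u n * s) * ennreal (T (0 + 1 / u n * s))) \<partial>lborel)"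
      by (rule nn_integral_cmult[symmetric]) measurable
    also have "\<dots> = (\<integral>\<^sup>+s. ennreal (u n powr a) * ennreal (f n s) \<partial>lborel)"
    proof (intro nn_integral_cong)
      fix s
      show "ennreal \<bar>1 / u n\<bar> * (ennreal (u n * exp (- u n * (0 + 1 / u n * s))) * indicator {0<..} (0 + 1 / u n * s) * ennreal (T (0 + 1 / u n * s))) =
        ennreal (u n powr a) * ennreal (f n s)"
      proof (cases "s > 0")
        case True
        have p: "u n powr a * (s powr ((1 - a) - 1) * (s / u n) powr a) = 1"
        proof -
          have "u n powr a * (s powr ((1 - a) - 1) * (s / u n) powr a) = (u n powr a / u n powr a) * s powr (((1 - a) - 1) + a)"
            by (simp only: powr_divide powr_add times_divide_eq_right times_divide_eq_left mult_ac)
          thus ?thesis using True un by simp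
        qed
        have "u n powr a * f n s = (u n powr a * (s powr ((1 - a) - 1) * (s / u n) powr a)) * (exp (- s) * T (s / u n))"
          using True by (simp add: f_def)
        hence "u n powr a * f n s = exp (- s) * T (s / u n)" unfolding p by simp
        moreover have "\<bar>1 / u n\<bar> * (u n * exp (- u n * (0 + 1 / u n * s)) * T (0 + 1 / u n * s)) = exp (- s) * T (s / u n)"
          using un by simp
        moreover have "0 < 0 + 1 / u n * s" using True un by simp
        hence "ennreal \<bar>1 / u n\<bar> * (ennreal (u n * exp (- u n * (0 + 1 / u n * s))) * indicator {0<..} (0 + 1 / u n * s) * ennreal (T (0 + 1 / u n * s)))
          = ennreal (\<bar>1 / u n\<bar> * (u n * exp (- u n * (0 + 1 / u n * s)) * T (0 + 1 / u n * s)))"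
          using un T_nn by (subst ennreal_mult, simp, simp, subst ennreal_mult) (auto simp: indicator_def)
        ultimately show ?thesis by (simp add: f_nn flip: ennreal_mult)
      qed (use un in \<open>auto simp: f_def indicator_def zero_less_divide_iff\<close>)
    qed
    also have "\<dots> = ennreal (u n powr a) * (\<integral>\<^sup>+s. ennreal (f n s) \<partial>lborel)"
      by (rule nn_integral_cmult) measurable
    finally have A: "(\<integral>\<^sup>+\<omega>. ennreal (1 - exp (- u n * Y \<omega>)) \<partial>M) = ennreal (u n powr a) * (\<integral>\<^sup>+s. ennreal (f n s) \<partial>lborel)" .
    have "expectation (\<lambda>\<omega>. 1 - exp (- u n * Y \<omega>)) = enn2real (\<integral>\<^sup>+\<omega>. ennreal (1 - exp (- u n * Y \<omega>)) \<partial>M)"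
      by (rule integral_eq_nn_integral) (use pos un in \<open>auto elim!: eventually_mono\<close>)
    also have "\<dots> = u n powr a * integral\<^sup>L lborel (f n)"
      unfolding A by (subst integral_eq_nn_integral[of "f n"]) (auto simp: enn2real_mult f_nn)
    finally have "1 - expectation (\<lambda>\<omega>. exp (- u n * Y \<omega>)) = u n powr a * integral\<^sup>L lborel (f n)"
      unfolding ee .
    hence "u n powr (-a) * (1 - expectation (\<lambda>\<omega>. exp (- u n * Y \<omega>))) = (u n powr (-a) * u n powr a) * integral\<^sup>L lborel (f n)"
      by simp
    also have "u n powr (-a) * u n powr a = 1" using un by (simp flip: powr_add)
    finally show ?thesis by simp
  qed
  have "(\<lambda>n. integral\<^sup>L lborel (f n)) \<longlonglongrightarrow> integral\<^sup>L lborel (\<lambda>s. C * f0 s)"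
  proof (rule integral_dominated_convergence[where w="\<lambda>s. B * f0 s"])
    show "integrable lborel (\<lambda>s. B * f0 s)" using hb by (auto simp: has_bochner_integral_iff)
    have un: "filterlim (\<lambda>n. s / u n) at_top sequentially" if "s > 0" for s
    proof -
      have "filterlim (\<lambda>n. inverse (u n)) at_top sequentially"
        by (rule filterlim_inverse_at_top[OF u(2)]) (auto simp: u)
      thus ?thesis unfolding divide_inverse using that
        by (intro filterlim_tendsto_pos_mult_at_top[of _ s]) auto
    qed
    show "AE s in lborel. (\<lambda>n. f n s) \<longlonglongrightarrow> C * f0 s"
    proof (intro AE_I2)
      fix s :: real
      show "(\<lambda>n. f n s) \<longlonglongrightarrow> C * f0 s"
      proof (cases "s > 0")
        case True
        have "(\<lambda>n. (s / u n) powr a * T (s / u n)) \<longlonglongrightarrow> C"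
          using filterlim_compose[OF tail un[OF True]] by (simp add: T_def)
        hence "(\<lambda>n. s powr ((1 - a) - 1) * exp (- s) * ((s / u n) powr a * T (s / u n))) \<longlonglongrightarrow> s powr ((1 - a) - 1) * exp (- s) * C"
          by (intro tendsto_intros)
        thus ?thesis using True by (simp add: f_def f0_def mult_ac)
      qed (simp add: f_def f0_def)
    qed
    show "AE s in lborel. norm (f n s) \<le> B * f0 s" for n
    proof (intro AE_I2)
      fix s :: real
      show "norm (f n s) \<le> B * f0 s"
      proof (cases "s > 0")
        case True
        hence "(s / u n) powr a * T (s / u n) \<le> B" using u(1)[of n] B[of "s / u n"] by (simp add: T_def)
        hence "s powr ((1 - a) - 1) * exp (- s) * ((s / u n) powr a * T (s / u n)) \<le> s powr ((1 - a) - 1) * exp (- s) * B"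
          by (intro mult_left_mono) auto
        thus ?thesis using True T_nn[of "s / u n"] by (simp add: f_def f0_def mult_ac abs_mult)
      qed (simp add: f_def f0_def)
    qed
  qed auto
  thus ?thesis unfolding eq using hb by (simp add: has_bochner_integral_iff)
qed

text \<open>Dominated convergence: 1 - exp (- x) \<le> x gives the dominating variable z Y.\<close>

lemma (in prob_space) laplace_exponent_finite_mean:
  fixes Y :: "'a \<Rightarrow> real"
  assumes Y: "integrable M Y" and pos: "AE \<omega> in M. Y \<omega> > 0" and z: "z \<ge> 0"
  shows "(\<lambda>n. real n * (1 - expectation (\<lambda>\<omega>. exp (- (z / real n) * Y \<omega>)))) \<longlonglongrightarrow> z * expectation Y"
proof -
  have [measurable]: "Y \<in> borel_measurable M" using Y by auto
  have ee: "real n * (1 - expectation (\<lambda>\<omega>. exp (- (z / real n) * Y \<omega>))) = expectation (\<lambda>\<omega>. real n * (1 - exp (- (z / real n) * Y \<omega>)))" for n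
  proof -
    have "integrable M (\<lambda>\<omega>. exp (- (z / real n) * Y \<omega>))"
      by (rule integrable_const_bound[where B=1]) (use pos z in \<open>auto elim!: eventually_mono\<close>)
    thus ?thesis by (simp add: prob_space)
  qed
  have "(\<lambda>n. expectation (\<lambda>\<omega>. real n * (1 - exp (- (z / real n) * Y \<omega>)))) \<longlonglongrightarrow> expectation (\<lambda>\<omega>. z * Y \<omega>)"
  proof (rule integral_dominated_convergence[where w="\<lambda>\<omega>. z * Y \<omega>"])
    show "AE \<omega> in M. (\<lambda>n. real n * (1 - exp (- (z / real n) * Y \<omega>))) \<longlonglongrightarrow> z * Y \<omega>"
    proof (intro AE_I2)
      fix \<omega>
      have "(\<lambda>n. real n * (1 - exp (- (z / real n) * y))) \<longlonglongrightarrow> z * y" for y :: real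
      proof (cases "z * y = 0")
        case False
        have "(\<lambda>n. real n * (1 - exp (- (w / real n)))) \<longlonglongrightarrow> w" for w :: real by real_asymp
        from this[of "z * y"] show ?thesis by simp
      qed auto
      thus "(\<lambda>n. real n * (1 - exp (- (z / real n) * Y \<omega>))) \<longlonglongrightarrow> z * Y \<omega>" .
    qed
    show "AE \<omega> in M. norm (real n * (1 - exp (- (z / real n) * Y \<omega>))) \<le> z * Y \<omega>" for n
      using pos
    proof eventually_elim
      case (elim \<omega>)
      have "1 - exp (- (z / real n) * Y \<omega>) \<le> (z / real n) * Y \<omega>"
        using exp_ge_add_one_self[of "- (z / real n) * Y \<omega>"] by linarith
      hence "real n * (1 - exp (- (z / real n) * Y \<omega>)) \<le> real n * ((z / real n) * Y \<omega>)"
        by (rule mult_left_mono) auto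
      also have "\<dots> \<le> z * Y \<omega>" using z elim by simp
      finally show ?case using z elim by (simp add: abs_mult)
    qed
  qed (use Y in auto)
  thus ?thesis unfolding ee by simp
qed

lemma (in prob_space) integrable_tail_powr:
  fixes Y :: "'a \<Rightarrow> real"
  assumes Y[measurable]: "Y \<in> borel_measurable M" and pos: "AE \<omega> in M. Y \<omega> > 0" and a: "a > 1"
    and B: "\<And>x. x > 0 \<Longrightarrow> x powr a * \<P>(\<omega> in M. Y \<omega> > x) \<le> B"
  shows "integrable M Y"
proof (rule integrableI_nonneg)
  have B0: "B \<ge> 0" using B[of 1] by (auto intro: order_trans[rotated])
  have "(\<integral>\<^sup>+\<omega>. ennreal (Y \<omega>) \<partial>M) = (\<integral>\<^sup>+\<omega>. (\<integral>\<^sup>+x. ennreal 1 * indicator {0<..<Y \<omega>} x \<partial>lborel) \<partial>M)"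
    by (rule nn_integral_cong_AE) (use pos in \<open>auto elim!: eventually_mono\<close>)
  also have "\<dots> = (\<integral>\<^sup>+x. ennreal 1 * indicator {0<..} x * ennreal (\<P>(\<omega> in M. Y \<omega> > x)) \<partial>lborel)"
    by (rule layer_cake) auto
  also have "\<dots> \<le> (\<integral>\<^sup>+x. indicator {0..1} x + ennreal (B * x powr (-a)) * indicator {1..} x \<partial>lborel)"
  proof (intro nn_integral_mono)
    fix x :: real
    show "ennreal 1 * indicator {0<..} x * ennreal (\<P>(\<omega> in M. Y \<omega> > x)) \<le>
      indicator {0..1} x + ennreal (B * x powr (-a)) * indicator {1..} x"
    proof (cases "x > 1")
      case True
      have "\<P>(\<omega> in M. Y \<omega> > x) \<le> B * x powr (-a)"
        using B[of x] True by (simp add: powr_minus field_simps)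
      thus ?thesis using True by (auto simp: indicator_def intro: ennreal_leI)
    next
      case False
      thus ?thesis by (cases "x > 0") (auto simp: indicator_def intro!: order_trans[OF _ add_increasing2[OF _ order_refl]])
    qed
  qed
  also have "\<dots> = (\<integral>\<^sup>+x. indicator {0..1::real} x \<partial>lborel) + (\<integral>\<^sup>+x. ennreal (B * x powr (-a)) * indicator {1..} x \<partial>lborel)"
    by (rule nn_integral_add) auto
  also have "(\<integral>\<^sup>+x. ennreal (B * x powr (-a)) * indicator {1..} x \<partial>lborel) = ennreal (0 - (- B / (a - 1) * 1 powr (1 - a)))"
  proof (rule nn_integral_FTC_atLeast[where F="\<lambda>x. - B / (a - 1) * x powr (1 - a)"])
    show "((\<lambda>x. - B / (a - 1) * x powr (1 - a)) has_real_derivative B * x powr (-a)) (at x)" if x: "1 \<le> x" for x :: real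
    proof -
      have "((\<lambda>x. - B / (a - 1) * x powr (1 - a)) has_real_derivative - B / (a - 1) * ((1 - a) * x powr (1 - a - 1))) (at x)"
        using x by (intro DERIV_cmult has_real_derivative_powr) auto
      moreover have "- B / (a - 1) * ((1 - a) * x powr (1 - a - 1)) = B * x powr (-a)"
        using a by (simp add: field_simps)
      ultimately show ?thesis by simp
    qed
  next
    have "((\<lambda>x. - B / (a - 1) * x powr (1 - a)) \<longlongrightarrow> - B / (a - 1) * 0) at_top"
      using a by (intro tendsto_intros tendsto_neg_powr filterlim_ident) auto
    thus "((\<lambda>x. - B / (a - 1) * x powr (1 - a)) \<longlongrightarrow> 0) at_top" by simp
  qed (use B0 in auto)
  also have "(\<integral>\<^sup>+x. indicator {0..1::real} x \<partial>lborel) + ennreal (0 - (- B / (a - 1) * 1 powr (1 - a))) < \<infinity>"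
    by simp
  finally show "(\<integral>\<^sup>+\<omega>. ennreal (Y \<omega>) \<partial>M) < \<infinity>" .
qed (use pos in \<open>auto elim!: eventually_mono\<close>)

text \<open>min ((u y)^2) 1 is the integral of 2 u^2 x over x between 0 and min y (1/u). After the
  layer cake formula the integrand is at most 2 u^2 B, on an interval of length 1/u.\<close>

lemma (in prob_space) truncated_second_moment_le:
  fixes Y :: "'a \<Rightarrow> real"
  assumes Y[measurable]: "Y \<in> borel_measurable M" and pos: "AE \<omega> in M. Y \<omega> > 0"
    and B: "\<And>x. x > 0 \<Longrightarrow> x * \<P>(\<omega> in M. Y \<omega> > x) \<le> B" and u: "u > 0"
  shows "expectation (\<lambda>\<omega>. min ((u * Y \<omega>)\<^sup>2) 1) \<le> 2 * B * u"
proof -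
  have B0: "B \<ge> 0" using B[of 1] by (auto intro: order_trans[rotated])
  have "ennreal (expectation (\<lambda>\<omega>. min ((u * Y \<omega>)\<^sup>2) 1)) = (\<integral>\<^sup>+\<omega>. ennreal (min ((u * Y \<omega>)\<^sup>2) 1) \<partial>M)"
    by (intro nn_integral_eq_integral[symmetric] integrable_const_bound[where B=1]) auto
  also have "\<dots> = (\<integral>\<^sup>+\<omega>. (\<integral>\<^sup>+x. ennreal (2 * u\<^sup>2 * x * indicator {0..1/u} x) * indicator {0<..<Y \<omega>} x \<partial>lborel) \<partial>M)"
  proof (rule nn_integral_cong_AE)
    show "AE \<omega> in M. ennreal (min ((u * Y \<omega>)\<^sup>2) 1) =
      (\<integral>\<^sup>+x. ennreal (2 * u\<^sup>2 * x * indicator {0..1/u} x) * indicator {0<..<Y \<omega>} x \<partial>lborel)"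
      using pos
    proof eventually_elim
      case (elim \<omega>)
      define y where "y = min (Y \<omega>) (1 / u)"
      have y: "y \<ge> 0" using elim u by (simp add: y_def)
      have "(\<integral>\<^sup>+x. ennreal (2 * u\<^sup>2 * x * indicator {0..1/u} x) * indicator {0<..<Y \<omega>} x \<partial>lborel) =
        (\<integral>\<^sup>+x. ennreal (2 * u\<^sup>2 * x) * indicator {0<..<y} x \<partial>lborel)"
      proof (rule nn_integral_cong_AE)
        show "AE x in lborel. ennreal (2 * u\<^sup>2 * x * indicator {0..1/u} x) * indicator {0<..<Y \<omega>} x =
           ennreal (2 * u\<^sup>2 * x) * indicator {0<..<y} x"
          using AE_lborel_singleton[of "1/u"] by eventually_elim (auto simp: y_def indicator_def)
      qed
      also have "(\<integral>\<^sup>+x. ennreal (2 * u\<^sup>2 * x) * indicator {0<..<y} x \<partial>lborel) = ennreal (u\<^sup>2 * y\<^sup>2 - u\<^sup>2 * 0\<^sup>2)"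
      proof (rule nn_integral_Ioo_FTC[where F="\<lambda>x. u\<^sup>2 * x\<^sup>2"])
        show "((\<lambda>x. u\<^sup>2 * x\<^sup>2) has_real_derivative 2 * u\<^sup>2 * x) (at x)" for x
          by (auto intro!: derivative_eq_intros)
      qed (use y in auto)
      also have "u\<^sup>2 * y\<^sup>2 - u\<^sup>2 * 0\<^sup>2 = min ((u * Y \<omega>)\<^sup>2) 1"
      proof (cases "Y \<omega> \<le> 1 / u")
        case True
        hence "u * Y \<omega> \<le> 1" using u by (simp add: field_simps)
        hence "(u * Y \<omega>)\<^sup>2 \<le> 1" using elim u by (simp add: power_le_one)
        thus ?thesis using True by (simp add: y_def power_mult_distrib)
      next
        case False
        hence "u * Y \<omega> \<ge> 1" using u by (simp add: field_simps)
        hence "(u * Y \<omega>)\<^sup>2 \<ge> 1" by simp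
        thus ?thesis using False u by (simp add: y_def power_mult_distrib power_divide)
      qed
      finally show ?case by simp
    qed
  qed
  also have "\<dots> = (\<integral>\<^sup>+x. ennreal (2 * u\<^sup>2 * x * indicator {0..1/u} x) * indicator {0<..} x * ennreal (\<P>(\<omega> in M. Y \<omega> > x)) \<partial>lborel)"
    by (rule layer_cake) auto
  also have "\<dots> \<le> (\<integral>\<^sup>+x. ennreal (2 * u\<^sup>2 * B) * indicator {0..1/u} x \<partial>lborel)"
  proof (intro nn_integral_mono)
    fix x :: real
    show "ennreal (2 * u\<^sup>2 * x * indicator {0..1/u} x) * indicator {0<..} x * ennreal (\<P>(\<omega> in M. Y \<omega> > x))
      \<le> ennreal (2 * u\<^sup>2 * B) * indicator {0..1/u} x"
    proof (cases "x > 0 \<and> x \<le> 1 / u")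
      case True
      have "2 * u\<^sup>2 * (x * \<P>(\<omega> in M. Y \<omega> > x)) \<le> 2 * u\<^sup>2 * B"
        using B[of x] True by (intro mult_left_mono) auto
      thus ?thesis using True by (auto simp: indicator_def mult.assoc intro!: ennreal_leI simp flip: ennreal_mult)
    qed (auto simp: indicator_def)
  qed
  also have "\<dots> = ennreal (2 * u\<^sup>2 * B * (1 / u))"
    using u B0 by (simp add: nn_integral_cmult flip: ennreal_mult)
  also have "2 * u\<^sup>2 * B * (1 / u) = 2 * B * u" using u by (simp add: power2_eq_square)
  finally show ?thesis using B0 u by simp
qed

text \<open>Every truncation f that agrees with min x 1 to second order at 0 yields the same
  truncated mean up to a bounded error, by the bound on the truncated second moment. It serves
  twice: with \<open>sin\<close>, which defines the time scale, and with 1 - exp (- x), which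
  defines the Laplace exponent.\<close>

lemma (in prob_space) truncated_mean_approx:
  fixes Y :: "'a \<Rightarrow> real" and f :: "real \<Rightarrow> real"
  assumes Y[measurable]: "Y \<in> borel_measurable M" and pos: "AE \<omega> in M. Y \<omega> > 0"
    and B: "\<And>x. x > 0 \<Longrightarrow> x * \<P>(\<omega> in M. Y \<omega> > x) \<le> B" and u: "u > 0"
    and f[measurable]: "f \<in> borel_measurable borel"
    and f_le: "\<And>x. x > 0 \<Longrightarrow> \<bar>f x\<bar> \<le> 1" "\<And>x. x > 0 \<Longrightarrow> \<bar>f x - min x 1\<bar> \<le> 2 * min (x\<^sup>2) 1"
  shows "\<bar>expectation (\<lambda>\<omega>. f (u * Y \<omega>)) / u - expectation (\<lambda>\<omega>. min (Y \<omega>) (1 / u))\<bar> \<le> 4 * B"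
proof -
  have i1: "integrable M (\<lambda>\<omega>. f (u * Y \<omega>))"
    by (rule integrable_const_bound[where B=1]) (use pos u f_le in \<open>auto elim!: eventually_mono\<close>)
  have i2: "integrable M (\<lambda>\<omega>. min (u * Y \<omega>) 1)"
    by (rule integrable_const_bound[where B=1]) (use pos u in \<open>auto elim!: eventually_mono\<close>)
  have i3: "integrable M (\<lambda>\<omega>. min ((u * Y \<omega>)\<^sup>2) 1)"
    by (rule integrable_const_bound[where B=1]) auto
  have "min (Y \<omega>) (1 / u) = min (u * Y \<omega>) 1 / u" for \<omega> using u by (auto simp: min_def field_simps)
  hence "\<bar>expectation (\<lambda>\<omega>. f (u * Y \<omega>)) / u - expectation (\<lambda>\<omega>. min (Y \<omega>) (1 / u))\<bar>
     = \<bar>expectation (\<lambda>\<omega>. f (u * Y \<omega>) - min (u * Y \<omega>) 1)\<bar> / u"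
    using i1 i2 u by (simp add: diff_divide_distrib[symmetric])
  also have "\<dots> \<le> expectation (\<lambda>\<omega>. \<bar>f (u * Y \<omega>) - min (u * Y \<omega>) 1\<bar>) / u"
    using u by (intro divide_right_mono integral_abs_bound) auto
  also have "\<dots> \<le> expectation (\<lambda>\<omega>. 2 * min ((u * Y \<omega>)\<^sup>2) 1) / u"
    using u i1 i2 i3 f_le pos
    by (intro divide_right_mono integral_mono_AE) (auto elim!: eventually_mono)
  also have "\<dots> \<le> 2 * (2 * B * u) / u"
    using u i3 truncated_second_moment_le[OF Y pos B u] by (intro divide_right_mono) auto
  finally show ?thesis using u by simp
qed

text \<open>Pointwise, min Y t - min Y s lies between t - s times the indicators of Y > t and of Y >
  s.\<close>

lemma (in prob_space) truncated_mean_increment: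
  fixes Y :: "'a \<Rightarrow> real"
  assumes Y[measurable]: "Y \<in> borel_measurable M" and pos: "AE \<omega> in M. Y \<omega> > 0" and uv: "0 \<le> s" "s \<le> t"
  shows "expectation (\<lambda>\<omega>. min (Y \<omega>) t) - expectation (\<lambda>\<omega>. min (Y \<omega>) s) \<le> (t - s) * \<P>(\<omega> in M. Y \<omega> > s)"
    and "(t - s) * \<P>(\<omega> in M. Y \<omega> > t) \<le> expectation (\<lambda>\<omega>. min (Y \<omega>) t) - expectation (\<lambda>\<omega>. min (Y \<omega>) s)"
proof -
  have i: "integrable M (\<lambda>\<omega>. min (Y \<omega>) t)" if "t \<ge> 0" for t
    by (rule integrable_const_bound[where B=t]) (use pos that in \<open>auto elim!: eventually_mono\<close>)
  have eq: "expectation (\<lambda>\<omega>. min (Y \<omega>) t) - expectation (\<lambda>\<omega>. min (Y \<omega>) s) = expectation (\<lambda>\<omega>. min (Y \<omega>) t - min (Y \<omega>) s)"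
    using i uv by simp
  have ind: "expectation (\<lambda>\<omega>. (t - s) * indicator {\<omega>\<in>space M. Y \<omega> > x} \<omega>) = (t - s) * \<P>(\<omega> in M. Y \<omega> > x)" for x
    by (simp add: Int_absorb1)
  have ii: "integrable M (\<lambda>\<omega>. (t - s) * indicator {\<omega>\<in>space M. Y \<omega> > x} \<omega>)" for x
    by (intro integrable_mult_right integrable_real_indicator) (auto simp: emeasure_eq_measure)
  show "expectation (\<lambda>\<omega>. min (Y \<omega>) t) - expectation (\<lambda>\<omega>. min (Y \<omega>) s) \<le> (t - s) * \<P>(\<omega> in M. Y \<omega> > s)"
    unfolding eq ind[symmetric] by (intro integral_mono) (use i ii uv in \<open>auto simp: indicator_def\<close>)
  show "(t - s) * \<P>(\<omega> in M. Y \<omega> > t) \<le> expectation (\<lambda>\<omega>. min (Y \<omega>) t) - expectation (\<lambda>\<omega>. min (Y \<omega>) s)"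
    unfolding eq ind[symmetric] by (intro integral_mono) (use i ii uv in \<open>auto simp: indicator_def\<close>)
qed

text \<open>Doubling the level s raises the truncated mean by at most s times the tail at s, hence
  by at most B, and about log 2 (t/s) doublings lead from s to t. The additional 1 pays for rounding
  up.\<close>

lemma (in prob_space) truncated_mean_log_increment:
  fixes Y :: "'a \<Rightarrow> real"
  assumes Y: "Y \<in> borel_measurable M" and pos: "AE \<omega> in M. Y \<omega> > 0"
    and B: "\<And>x. x > 0 \<Longrightarrow> x * \<P>(\<omega> in M. Y \<omega> > x) \<le> B" and s: "s > 0" and t: "t > 0"
  shows "\<bar>expectation (\<lambda>\<omega>. min (Y \<omega>) t) - expectation (\<lambda>\<omega>. min (Y \<omega>) s)\<bar> \<le> B * (\<bar>log 2 (t / s)\<bar> + 1)"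
proof -
  define H where "H t = expectation (\<lambda>\<omega>. min (Y \<omega>) t)" for t
  have B0: "B \<ge> 0" using B[of 1] by (auto intro: order_trans[rotated])
  have H_mono: "H s \<le> H t" if "0 \<le> s" "s \<le> t" for s t
    using truncated_mean_increment(2)[OF Y pos that] that
    unfolding H_def by (smt (verit) measure_nonneg mult_nonneg_nonneg)
  have dbl: "H (2 * s) - H s \<le> B" if "s > 0" for s
    using truncated_mean_increment(1)[OF Y pos, of s "2 * s"] B[of s] that unfolding H_def by auto
  have pw: "H (2 ^ k * s) - H s \<le> B * real k" if "s > 0" for s k
  proof (induction k)
    case (Suc k)
    have "H (2 * (2 ^ k * s)) - H (2 ^ k * s) \<le> B" using that by (intro dbl) auto
    thus ?case using Suc by (simp add: algebra_simps)
  qed simp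
  have main: "\<bar>H t - H s\<bar> \<le> B * (\<bar>log 2 (t / s)\<bar> + 1)" if st: "0 < s" "s \<le> t" for s t
  proof -
    define k where "k = nat \<lceil>log 2 (t / s)\<rceil>"
    have l0: "log 2 (t / s) \<ge> 0" using st by (simp add: field_simps)
    have k1: "log 2 (t / s) \<le> real k" and k2: "real k \<le> log 2 (t / s) + 1"
      unfolding k_def using l0 by linarith+
    have "t / s = 2 powr log 2 (t / s)" using st by simp
    also have "\<dots> \<le> 2 powr real k" using k1 by (intro powr_mono) auto
    finally have "t \<le> 2 ^ k * s" using st by (simp add: powr_realpow field_simps)
    hence "H t \<le> H (2 ^ k * s)" using st by (intro H_mono) auto
    also have "\<dots> \<le> H s + B * real k" using pw[of s k] st by simp
    also have "\<dots> \<le> H s + B * (log 2 (t / s) + 1)" using k2 B0 by (intro add_left_mono mult_left_mono) auto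
    finally show ?thesis using H_mono[of s t] st l0 by simp
  qed
  show ?thesis
  proof (cases "s \<le> t")
    case True thus ?thesis using main s by (simp add: H_def)
  next
    case False
    have "\<bar>log 2 (s / t)\<bar> = \<bar>log 2 (t / s)\<bar>" using s t by (simp add: log_divide)
    thus ?thesis using main[of t s] False t by (simp add: H_def abs_minus_commute)
  qed
qed

text \<open>Each doubling of a large level s adds at least s times the tail at 2 s, which exceeds
  C/4 because 2 s times that tail exceeds C/2.\<close>

lemma (in prob_space) truncated_mean_at_top:
  fixes Y :: "'a \<Rightarrow> real"
  assumes Y: "Y \<in> borel_measurable M" and pos: "AE \<omega> in M. Y \<omega> > 0"
    and C: "C > 0" and tail: "((\<lambda>x. x * \<P>(\<omega> in M. Y \<omega> > x)) \<longlongrightarrow> C) at_top"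
  shows "filterlim (\<lambda>t. expectation (\<lambda>\<omega>. min (Y \<omega>) t)) at_top at_top"
proof -
  define H where "H t = expectation (\<lambda>\<omega>. min (Y \<omega>) t)" for t
  have H_mono: "H s \<le> H t" if "0 \<le> s" "s \<le> t" for s t
    using truncated_mean_increment(2)[OF Y pos that] that
    unfolding H_def by (smt (verit) measure_nonneg mult_nonneg_nonneg)
  have H0: "H t \<ge> 0" if "t \<ge> 0" for t
    unfolding H_def by (rule integral_nonneg_AE) (use pos that in \<open>auto elim!: eventually_mono\<close>)
  have "\<forall>\<^sub>F x in at_top. x * \<P>(\<omega> in M. Y \<omega> > x) > C / 2"
    using tail C by (intro order_tendstoD) auto
  then obtain x0 where x0: "\<And>x. x \<ge> x0 \<Longrightarrow> x * \<P>(\<omega> in M. Y \<omega> > x) > C / 2"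
    by (auto simp: eventually_at_top_linorder)
  define x1 where "x1 = max x0 1"
  have x1: "x1 \<ge> 1" "x1 \<ge> x0" by (auto simp: x1_def)
  have pw: "real k * (C / 4) \<le> H (2 ^ k * x1)" for k
  proof (induction k)
    case 0 thus ?case using H0[of x1] x1 by simp
  next
    case (Suc k)
    define s where "s = 2 ^ k * x1"
    have s: "s \<ge> x1" using x1 by (simp add: s_def mult_le_cancel_right1)
    have "(2 * s - s) * \<P>(\<omega> in M. Y \<omega> > 2 * s) \<le> H (2 * s) - H s"
      unfolding H_def by (rule truncated_mean_increment(2)[OF Y pos]) (use s x1 in auto)
    moreover have "2 * s * \<P>(\<omega> in M. Y \<omega> > 2 * s) > C / 2" using s x1 by (intro x0) auto
    ultimately have "C / 4 \<le> H (2 * s) - H s" by simp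
    thus ?case using Suc by (simp add: s_def algebra_simps)
  qed
  show ?thesis
    unfolding H_def[symmetric] filterlim_at_top
  proof
    fix Z :: real
    obtain k :: nat where k: "real k > Z / (C / 4)" using reals_Archimedean2 by blast
    hence "Z \<le> real k * (C / 4)" using C by (simp add: field_simps)
    hence "Z \<le> H (2 ^ k * x1)" using pw[of k] by linarith
    thus "\<forall>\<^sub>F t in at_top. Z \<le> H t"
      unfolding eventually_at_top_linorder
      by (intro exI[of _ "2 ^ k * x1"]) (use x1 in \<open>auto intro: order_trans[OF _ H_mono]\<close>)
  qed
qed

lemma sin_min_bound:
  fixes x :: real assumes "x > 0" shows "\<bar>sin x - min x 1\<bar> \<le> 2 * min (x\<^sup>2) 1"
proof (cases "x \<le> 1")
  case True
  have "\<bar>sin x - x\<bar> \<le> x\<^sup>2 / 2"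
    using Maclaurin_sin_bound[of x 2] by (simp add: lessThan_nat_numeral lessThan_Suc sin_coeff_def)
  moreover have "0 \<le> x\<^sup>2" "x\<^sup>2 \<le> 1" using True assms by (auto simp: power_le_one)
  ultimately show ?thesis using True by linarith
next
  case False
  hence "x\<^sup>2 \<ge> 1" by simp
  thus ?thesis using False sin_le_one[of x] sin_ge_minus_one[of x] by (simp add: abs_le_iff)
qed

lemma exp_min_bound:
  fixes x :: real assumes "x > 0" shows "\<bar>(1 - exp (- x)) - min x 1\<bar> \<le> 2 * min (x\<^sup>2) 1"
proof (cases "x \<le> 1")
  case True
  have 1: "exp (- x) \<ge> 1 - x" using exp_ge_add_one_self[of "-x"] by simp
  have "exp (- x) = 1 / exp x" by (simp add: exp_minus divide_inverse)
  also have "\<dots> \<le> 1 / (1 + x)" using exp_ge_add_one_self[of x] assms by (intro divide_left_mono) auto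
  also have "\<dots> = 1 - x + x\<^sup>2 / (1 + x)" using assms by (simp add: field_simps power2_eq_square)
  also have "\<dots> \<le> 1 - x + x\<^sup>2" using assms by (simp add: field_simps)
  finally show ?thesis using 1 True assms by (simp add: power_le_one)
next
  case False
  hence "x\<^sup>2 \<ge> 1" by simp
  moreover have "exp (- x) \<le> 1" using assms by simp
  moreover have "exp (- x) > 0" by simp
  moreover have "min (x\<^sup>2) 1 = 1" "min x 1 = 1" using calculation False by auto
  ultimately show ?thesis by linarith
qed

text \<open>Let H be the truncated mean and u = z / (n m_n). Up to 4 B each, m_n equals H
  (n/\<theta>) and E (1 - exp (- u Y)) / u equals H (1/u). The two levels differ by the factor m_n
  \<theta> / z, which moves H only by O(log m_n), and this is negligible against m_n. Multiplying
  the second quantity by n u = z / m_n gives the limit z.\<close>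

lemma (in prob_space) laplace_exponent_critical:
  fixes Y :: "'a \<Rightarrow> real" and \<theta> C :: real
  assumes Y[measurable]: "Y \<in> borel_measurable M" and pos: "AE \<omega> in M. Y \<omega> > 0"
    and C: "C > 0" and tail: "((\<lambda>x. x * \<P>(\<omega> in M. Y \<omega> > x)) \<longlongrightarrow> C) at_top"
    and B: "\<And>x. x > 0 \<Longrightarrow> x * \<P>(\<omega> in M. Y \<omega> > x) \<le> B" and \<theta>: "\<theta> > 0" and z: "z > 0"
  defines "m \<equiv> \<lambda>n::nat. (real n / \<theta>) * expectation (\<lambda>\<omega>. sin (\<theta> * Y \<omega> / real n))"
  shows "filterlim m at_top sequentially"
    and "(\<lambda>n. real n * (1 - expectation (\<lambda>\<omega>. exp (- (z / (real n * m n)) * Y \<omega>)))) \<longlonglongrightarrow> z"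
proof -
  define H where "H t = expectation (\<lambda>\<omega>. min (Y \<omega>) t)" for t
  have B0: "B \<ge> 0" using B[of 1] by (auto intro: order_trans[rotated])
  have mH: "\<bar>m n - H (real n / \<theta>)\<bar> \<le> 4 * B" if "n > 0" for n
    using truncated_mean_approx[OF Y pos B, of "\<theta> / real n" sin] \<theta> that sin_min_bound
    by (simp add: m_def H_def mult_ac)
  have Htop: "filterlim H at_top at_top"
    unfolding H_def by (rule truncated_mean_at_top[OF Y pos C tail])
  have "filterlim (\<lambda>n::nat. real n / \<theta>) at_top sequentially"
    using \<theta> by real_asymp
  hence "filterlim (\<lambda>n. - 4 * B + H (real n / \<theta>)) at_top sequentially"
    by (intro filterlim_tendsto_add_at_top[OF tendsto_const] filterlim_compose[OF Htop])
  thus mtop: "filterlim m at_top sequentially"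
  proof (rule filterlim_at_top_mono)
    show "\<forall>\<^sub>F n in sequentially. - 4 * B + H (real n / \<theta>) \<le> m n"
      using eventually_gt_at_top[of 0]
    proof eventually_elim
      case (elim n) thus ?case using mH[of n] by linarith
    qed
  qed
  show "(\<lambda>n. real n * (1 - expectation (\<lambda>\<omega>. exp (- (z / (real n * m n)) * Y \<omega>)))) \<longlonglongrightarrow> z"
  proof -
    \<comment> \<open>8 B collects the two truncation errors, the logarithmic term the change of
      level; division by m_n makes the error relative.\<close>
    define e where "e n = (8 * B + B * (\<bar>log 2 (m n * \<theta> / z)\<bar> + 1)) / m n" for n
    have "((\<lambda>x. (8 * B + B * (\<bar>log 2 (x * \<theta> / z)\<bar> + 1)) / x) \<longlongrightarrow> 0) at_top"
    proof (rule Lim_transform_eventually)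
      show "((\<lambda>x. (8 * B + B * (log 2 (x * (\<theta> / z)) + 1)) / x) \<longlongrightarrow> 0) at_top"
      proof -
        have "\<theta> / z > 0" using \<theta> z by simp
        thus ?thesis by real_asymp
      qed
      show "\<forall>\<^sub>F x in at_top. (8 * B + B * (log 2 (x * (\<theta> / z)) + 1)) / x = (8 * B + B * (\<bar>log 2 (x * \<theta> / z)\<bar> + 1)) / x"
        using eventually_ge_at_top[of "z / \<theta>"]
      proof eventually_elim
        case (elim x)
        hence "x * (\<theta> / z) \<ge> 1" using \<theta> z by (simp add: field_simps)
        hence "log 2 (x * (\<theta> / z)) \<ge> 0" by (simp add: zero_le_log_cancel_iff)
        thus ?case by simp
      qed
    qed
    from filterlim_compose[OF this mtop] have e0: "e \<longlonglongrightarrow> 0" unfolding e_def .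
    have ev: "\<forall>\<^sub>F n in sequentially. m n > 0" using mtop by (auto simp: filterlim_at_top_dense)
    have bound: "\<forall>\<^sub>F n in sequentially. norm (real n * (1 - expectation (\<lambda>\<omega>. exp (- (z / (real n * m n)) * Y \<omega>))) - z) \<le> z * e n"
      using ev eventually_gt_at_top[of 0]
    proof eventually_elim
      case (elim n)
      define u where "u = z / (real n * m n)"
      have u: "u > 0" using elim z by (simp add: u_def)
      have "integrable M (\<lambda>\<omega>. exp (- u * Y \<omega>))"
        by (rule integrable_const_bound[where B=1]) (use pos u in \<open>auto elim!: eventually_mono\<close>)
      hence eq: "expectation (\<lambda>\<omega>. 1 - exp (- (u * Y \<omega>))) = 1 - expectation (\<lambda>\<omega>. exp (- u * Y \<omega>))"
        by (simp add: prob_space)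
      have "\<bar>expectation (\<lambda>\<omega>. 1 - exp (- (u * Y \<omega>))) / u - H (1 / u)\<bar> \<le> 4 * B"
        unfolding H_def
        by (rule truncated_mean_approx[OF Y pos B u, where f="\<lambda>x. 1 - exp (- x)"]) (use exp_min_bound in auto)
      moreover have "\<bar>H (1 / u) - H (real n / \<theta>)\<bar> \<le> B * (\<bar>log 2 ((1 / u) / (real n / \<theta>))\<bar> + 1)"
        unfolding H_def using elim \<theta> u by (intro truncated_mean_log_increment[OF Y pos B]) auto
      moreover have "(1 / u) / (real n / \<theta>) = m n * \<theta> / z" using elim z by (simp add: u_def field_simps)
      ultimately have "\<bar>(1 - expectation (\<lambda>\<omega>. exp (- u * Y \<omega>))) / u - m n\<bar> \<le> 8 * B + B * (\<bar>log 2 (m n * \<theta> / z)\<bar> + 1)"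
        using mH[of n] elim unfolding eq by simp
      hence "z / m n * \<bar>(1 - expectation (\<lambda>\<omega>. exp (- u * Y \<omega>))) / u - m n\<bar> \<le> z / m n * (8 * B + B * (\<bar>log 2 (m n * \<theta> / z)\<bar> + 1))"
        using elim z by (intro mult_left_mono) auto
      also have "\<dots> = z * e n" by (simp add: e_def)
      also have "z / m n * \<bar>(1 - expectation (\<lambda>\<omega>. exp (- u * Y \<omega>))) / u - m n\<bar> =
          \<bar>z / m n * ((1 - expectation (\<lambda>\<omega>. exp (- u * Y \<omega>))) / u - m n)\<bar>"
        using elim z by (simp add: abs_mult)
      also have "z / m n * ((1 - expectation (\<lambda>\<omega>. exp (- u * Y \<omega>))) / u - m n) = real n * (1 - expectation (\<lambda>\<omega>. exp (- u * Y \<omega>))) - z"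
        using elim z by (simp add: u_def field_simps)
      finally show ?case by (simp add: u_def)
    qed
    have "(\<lambda>n. real n * (1 - expectation (\<lambda>\<omega>. exp (- (z / (real n * m n)) * Y \<omega>))) - z) \<longlonglongrightarrow> 0"
      by (rule Lim_null_comparison[OF bound]) (use tendsto_mult_right_zero[OF e0] in auto)
    thus ?thesis by (simp add: LIM_zero_iff)
  qed
qed

text \<open>Because some random variable has this tail, positivity, the bound 1 and monotonicity are
  those of probabilities. They are exactly what the Laplace transform and the Tauberian theorem ask
  for.\<close>

lemma mittag_leffler_distributed_tail:
  assumes P: "prob_space P" and X: "mittag_leffler_distributed P X a r"
    and a: "0 < a" "a < 1" and r: "r > 0"
  defines "F \<equiv> \<lambda>t. mittag_leffler a (- r * t powr a)"
  shows "\<And>t. t \<ge> 0 \<Longrightarrow> 0 \<le> F t" "\<And>t. t \<ge> 0 \<Longrightarrow> F t \<le> 1" "F 0 = 1"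
    "\<And>s t. 0 \<le> s \<Longrightarrow> s \<le> t \<Longrightarrow> F t \<le> F s"
    "((\<lambda>t. t powr a * F t) \<longlongrightarrow> 1 / (r * Gamma (1 - a))) at_top"
proof -
  interpret P: prob_space P by (rule P)
  have [measurable]: "X \<in> borel_measurable P" using X by (simp add: mittag_leffler_distributed_def)
  have F: "F t = \<P>(\<omega> in P. X \<omega> > t)" if "t \<ge> 0" for t
    using X that by (simp add: mittag_leffler_distributed_def F_def)
  show 1: "0 \<le> F t" if "t \<ge> 0" for t using F[OF that] by simp
  show 2: "F t \<le> 1" if "t \<ge> 0" for t using F[OF that] by simp
  show "F 0 = 1" by (simp add: F_def mittag_leffler_0)
  show 3: "F t \<le> F s" if "0 \<le> s" "s \<le> t" for s t
    using that by (simp add: F) (intro P.finite_measure_mono, auto)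
  show "((\<lambda>t. t powr a * F t) \<longlongrightarrow> 1 / (r * Gamma (1 - a))) at_top"
    unfolding F_def by (rule mittag_leffler_asymp[OF a r]) (use 1 2 3 in \<open>auto simp: F_def\<close>)
qed

lemma tail_powr_bounded:
  fixes T :: "real \<Rightarrow> real"
  assumes lim: "((\<lambda>x. x powr a * T x) \<longlongrightarrow> C) at_top" and T: "\<And>x. x > 0 \<Longrightarrow> 0 \<le> T x" "\<And>x. x > 0 \<Longrightarrow> T x \<le> 1"
    and a: "a > 0"
  shows "\<exists>B. \<forall>x>0. x powr a * T x \<le> B"
proof -
  have "\<forall>\<^sub>F x in at_top. x powr a * T x < C + 1" using lim by (intro order_tendstoD) auto
  then obtain x0 where x0: "\<And>x. x \<ge> x0 \<Longrightarrow> x powr a * T x < C + 1" by (auto simp: eventually_at_top_linorder)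
  have "x powr a * T x \<le> max (C + 1) (\<bar>x0\<bar> powr a)" if "x > 0" for x
  proof (cases "x \<ge> x0")
    case True thus ?thesis using x0[of x] by simp
  next
    case False
    hence "x powr a * T x \<le> \<bar>x0\<bar> powr a * 1"
      using that T[of x] a by (intro mult_mono powr_mono2) auto
    thus ?thesis by simp
  qed
  thus ?thesis by blast
qed

text \<open>The tail of Y_1 is a product of two Mittag-Leffler tails, hence regularly varying of
  index \<alpha> + \<beta> with constant C. The cases below, at and above 1 are a heavy tail, a
  logarithmically diverging truncated mean and a finite mean; each time scale is made to produce the
  same shape of limit. The polynomial bound on c is for the count of arrivals in the subcritical
  regime.\<close>

lemma (in prob_space) interarrival_laplace_exponent:
  fixes Y :: "nat \<Rightarrow> 'a \<Rightarrow> real" and \<alpha> \<beta> lam mu :: real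
  assumes P: "prob_space P" "mittag_leffler_distributed P X1 \<alpha> lam" "mittag_leffler_distributed P X2 \<beta> mu"
    and orders: "0 < \<alpha>" "\<alpha> < 1" "0 < \<beta>" "\<beta> < 1" and rates: "0 < lam" "0 < mu"
    and Y[measurable]: "Y 1 \<in> borel_measurable M"
    and tail: "\<And>t. t \<ge> 0 \<Longrightarrow> \<P>(\<omega> in M. Y 1 \<omega> > t) =
        mittag_leffler \<alpha> (- lam * t powr \<alpha>) * mittag_leffler \<beta> (- mu * t powr \<beta>)"
  defines "K \<equiv> limit_rate M \<alpha> \<beta> lam mu Y"
    and "c \<equiv> \<lambda>n. real n * time_scale M \<alpha> \<beta> lam mu Y n"
  shows "AE \<omega> in M. Y 1 \<omega> > 0" "K > 0" "\<forall>\<^sub>F n in sequentially. c n > 0"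
    "\<And>z. z > 0 \<Longrightarrow> (\<lambda>n. real n * (1 - expectation (\<lambda>\<omega>. exp (- (z / c n) * Y 1 \<omega>)))) \<longlonglongrightarrow> (z / K) powr min 1 (\<alpha> + \<beta>)"
    "\<exists>D A. \<forall>n. c n \<le> D * real n ^ A"
proof -
  define F1 where "F1 t = mittag_leffler \<alpha> (- lam * t powr \<alpha>)" for t
  define F2 where "F2 t = mittag_leffler \<beta> (- mu * t powr \<beta>)" for t
  have [measurable]: "Y (Suc 0) \<in> borel_measurable M" using Y by simp
  note F1 = mittag_leffler_distributed_tail[OF P(1,2) orders(1,2) rates(1), folded F1_def]
  note F2 = mittag_leffler_distributed_tail[OF P(1,3) orders(3,4) rates(2), folded F2_def]
  define a where "a = \<alpha> + \<beta>"
  have a: "a > 0" using orders by (simp add: a_def)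
  define T where "T t = \<P>(\<omega> in M. Y 1 \<omega> > t)" for t
  have T: "T t = F1 t * F2 t" if "t \<ge> 0" for t using tail[OF that] by (simp add: T_def F1_def F2_def)
  have "T 0 = 1" using T[of 0] F1 F2 by simp
  thus pos: "AE \<omega> in M. Y 1 \<omega> > 0" unfolding T_def by (subst (asm) prob_Collect_eq_1) auto
  define C where "C = 1 / (lam * Gamma (1 - \<alpha>)) * (1 / (mu * Gamma (1 - \<beta>)))"
  have Gp: "Gamma (1 - \<alpha>) > 0" "Gamma (1 - \<beta>) > 0" using orders by (auto intro!: Gamma_real_pos)
  have C: "C > 0" using Gp rates by (simp add: C_def)
  have lim: "((\<lambda>x. x powr a * T x) \<longlongrightarrow> C) at_top"
  proof (rule Lim_transform_eventually)
    show "((\<lambda>t. (t powr \<alpha> * F1 t) * (t powr \<beta> * F2 t)) \<longlongrightarrow> C) at_top"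
      unfolding C_def by (intro tendsto_mult F1 F2)
    show "\<forall>\<^sub>F t in at_top. (t powr \<alpha> * F1 t) * (t powr \<beta> * F2 t) = t powr a * T t"
      using eventually_ge_at_top[of 0] by eventually_elim (simp add: T a_def powr_add)
  qed
  obtain B where B: "\<And>x. x > 0 \<Longrightarrow> x powr a * T x \<le> B"
    using tail_powr_bounded[OF lim _ _ a] by (auto simp: T_def)
  consider "a < 1" | "a = 1" | "a > 1" by linarith
  hence "K > 0 \<and> (\<forall>\<^sub>F n in sequentially. c n > 0) \<and>
    (\<forall>z>0. (\<lambda>n. real n * (1 - expectation (\<lambda>\<omega>. exp (- (z / c n) * Y 1 \<omega>)))) \<longlonglongrightarrow> (z / K) powr min 1 a) \<and>
    (\<exists>D A. \<forall>n. c n \<le> D * real n ^ A)"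
  proof cases
    case 1
    have Ga: "Gamma (1 - a) > 0" using 1 by (intro Gamma_real_pos) auto
    have K: "K = (lam * mu * Gamma (1 - \<alpha>) * Gamma (1 - \<beta>) / Gamma (1 - a)) powr (1 / a)"
      using 1 by (simp add: K_def limit_rate_def a_def algebra_simps)
    have Kpos: "K > 0" using Gp Ga rates by (simp add: K)
    \<comment> \<open>The rate K is the one whose a-th power cancels the constant C * Gamma (1 - a)
      coming from the regularly varying tail.\<close>
    have Ka: "K powr a = 1 / (C * Gamma (1 - a))"
      using Gp Ga rates a by (simp add: K powr_powr C_def field_simps)
    have g: "max 1 (1 / a) = 1 / a" using 1 a by (simp add: field_simps)
    have c: "c n = real n powr (1 / a)" for n
    proof (cases "n = 0")
      case False thus ?thesis using 1 unfolding c_def time_scale_def a_def[symmetric] g by (simp add: powr_diff)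
    qed (use 1 in \<open>simp add: c_def\<close>)
    have "(\<lambda>n. real n * (1 - expectation (\<lambda>\<omega>. exp (- (z / c n) * Y 1 \<omega>)))) \<longlonglongrightarrow> (z / K) powr min 1 a" if z: "z > 0" for z
    \<comment> \<open>The shift skips n = 0, where c vanishes and z / c n is not positive.\<close>
    proof (rule LIMSEQ_imp_Suc)
      have u: "z / c (Suc n) > 0" for n using z by (simp add: c)
      have "(\<lambda>n. (z / c (Suc n)) powr (-a) * (1 - expectation (\<lambda>\<omega>. exp (- (z / c (Suc n)) * Y 1 \<omega>)))) \<longlonglongrightarrow> C * Gamma (1 - a)"
      proof (rule laplace_exponent_regularly_varying[OF Y pos a 1 _ lim[unfolded T_def] B[unfolded T_def]])
        show "(\<lambda>n. z / c (Suc n)) \<longlonglongrightarrow> 0" unfolding c using z a by real_asymp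
      qed (use C u in auto)
      from tendsto_mult[OF tendsto_const[of "z powr a"] this]
      have "(\<lambda>n. z powr a * (z / c (Suc n)) powr (-a) * (1 - expectation (\<lambda>\<omega>. exp (- (z / c (Suc n)) * Y 1 \<omega>)))) \<longlonglongrightarrow> z powr a * (C * Gamma (1 - a))"
        by (simp add: mult.assoc)
      moreover have "z powr a * (z / c (Suc n)) powr (-a) = real (Suc n)" for n
      proof -
        have "z powr a * (z / c (Suc n)) powr (-a) = c (Suc n) powr a * (z powr a / z powr a)"
          by (simp add: powr_divide powr_minus_divide)
        also have "\<dots> = real (Suc n)" using z a by (simp add: c powr_powr del: of_nat_Suc)
        finally show ?thesis .
      qed
      moreover have "z powr a * (C * Gamma (1 - a)) = (z / K) powr min 1 a"
        using 1 Ka by (simp add: powr_divide)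
      ultimately show "(\<lambda>n. real (Suc n) * (1 - expectation (\<lambda>\<omega>. exp (- (z / c (Suc n)) * Y 1 \<omega>)))) \<longlonglongrightarrow> (z / K) powr min 1 a"
        by simp
    qed
    moreover have "\<forall>\<^sub>F n in sequentially. c n > 0"
      using eventually_gt_at_top[of 0] by eventually_elim (simp add: c)
    moreover have "\<exists>D A. \<forall>n. c n \<le> D * real n ^ A"
    proof (intro exI allI)
      fix n :: nat
      show "c n \<le> 1 * real n ^ (nat \<lceil>1 / a\<rceil>)"
      proof (cases "n = 0")
        case False
        have "real n powr (1 / a) \<le> real n powr (real (nat \<lceil>1 / a\<rceil>))"
          using False a by (intro powr_mono) (auto simp: real_nat_ceiling_ge)
        thus ?thesis using False by (simp add: c powr_realpow)
      qed (simp add: c)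
    qed
    ultimately show ?thesis using Kpos by blast
  next
    case 2
    have s: "sin (pi * \<alpha>) > 0" using orders by (intro sin_gt_zero) auto
    \<comment> \<open>With this \<theta> the time scale is literally the sine mean \<open>m\<close>
      of the critical lemma.\<close>
    define \<theta> where "\<theta> = 2 * lam * mu / sin (pi * \<alpha>)"
    have th: "\<theta> > 0" using s rates by (simp add: \<theta>_def)
    have K: "K = 1" using 2 by (simp add: K_def limit_rate_def a_def)
    define m where "m n = (real n / \<theta>) * expectation (\<lambda>\<omega>. sin (\<theta> * Y 1 \<omega> / real n))" for n
    have m: "time_scale M \<alpha> \<beta> lam mu Y n = m n" for n
    proof -
      have e: "2 * lam * mu * y / (real n * sin (pi * \<alpha>)) = \<theta> * y / real n" for y
        by (simp add: \<theta>_def mult.commute)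
      show ?thesis using 2 unfolding time_scale_def m_def a_def[symmetric] e by (simp add: \<theta>_def)
    qed
    have lim1: "((\<lambda>x. x * \<P>(\<omega> in M. Y 1 \<omega> > x)) \<longlongrightarrow> C) at_top"
      by (rule Lim_transform_eventually[OF lim[unfolded T_def 2]])
        (use eventually_ge_at_top[of 0] in \<open>eventually_elim, simp\<close>)
    have B1: "x * \<P>(\<omega> in M. Y 1 \<omega> > x) \<le> B" if "x > 0" for x using B[OF that] that 2 by (simp add: T_def)
    note L = laplace_exponent_critical[OF Y pos C lim1 B1 th]
    have mt: "filterlim m at_top sequentially" unfolding m_def by (rule L(1)[OF _ zero_less_one])
    hence "\<forall>\<^sub>F n in sequentially. m n > 0" by (auto simp: filterlim_at_top_dense)
    hence "\<forall>\<^sub>F n in sequentially. c n > 0"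
      using eventually_gt_at_top[of 0] by eventually_elim (simp add: c_def m)
    moreover have "(\<lambda>n. real n * (1 - expectation (\<lambda>\<omega>. exp (- (z / c n) * Y 1 \<omega>)))) \<longlonglongrightarrow> (z / K) powr min 1 a" if z: "z > 0" for z
      using L(2)[OF _ z] z unfolding c_def m m_def 2 K by simp
    moreover have "\<exists>D A. \<forall>n. c n \<le> D * real n ^ A"
    proof (intro exI allI)
      fix n :: nat
      have "expectation (\<lambda>\<omega>. sin (\<theta> * Y 1 \<omega> / real n)) \<le> expectation (\<lambda>\<omega>. 1)"
        by (intro integral_mono integrable_const_bound[where B=1]) auto
      hence "m n \<le> (real n / \<theta>) * 1" unfolding m_def using th
        by (intro mult_left_mono) (auto simp: prob_space)
      hence "real n * m n \<le> real n * (real n / \<theta>)" by (intro mult_left_mono) auto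
      thus "c n \<le> (1 / \<theta>) * real n ^ 2" by (simp add: c_def m power2_eq_square)
    qed
    ultimately show ?thesis using K by auto
  next
    case 3
    have intY: "integrable M (Y 1)" by (rule integrable_tail_powr[OF Y pos 3 B[unfolded T_def]])
    have EY: "expectation (Y 1) > 0"
    proof -
      have "expectation (Y 1) \<ge> 0" by (rule integral_nonneg_AE) (use pos in \<open>auto elim: eventually_mono\<close>)
      moreover have "expectation (Y 1) \<noteq> 0"
      proof
        assume "expectation (Y 1) = 0"
        moreover have "AE \<omega> in M. 0 \<le> Y 1 \<omega>" using pos by (rule AE_mp) auto
        ultimately have "AE \<omega> in M. Y 1 \<omega> = 0"
          using integral_nonneg_eq_0_iff_AE[OF intY] by simp
        hence "AE \<omega> in M. False" using pos by eventually_elim simp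
        thus False by simp
      qed
      ultimately show ?thesis by simp
    qed
    have K: "K = 1 / expectation (Y 1)" using 3 by (simp add: K_def limit_rate_def a_def)
    have g: "max 1 (1 / a) - 1 = 0" using 3 by (simp add: field_simps)
    have c: "c n = real n" for n
      using 3 unfolding c_def time_scale_def a_def[symmetric] g by (cases "n = 0") auto
    have "(\<lambda>n. real n * (1 - expectation (\<lambda>\<omega>. exp (- (z / c n) * Y 1 \<omega>)))) \<longlonglongrightarrow> (z / K) powr min 1 a" if z: "z > 0" for z
      using laplace_exponent_finite_mean[OF intY pos, of z] z 3 EY unfolding c K by simp
    moreover have "\<forall>\<^sub>F n in sequentially. c n > 0"
      using eventually_gt_at_top[of 0] by eventually_elim (simp add: c)
    moreover have "\<exists>D A. \<forall>n. c n \<le> D * real n ^ A"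
      by (intro exI[of _ 1]) (auto simp: c)
    ultimately show ?thesis using K EY by auto
  qed
  thus "K > 0" "\<forall>\<^sub>F n in sequentially. c n > 0"
    "\<And>z. z > 0 \<Longrightarrow> (\<lambda>n. real n * (1 - expectation (\<lambda>\<omega>. exp (- (z / c n) * Y 1 \<omega>)))) \<longlonglongrightarrow> (z / K) powr min 1 (\<alpha> + \<beta>)"
    "\<exists>D A. \<forall>n. c n \<le> D * real n ^ A"
    by (simp_all add: a_def)
qed

abbreviation "real_sequences \<equiv> Pi\<^sub>M (UNIV :: nat set) (\<lambda>_. borel :: real measure)"
abbreviation "nat_sequences \<equiv> Pi\<^sub>M (UNIV :: nat set) (\<lambda>_. count_space (UNIV :: nat set))"

section \<open>The embedded chain as a reflected random walk\<close>

definition coin_space :: "real \<Rightarrow> (nat \<Rightarrow> bool) measure" where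
  "coin_space p = Pi\<^sub>M UNIV (\<lambda>_. measure_pmf (bernoulli_pmf p))"

definition walk :: "(nat \<Rightarrow> bool) \<Rightarrow> nat \<Rightarrow> real" where
  "walk w k = (\<Sum>j<k. if w j then 1 else -1)"

text \<open>A coin is consumed also at 0, where its outcome is ignored, so the chain and
  \<open>walk\<close> run on the same tosses step by step.\<close>

primrec coin_chain :: "(nat \<Rightarrow> bool) \<Rightarrow> nat \<Rightarrow> nat" where
  "coin_chain w 0 = 0"
| "coin_chain w (Suc k) = (if coin_chain w k = 0 then 1
     else if w k then coin_chain w k + 1 else coin_chain w k - 1)"

text \<open>The discrete form of the supremum in the Skorokhod reflection: the running maximum of
  the negative part.\<close>

primrec max_deficit :: "(nat \<Rightarrow> real) \<Rightarrow> nat \<Rightarrow> real" where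
  "max_deficit g 0 = max (- g 0) 0"
| "max_deficit g (Suc i) = max (max_deficit g i) (- g (Suc i))"

text \<open>With \<open>max_deficit_least\<close> this describes the running maximum as the least
  nonnegative upper bound of - g on {..i}; comparisons between different time grids go through these
  two facts.\<close>

lemma max_deficit_ge: "j \<le> i \<Longrightarrow> - g j \<le> max_deficit g i" "0 \<le> max_deficit g i"
  by (induction i) (auto simp: le_Suc_eq le_max_iff_disj)

lemma max_deficit_least: "0 \<le> c \<Longrightarrow> (\<And>j. j \<le> i \<Longrightarrow> - g j \<le> c) \<Longrightarrow> max_deficit g i \<le> c"
  by (induction i) auto

lemma walk_0[simp]: "walk w 0 = 0" and walk_Suc: "walk w (Suc k) = walk w k + (if w k then 1 else -1)"
  by (simp_all add: walk_def)

text \<open>The chain is the walk pushed up at 0 by steps of size 0 or 2; comparing the push with the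
  one of the Skorokhod reflection costs at most 2.\<close>

lemma coin_chain_reflection:
  "max_deficit (walk w) k \<le> real (coin_chain w k) - walk w k"
  "real (coin_chain w k) - walk w k \<le> max_deficit (walk w) k + 2"
proof (induction k)
  case (Suc k)
  have ge: "- walk w k \<le> max_deficit (walk w) k" by (rule max_deficit_ge) simp
  { case 1 show ?case using Suc ge by (cases "coin_chain w k") (auto simp: walk_Suc) }
  { case 2 show ?case using Suc ge by (cases "coin_chain w k") (auto simp: walk_Suc) }
qed auto

lemma prob_space_coin_space: "prob_space (coin_space p)"
  unfolding coin_space_def by (intro prob_space_PiM prob_space_measure_pmf)

lemma space_coin_space[simp]: "space (coin_space p) = UNIV"
  by (simp add: coin_space_def space_PiM)

lemma measurable_coin[measurable]: "(\<lambda>w. w k) \<in> measurable (coin_space p) (count_space UNIV)"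
proof -
  have "(\<lambda>w. w k) \<in> measurable (coin_space p) (measure_pmf (bernoulli_pmf p))"
    unfolding coin_space_def by measurable
  thus ?thesis by simp
qed

lemma measurable_coin_chain[measurable]: "(\<lambda>w. coin_chain w k) \<in> measurable (coin_space p) (count_space UNIV)"
  by (induction k) simp_all

lemma measurable_walk[measurable]: "(\<lambda>w. walk w k) \<in> borel_measurable (coin_space p)"
  unfolding walk_def by measurable

lemma coin_chain_cong: "(\<And>j. j < k \<Longrightarrow> w j = w' j) \<Longrightarrow> coin_chain w k = coin_chain w' k"
  by (induction k) auto

section \<open>The law of the embedded chain\<close>

lemma indep_vars_coin: "prob_space.indep_vars (coin_space p) (\<lambda>_. count_space UNIV) (\<lambda>k w. w k) UNIV"
proof -
  interpret prob_space "coin_space p" by (rule prob_space_coin_space)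
  have d: "distr (coin_space p) (measure_pmf (bernoulli_pmf p)) (\<lambda>w. w k) = measure_pmf (bernoulli_pmf p)" for k
    unfolding coin_space_def by (rule distr_PiM_component) (auto intro: prob_space_measure_pmf)
  have "indep_vars (\<lambda>_. measure_pmf (bernoulli_pmf p)) (\<lambda>k w. w k) UNIV"
  proof (subst indep_vars_iff_distr_eq_PiM)
    show "distr (coin_space p) (Pi\<^sub>M UNIV (\<lambda>i. measure_pmf (bernoulli_pmf p))) (\<lambda>x. \<lambda>i\<in>UNIV. x i) =
      Pi\<^sub>M UNIV (\<lambda>i. distr (coin_space p) (measure_pmf (bernoulli_pmf p)) (\<lambda>w. w i))"
      unfolding d by (simp add: coin_space_def restrict_def distr_id)
    show "(\<lambda>w. w i) \<in> measurable (coin_space p) (measure_pmf (bernoulli_pmf p))" for i by simp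
  qed simp
  thus ?thesis unfolding indep_vars_def by simp
qed

lemma distr_coin: "distr (coin_space p) (count_space UNIV) (\<lambda>w. w k) = measure_pmf (bernoulli_pmf p)"
proof -
  have "distr (coin_space p) (count_space UNIV) (\<lambda>w. w k) = distr (coin_space p) (measure_pmf (bernoulli_pmf p)) (\<lambda>w. w k)"
    by (rule distr_cong) auto
  also have "\<dots> = measure_pmf (bernoulli_pmf p)"
    unfolding coin_space_def by (rule distr_PiM_component) (auto intro: prob_space_measure_pmf)
  finally show ?thesis .
qed

lemma prob_coin:
  assumes "0 \<le> p" "p \<le> 1"
  shows "measure (coin_space p) {w. w k} = p" "measure (coin_space p) {w. \<not> w k} = 1 - p"
proof -
  have "measure (coin_space p) {w. Q (w k)} = measure (measure_pmf (bernoulli_pmf p)) {b. Q b}" for Q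
    unfolding distr_coin[of p k, symmetric] by (subst measure_distr) (auto simp: vimage_def)
  note this[of "\<lambda>b. b"] this[of Not]
  moreover have "{b. b} = {True}" "{b. \<not> b} = {False}" by auto
  ultimately show "measure (coin_space p) {w. w k} = p" "measure (coin_space p) {w. \<not> w k} = 1 - p"
    using assms by (simp_all add: measure_pmf_single)
qed

lemma (in prob_space) indep_var_past_present:
  assumes X: "indep_vars (\<lambda>_. N) X (UNIV :: nat set)"
    and f: "f \<in> measurable (Pi\<^sub>M {..<k} (\<lambda>_. N)) S" and g: "g \<in> measurable N T"
  shows "indep_var S (\<lambda>\<omega>. f (\<lambda>i\<in>{..<k}. X i \<omega>)) T (\<lambda>\<omega>. g (X k \<omega>))"
proof -
  have "indep_var (Pi\<^sub>M {..<k} (\<lambda>_. N)) (\<lambda>\<omega>. \<lambda>i\<in>{..<k}. X i \<omega>) (Pi\<^sub>M {k} (\<lambda>_. N)) (\<lambda>\<omega>. \<lambda>i\<in>{k}. X i \<omega>)"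
    by (rule indep_var_restrict[OF X]) auto
  from indep_var_compose[OF this f, of "\<lambda>x. g (x k)" T] g
  show ?thesis by (simp add: comp_def)
qed

lemma measurable_coin_chain_PiM:
  "j \<le> k \<Longrightarrow> (\<lambda>w. coin_chain w j) \<in> measurable (Pi\<^sub>M {..<k} (\<lambda>_. count_space UNIV)) (count_space UNIV)"
proof (induction j)
  case (Suc j)
  have [measurable]: "(\<lambda>w. coin_chain w j) \<in> measurable (Pi\<^sub>M {..<k} (\<lambda>_. count_space UNIV)) (count_space UNIV)"
    "(\<lambda>w. w j) \<in> measurable (Pi\<^sub>M {..<k} (\<lambda>_. count_space UNIV)) (count_space (UNIV :: bool set))"
    using Suc by auto
  show ?case by simp
qed simp

text \<open>Toss k alone decides the step from time k to k + 1, while the path up to time k depends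
  on the tosses before k; independence makes the cylinder probabilities products.\<close>

lemma cylinder_prob_coin_chain:
  assumes p: "0 \<le> p" "p \<le> 1"
  shows "measure (coin_space p) {w. \<forall>j\<le>k. coin_chain w j = x j} =
    (if x 0 = 0 then \<Prod>j<k. queue_transition p (x j) (x (Suc j)) else 0)"
proof (induction k)
  case 0
  interpret prob_space "coin_space p" by (rule prob_space_coin_space)
  show ?case using prob_space by (auto simp: eq_commute[of 0])
next
  case (Suc k)
  interpret prob_space "coin_space p" by (rule prob_space_coin_space)
  \<comment> \<open>\<open>G b\<close> states that outcome b of toss k leads from x k to x (Suc
    k).\<close>
  define G where "G b \<longleftrightarrow> x (Suc k) = (if x k = 0 then 1 else if b then x k + 1 else x k - 1)" for b
  have eq: "{w. \<forall>j\<le>Suc k. coin_chain w j = x j} = {w. (\<forall>j\<le>k. coin_chain w j = x j) \<and> G (w k)}"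
  proof (rule Collect_cong)
    fix w
    have "coin_chain w (Suc k) = x (Suc k) \<longleftrightarrow> G (w k)" if "coin_chain w k = x k"
      using that by (simp add: G_def eq_commute[of "x (Suc k)"])
    moreover have "(\<forall>j\<le>Suc k. coin_chain w j = x j) \<longleftrightarrow> (\<forall>j\<le>k. coin_chain w j = x j) \<and> coin_chain w (Suc k) = x (Suc k)"
      by (simp only: le_Suc_eq) blast
    ultimately show "(\<forall>j\<le>Suc k. coin_chain w j = x j) \<longleftrightarrow> (\<forall>j\<le>k. coin_chain w j = x j) \<and> G (w k)"
      by blast
  qed
  have G: "measure (coin_space p) {w. G (w k)} = queue_transition p (x k) (x (Suc k))"
  proof -
    consider "x k = 0" "x (Suc k) = 1" | "x k = 0" "x (Suc k) \<noteq> 1"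
      | "x k \<noteq> 0" "x (Suc k) = x k + 1" | "x k \<noteq> 0" "x (Suc k) = x k - 1"
      | "x k \<noteq> 0" "x (Suc k) \<noteq> x k + 1" "x (Suc k) \<noteq> x k - 1" by blast
    thus ?thesis
    proof cases
      case 1 thus ?thesis using prob_space by (simp add: G_def queue_transition_def)
    next
      case 2 thus ?thesis by (simp add: G_def queue_transition_def)
    next
      case 3 
      hence "{w. G (w k)} = {w. w k}" by (auto simp: G_def)
      thus ?thesis using 3 prob_coin(1)[OF p, of k] by (simp add: queue_transition_def)
    next
      case 4
      hence "{w. G (w k)} = {w. \<not> w k}" by (auto simp: G_def)
      thus ?thesis using 4 prob_coin(2)[OF p, of k] by (simp add: queue_transition_def)
    next
      case 5
      hence "{w. G (w k)} = {}" by (auto simp: G_def)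
      thus ?thesis using 5 by (simp add: queue_transition_def)
    qed
  qed
  define h where "h w \<longleftrightarrow> (\<forall>j\<le>k. coin_chain w j = x j)" for w
  have hcong: "h (\<lambda>i\<in>{..<k}. w i) = h w" for w
    unfolding h_def by (intro all_cong arg_cong2[where f="(=)"] coin_chain_cong refl) auto
  have hm: "h \<in> measurable (Pi\<^sub>M {..<k} (\<lambda>_. count_space UNIV)) (count_space UNIV)"
  proof -
    have "Measurable.pred (Pi\<^sub>M {..<k} (\<lambda>_. count_space UNIV)) (\<lambda>w. \<forall>j\<in>{..k}. coin_chain w j = x j)"
    proof (intro pred_intros_finite)
      fix j assume "j \<in> {..k}"
      hence [measurable]: "(\<lambda>w. coin_chain w j) \<in> measurable (Pi\<^sub>M {..<k} (\<lambda>_. count_space UNIV)) (count_space UNIV)"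
        using measurable_coin_chain_PiM by simp
      show "Measurable.pred (Pi\<^sub>M {..<k} (\<lambda>_. count_space UNIV)) (\<lambda>w. coin_chain w j = x j)" by measurable
    qed simp
    thus ?thesis unfolding h_def[abs_def] Ball_def atMost_iff .
  qed
  have "indep_var (count_space UNIV) (\<lambda>w. h (\<lambda>i\<in>{..<k}. w i)) (count_space UNIV) (\<lambda>w. G (w k))"
    by (rule indep_var_past_present[OF indep_vars_coin hm]) simp
  hence "indep_var (count_space UNIV) h (count_space UNIV) (\<lambda>w. G (w k))" unfolding hcong by simp
  from indep_varD[OF this, of "{True}" "{True}"]
  have "measure (coin_space p) {w. h w \<and> G (w k)} = measure (coin_space p) {w. h w} * measure (coin_space p) {w. G (w k)}"
    by (simp add: vimage_def)
  thus ?case unfolding eq G using Suc by (simp add: h_def)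
qed

lemma cylinder_prob_markov_chain:
  assumes M: "prob_space M" and q: "markov_chain M q (queue_transition p)" and q0: "AE \<omega> in M. q 0 \<omega> = 0"
  shows "measure M {\<omega>\<in>space M. \<forall>j\<le>k. q j \<omega> = x j} =
    (if x 0 = 0 then \<Prod>j<k. queue_transition p (x j) (x (Suc j)) else 0)"
proof (induction k)
  case 0
  interpret prob_space M by (rule M)
  have [measurable]: "q k \<in> measurable M (count_space UNIV)" for k using q by (simp add: markov_chain_def)
  show ?case
  proof (cases "x 0 = 0")
    case True
    have "prob {\<omega>\<in>space M. q 0 \<omega> = 0} = 1" using q0 by (subst prob_Collect_eq_1) auto
    thus ?thesis using True by simp
  next
    case False
    have "prob {\<omega>\<in>space M. q 0 \<omega> = x 0} = 0" using q0 False by (subst prob_Collect_eq_0) (auto elim!: eventually_mono)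
    thus ?thesis using False by simp
  qed
next
  case (Suc k)
  interpret prob_space M by (rule M)
  have eq: "{\<omega>\<in>space M. \<forall>j\<le>Suc k. q j \<omega> = x j} = {\<omega>\<in>space M. q (Suc k) \<omega> = x (Suc k) \<and> (\<forall>j\<le>k. q j \<omega> = x j)}"
    by (auto simp: le_Suc_eq)
  have [measurable]: "q k \<in> measurable M (count_space UNIV)" for k using q by (simp add: markov_chain_def)
  show ?case
  proof (cases "prob {\<omega>\<in>space M. \<forall>j\<le>k. q j \<omega> = x j} > 0")
    case True
    hence "\<P>(\<omega> in M. q (Suc k) \<omega> = x (Suc k) \<bar> \<forall>j\<le>k. q j \<omega> = x j) = queue_transition p (x k) (x (Suc k))"
      using q by (simp add: markov_chain_def)
    hence "prob {\<omega>\<in>space M. q (Suc k) \<omega> = x (Suc k) \<and> (\<forall>j\<le>k. q j \<omega> = x j)} =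
      queue_transition p (x k) (x (Suc k)) * prob {\<omega>\<in>space M. \<forall>j\<le>k. q j \<omega> = x j}"
      using True by (simp add: cond_prob_def field_simps)
    thus ?thesis unfolding eq using Suc by simp
  next
    \<comment> \<open>The transition law says nothing when the past has probability 0; then both
      sides vanish, the left by monotonicity and the right by the induction hypothesis.\<close>
    case False
    hence z: "prob {\<omega>\<in>space M. \<forall>j\<le>k. q j \<omega> = x j} = 0" by (simp add: zero_less_measure_iff)
    have "prob {\<omega>\<in>space M. q (Suc k) \<omega> = x (Suc k) \<and> (\<forall>j\<le>k. q j \<omega> = x j)} \<le> prob {\<omega>\<in>space M. \<forall>j\<le>k. q j \<omega> = x j}"
      by (intro finite_measure_mono) auto
    hence "prob {\<omega>\<in>space M. q (Suc k) \<omega> = x (Suc k) \<and> (\<forall>j\<le>k. q j \<omega> = x j)} = 0"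
      unfolding z by (simp only: measure_le_0_iff)
    thus ?thesis unfolding eq using Suc z by (auto split: if_splits)
  qed
qed

text \<open>Initial segments are valued in the countable set of lists, so their laws are determined
  by point masses, which are the cylinder probabilities. A product set over a finite index set is a
  preimage of a set of lists.\<close>

lemma nat_process_distr_eqI:
  fixes q :: "nat \<Rightarrow> 'a \<Rightarrow> nat" and q' :: "nat \<Rightarrow> 'b \<Rightarrow> nat"
  assumes M: "prob_space M" and M': "prob_space M'"
    and q: "\<And>k. q k \<in> measurable M (count_space UNIV)" and q': "\<And>k. q' k \<in> measurable M' (count_space UNIV)"
    and eq: "\<And>k x. measure M {\<omega>\<in>space M. \<forall>j\<le>k. q j \<omega> = x j} = measure M' {\<omega>\<in>space M'. \<forall>j\<le>k. q' j \<omega> = x j}"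
  shows "distr M nat_sequences (\<lambda>\<omega> k. q k \<omega>) = distr M' nat_sequences (\<lambda>\<omega> k. q' k \<omega>)"
proof -
  interpret M: prob_space M by (rule M)
  interpret M': prob_space M' by (rule M')
  note [measurable] = q q'
  have qm[measurable]: "(\<lambda>\<omega> k. q k \<omega>) \<in> measurable M nat_sequences"
    by (rule measurable_PiM_single') auto
  have qm'[measurable]: "(\<lambda>\<omega> k. q' k \<omega>) \<in> measurable M' nat_sequences"
    by (rule measurable_PiM_single') auto
  define l where "l k \<omega> = map (\<lambda>j. q j \<omega>) [0..<Suc k]" for k \<omega>
  define l' where "l' k \<omega> = map (\<lambda>j. q' j \<omega>) [0..<Suc k]" for k \<omega>
  have lmeas: "(\<lambda>\<omega>. map (\<lambda>j. r j \<omega>) xs) \<in> measurable N (count_space UNIV)"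
    if "\<And>j. r j \<in> measurable N (count_space UNIV)" for r :: "nat \<Rightarrow> 'z \<Rightarrow> nat" and N xs
  proof (subst measurable_count_space_eq2_countable, intro conjI allI ballI)
    fix ys
    note [measurable] = that
    have "(\<lambda>\<omega>. map (\<lambda>j. r j \<omega>) xs) -` {ys} \<inter> space N =
      (if length xs = length ys then {\<omega>\<in>space N. \<forall>i<length xs. r (xs ! i) \<omega> = ys ! i} else {})"
      by (auto simp: list_eq_iff_nth_eq)
    also have "\<dots> \<in> sets N" by auto
    finally show "(\<lambda>\<omega>. map (\<lambda>j. r j \<omega>) xs) -` {ys} \<inter> space N \<in> sets N" .
  qed auto
  have lm[measurable]: "l k \<in> measurable M (count_space UNIV)" for k
    unfolding l_def by (rule lmeas) measurable
  have lm'[measurable]: "l' k \<in> measurable M' (count_space UNIV)" for k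
    unfolding l'_def by (rule lmeas) measurable
  have lists: "distr M (count_space UNIV) (l k) = distr M' (count_space UNIV) (l' k)" for k
  proof (rule measure_eqI_countable)
    fix xs :: "nat list"
    have s: "{\<omega>\<in>space M. l k \<omega> = xs} = (if length xs = Suc k then {\<omega>\<in>space M. \<forall>j\<le>k. q j \<omega> = xs ! j} else {})"
      by (auto simp: l_def list_eq_iff_nth_eq less_Suc_eq_le simp del: upt_Suc)
    have s': "{\<omega>\<in>space M'. l' k \<omega> = xs} = (if length xs = Suc k then {\<omega>\<in>space M'. \<forall>j\<le>k. q' j \<omega> = xs ! j} else {})"
      by (auto simp: l'_def list_eq_iff_nth_eq less_Suc_eq_le simp del: upt_Suc)
    have "M.prob {\<omega>\<in>space M. l k \<omega> = xs} = M'.prob {\<omega>\<in>space M'. l' k \<omega> = xs}"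
      unfolding s s' using eq[of k "\<lambda>j. xs ! j"] by simp
    thus "emeasure (distr M (count_space UNIV) (l k)) {xs} = emeasure (distr M' (count_space UNIV) (l' k)) {xs}"
      by (simp add: emeasure_distr vimage_def Int_def conj_commute M.emeasure_eq_measure M'.emeasure_eq_measure)
  qed auto
  show ?thesis
  proof (rule measure_eqI_PiM_infinite)
    show "finite_measure (distr M nat_sequences (\<lambda>\<omega> k. q k \<omega>))"
      by (intro prob_space.finite_measure M.prob_space_distr qm)
    fix A :: "nat \<Rightarrow> nat set" and J :: "nat set"
    assume J: "finite J"
    obtain k where k: "J \<subseteq> {..k}" using J by (metis finite_nat_iff_bounded_le)
    define S where "S = {xs. \<forall>j\<in>J. xs ! j \<in> A j}"
    have PS: "prod_emb UNIV (\<lambda>_. count_space UNIV) J (Pi\<^sub>E J A) \<in> sets nat_sequences"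
      using J by (intro sets_PiM_I) auto
    have l_nth: "l k \<omega> ! j = q j \<omega>" "l' k \<omega>' ! j = q' j \<omega>'" if "j \<in> J" for j \<omega> \<omega>'
      using that k by (auto simp: l_def l'_def nth_map subset_iff less_Suc_eq_le simp del: upt_Suc)
    have "(\<lambda>\<omega> k. q k \<omega>) -` prod_emb UNIV (\<lambda>_. count_space UNIV) J (Pi\<^sub>E J A) \<inter> space M = l k -` S \<inter> space M"
      by (auto simp: prod_emb_def S_def space_PiM PiE_iff l_nth)
    hence "emeasure (distr M nat_sequences (\<lambda>\<omega> k. q k \<omega>)) (prod_emb UNIV (\<lambda>_. count_space UNIV) J (Pi\<^sub>E J A))
      = emeasure (distr M (count_space UNIV) (l k)) S"
      using emeasure_distr[OF qm PS] emeasure_distr[OF lm, of S k] by simp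
    also have "\<dots> = emeasure (distr M' (count_space UNIV) (l' k)) S" by (simp add: lists)
    also have "emeasure (distr M' (count_space UNIV) (l' k)) S = emeasure (distr M' nat_sequences (\<lambda>\<omega> k. q' k \<omega>)) (prod_emb UNIV (\<lambda>_. count_space UNIV) J (Pi\<^sub>E J A))"
    proof -
    have "(\<lambda>\<omega> k. q' k \<omega>) -` prod_emb UNIV (\<lambda>_. count_space UNIV) J (Pi\<^sub>E J A) \<inter> space M' = l' k -` S \<inter> space M'"
      by (auto simp: prod_emb_def S_def space_PiM PiE_iff l_nth)
    thus ?thesis
      using emeasure_distr[OF qm' PS] emeasure_distr[OF lm', of S k] by simp
    qed
    finally show "emeasure (distr M nat_sequences (\<lambda>\<omega> k. q k \<omega>)) (prod_emb UNIV (\<lambda>_. count_space UNIV) J (Pi\<^sub>E J A))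
      = emeasure (distr M' nat_sequences (\<lambda>\<omega> k. q' k \<omega>)) (prod_emb UNIV (\<lambda>_. count_space UNIV) J (Pi\<^sub>E J A))" .
  qed auto
qed

lemma distr_queue_chain:
  assumes M: "prob_space M" and q: "markov_chain M q (queue_transition p)" and q0: "AE \<omega> in M. q 0 \<omega> = 0"
    and p: "0 \<le> p" "p \<le> 1"
  shows "distr M nat_sequences (\<lambda>\<omega> k. q k \<omega>) =
    distr (coin_space p) nat_sequences coin_chain"
proof -
  have "distr M nat_sequences (\<lambda>\<omega> k. q k \<omega>) =
    distr (coin_space p) nat_sequences (\<lambda>w k. coin_chain w k)"
  proof (rule nat_process_distr_eqI[OF M prob_space_coin_space])
    show "q k \<in> measurable M (count_space UNIV)" for k using q by (simp add: markov_chain_def)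
    show "measure M {\<omega> \<in> space M. \<forall>j\<le>k. q j \<omega> = x j} =
       measure (coin_space p) {\<omega> \<in> space (coin_space p). \<forall>j\<le>k. coin_chain \<omega> j = x j}" for k x
      using cylinder_prob_markov_chain[OF M q q0, of k x] cylinder_prob_coin_chain[OF p, of k x] by simp
  qed simp
  thus ?thesis by simp
qed

section \<open>Independent blocks of i.i.d. sequences\<close>

lemma indep_vars_PiM_coordinates:
  assumes "\<And>i. i \<in> I \<Longrightarrow> prob_space (D i)" "I \<noteq> {}"
  shows "prob_space.indep_vars (Pi\<^sub>M I D) D (\<lambda>i w. w i) I"
proof -
  interpret prob_space "Pi\<^sub>M I D" by (rule prob_space_PiM) (rule assms)
  have "distr (Pi\<^sub>M I D) (Pi\<^sub>M I D) (\<lambda>x. restrict x I) = distr (Pi\<^sub>M I D) (Pi\<^sub>M I D) (\<lambda>x. x)"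
    by (rule distr_cong) (auto simp: space_PiM)
  also have "\<dots> = Pi\<^sub>M I D" by (rule distr_id)
  also have "\<dots> = Pi\<^sub>M I (\<lambda>i. distr (Pi\<^sub>M I D) (D i) (\<lambda>w. w i))"
    by (rule PiM_cong) (use distr_PiM_component[of I D] assms in auto)
  finally show ?thesis using assms
    by (subst indep_vars_iff_distr_eq_PiM') auto
qed

text \<open>The index intervals {i * b..<i * b + b} are disjoint, which gives independence of the
  blocks; each is an injective reindexing of the first one, which gives equality of their
  laws.\<close>

lemma distr_PiM_blocks:
  fixes D :: "'b measure" and T :: "'c measure"
  assumes D: "prob_space D" and f: "f \<in> measurable (Pi\<^sub>M {..<b} (\<lambda>_. D)) T"
  shows "distr (Pi\<^sub>M UNIV (\<lambda>_. D)) (Pi\<^sub>M UNIV (\<lambda>_. T)) (\<lambda>w i. f (\<lambda>j\<in>{..<b}. w (i * b + j))) =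
    Pi\<^sub>M (UNIV::nat set) (\<lambda>_. distr (Pi\<^sub>M UNIV (\<lambda>_. D)) T (\<lambda>w. f (\<lambda>j\<in>{..<b}. w j)))"
proof -
  define P where "P = Pi\<^sub>M (UNIV::nat set) (\<lambda>_. D)"
  interpret prob_space P unfolding P_def by (intro prob_space_PiM D)
  have ind: "indep_vars (\<lambda>_. D) (\<lambda>i w. w i) UNIV"
    unfolding P_def by (rule indep_vars_PiM_coordinates) (use D in auto)
  define Kb where "Kb i = {i * b..<i * b + b}" for i :: nat
  have disj: "disjoint_family_on Kb UNIV"
  proof (unfold disjoint_family_on_def, intro ballI impI)
    fix m n :: nat assume "m \<noteq> n"
    hence "m + 1 \<le> n \<or> n + 1 \<le> m" by linarith
    hence "(m + 1) * b \<le> n * b \<or> (n + 1) * b \<le> m * b" using mult_le_mono1 by blast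
    thus "Kb m \<inter> Kb n = {}" by (auto simp: Kb_def)
  qed
  have i1: "indep_vars (\<lambda>i. Pi\<^sub>M (Kb i) (\<lambda>_. D)) (\<lambda>i w. \<lambda>j\<in>Kb i. w j) UNIV"
    by (rule indep_vars_restrict[OF ind _ disj]) auto
  have g: "(\<lambda>x. f (\<lambda>j\<in>{..<b}. x (i * b + j))) \<in> measurable (Pi\<^sub>M (Kb i) (\<lambda>_. D)) T" for i
    by (rule measurable_compose[OF _ f], rule measurable_restrict) (auto simp: Kb_def)
  have r: "(\<lambda>j\<in>{..<b}. (\<lambda>j\<in>Kb i. w j) (i * b + j)) = (\<lambda>j\<in>{..<b}. w (i * b + j))" for i and w :: "nat \<Rightarrow> 'b"
    by (auto simp: Kb_def fun_eq_iff)
  have i2: "indep_vars (\<lambda>_. T) (\<lambda>i w. f (\<lambda>j\<in>{..<b}. w (i * b + j))) UNIV"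
    using indep_vars_compose2[OF i1, where N="\<lambda>_. T" and Y="\<lambda>i x. f (\<lambda>j\<in>{..<b}. x (i * b + j))"] g
    unfolding r by auto
  have m: "(\<lambda>w. \<lambda>j\<in>{..<b}. w (i * b + j)) \<in> measurable P (Pi\<^sub>M {..<b} (\<lambda>_. D))" for i
    unfolding P_def by (rule measurable_restrict) auto
  have rv: "random_variable T (\<lambda>w. f (\<lambda>j\<in>{..<b}. w (i * b + j)))" for i
    by (rule measurable_compose[OF m f])
  have re: "distr P (Pi\<^sub>M {..<b} (\<lambda>_. D)) (\<lambda>w. \<lambda>j\<in>{..<b}. w (i * b + j)) = Pi\<^sub>M {..<b} (\<lambda>_. D)" for i
    unfolding P_def by (rule distr_PiM_reindex) (use D in \<open>auto simp: inj_on_def\<close>)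
  have same: "distr P T (\<lambda>w. f (\<lambda>j\<in>{..<b}. w (i * b + j))) = distr (Pi\<^sub>M {..<b} (\<lambda>_. D)) T f" for i
    using distr_distr[OF f m, of i] unfolding re[of i] by (simp add: comp_def)
  from indep_vars_iff_distr_eq_PiM[THEN iffD1, OF _ rv i2]
  have "distr P (Pi\<^sub>M UNIV (\<lambda>_. T)) (\<lambda>w i. f (\<lambda>j\<in>{..<b}. w (i * b + j))) = Pi\<^sub>M UNIV (\<lambda>_. distr (Pi\<^sub>M {..<b} (\<lambda>_. D)) T f)"
    unfolding same restrict_UNIV by simp
  moreover have "distr P T (\<lambda>w. f (\<lambda>j\<in>{..<b}. w j)) = distr (Pi\<^sub>M {..<b} (\<lambda>_. D)) T f" using same[of 0] by simp
  ultimately show ?thesis unfolding P_def[symmetric] by simp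
qed

text \<open>The walk is stopped at the first passage above \<open>x\<close>; the exponential of the stopped walk
  has mean at most \<open>\<rho>\<^sup>b\<close>.\<close>

lemma (in prob_space) exponential_maximal_inequality:
  fixes X :: "nat \<Rightarrow> 'a \<Rightarrow> real"
  assumes X: "indep_vars (\<lambda>_. borel) X UNIV" and bd: "\<And>i \<omega>. \<bar>X i \<omega>\<bar> \<le> B"
    and \<rho>: "\<And>i. expectation (\<lambda>\<omega>. exp (\<theta> * X i \<omega>)) \<le> \<rho>" "1 \<le> \<rho>" and \<theta>: "\<theta> \<ge> 0"
  shows "\<P>(\<omega> in M. \<exists>j\<le>b. (\<Sum>i<j. X i \<omega>) \<ge> x) \<le> exp (- \<theta> * x) * \<rho> ^ b"
proof -
  have [measurable]: "X i \<in> borel_measurable M" for i using X by (auto simp: indep_vars_def)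
  \<comment> \<open>The stopped partial sum, written on plain sequences: \<open>T j w\<close> then
    visibly depends only on the first j coordinates, hence is independent of X j.\<close>
  define T where "T = rec_nat (\<lambda>_. 0) (\<lambda>j t (w::nat\<Rightarrow>real). if t w \<ge> x then t w else t w + w j)"
  have T0: "T 0 w = 0" and TS: "T (Suc j) w = (if T j w \<ge> x then T j w else T j w + w j)" for j w
    by (simp_all add: T_def)
  have Tcong: "T j w = T j w'" if "\<And>i. i < j \<Longrightarrow> w i = w' i" for j w w'
    using that by (induction j) (auto simp: T0 TS)
  have Tm: "T j \<in> borel_measurable (Pi\<^sub>M {..<k} (\<lambda>_. borel))" if "j \<le> k" for j k
    using that
  proof (induction j)
    case (Suc j)
    have [measurable]: "T j \<in> borel_measurable (Pi\<^sub>M {..<k} (\<lambda>_. borel))"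
      "(\<lambda>w. w j) \<in> borel_measurable (Pi\<^sub>M {..<k} (\<lambda>_. borel))" using Suc by auto
    show ?case unfolding TS[abs_def] by measurable
  qed (simp add: T0[abs_def])
  define R where "R j \<omega> = T j (\<lambda>i. X i \<omega>)" for j \<omega>
  have Req: "R j \<omega> = T j (\<lambda>i\<in>{..<j}. X i \<omega>)" for j \<omega> unfolding R_def by (rule Tcong) auto
  have [measurable]: "R j \<in> borel_measurable M" for j
    unfolding Req[abs_def] by (rule measurable_compose[OF _ Tm[OF order_refl]], rule measurable_restrict) simp
  have Rb: "\<bar>R j \<omega>\<bar> \<le> B * real j" for j \<omega>
  proof (induction j)
    case (Suc j)
    have "0 \<le> B" using bd[of 0 \<omega>] by linarith
    have "\<bar>R (Suc j) \<omega>\<bar> \<le> \<bar>R j \<omega>\<bar> + \<bar>X j \<omega>\<bar>" by (auto simp: R_def TS)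
    also have "\<dots> \<le> B * real j + B" using Suc bd by (intro add_mono) auto
    finally show ?case by (simp add: algebra_simps)
  qed (simp add: R_def T0)
  have B0: "0 \<le> B" using bd[of 0 undefined] by linarith
  have expb: "exp (\<theta> * y) \<le> exp (\<theta> * c)" if "\<bar>y\<bar> \<le> c" for y c :: real
    using that \<theta> by (auto intro!: mult_left_mono)
  have iR: "integrable M (\<lambda>\<omega>. exp (\<theta> * R j \<omega>))" for j
    by (rule integrable_const_bound[where B="exp (\<theta> * (B * real j))"]) (use expb[OF Rb] in auto)
  have iX: "integrable M (\<lambda>\<omega>. exp (\<theta> * X j \<omega>))" for j
    by (rule integrable_const_bound[where B="exp (\<theta> * B)"]) (use expb[OF bd] in auto)
  have main: "expectation (\<lambda>\<omega>. exp (\<theta> * R j \<omega>)) \<le> \<rho> ^ j" for j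
  proof (induction j)
    case 0 thus ?case by (simp add: R_def T0 prob_space)
  next
    case (Suc j)
    \<comment> \<open>U is the part still running, V the part already stopped. The next step
      multiplies U by an independent factor of mean at most \<rho>; V does not change and is bounded
      by V \<rho> because \<rho> \<ge> 1.\<close>
    define U where "U \<omega> = exp (\<theta> * R j \<omega>) * indicator {..<x} (R j \<omega>)" for \<omega>
    define V where "V \<omega> = exp (\<theta> * R j \<omega>) * indicator {x..} (R j \<omega>)" for \<omega>
    have [measurable]: "U \<in> borel_measurable M" "V \<in> borel_measurable M"
      unfolding U_def[abs_def] V_def[abs_def] by measurable
    have iU: "integrable M U"
      by (rule integrable_const_bound[where B="exp (\<theta> * (B * real j))"])
         (use expb[OF Rb] in \<open>auto simp: U_def indicator_def\<close>)
    have iV: "integrable M V"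
      by (rule integrable_const_bound[where B="exp (\<theta> * (B * real j))"])
         (use expb[OF Rb] in \<open>auto simp: V_def indicator_def\<close>)
    have ind: "indep_var borel U borel (\<lambda>\<omega>. exp (\<theta> * X j \<omega>))"
    proof -
      have "(\<lambda>w. exp (\<theta> * T j w) * indicator {..<x} (T j w)) \<in> borel_measurable (Pi\<^sub>M {..<j} (\<lambda>_. borel))"
        using Tm[of j j] by measurable
      from indep_var_past_present[OF X this, of "\<lambda>y. exp (\<theta> * y)" borel]
      show ?thesis unfolding Req[symmetric] U_def[abs_def] by simp
    qed
    have EUX: "expectation (\<lambda>\<omega>. U \<omega> * exp (\<theta> * X j \<omega>)) = expectation U * expectation (\<lambda>\<omega>. exp (\<theta> * X j \<omega>))"
      and iUX: "integrable M (\<lambda>\<omega>. U \<omega> * exp (\<theta> * X j \<omega>))"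
      using indep_var_lebesgue_integral[OF ind iU iX] indep_var_integrable[OF ind iU iX] by auto
    have "exp (\<theta> * R (Suc j) \<omega>) = V \<omega> + U \<omega> * exp (\<theta> * X j \<omega>)" for \<omega>
      by (auto simp: R_def TS U_def V_def exp_add algebra_simps)
    hence "expectation (\<lambda>\<omega>. exp (\<theta> * R (Suc j) \<omega>)) = expectation V + expectation U * expectation (\<lambda>\<omega>. exp (\<theta> * X j \<omega>))"
      using iV iUX EUX by simp
    also have "\<dots> \<le> expectation V * \<rho> + expectation U * \<rho>"
    proof (intro add_mono mult_left_mono \<rho>)
      have "expectation V \<ge> 0" by (intro integral_nonneg_AE) (auto simp: V_def)
      thus "expectation V \<le> expectation V * \<rho>" using \<rho>(2) by (simp add: mult_le_cancel_left1)
      show "0 \<le> expectation U" by (intro integral_nonneg_AE) (auto simp: U_def)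
    qed
    also have "\<dots> = expectation (\<lambda>\<omega>. V \<omega> + U \<omega>) * \<rho>" using iU iV by (simp add: algebra_simps)
    also have "(\<lambda>\<omega>. V \<omega> + U \<omega>) = (\<lambda>\<omega>. exp (\<theta> * R j \<omega>))" by (auto simp: V_def U_def indicator_def)
    also have "expectation (\<lambda>\<omega>. exp (\<theta> * R j \<omega>)) * \<rho> \<le> \<rho> ^ j * \<rho>" using Suc \<rho> by (intro mult_right_mono) auto
    finally show ?case by (simp add: mult.commute)
  qed
  have stop: "if \<exists>j\<le>k. (\<Sum>i<j. X i \<omega>) \<ge> x then R k \<omega> \<ge> x else R k \<omega> = (\<Sum>i<k. X i \<omega>)" for k \<omega>
  proof (induction k)
    case 0 thus ?case by (auto simp: R_def T0)
  next
    case (Suc k)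
    have R1: "R (Suc k) \<omega> = (if R k \<omega> \<ge> x then R k \<omega> else R k \<omega> + X k \<omega>)" by (simp add: R_def TS)
    show ?case
    proof (cases "\<exists>j\<le>k. (\<Sum>i<j. X i \<omega>) \<ge> x")
      case True
      hence "\<exists>j\<le>Suc k. (\<Sum>i<j. X i \<omega>) \<ge> x" using le_SucI by blast
      thus ?thesis using Suc True R1 by auto
    next
      case False
      hence "R k \<omega> = (\<Sum>i<k. X i \<omega>)" "\<not> R k \<omega> \<ge> x" using Suc by auto
      thus ?thesis using False R1 by (auto simp: le_Suc_eq)
    qed
  qed
  have "\<P>(\<omega> in M. \<exists>j\<le>b. (\<Sum>i<j. X i \<omega>) \<ge> x) \<le> \<P>(\<omega> in M. exp (\<theta> * R b \<omega>) \<ge> exp (\<theta> * x))"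
  proof (intro finite_measure_mono Collect_mono_iff subsetI)
    fix \<omega> assume "\<omega> \<in> {\<omega> \<in> space M. \<exists>j\<le>b. x \<le> (\<Sum>i<j. X i \<omega>)}"
    hence "R b \<omega> \<ge> x" "\<omega> \<in> space M" using stop[of b \<omega>] by (auto split: if_splits)
    thus "\<omega> \<in> {\<omega> \<in> space M. exp (\<theta> * x) \<le> exp (\<theta> * R b \<omega>)}" using \<theta> by (auto intro: mult_left_mono)
  qed measurable
  also have "\<dots> \<le> expectation (\<lambda>\<omega>. exp (\<theta> * R b \<omega>)) / exp (\<theta> * x)"
    by (rule integral_Markov_inequality_measure[where A="{}"]) (use iR in auto)
  also have "\<dots> \<le> \<rho> ^ b / exp (\<theta> * x)" using main by (intro divide_right_mono) auto
  also have "\<dots> = exp (- \<theta> * x) * \<rho> ^ b" by (simp add: exp_minus divide_inverse)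
  finally show ?thesis .
qed

section \<open>Exponential deviation bounds for the walk\<close>

lemma exp_le_quadratic:
  fixes y :: real assumes "\<bar>y\<bar> \<le> 1" shows "exp y \<le> 1 + y + y\<^sup>2"
proof (cases "y \<ge> 0")
  case True thus ?thesis using exp_bound[of y] assms by simp
next
  case False
  have "exp y = 1 / exp (- y)" by (simp add: exp_minus divide_inverse)
  also have "\<dots> \<le> 1 / (1 - y)" using exp_ge_add_one_self[of "- y"] False by (intro divide_left_mono) auto
  also have "\<dots> \<le> 1 + y + y\<^sup>2"
  proof -
    have "(1 + y + y\<^sup>2) * (1 - y) = 1 + (- y) * y\<^sup>2" by (simp add: algebra_simps power2_eq_square)
    moreover have "0 \<le> (- y) * y\<^sup>2" using False by (intro mult_nonneg_nonneg) auto
    ultimately show ?thesis using False by (simp add: divide_le_eq)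
  qed
  finally show ?thesis .
qed

text \<open>Centred steps are bounded by 2, so for \<theta> \<le> 1/2 the quadratic bound on exp
  gives each factor mean at most 1 + 4 \<theta>^2 \<le> exp (4 \<theta>^2). The sign \<sigma> treats
  upward and downward deviations alike, whence the factor 2. The free parameter \<theta> is tuned
  differently in the two regimes.\<close>

lemma walk_maximal_inequality:
  assumes p: "0 \<le> p" "p \<le> 1" and \<theta>: "0 \<le> \<theta>" "\<theta> \<le> 1/2"
  shows "\<P>(w in coin_space p. \<exists>j\<le>b. \<bar>walk w (s + j) - walk w s - (2 * p - 1) * real j\<bar> \<ge> x)
    \<le> 2 * exp (- \<theta> * x + 4 * \<theta>\<^sup>2 * real b)"
proof -
  interpret prob_space "coin_space p" by (rule prob_space_coin_space)
  define X where "X \<sigma> i w = \<sigma> * ((if w (s + i) then 1 else -1) - (2 * p - 1))" for \<sigma> :: real and i :: nat and w :: "nat \<Rightarrow> bool"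
  have [measurable]: "X \<sigma> i \<in> borel_measurable (coin_space p)" for \<sigma> i unfolding X_def by measurable
  have ind: "indep_vars (\<lambda>_. borel) (X \<sigma>) UNIV" for \<sigma>
  proof -
    have "indep_vars (\<lambda>i. Pi\<^sub>M {s + i} (\<lambda>_. count_space UNIV)) (\<lambda>i w. \<lambda>j\<in>{s + i}. w j) UNIV"
      by (rule indep_vars_restrict[OF indep_vars_coin]) (auto simp: disjoint_family_on_def)
    from indep_vars_compose2[OF this, of "\<lambda>i x. x (s + i)" "\<lambda>_. count_space UNIV"]
    have "indep_vars (\<lambda>_. count_space UNIV) (\<lambda>i w. w (s + i)) UNIV" by simp
    from indep_vars_compose2[OF this, of "\<lambda>_ b. \<sigma> * ((if b then 1 else -1) - (2 * p - 1))" "\<lambda>_. borel"]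
    show ?thesis by (simp add: X_def[abs_def])
  qed
  have sum: "(\<Sum>i<j. X \<sigma> i w) = \<sigma> * (walk w (s + j) - walk w s - (2 * p - 1) * real j)" for \<sigma> j w
    by (induction j) (auto simp: X_def walk_Suc algebra_simps)
  have abs2: "\<bar>X \<sigma> i w\<bar> \<le> 2" if "\<bar>\<sigma>\<bar> = 1" for \<sigma> i w
    using p that by (auto simp: X_def abs_mult)
  have ER: "expectation (\<lambda>w. exp (\<theta> * X \<sigma> i w)) \<le> exp (4 * \<theta>\<^sup>2)" if \<sigma>: "\<bar>\<sigma>\<bar> = 1" for \<sigma> i
  proof -
    have iX: "integrable (coin_space p) (X \<sigma> i)"
      by (rule integrable_const_bound[where B=2]) (use abs2[OF \<sigma>] in auto)
    have "X \<sigma> i = (\<lambda>w. \<sigma> * (2 * indicator {w. w (s + i)} w - 2 * p))" by (auto simp: X_def)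
    moreover have "{w. w (s + i)} \<in> sets (coin_space p)"
      using measurable_sets[OF measurable_coin[of "s + i" p], of "{True}"] by (simp add: vimage_def)
    hence "integrable (coin_space p) (indicator {w. w (s + i)} :: _ \<Rightarrow> real)"
      by (intro integrable_real_indicator) (auto simp: emeasure_eq_measure)
    ultimately have EX: "expectation (X \<sigma> i) = 0"
      using prob_coin(1)[OF p, of "s + i"] prob_space by simp
    have "expectation (\<lambda>w. exp (\<theta> * X \<sigma> i w)) \<le> expectation (\<lambda>w. 1 + \<theta> * X \<sigma> i w + 4 * \<theta>\<^sup>2)"
    proof (rule integral_mono)
      show "integrable (coin_space p) (\<lambda>w. exp (\<theta> * X \<sigma> i w))"
      proof (rule integrable_const_bound[where B="exp (\<theta> * 2)"])
        have "\<theta> * X \<sigma> i w \<le> \<theta> * 2" for w using abs2[OF \<sigma>, of i w] \<theta> by (intro mult_left_mono) auto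
        thus "AE w in coin_space p. norm (exp (\<theta> * X \<sigma> i w)) \<le> exp (\<theta> * 2)" by simp
      qed measurable
      show "integrable (coin_space p) (\<lambda>w. 1 + \<theta> * X \<sigma> i w + 4 * \<theta>\<^sup>2)" using iX by auto
      fix w
      have b: "\<bar>\<theta> * X \<sigma> i w\<bar> \<le> \<theta> * 2" using abs2[OF \<sigma>, of i w] \<theta> by (simp add: abs_mult mult_left_mono)
      hence "exp (\<theta> * X \<sigma> i w) \<le> 1 + \<theta> * X \<sigma> i w + (\<theta> * X \<sigma> i w)\<^sup>2"
        using \<theta> by (intro exp_le_quadratic) auto
      also have "(\<theta> * X \<sigma> i w)\<^sup>2 \<le> (\<theta> * 2)\<^sup>2" using b by (intro iffD1[OF abs_le_square_iff]) auto
      finally show "exp (\<theta> * X \<sigma> i w) \<le> 1 + \<theta> * X \<sigma> i w + 4 * \<theta>\<^sup>2" by (simp add: power_mult_distrib)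
    qed
    also have "\<dots> = 1 + 4 * \<theta>\<^sup>2" using iX EX prob_space by simp
    also have "\<dots> \<le> exp (4 * \<theta>\<^sup>2)" by (rule exp_ge_add_one_self)
    finally show ?thesis .
  qed
  have one: "\<P>(w in coin_space p. \<exists>j\<le>b. (\<Sum>i<j. X \<sigma> i w) \<ge> x) \<le> exp (- \<theta> * x + 4 * \<theta>\<^sup>2 * real b)" if \<sigma>: "\<bar>\<sigma>\<bar> = 1" for \<sigma>
  proof -
    have "\<P>(w in coin_space p. \<exists>j\<le>b. (\<Sum>i<j. X \<sigma> i w) \<ge> x) \<le> exp (- \<theta> * x) * exp (4 * \<theta>\<^sup>2) ^ b"
      by (rule exponential_maximal_inequality[OF ind abs2[OF \<sigma>] ER[OF \<sigma>]]) (use \<theta> in auto)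
    also have "\<dots> = exp (- \<theta> * x + 4 * \<theta>\<^sup>2 * real b)" by (simp add: mult_ac flip: exp_of_nat_mult exp_add)
    finally show ?thesis .
  qed
  have "\<P>(w in coin_space p. \<exists>j\<le>b. \<bar>walk w (s + j) - walk w s - (2 * p - 1) * real j\<bar> \<ge> x)
    \<le> measure (coin_space p) ({w\<in>space (coin_space p). \<exists>j\<le>b. (\<Sum>i<j. X 1 i w) \<ge> x} \<union> {w\<in>space (coin_space p). \<exists>j\<le>b. (\<Sum>i<j. X (-1) i w) \<ge> x})"
  proof (rule finite_measure_mono)
    show "{w \<in> space (coin_space p). \<exists>j\<le>b. \<bar>walk w (s + j) - walk w s - (2 * p - 1) * real j\<bar> \<ge> x} \<subseteq>
      {w\<in>space (coin_space p). \<exists>j\<le>b. (\<Sum>i<j. X 1 i w) \<ge> x} \<union> {w\<in>space (coin_space p). \<exists>j\<le>b. (\<Sum>i<j. X (-1) i w) \<ge> x}"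
      by (auto simp: sum abs_real_def split: if_splits)
  qed measurable
  also have "\<dots> \<le> \<P>(w in coin_space p. \<exists>j\<le>b. (\<Sum>i<j. X 1 i w) \<ge> x) + \<P>(w in coin_space p. \<exists>j\<le>b. (\<Sum>i<j. X (-1) i w) \<ge> x)"
    by (rule measure_Un_le) measurable
  finally show ?thesis using one[of 1] one[of "-1"] by simp
qed

lemma laplace_iid_sum:
  fixes \<mu> :: "real measure"
  assumes \<mu>: "real_distribution \<mu>" and pos: "AE x in \<mu>. x \<ge> 0" and z: "z \<ge> 0"
  shows "(\<integral>y. exp (- z * (\<Sum>j<k. y j)) \<partial>Pi\<^sub>M UNIV (\<lambda>_. \<mu>)) = (\<integral>x. exp (- z * x) \<partial>\<mu>) ^ k"
    "integrable (Pi\<^sub>M UNIV (\<lambda>_. \<mu>)) (\<lambda>y. exp (- z * (\<Sum>j<k. y j)))"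
proof -
  interpret \<mu>: real_distribution \<mu> by (rule \<mu>)
  have ps: "prob_space \<mu>" by unfold_locales
  interpret prob_space "Pi\<^sub>M (UNIV::nat set) (\<lambda>_. \<mu>)" by (intro prob_space_PiM ps)
  have comp[measurable]: "(\<lambda>y. y i) \<in> borel_measurable (Pi\<^sub>M UNIV (\<lambda>_. \<mu>))" for i :: nat
    using measurable_component_singleton[of i UNIV "\<lambda>_. \<mu>"] by simp
  have "indep_vars (\<lambda>_. \<mu>) (\<lambda>i y. y i) (UNIV :: nat set)"
    by (rule indep_vars_PiM_coordinates) (use ps in auto)
  from indep_vars_compose2[OF this, of "\<lambda>_ x. exp (- z * x)" "\<lambda>_. borel"]
  have "indep_vars (\<lambda>_. borel) (\<lambda>i y. exp (- z * y i)) (UNIV :: nat set)" by simp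
  hence ind: "indep_vars (\<lambda>_. borel) (\<lambda>i y. exp (- z * y i)) {..<k}"
    by (rule indep_vars_subset) auto
  have d: "distr (Pi\<^sub>M UNIV (\<lambda>_. \<mu>)) \<mu> (\<lambda>y. y i) = \<mu>" for i :: nat
    by (rule distr_PiM_component) (use ps in auto)
  have int: "integrable (Pi\<^sub>M UNIV (\<lambda>_. \<mu>)) (\<lambda>y. exp (- z * y i))" for i :: nat
  proof -
    have "integrable \<mu> (\<lambda>x. exp (- z * x))"
      by (rule \<mu>.integrable_const_bound[where B=1]) (use pos z in \<open>auto elim!: eventually_mono\<close>)
    hence "integrable (distr (Pi\<^sub>M UNIV (\<lambda>_. \<mu>)) \<mu> (\<lambda>y. y i)) (\<lambda>x. exp (- z * x))" unfolding d .
    thus ?thesis by (subst (asm) integrable_distr_eq) auto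
  qed
  have E: "(\<integral>y. exp (- z * y i) \<partial>Pi\<^sub>M UNIV (\<lambda>_. \<mu>)) = (\<integral>x. exp (- z * x) \<partial>\<mu>)" for i :: nat
  proof -
    have "(\<integral>x. exp (- z * x) \<partial>distr (Pi\<^sub>M UNIV (\<lambda>_. \<mu>)) \<mu> (\<lambda>y. y i)) = (\<integral>y. exp (- z * y i) \<partial>Pi\<^sub>M UNIV (\<lambda>_. \<mu>))"
      by (subst integral_distr) auto
    thus ?thesis unfolding d by simp
  qed
  have eq: "exp (- z * (\<Sum>j<k. y j)) = (\<Prod>j<k. exp (- z * y j))" for y :: "nat \<Rightarrow> real"
    by (simp add: sum_distrib_left sum_negf flip: exp_sum)
  show "(\<integral>y. exp (- z * (\<Sum>j<k. y j)) \<partial>Pi\<^sub>M UNIV (\<lambda>_. \<mu>)) = (\<integral>x. exp (- z * x) \<partial>\<mu>) ^ k"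
    unfolding eq using int E by (subst indep_vars_lebesgue_integral[OF _ ind]) auto
  show "integrable (Pi\<^sub>M UNIV (\<lambda>_. \<mu>)) (\<lambda>y. exp (- z * (\<Sum>j<k. y j)))"
    unfolding eq using int by (intro indep_vars_integrable[OF _ ind]) auto
qed

section \<open>Polygonal paths and convergence in distribution\<close>

definition clamp01 :: "real \<Rightarrow> real" where "clamp01 x = max 0 (min 1 x)"

text \<open>The linear interpolation through the points (v i, r i), written as a sum of ramps:
  summand i climbs from 0 to r (Suc i) - r i while t crosses the cell from v i to v (Suc i). No cell
  has to be located, so dependence on r and v is visibly measurable and, locally,
  continuous.\<close>

definition polygon :: "(nat \<Rightarrow> real) \<Rightarrow> (nat \<Rightarrow> real) \<Rightarrow> real \<Rightarrow> real" where
  "polygon r v t = r 0 + (\<Sum>i. (r (Suc i) - r i) * clamp01 ((t - v i) / (v (Suc i) - v i)))"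

text \<open>Unboundedness is asked for natural levels only, which keeps the condition countable and
  hence measurable.\<close>

definition good_knots :: "(nat \<Rightarrow> real) \<Rightarrow> bool" where
  "good_knots v \<longleftrightarrow> v 0 = 0 \<and> (\<forall>i. v i < v (Suc i)) \<and> (\<forall>k::nat. \<exists>i. v i > real k)"

lemma clamp01_simps: "0 \<le> clamp01 x" "clamp01 x \<le> 1" "x \<le> 0 \<Longrightarrow> clamp01 x = 0" "1 \<le> x \<Longrightarrow> clamp01 x = 1"
  "0 \<le> x \<Longrightarrow> x \<le> 1 \<Longrightarrow> clamp01 x = x" "\<bar>clamp01 x - clamp01 y\<bar> \<le> \<bar>x - y\<bar>"
  by (auto simp: clamp01_def)

lemma good_knots_strict_mono: "good_knots v \<Longrightarrow> strict_mono v"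
  by (simp add: good_knots_def strict_mono_Suc_iff)

lemma good_knots_unbounded:
  assumes "good_knots v" shows "\<exists>i. v i > x"
proof -
  obtain k :: nat where "real k > x" using reals_Archimedean2 by blast
  moreover obtain i where "v i > real k" using assms by (auto simp: good_knots_def)
  ultimately show ?thesis by (intro exI[of _ i]) simp
qed

lemma good_knots_nonneg: "good_knots v \<Longrightarrow> 0 \<le> v i"
  using strict_mono_less_eq[OF good_knots_strict_mono, of v 0 i] by (simp add: good_knots_def)

lemma good_knots_cell:
  assumes "good_knots v" "0 \<le> t" shows "\<exists>i. v i \<le> t \<and> t < v (Suc i)"
proof -
  define j where "j = (LEAST j. v j > t)"
  have j: "v j > t" unfolding j_def by (rule LeastI_ex[OF good_knots_unbounded[OF assms(1)]])
  hence "j \<noteq> 0" using assms by (auto simp: good_knots_def intro: ccontr)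
  then obtain i where i: "j = Suc i" by (cases j) auto
  have "\<not> v i > t" using not_less_Least[of i "\<lambda>j. v j > t"] i by (simp add: j_def)
  thus ?thesis using i j by (intro exI[of _ i]) auto
qed

lemma polygon_eq_sum:
  assumes "good_knots v" "t \<le> v j"
  shows "polygon r v t = r 0 + (\<Sum>i<j. (r (Suc i) - r i) * clamp01 ((t - v i) / (v (Suc i) - v i)))"
proof -
  have "(r (Suc i) - r i) * clamp01 ((t - v i) / (v (Suc i) - v i)) = 0" if "i \<notin> {..<j}" for i
  proof -
    have "v j \<le> v i" "v i < v (Suc i)"
      using that assms good_knots_strict_mono[of v] by (auto simp: strict_mono_less_eq good_knots_def)
    hence "(t - v i) / (v (Suc i) - v i) \<le> 0" using assms(2) by (intro divide_nonpos_pos) auto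
    thus ?thesis by (simp add: clamp01_simps)
  qed
  thus ?thesis unfolding polygon_def by (subst suminf_finite[of "{..<j}"]) auto
qed

lemma polygon_cell:
  assumes v: "good_knots v" and t: "v i \<le> t" "t \<le> v (Suc i)"
  shows "\<exists>s\<in>{0..1}. polygon r v t = r i + s * (r (Suc i) - r i)"
proof -
  define s where "s = (t - v i) / (v (Suc i) - v i)"
  have vi: "v i < v (Suc i)" using v by (simp add: good_knots_def)
  have s: "0 \<le> s" "s \<le> 1" unfolding s_def using t vi by auto
  have "clamp01 ((t - v j) / (v (Suc j) - v j)) = 1" if "j < i" for j
  proof -
    have "v (Suc j) \<le> v i" "v j < v (Suc j)"
      using that v good_knots_strict_mono[of v] by (auto simp: strict_mono_less_eq good_knots_def)
    hence "1 \<le> (t - v j) / (v (Suc j) - v j)" using t by (simp add: le_divide_eq)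
    thus ?thesis by (simp add: clamp01_simps)
  qed
  hence "(\<Sum>j<i. (r (Suc j) - r j) * clamp01 ((t - v j) / (v (Suc j) - v j))) = (\<Sum>j<i. r (Suc j) - r j)"
    by (intro sum.cong) auto
  hence "polygon r v t = r 0 + (\<Sum>j<i. r (Suc j) - r j) + (r (Suc i) - r i) * clamp01 s"
    using polygon_eq_sum[OF v t(2)] by (simp add: s_def)
  also have "(\<Sum>j<i. r (Suc j) - r j) = r i - r 0" by (rule sum_lessThan_telescope)
  also have "clamp01 s = s" using s by (simp add: clamp01_simps)
  finally show ?thesis using s by (intro bexI[of _ s]) (auto simp: mult.commute)
qed

text \<open>On a cell the polygon is a convex combination of the two end heights. A value near both
  ends is therefore near the polygon, wherever in the cell it is attained; this absorbs the
  discrepancy between jump times and linear interpolation.\<close>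

lemma polygon_close:
  assumes v: "good_knots v" and t: "v i \<le> t" "t \<le> v (Suc i)"
    and x: "\<bar>x - r i\<bar> \<le> e" "\<bar>x - r (Suc i)\<bar> \<le> e"
  shows "\<bar>x - polygon r v t\<bar> \<le> e"
proof -
  obtain s where s: "s \<in> {0..1}" "polygon r v t = r i + s * (r (Suc i) - r i)"
    using polygon_cell[OF v t] by blast
  have "x - polygon r v t = (1 - s) * (x - r i) + s * (x - r (Suc i))" by (simp add: s algebra_simps)
  hence "\<bar>x - polygon r v t\<bar> \<le> (1 - s) * \<bar>x - r i\<bar> + s * \<bar>x - r (Suc i)\<bar>"
    using s abs_triangle_ineq[of "(1 - s) * (x - r i)" "s * (x - r (Suc i))"] by (simp add: abs_mult)
  also have "\<dots> \<le> (1 - s) * e + s * e" using s x by (intro add_mono mult_left_mono) auto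
  finally show ?thesis by (simp add: algebra_simps)
qed

lemma continuous_on_polygon:
  assumes v: "good_knots v" shows "continuous_on A (polygon r v)"
proof (rule continuous_at_imp_continuous_on, rule ballI)
  fix t :: real
  obtain j where j: "v j > t" using good_knots_unbounded[OF v] by blast
  have "continuous_on {..<v j} (\<lambda>t. r 0 + (\<Sum>i<j. (r (Suc i) - r i) * clamp01 ((t - v i) / (v (Suc i) - v i))))"
  proof -
    have "v (Suc i) - v i \<noteq> 0" for i using v by (simp add: good_knots_def) (metis less_irrefl)
    thus ?thesis unfolding clamp01_def by (intro continuous_intros) auto
  qed
  hence "continuous_on {..<v j} (polygon r v)"
    by (rule continuous_on_eq) (simp add: polygon_eq_sum[OF v less_imp_le, of _ j])
  thus "isCont (polygon r v) t" using j by (auto simp: continuous_on_eq_continuous_at)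
qed

lemma cadlag_spaceI_continuous:
  assumes "continuous_on {0..} g" shows "(\<lambda>t\<in>{0..}. g t) \<in> cadlag_space"
  unfolding cadlag_space_def
proof (intro CollectI conjI allI impI)
  fix t :: real assume t: "0 \<le> t"
  have lim: "(g \<longlongrightarrow> g t) (at t within {0..})" using assms t by (auto simp: continuous_on)
  have "(g \<longlongrightarrow> g t) (at_right t)" by (rule tendsto_within_subset[OF lim]) (use t in auto)
  moreover have "\<forall>\<^sub>F s in at_right t. g s = (\<lambda>t\<in>{0..}. g t) s"
    using t by (auto simp: eventually_at_filter)
  ultimately show "((\<lambda>t\<in>{0..}. g t) \<longlongrightarrow> (\<lambda>t\<in>{0..}. g t) t) (at_right t)"
    using t by (auto intro: Lim_transform_eventually)
  assume t: "0 < t"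
  have "(g \<longlongrightarrow> g t) (at_left t)"
  proof -
    have "at t within {0..} = at t" using t by (intro at_within_interior) auto
    thus ?thesis using lim by (auto intro: filterlim_at_split[THEN iffD1, THEN conjunct1])
  qed
  moreover have "\<forall>\<^sub>F s in at_left t. g s = (\<lambda>t\<in>{0..}. g t) s"
    using eventually_at_left_real[OF t] by eventually_elim auto
  ultimately show "\<exists>l. ((\<lambda>t\<in>{0..}. g t) \<longlongrightarrow> l) (at_left t)"
    by (intro exI[of _ "g t"]) (rule Lim_transform_eventually)
qed auto

text \<open>Bad knots are sent to the zero path, so that the map is total into the path space and
  measurable.\<close>

definition poly_path :: "(nat \<Rightarrow> real) \<times> (nat \<Rightarrow> real) \<Rightarrow> real \<Rightarrow> real" where
  "poly_path u = (\<lambda>t\<in>{0..}. if good_knots (snd u) then polygon (fst u) (snd u) t else 0)"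

lemma poly_path_in_cadlag: "poly_path u \<in> cadlag_space"
proof (cases "good_knots (snd u)")
  case True thus ?thesis unfolding poly_path_def by (auto intro!: cadlag_spaceI_continuous continuous_on_polygon)
next
  case False thus ?thesis unfolding poly_path_def by (auto intro!: cadlag_spaceI_continuous)
qed

text \<open>Up to time T only the ramps before one fixed knot beyond T contribute. Each of these
  finitely many ramps depends continuously on its data, uniformly in t, because
  \<open>clamp01\<close> is 1-Lipschitz and the limiting gaps are positive.\<close>

lemma limitin_poly_path:
  fixes r v :: "nat \<Rightarrow> nat \<Rightarrow> real"
  assumes good: "good_knots v'" "\<And>n. good_knots (v n)"
    and r: "\<And>i. (\<lambda>n. r n i) \<longlonglongrightarrow> r' i" and v: "\<And>i. (\<lambda>n. v n i) \<longlonglongrightarrow> v' i"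
  shows "limitin U_topology (\<lambda>n. poly_path (r n, v n)) (poly_path (r', v')) sequentially"
  unfolding limitin_U_topology
proof (intro conjI allI impI always_eventually poly_path_in_cadlag)
  fix T :: real assume T: "0 \<le> T"
  obtain j where j: "v' j > T" using good_knots_unbounded[OF good(1)] by blast
  define d where "d n i = v n (Suc i) - v n i" for n i
  define d' where "d' i = v' (Suc i) - v' i" for i
  have d: "d n i > 0" for n i using good(2)[of n] by (simp add: d_def good_knots_def)
  have d': "d' i > 0" for i using good(1) by (simp add: d'_def good_knots_def)
  \<comment> \<open>A bound, uniform over t in [0, T], for the change of the argument of ramp
    i.\<close>
  define e where "e n i = T * \<bar>1 / d n i - 1 / d' i\<bar> + \<bar>v n i / d n i - v' i / d' i\<bar>" for n i
  define E where "E n = \<bar>r n 0 - r' 0\<bar> + (\<Sum>i<j. \<bar>(r n (Suc i) - r n i) - (r' (Suc i) - r' i)\<bar> + \<bar>r' (Suc i) - r' i\<bar> * e n i)" for n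
  have dl: "(\<lambda>n. d n i) \<longlonglongrightarrow> d' i" for i unfolding d_def d'_def by (intro tendsto_intros v)
  have "(\<lambda>n. e n i) \<longlonglongrightarrow> T * \<bar>1 / d' i - 1 / d' i\<bar> + \<bar>v' i / d' i - v' i / d' i\<bar>" for i
    unfolding e_def using d'[of i] by (intro tendsto_intros dl v) auto
  hence el: "(\<lambda>n. e n i) \<longlonglongrightarrow> 0" for i by simp
  have "E \<longlonglongrightarrow> \<bar>r' 0 - r' 0\<bar> + (\<Sum>i<j. \<bar>(r' (Suc i) - r' i) - (r' (Suc i) - r' i)\<bar> + \<bar>r' (Suc i) - r' i\<bar> * 0)"
    unfolding E_def by (intro tendsto_intros r el)
  hence El: "E \<longlonglongrightarrow> 0" by simp
  have "\<forall>\<^sub>F n in sequentially. v n j > T" using v j by (intro order_tendstoD) auto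
  hence bnd: "\<forall>\<^sub>F n in sequentially. \<forall>t\<in>{0..T}. \<bar>poly_path (r n, v n) t - poly_path (r', v') t\<bar> \<le> E n"
  proof eventually_elim
    case (elim n)
    show ?case
    proof
      fix t assume t: "t \<in> {0..T}"
      have cl: "\<bar>clamp01 ((t - v n i) / d n i) - clamp01 ((t - v' i) / d' i)\<bar> \<le> e n i" for i
      proof -
        have eq: "(t - v n i) / d n i - (t - v' i) / d' i = t * (1 / d n i - 1 / d' i) - (v n i / d n i - v' i / d' i)"
          by (simp add: diff_divide_distrib algebra_simps)
        have "\<bar>(t - v n i) / d n i - (t - v' i) / d' i\<bar> \<le> \<bar>t * (1 / d n i - 1 / d' i)\<bar> + \<bar>v n i / d n i - v' i / d' i\<bar>"
          unfolding eq by (rule abs_triangle_ineq4)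
        also have "\<dots> \<le> e n i" using t unfolding e_def by (auto simp: abs_mult intro!: mult_right_mono)
        finally show ?thesis using clamp01_simps(6) order_trans by blast
      qed
      have term_le: "\<bar>(r n (Suc i) - r n i) * clamp01 ((t - v n i) / d n i) - (r' (Suc i) - r' i) * clamp01 ((t - v' i) / d' i)\<bar>
        \<le> \<bar>(r n (Suc i) - r n i) - (r' (Suc i) - r' i)\<bar> + \<bar>r' (Suc i) - r' i\<bar> * e n i" for i
      proof -
        have eq: "(r n (Suc i) - r n i) * clamp01 ((t - v n i) / d n i) - (r' (Suc i) - r' i) * clamp01 ((t - v' i) / d' i)
          = ((r n (Suc i) - r n i) - (r' (Suc i) - r' i)) * clamp01 ((t - v n i) / d n i)
            + (r' (Suc i) - r' i) * (clamp01 ((t - v n i) / d n i) - clamp01 ((t - v' i) / d' i))"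
          by (simp add: algebra_simps)
        have "\<bar>(r n (Suc i) - r n i) * clamp01 ((t - v n i) / d n i) - (r' (Suc i) - r' i) * clamp01 ((t - v' i) / d' i)\<bar>
          \<le> \<bar>(r n (Suc i) - r n i) - (r' (Suc i) - r' i)\<bar> * \<bar>clamp01 ((t - v n i) / d n i)\<bar>
            + \<bar>r' (Suc i) - r' i\<bar> * \<bar>clamp01 ((t - v n i) / d n i) - clamp01 ((t - v' i) / d' i)\<bar>"
          unfolding eq abs_mult[symmetric] by (rule abs_triangle_ineq)
        also have "\<dots> \<le> \<bar>(r n (Suc i) - r n i) - (r' (Suc i) - r' i)\<bar> * 1 + \<bar>r' (Suc i) - r' i\<bar> * e n i"
          using cl clamp01_simps(1,2) by (intro add_mono mult_left_mono) (auto simp: abs_le_iff)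
        finally show ?thesis by simp
      qed
      have p1: "poly_path (r n, v n) t = r n 0 + (\<Sum>i<j. (r n (Suc i) - r n i) * clamp01 ((t - v n i) / d n i))"
        using t elim polygon_eq_sum[OF good(2)[of n], of t j "r n"] good(2)[of n] by (simp add: poly_path_def d_def)
      have p2: "poly_path (r', v') t = r' 0 + (\<Sum>i<j. (r' (Suc i) - r' i) * clamp01 ((t - v' i) / d' i))"
        using t j polygon_eq_sum[OF good(1), of t j r'] good(1) by (simp add: poly_path_def d'_def)
      have eq: "poly_path (r n, v n) t - poly_path (r', v') t = (r n 0 - r' 0) +
        (\<Sum>i<j. (r n (Suc i) - r n i) * clamp01 ((t - v n i) / d n i) - (r' (Suc i) - r' i) * clamp01 ((t - v' i) / d' i))"
        unfolding p1 p2 sum_subtractf by simp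
      have "\<bar>poly_path (r n, v n) t - poly_path (r', v') t\<bar> \<le> \<bar>r n 0 - r' 0\<bar> + (\<Sum>i<j. \<bar>(r n (Suc i) - r n i) * clamp01 ((t - v n i) / d n i) - (r' (Suc i) - r' i) * clamp01 ((t - v' i) / d' i)\<bar>)"
        unfolding eq by (rule order_trans[OF abs_triangle_ineq add_left_mono[OF sum_abs]])
      also have "\<dots> \<le> E n" unfolding E_def by (intro add_left_mono sum_mono term_le)
      finally show "\<bar>poly_path (r n, v n) t - poly_path (r', v') t\<bar> \<le> E n" .
    qed
  qed
  show "uniform_limit {0..T} (\<lambda>n. poly_path (r n, v n)) (poly_path (r', v')) sequentially"
  proof (rule uniform_limitI)
    fix \<epsilon> :: real assume "\<epsilon> > 0"
    hence "\<forall>\<^sub>F n in sequentially. E n < \<epsilon>" using El by (intro order_tendstoD) auto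
    with bnd show "\<forall>\<^sub>F n in sequentially. \<forall>t\<in>{0..T}. dist (poly_path (r n, v n) t) (poly_path (r', v') t) < \<epsilon>"
      by eventually_elim (auto simp: dist_real_def intro: le_less_trans)
  qed
qed

abbreviation knot_algebra :: "((nat \<Rightarrow> real) \<times> (nat \<Rightarrow> real)) measure" where
  "knot_algebra \<equiv> real_sequences \<Otimes>\<^sub>M real_sequences"

text \<open>Identification with the Borel sets makes closures of arbitrary sets measurable, which is
  how the oscillation sets below become events.\<close>

lemma sets_knot_algebra: "sets knot_algebra = sets borel"
proof -
  have "sets (Pi\<^sub>M UNIV (\<lambda>_::nat. borel :: real measure)) = sets borel" by (rule sets_PiM_equal_borel)
  hence "sets knot_algebra = sets ((borel :: (nat \<Rightarrow> real) measure) \<Otimes>\<^sub>M (borel :: (nat \<Rightarrow> real) measure))"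
    by (intro sets_pair_measure_cong) auto
  thus ?thesis unfolding borel_prod .
qed

lemma measurable_knots[measurable]:
  "(\<lambda>u. fst u i) \<in> borel_measurable knot_algebra" "(\<lambda>u. snd u i) \<in> borel_measurable knot_algebra"
  by (auto intro!: measurable_compose[OF measurable_fst measurable_component_singleton]
    measurable_compose[OF measurable_snd measurable_component_singleton])

lemma pred_good_knots[measurable]: "Measurable.pred knot_algebra (\<lambda>u. good_knots (snd u))"
  unfolding good_knots_def by measurable

section \<open>Measurability of path-valued maps\<close>

lemma measurable_into_cadlag:
  assumes "\<And>\<omega>. \<omega> \<in> space M \<Longrightarrow> x \<omega> \<in> cadlag_space" "\<And>t. t \<ge> 0 \<Longrightarrow> (\<lambda>\<omega>. x \<omega> t) \<in> borel_measurable M"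
  shows "x \<in> measurable M cadlag_measure"
  unfolding cadlag_measure_def
proof (rule measurable_restrict_space2)
  show "x \<in> space M \<rightarrow> cadlag_space" using assms by auto
  have "(\<lambda>\<omega>. \<lambda>t\<in>{0..}. x \<omega> t) \<in> measurable M (Pi\<^sub>M {0..} (\<lambda>_. borel))"
    by (rule measurable_restrict) (use assms in auto)
  moreover have "(\<lambda>t\<in>{0..}. x \<omega> t) = x \<omega>" if "\<omega> \<in> space M" for \<omega>
    using assms(1)[OF that] by (auto simp: cadlag_space_def extensional_restrict)
  ultimately show "x \<in> measurable M (Pi\<^sub>M {0..} (\<lambda>_. borel))"
    by (subst measurable_cong[where g="\<lambda>\<omega>. \<lambda>t\<in>{0..}. x \<omega> t"]) auto
qed

lemma measurable_poly_path[measurable]: "poly_path \<in> measurable knot_algebra cadlag_measure"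
proof (rule measurable_into_cadlag)
  fix t :: real assume t: "t \<ge> 0"
  have "(\<lambda>u. polygon (fst u) (snd u) t) \<in> borel_measurable knot_algebra"
    unfolding polygon_def clamp01_def by measurable
  hence "(\<lambda>u. if good_knots (snd u) then polygon (fst u) (snd u) t else 0) \<in> borel_measurable knot_algebra"
    by measurable
  thus "(\<lambda>u. poly_path u t) \<in> borel_measurable knot_algebra" using t by (simp add: poly_path_def)
qed (rule poly_path_in_cadlag)

lemma space_cadlag_measure: "space cadlag_measure = cadlag_space"
  by (auto simp: cadlag_measure_def space_restrict_space space_PiM cadlag_space_def PiE_def)

text \<open>The set where f and g differ is null, so in the completion it is measurable together
  with all its subsets.\<close>

lemma AE_eq_borel_measurable_completion:
  fixes f g :: "'a \<Rightarrow> real"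
  assumes ae: "AE \<omega> in M. f \<omega> = g \<omega>" and g: "g \<in> borel_measurable M"
  shows "f \<in> borel_measurable (completion M)"
proof (rule measurableI)
  fix A :: "real set" assume A: "A \<in> sets borel"
  have 1: "Measurable.pred (completion M) (\<lambda>\<omega>. f \<omega> \<noteq> g \<omega>)"
    by (rule sets_completion_AE) (use ae in auto)
  have 2: "Measurable.pred (completion M) (\<lambda>\<omega>. f \<omega> \<in> A \<and> f \<omega> \<noteq> g \<omega>)"
    by (rule sets_completion_AE) (use ae in \<open>auto elim!: eventually_mono\<close>)
  have 3: "Measurable.pred (completion M) (\<lambda>\<omega>. g \<omega> \<in> A)"
    using measurable_completion[OF g] A by measurable
  have "Measurable.pred (completion M) (\<lambda>\<omega>. (g \<omega> \<in> A \<and> \<not> f \<omega> \<noteq> g \<omega>) \<or> (f \<omega> \<in> A \<and> f \<omega> \<noteq> g \<omega>))"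
    using 1 2 3 by measurable
  also have "(\<lambda>\<omega>. (g \<omega> \<in> A \<and> \<not> f \<omega> \<noteq> g \<omega>) \<or> (f \<omega> \<in> A \<and> f \<omega> \<noteq> g \<omega>)) = (\<lambda>\<omega>. f \<omega> \<in> A)" by auto
  finally show "f -` A \<inter> space (completion M) \<in> sets (completion M)"
    by (simp add: pred_def vimage_def Int_def conj_commute)
qed simp

text \<open>Around such a path the functional varies by at most \<eta> on the tube of radius 1 / (k
  + 1) over [0, k]. The slack d makes membership stable under small perturbations of the path. A
  single index governs radius and horizon, so that the sets increase with k.\<close>

definition small_oscillation :: "((real \<Rightarrow> real) \<Rightarrow> real) \<Rightarrow> real \<Rightarrow> nat \<Rightarrow> (real \<Rightarrow> real) set" where
  "small_oscillation f \<eta> k = {z \<in> cadlag_space. \<exists>d>0. \<forall>y\<in>cadlag_space. \<forall>y'\<in>cadlag_space.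
     (\<forall>t\<in>{0..real k}. \<bar>y t - z t\<bar> < 1 / (real k + 1) + d) \<longrightarrow>
     (\<forall>t\<in>{0..real k}. \<bar>y' t - z t\<bar> < 1 / (real k + 1) + d) \<longrightarrow> \<bar>f y - f y'\<bar> \<le> \<eta>}"

lemma small_oscillation_mono:
  assumes "k \<le> k'" shows "small_oscillation f \<eta> k \<subseteq> small_oscillation f \<eta> k'"
proof
  fix z assume z: "z \<in> small_oscillation f \<eta> k"
  then obtain d where d: "d > 0" "\<And>y y'. y \<in> cadlag_space \<Longrightarrow> y' \<in> cadlag_space \<Longrightarrow>
     (\<forall>t\<in>{0..real k}. \<bar>y t - z t\<bar> < 1 / (real k + 1) + d) \<Longrightarrow>
     (\<forall>t\<in>{0..real k}. \<bar>y' t - z t\<bar> < 1 / (real k + 1) + d) \<Longrightarrow> \<bar>f y - f y'\<bar> \<le> \<eta>"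
    by (auto simp: small_oscillation_def)
  have "1 / (real k' + 1) \<le> 1 / (real k + 1)" using assms by (simp add: frac_le)
  hence m: "\<forall>t\<in>{0..real k}. \<bar>y t - z t\<bar> < 1 / (real k + 1) + d"
    if "\<forall>t\<in>{0..real k'}. \<bar>y t - z t\<bar> < 1 / (real k' + 1) + d" for y
  proof (intro ballI)
    fix t assume "t \<in> {0..real k}"
    hence "\<bar>y t - z t\<bar> < 1 / (real k' + 1) + d" using that assms by auto
    thus "\<bar>y t - z t\<bar> < 1 / (real k + 1) + d" using \<open>1 / (real k' + 1) \<le> 1 / (real k + 1)\<close> by linarith
  qed
  show "z \<in> small_oscillation f \<eta> k'"
    unfolding small_oscillation_def using z d(1)
    by (auto simp: small_oscillation_def intro!: exI[of _ d] d(2) m)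
qed

text \<open>Continuity at z yields a tube of radius e over [0, T] on which f stays within \<eta> / 2
  of f z. Any k > max T (2/e) fits into it and leaves e/2 for the slack.\<close>

lemma small_oscillation_exhaust:
  assumes f: "continuous_map U_topology euclideanreal f" and z: "z \<in> cadlag_space" and \<eta>: "\<eta> > 0"
  shows "\<exists>k. z \<in> small_oscillation f \<eta> k"
proof -
  define V where "V = {y \<in> cadlag_space. f y \<in> ball (f z) (\<eta> / 2)}"
  have "openin U_topology V"
    using openin_continuous_map_preimage[OF f, of "ball (f z) (\<eta> / 2)"] by (simp add: V_def topspace_U_topology)
  moreover have "z \<in> V" using z \<eta> by (simp add: V_def)
  ultimately obtain T e where T: "T \<ge> 0" "e > 0"
    "\<And>y. y \<in> cadlag_space \<Longrightarrow> (\<forall>t\<in>{0..T}. \<bar>y t - z t\<bar> < e) \<Longrightarrow> y \<in> V"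
    unfolding openin_U_topology uc_open_def by blast
  obtain k :: nat where k: "real k > max T (2 / e)" using reals_Archimedean2 by blast
  have k1: "1 / (real k + 1) < e / 2"
  proof -
    have "2 / e < real k + 1" using k by simp
    thus ?thesis using T by (simp add: field_simps)
  qed
  have inV: "y \<in> V" if "y \<in> cadlag_space" "\<forall>t\<in>{0..real k}. \<bar>y t - z t\<bar> < 1 / (real k + 1) + e / 2" for y
  proof (rule T(3)[OF that(1)], rule ballI)
    fix t assume "t \<in> {0..T}"
    hence "\<bar>y t - z t\<bar> < 1 / (real k + 1) + e / 2" using that(2) k by auto
    thus "\<bar>y t - z t\<bar> < e" using k1 by linarith
  qed
  have "\<bar>f y - f y'\<bar> \<le> \<eta>" if "y \<in> V" "y' \<in> V" for y y'
  proof -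
    have "dist (f z) (f y) < \<eta> / 2" "dist (f z) (f y') < \<eta> / 2" using that by (auto simp: V_def)
    thus ?thesis unfolding dist_real_def by linarith
  qed
  hence "z \<in> small_oscillation f \<eta> k"
    unfolding small_oscillation_def using z T(2) by (auto intro!: exI[of _ "e / 2"] inV)
  thus ?thesis ..
qed

lemma small_oscillation_eventually:
  assumes lim: "limitin U_topology x z sequentially" and z: "z \<in> small_oscillation f \<eta> k"
  shows "\<forall>\<^sub>F n in sequentially. x n \<in> small_oscillation f \<eta> k"
proof -
  obtain d where d: "d > 0" "\<And>y y'. y \<in> cadlag_space \<Longrightarrow> y' \<in> cadlag_space \<Longrightarrow>
     (\<forall>t\<in>{0..real k}. \<bar>y t - z t\<bar> < 1 / (real k + 1) + d) \<Longrightarrow>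
     (\<forall>t\<in>{0..real k}. \<bar>y' t - z t\<bar> < 1 / (real k + 1) + d) \<Longrightarrow> \<bar>f y - f y'\<bar> \<le> \<eta>"
    using z by (auto simp: small_oscillation_def)
  have "uniform_limit {0..real k} x z sequentially" "\<forall>\<^sub>F n in sequentially. x n \<in> cadlag_space"
    using lim by (auto simp: limitin_U_topology)
  hence "\<forall>\<^sub>F n in sequentially. \<forall>t\<in>{0..real k}. dist (x n t) (z t) < d / 2"
    using d by (auto dest!: uniform_limitD[where e="d/2"])
  with \<open>\<forall>\<^sub>F n in sequentially. x n \<in> cadlag_space\<close> show ?thesis
  proof eventually_elim
    case (elim n)
    have tr: "\<forall>t\<in>{0..real k}. \<bar>y t - z t\<bar> < 1 / (real k + 1) + d"
      if "\<forall>t\<in>{0..real k}. \<bar>y t - x n t\<bar> < 1 / (real k + 1) + d / 2" for y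
    proof (intro ballI)
      fix t assume t: "t \<in> {0..real k}"
      have "\<bar>y t - x n t\<bar> < 1 / (real k + 1) + d / 2" "\<bar>x n t - z t\<bar> < d / 2"
        using that elim t by (auto simp: dist_real_def)
      thus "\<bar>y t - z t\<bar> < 1 / (real k + 1) + d" by linarith
    qed
    show ?case unfolding small_oscillation_def using elim(1) d(1)
      by (auto intro!: exI[of _ "d / 2"] d(2) tr)
  qed
qed

lemma limitin_poly_path_pair:
  assumes "good_knots (snd u')" "\<And>n. good_knots (snd (u n))" "u \<longlonglongrightarrow> (u' :: (nat \<Rightarrow> real) \<times> (nat \<Rightarrow> real))"
  shows "limitin U_topology (\<lambda>n. poly_path (u n)) (poly_path u') sequentially"
proof -
  have 1: "(\<lambda>n. fst (u n) i) \<longlonglongrightarrow> fst u' i" for i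
    by (rule continuous_on_tendsto_compose[OF continuous_on_product_coordinates tendsto_fst[OF assms(3)]]) auto
  have 2: "(\<lambda>n. snd (u n) i) \<longlonglongrightarrow> snd u' i" for i
    by (rule continuous_on_tendsto_compose[OF continuous_on_product_coordinates tendsto_snd[OF assms(3)]]) auto
  show ?thesis
    using limitin_poly_path[of "snd u'" "\<lambda>n. snd (u n)" "\<lambda>n. fst (u n)" "fst u'"] assms(1,2) 1 2 by simp
qed

text \<open>\<open>poly_path\<close> is sequentially continuous on the good knots, so the set is
  relatively open there: it is the set of good knots minus the closure of the remaining good knots,
  and that closure is Borel.\<close>

lemma small_oscillation_knots_measurable:
  "{u. good_knots (snd u) \<and> poly_path u \<in> small_oscillation f \<eta> k} \<in> sets knot_algebra"
proof -
  define Gd where "Gd = {u :: (nat \<Rightarrow> real) \<times> (nat \<Rightarrow> real). good_knots (snd u)}"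
  define G where "G = {u. good_knots (snd u) \<and> poly_path u \<in> small_oscillation f \<eta> k}"
  have Gd: "Gd \<in> sets knot_algebra"
    using pred_good_knots by (simp add: pred_def Gd_def space_pair_measure space_PiM)
  have "G = Gd - closure (Gd - G)"
  proof (intro equalityI subsetI)
    fix u assume u: "u \<in> G"
    have "u \<notin> closure (Gd - G)"
    proof
      assume "u \<in> closure (Gd - G)"
      then obtain w where w: "\<And>n. w n \<in> Gd - G" "w \<longlonglongrightarrow> u" by (auto simp: closure_sequential)
      have "limitin U_topology (\<lambda>n. poly_path (w n)) (poly_path u) sequentially"
        using w u by (intro limitin_poly_path_pair) (auto simp: Gd_def G_def)
      hence "\<forall>\<^sub>F n in sequentially. poly_path (w n) \<in> small_oscillation f \<eta> k"
        using u by (intro small_oscillation_eventually) (auto simp: G_def)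
      then obtain n where "poly_path (w n) \<in> small_oscillation f \<eta> k" by (auto dest: eventually_happens)
      thus False using w(1)[of n] by (simp add: Gd_def G_def)
    qed
    thus "u \<in> Gd - closure (Gd - G)" using u by (simp add: G_def Gd_def)
  next
    fix u assume "u \<in> Gd - closure (Gd - G)"
    thus "u \<in> G" using closure_subset[of "Gd - G"] by auto
  qed
  moreover have "closure (Gd - G) \<in> sets knot_algebra" unfolding sets_knot_algebra by (intro borel_closed closed_closure)
  ultimately show ?thesis using Gd unfolding G_def[symmetric] by (metis sets.Diff)
qed

lemma tendsto_indicator_AE_sup:
  "(\<And>k. A k \<in> sets M) \<Longrightarrow> incseq A \<Longrightarrow> prob_space M \<Longrightarrow> (AE \<omega> in M. \<exists>k. \<omega> \<in> A k) \<Longrightarrow> (\<lambda>k. measure M (A k)) \<longlonglongrightarrow> 1"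
proof -
  assume A: "\<And>k. A k \<in> sets M" "incseq A" and M: "prob_space M" and ae: "AE \<omega> in M. \<exists>k. \<omega> \<in> A k"
  interpret prob_space M by (rule M)
  have "(\<lambda>k. measure M (A k)) \<longlonglongrightarrow> measure M (\<Union>k. A k)"
    by (rule finite_Lim_measure_incseq) (use A in auto)
  moreover have "measure M (\<Union>k. A k) = 1"
    using ae A by (subst prob_eq_1) auto
  ultimately show ?thesis by simp
qed

text \<open>Functionals that are only continuous are handled through the sets of paths around which
  they oscillate little at a given scale: on polygons these sets are measurable, and they exhaust the path
  space, so that no tightness argument is needed.\<close>

theorem polygonal_approximation_criterion:
  fixes x :: "nat \<Rightarrow> 'm \<Rightarrow> real \<Rightarrow> real" and u :: "nat \<Rightarrow> nat \<Rightarrow> 'm \<Rightarrow> (nat \<Rightarrow> real) \<times> (nat \<Rightarrow> real)"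
    and z :: "'b \<Rightarrow> real \<Rightarrow> real" and u' :: "nat \<Rightarrow> 'b \<Rightarrow> (nat \<Rightarrow> real) \<times> (nat \<Rightarrow> real)"
  assumes M: "prob_space M" and N: "prob_space N"
    and x[measurable]: "\<And>n. x n \<in> measurable M cadlag_measure"
    and u[measurable]: "\<And>m n. u m n \<in> measurable M knot_algebra"
    and u'[measurable]: "\<And>m. u' m \<in> measurable N knot_algebra"
    and good_u: "\<And>m. \<forall>\<^sub>F n in sequentially. AE \<omega> in M. good_knots (snd (u m n \<omega>))"
    and good_u': "\<And>m. AE \<omega> in N. good_knots (snd (u' m \<omega>))"
    and lim: "AE \<omega> in N. limitin U_topology (\<lambda>m. poly_path (u' m \<omega>)) (z \<omega>) sequentially"
    and rep: "\<And>m. \<exists>(\<Omega> :: 'w measure) U U'. prob_space \<Omega> \<and> (\<forall>n. U n \<in> measurable \<Omega> knot_algebra) \<and>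
       U' \<in> measurable \<Omega> knot_algebra \<and>
       (\<forall>\<^sub>F n in sequentially. distr \<Omega> knot_algebra (U n) = distr M knot_algebra (u m n)) \<and>
       distr \<Omega> knot_algebra U' = distr N knot_algebra (u' m) \<and>
       (AE \<omega> in \<Omega>. \<forall>i. (\<lambda>n. fst (U n \<omega>) i) \<longlonglongrightarrow> fst (U' \<omega>) i \<and> (\<lambda>n. snd (U n \<omega>) i) \<longlonglongrightarrow> snd (U' \<omega>) i)"
    and approx: "\<And>\<epsilon> T. \<epsilon> > 0 \<Longrightarrow> T \<ge> 0 \<Longrightarrow> \<exists>m0. \<forall>m\<ge>m0. \<forall>\<^sub>F n in sequentially. \<exists>E\<in>sets M.
       measure M E \<ge> 1 - \<epsilon> \<and> (\<forall>\<omega>\<in>E. \<forall>t\<in>{0..T}. \<bar>x n \<omega> t - poly_path (u m n \<omega>) t\<bar> \<le> \<epsilon>)"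
    and f: "continuous_map U_topology euclideanreal f" "f \<in> borel_measurable cadlag_measure" "bounded (f ` cadlag_space)"
  shows "(\<lambda>n. \<integral>\<omega>. f (x n \<omega>) \<partial>M) \<longlonglongrightarrow> (\<integral>\<omega>. f (z \<omega>) \<partial>completion N)"
proof -
  interpret M: prob_space M by (rule M)
  interpret N: prob_space N by (rule N)
  note f(2)[measurable]
  obtain B where B: "\<And>y. y \<in> cadlag_space \<Longrightarrow> \<bar>f y\<bar> \<le> B" "B \<ge> 0"
    using f(3) unfolding bounded_iff by (metis image_eqI real_norm_def abs_ge_zero order_trans poly_path_in_cadlag)
  have fp: "(\<lambda>y. f (poly_path y)) \<in> borel_measurable knot_algebra" by measurable
  have fb: "\<bar>f (poly_path y)\<bar> \<le> B" for y by (rule B(1)[OF poly_path_in_cadlag])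
  have xin: "x n \<omega> \<in> cadlag_space" if "\<omega> \<in> space M" for n \<omega>
    using measurable_space[OF x that] by (simp add: space_cadlag_measure)
  have f_lim: "(\<lambda>n. f (y n)) \<longlonglongrightarrow> f y'" if "limitin U_topology y y' sequentially" for y y'
    using continuous_map_limit[OF f(1) that] by (simp add: comp_def)
  have zlim: "AE \<omega> in N. (\<lambda>m. f (poly_path (u' m \<omega>))) \<longlonglongrightarrow> f (z \<omega>)"
    using lim by eventually_elim (rule f_lim)
  \<comment> \<open>The limit path carries no measurability hypothesis; f of it is almost everywhere
    a limit of measurable variables, which is enough in the completion.\<close>
  have zm: "(\<lambda>\<omega>. f (z \<omega>)) \<in> borel_measurable (completion N)"
  proof (rule AE_eq_borel_measurable_completion)
    show "(\<lambda>\<omega>. lim (\<lambda>m. f (poly_path (u' m \<omega>)))) \<in> borel_measurable N" by measurable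
    show "AE \<omega> in N. f (z \<omega>) = lim (\<lambda>m. f (poly_path (u' m \<omega>)))"
      using zlim by eventually_elim (simp add: limI)
  qed
  have um: "(\<lambda>\<omega>. f (poly_path (u' m \<omega>))) \<in> borel_measurable N" for m by measurable
  have Elim: "(\<lambda>m. \<integral>\<omega>. f (poly_path (u' m \<omega>)) \<partial>N) \<longlonglongrightarrow> (\<integral>\<omega>. f (z \<omega>) \<partial>completion N)"
  proof -
    interpret cN: prob_space "completion N"
      by (rule prob_spaceI) (simp add: N.emeasure_space_1)
    have "(\<lambda>m. \<integral>\<omega>. f (poly_path (u' m \<omega>)) \<partial>completion N) \<longlonglongrightarrow> (\<integral>\<omega>. f (z \<omega>) \<partial>completion N)"
    proof (rule integral_dominated_convergence[where w="\<lambda>_. B"])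
      show "AE \<omega> in completion N. (\<lambda>m. f (poly_path (u' m \<omega>))) \<longlonglongrightarrow> f (z \<omega>)" by (rule AE_completion[OF zlim])
    qed (use zm fb measurable_completion[OF um] in auto)
    thus ?thesis by (simp add: integral_completion[OF um])
  qed
  \<comment> \<open>One \<eta> each comes from the oscillation, from the limit in n and from the
    limit in m. The exceptional set has probability at most \<epsilon> + 2 \<eta> \<le> 3 \<eta>,
    and there the integrands differ by at most 2 B.\<close>
  have main: "\<forall>\<^sub>F n in sequentially. \<bar>(\<integral>\<omega>. f (x n \<omega>) \<partial>M) - (\<integral>\<omega>. f (z \<omega>) \<partial>completion N)\<bar> \<le> 3 * \<eta> + 2 * B * (3 * \<eta>)" if \<eta>: "\<eta> > 0" for \<eta>
  proof -
    define G where "G k = {u. good_knots (snd u) \<and> poly_path u \<in> small_oscillation f \<eta> k}" for k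
    have Gm[measurable]: "G k \<in> sets knot_algebra" for k
      unfolding G_def by (rule small_oscillation_knots_measurable)
    \<comment> \<open>On \<open>H j\<close> all limiting polygons from index j on lie in the j-th
      oscillation set. These events increase to full probability, so j can be fixed before m and n
      are chosen.\<close>
    define H where "H j = {\<omega> \<in> space N. \<forall>m\<ge>j. u' m \<omega> \<in> G j}" for j
    have Hm: "H j \<in> sets N" for j unfolding H_def by measurable
    have "(\<lambda>j. measure N (H j)) \<longlonglongrightarrow> 1"
    proof (rule tendsto_indicator_AE_sup[OF Hm _ N])
      show "incseq H"
      proof (rule incseq_SucI, rule subsetI)
        fix j \<omega> assume "\<omega> \<in> H j"
        thus "\<omega> \<in> H (Suc j)" using small_oscillation_mono[of j "Suc j" f \<eta>] by (auto simp: H_def G_def)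
      qed
      have "AE \<omega> in N. \<forall>m. good_knots (snd (u' m \<omega>))" using good_u' by (simp add: AE_all_countable)
      with lim show "AE \<omega> in N. \<exists>k. \<omega> \<in> H k"
        using AE_space
      proof eventually_elim
        case (elim \<omega>)
        have "z \<omega> \<in> cadlag_space" using elim by (simp add: limitin_U_topology)
        then obtain k where k: "z \<omega> \<in> small_oscillation f \<eta> k"
          using small_oscillation_exhaust[OF f(1) _ \<eta>] by blast
        obtain m0 where m0: "\<And>m. m \<ge> m0 \<Longrightarrow> poly_path (u' m \<omega>) \<in> small_oscillation f \<eta> k"
          using small_oscillation_eventually[OF elim(1) k] by (auto simp: eventually_sequentially)
        have "\<omega> \<in> H (max k m0)"
          using elim m0 small_oscillation_mono[of k "max k m0" f \<eta>] by (auto simp: H_def G_def)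
        thus ?case ..
      qed
    qed
    hence "\<forall>\<^sub>F j in sequentially. measure N (H j) > 1 - \<eta>" using \<eta> by (intro order_tendstoD) auto
    then obtain j where j: "measure N (H j) > 1 - \<eta>" by (auto dest: eventually_happens)
    \<comment> \<open>Small enough for the exceptional probability and for the tube radius belonging
      to j.\<close>
    define \<epsilon> where "\<epsilon> = min \<eta> (1 / (real j + 1))"
    have "\<epsilon> > 0" using \<eta> by (simp add: \<epsilon>_def)
    from approx[OF this, of "real j"] obtain m0 where m0: "\<And>m. m \<ge> m0 \<Longrightarrow> \<forall>\<^sub>F n in sequentially. \<exists>E\<in>sets M.
       measure M E \<ge> 1 - \<epsilon> \<and> (\<forall>\<omega>\<in>E. \<forall>t\<in>{0..real j}. \<bar>x n \<omega> t - poly_path (u m n \<omega>) t\<bar> \<le> \<epsilon>)" by auto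
    have "\<forall>\<^sub>F m in sequentially. \<bar>(\<integral>\<omega>. f (poly_path (u' m \<omega>)) \<partial>N) - (\<integral>\<omega>. f (z \<omega>) \<partial>completion N)\<bar> < \<eta>"
      using tendstoD[OF Elim \<eta>] by (simp add: dist_real_def)
    then obtain m where m: "m \<ge> m0" "m \<ge> j"
      "\<bar>(\<integral>\<omega>. f (poly_path (u' m \<omega>)) \<partial>N) - (\<integral>\<omega>. f (z \<omega>) \<partial>completion N)\<bar> < \<eta>"
      using eventually_happens[OF eventually_conj[OF eventually_conj[OF eventually_ge_at_top[of m0] eventually_ge_at_top[of j]]]]
      by fastforce
    have Gj: "measure N {\<omega> \<in> space N. u' m \<omega> \<in> G j} > 1 - \<eta>"
    proof -
      have "measure N (H j) \<le> measure N {\<omega> \<in> space N. u' m \<omega> \<in> G j}"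
        using m by (intro N.finite_measure_mono) (auto simp: H_def)
      thus ?thesis using j by simp
    qed
    obtain \<Omega> :: "'w measure" and U U' where R: "prob_space \<Omega>" "\<And>n. U n \<in> measurable \<Omega> knot_algebra" "U' \<in> measurable \<Omega> knot_algebra"
       "\<forall>\<^sub>F n in sequentially. distr \<Omega> knot_algebra (U n) = distr M knot_algebra (u m n)" "distr \<Omega> knot_algebra U' = distr N knot_algebra (u' m)"
       "AE \<omega> in \<Omega>. \<forall>i. (\<lambda>n. fst (U n \<omega>) i) \<longlonglongrightarrow> fst (U' \<omega>) i \<and> (\<lambda>n. snd (U n \<omega>) i) \<longlonglongrightarrow> snd (U' \<omega>) i"
      using rep[of m] by blast
    interpret W: prob_space \<Omega> by (rule R(1))
    note [measurable] = R(2,3)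
    obtain n0 where n0: "\<And>n. n \<ge> n0 \<Longrightarrow> distr \<Omega> knot_algebra (U n) = distr M knot_algebra (u m n)"
      "\<And>n. n \<ge> n0 \<Longrightarrow> AE \<omega> in M. good_knots (snd (u m n \<omega>))"
      using eventually_conj[OF R(4) good_u[of m]] by (auto simp: eventually_sequentially)
    have gU: "AE \<omega> in \<Omega>. good_knots (snd (U n \<omega>))" if "n \<ge> n0" for n
    proof -
      have "AE u in distr M knot_algebra (u m n). good_knots (snd u)"
        using n0(2)[OF that] by (subst AE_distr_iff) (auto simp: pred_def[symmetric])
      thus ?thesis unfolding n0(1)[OF that, symmetric]
        by (subst (asm) AE_distr_iff) (auto simp: pred_def[symmetric])
    qed
    have gU': "AE \<omega> in \<Omega>. good_knots (snd (U' \<omega>))"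
    proof -
      have "AE u in distr N knot_algebra (u' m). good_knots (snd u)"
        using good_u'[of m] by (subst AE_distr_iff) (auto simp: pred_def[symmetric])
      thus ?thesis unfolding R(5)[symmetric]
        by (subst (asm) AE_distr_iff) (auto simp: pred_def[symmetric])
    qed
    have UL: "AE \<omega> in \<Omega>. (\<forall>n. good_knots (snd (U (n + n0) \<omega>))) \<and> limitin U_topology (\<lambda>n. poly_path (U (n + n0) \<omega>)) (poly_path (U' \<omega>)) sequentially"
    proof -
      have "AE \<omega> in \<Omega>. \<forall>n. good_knots (snd (U (n + n0) \<omega>))" using gU by (auto simp: AE_all_countable)
      with R(6) gU' show ?thesis
      proof eventually_elim
        case (elim \<omega>)
        have "limitin U_topology (\<lambda>n. poly_path (fst (U (n + n0) \<omega>), snd (U (n + n0) \<omega>))) (poly_path (fst (U' \<omega>), snd (U' \<omega>))) sequentially"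
          by (intro limitin_poly_path) (use elim in \<open>auto intro: LIMSEQ_ignore_initial_segment\<close>)
        thus ?case using elim by simp
      qed
    qed
    have E1: "(\<lambda>n. \<integral>\<omega>. f (poly_path (u m n \<omega>)) \<partial>M) \<longlonglongrightarrow> (\<integral>\<omega>. f (poly_path (u' m \<omega>)) \<partial>N)"
    proof (rule LIMSEQ_offset[where k=n0])
      have "(\<lambda>n. \<integral>\<omega>. f (poly_path (U (n + n0) \<omega>)) \<partial>\<Omega>) \<longlonglongrightarrow> (\<integral>\<omega>. f (poly_path (U' \<omega>)) \<partial>\<Omega>)"
      proof (rule integral_dominated_convergence[where w="\<lambda>_. B"])
        show "AE \<omega> in \<Omega>. (\<lambda>n. f (poly_path (U (n + n0) \<omega>))) \<longlonglongrightarrow> f (poly_path (U' \<omega>))"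
          using UL by eventually_elim (rule f_lim, blast)
      qed (use fb in auto)
      moreover have "(\<integral>\<omega>. f (poly_path (U (n + n0) \<omega>)) \<partial>\<Omega>) = (\<integral>\<omega>. f (poly_path (u m (n + n0) \<omega>)) \<partial>M)" for n
        using integral_distr[OF R(2) fp, of "n + n0"] integral_distr[OF u fp, of m "n + n0"] n0(1)[of "n + n0"] by simp
      moreover have "(\<integral>\<omega>. f (poly_path (U' \<omega>)) \<partial>\<Omega>) = (\<integral>\<omega>. f (poly_path (u' m \<omega>)) \<partial>N)"
        using integral_distr[OF R(3) fp] integral_distr[OF u' fp, of m] R(5) by simp
      ultimately show "(\<lambda>n. \<integral>\<omega>. f (poly_path (u m (n + n0) \<omega>)) \<partial>M) \<longlonglongrightarrow> (\<integral>\<omega>. f (poly_path (u' m \<omega>)) \<partial>N)" by simp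
    qed
    have E2: "\<forall>\<^sub>F n in sequentially. measure M {\<omega> \<in> space M. u m n \<omega> \<in> G j} > 1 - 2 * \<eta>"
    proof -
      have im: "(\<lambda>u. indicator (G j) u :: real) \<in> borel_measurable knot_algebra" by measurable
      \<comment> \<open>The open-set half of the portmanteau theorem. With the indicator of the
        limit as a factor the integrand converges in either case: it is eventually 1 if the limit
        lies in \<open>G j\<close>, and always 0 otherwise.\<close>
      have "(\<lambda>n. \<integral>\<omega>. indicator (G j) (U' \<omega>) * indicator (G j) (U (n + n0) \<omega>) \<partial>\<Omega>) \<longlonglongrightarrow> (\<integral>\<omega>. indicator (G j) (U' \<omega>) \<partial>\<Omega> :: real)"
      proof (rule integral_dominated_convergence[where w="\<lambda>_. 1"])
        show "AE \<omega> in \<Omega>. (\<lambda>n. indicator (G j) (U' \<omega>) * indicator (G j) (U (n + n0) \<omega>)) \<longlonglongrightarrow> (indicator (G j) (U' \<omega>) :: real)"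
          using UL
        proof eventually_elim
          case (elim \<omega>)
          show ?case
          proof (cases "U' \<omega> \<in> G j")
            case True
            hence "\<forall>\<^sub>F n in sequentially. poly_path (U (n + n0) \<omega>) \<in> small_oscillation f \<eta> j"
              using elim by (intro small_oscillation_eventually) (auto simp: G_def)
            hence "\<forall>\<^sub>F n in sequentially. indicator (G j) (U' \<omega>) * indicator (G j) (U (n + n0) \<omega>) = (1 :: real)"
              by eventually_elim (use elim True in \<open>auto simp: G_def\<close>)
            thus ?thesis using True by (simp add: tendsto_eventually)
          qed simp
        qed
      qed (auto simp: indicator_def)
      moreover have "(\<integral>\<omega>. indicator (G j) (U' \<omega>) \<partial>\<Omega> :: real) = measure N {\<omega> \<in> space N. u' m \<omega> \<in> G j}"
      proof -
        have "(\<integral>\<omega>. indicator (G j) (U' \<omega>) \<partial>\<Omega> :: real) = (\<integral>\<omega>. indicator (G j) (u' m \<omega>) \<partial>N)"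
          using integral_distr[OF R(3) im] integral_distr[OF u' im, of m] R(5) by simp
        also have "\<dots> = (\<integral>\<omega>. indicator {\<omega> \<in> space N. u' m \<omega> \<in> G j} \<omega> \<partial>N)"
          by (intro Bochner_Integration.integral_cong) (auto simp: indicator_def)
        also have "\<dots> = measure N {\<omega> \<in> space N. u' m \<omega> \<in> G j}" by (simp add: Int_absorb1)
        finally show ?thesis .
      qed
      ultimately have "\<forall>\<^sub>F n in sequentially. (\<integral>\<omega>. indicator (G j) (U' \<omega>) * indicator (G j) (U (n + n0) \<omega>) \<partial>\<Omega>) > 1 - 2 * \<eta>"
        using Gj \<eta> by (intro order_tendstoD(1)) auto
      hence "\<forall>\<^sub>F n in sequentially. measure M {\<omega> \<in> space M. u m (n + n0) \<omega> \<in> G j} > 1 - 2 * \<eta>"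
      proof eventually_elim
        case (elim n)
        have "(\<integral>\<omega>. indicator (G j) (U' \<omega>) * indicator (G j) (U (n + n0) \<omega>) \<partial>\<Omega> :: real) \<le> (\<integral>\<omega>. indicator (G j) (U (n + n0) \<omega>) \<partial>\<Omega>)"
          by (intro integral_mono W.integrable_const_bound[where B=1]) (auto simp: indicator_def)
        also have "\<dots> = (\<integral>\<omega>. indicator (G j) (u m (n + n0) \<omega>) \<partial>M)"
          using integral_distr[OF R(2) im, of "n + n0"] integral_distr[OF u im, of m "n + n0"] n0(1)[of "n + n0"] by simp
        also have "\<dots> = (\<integral>\<omega>. indicator {\<omega> \<in> space M. u m (n + n0) \<omega> \<in> G j} \<omega> \<partial>M)"
          by (intro Bochner_Integration.integral_cong) (auto simp: indicator_def)
        also have "\<dots> = measure M {\<omega> \<in> space M. u m (n + n0) \<omega> \<in> G j}" by (simp add: Int_absorb1)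
        finally show ?case using elim by simp
      qed
      thus ?thesis by (subst (asm) eventually_sequentially_seg)
    qed
    have E3: "\<forall>\<^sub>F n in sequentially. \<bar>(\<integral>\<omega>. f (poly_path (u m n \<omega>)) \<partial>M) - (\<integral>\<omega>. f (poly_path (u' m \<omega>)) \<partial>N)\<bar> < \<eta>"
      using tendstoD[OF E1 \<eta>] by (simp add: dist_real_def)
    show ?thesis using E2 E3 m0[OF m(1)]
    proof eventually_elim
      case (elim n)
      obtain E where E: "E \<in> sets M" "measure M E \<ge> 1 - \<epsilon>"
        "\<And>\<omega> t. \<omega> \<in> E \<Longrightarrow> t \<in> {0..real j} \<Longrightarrow> \<bar>x n \<omega> t - poly_path (u m n \<omega>) t\<bar> \<le> \<epsilon>" using elim(3) by blast
      define S where "S = E \<inter> {\<omega> \<in> space M. u m n \<omega> \<in> G j}"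
      have Sm[measurable]: "S \<in> sets M" unfolding S_def using E by measurable
      have pS: "measure M (space M - S) \<le> 3 * \<eta>"
      proof -
        have "measure M (space M - S) \<le> measure M ((space M - E) \<union> (space M - {\<omega> \<in> space M. u m n \<omega> \<in> G j}))"
          using E by (intro M.finite_measure_mono) (auto simp: S_def)
        also have "\<dots> \<le> measure M (space M - E) + measure M (space M - {\<omega> \<in> space M. u m n \<omega> \<in> G j})"
          using E by (intro measure_Un_le) auto
        also have "\<dots> = (1 - measure M E) + (1 - measure M {\<omega> \<in> space M. u m n \<omega> \<in> G j})"
          using E by (simp add: M.prob_compl)
        finally show ?thesis using E(2) elim(1) by (simp add: \<epsilon>_def)
      qed
      have pt: "\<bar>f (x n \<omega>) - f (poly_path (u m n \<omega>))\<bar> \<le> \<eta> + 2 * B * indicator (space M - S) \<omega>" if \<omega>: "\<omega> \<in> space M" for \<omega>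
      proof (cases "\<omega> \<in> S")
        case True
        hence "poly_path (u m n \<omega>) \<in> small_oscillation f \<eta> j" by (auto simp: S_def G_def)
        then obtain d where d: "d > 0" "\<And>y y'. y \<in> cadlag_space \<Longrightarrow> y' \<in> cadlag_space \<Longrightarrow>
           (\<forall>t\<in>{0..real j}. \<bar>y t - poly_path (u m n \<omega>) t\<bar> < 1 / (real j + 1) + d) \<Longrightarrow>
           (\<forall>t\<in>{0..real j}. \<bar>y' t - poly_path (u m n \<omega>) t\<bar> < 1 / (real j + 1) + d) \<Longrightarrow> \<bar>f y - f y'\<bar> \<le> \<eta>"
          by (auto simp: small_oscillation_def)
        have "\<bar>f (x n \<omega>) - f (poly_path (u m n \<omega>))\<bar> \<le> \<eta>"
        proof (rule d(2)[OF xin[OF \<omega>] poly_path_in_cadlag])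
          show "\<forall>t\<in>{0..real j}. \<bar>x n \<omega> t - poly_path (u m n \<omega>) t\<bar> < 1 / (real j + 1) + d"
          proof
            fix t assume "t \<in> {0..real j}"
            hence "\<bar>x n \<omega> t - poly_path (u m n \<omega>) t\<bar> \<le> \<epsilon>" using E(3) True by (auto simp: S_def)
            also have "\<epsilon> < 1 / (real j + 1) + d" using d(1) by (simp add: \<epsilon>_def min_less_iff_disj)
            finally show "\<bar>x n \<omega> t - poly_path (u m n \<omega>) t\<bar> < 1 / (real j + 1) + d" .
          qed
          show "\<forall>t\<in>{0..real j}. \<bar>poly_path (u m n \<omega>) t - poly_path (u m n \<omega>) t\<bar> < 1 / (real j + 1) + d"
            using d(1) by (auto intro!: add_nonneg_pos)
        qed
        thus ?thesis using True by (auto simp: indicator_def)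
      next
        case False
        have "\<bar>f (x n \<omega>) - f (poly_path (u m n \<omega>))\<bar> \<le> 2 * B"
          using B(1)[OF xin[OF \<omega>], of n] fb[of "u m n \<omega>"] by linarith
        thus ?thesis using False \<omega> \<eta> by simp
      qed
      have i1: "integrable M (\<lambda>\<omega>. f (x n \<omega>))"
        by (rule M.integrable_const_bound[where B=B]) (use B xin in \<open>auto intro!: AE_I2\<close>)
      have i2: "integrable M (\<lambda>\<omega>. f (poly_path (u m n \<omega>)))"
        by (rule M.integrable_const_bound[where B=B]) (use fb in auto)
      have "\<bar>(\<integral>\<omega>. f (x n \<omega>) \<partial>M) - (\<integral>\<omega>. f (poly_path (u m n \<omega>)) \<partial>M)\<bar> = \<bar>\<integral>\<omega>. f (x n \<omega>) - f (poly_path (u m n \<omega>)) \<partial>M\<bar>"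
        using i1 i2 by simp
      also have "\<dots> \<le> (\<integral>\<omega>. \<bar>f (x n \<omega>) - f (poly_path (u m n \<omega>))\<bar> \<partial>M)" by (rule integral_abs_bound)
      also have "\<dots> \<le> (\<integral>\<omega>. \<eta> + 2 * B * indicator (space M - S) \<omega> \<partial>M)"
        using i1 i2 pt by (intro integral_mono) (auto simp: M.emeasure_eq_measure)
      also have "\<dots> = \<eta> + 2 * B * measure M (space M - S)"
        by (simp add: M.prob_space M.emeasure_eq_measure)
      also have "\<dots> \<le> \<eta> + 2 * B * (3 * \<eta>)" using pS B(2) by (intro add_left_mono mult_left_mono) auto
      finally show ?case using elim(2) m(3) by linarith
    qed
  qed
  show ?thesis
  proof (rule tendstoI)
    fix e :: real assume e: "e > 0"
    define D where "D = 3 + 6 * B"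
    have D: "D > 0" using B(2) by (simp add: D_def)
    define \<eta> where "\<eta> = e / (2 * D)"
    have \<eta>: "\<eta> > 0" using e D by (simp add: \<eta>_def)
    have "3 * \<eta> + 2 * B * (3 * \<eta>) = D * \<eta>" by (simp add: D_def algebra_simps)
    also have "\<dots> = e / 2" using D by (simp add: \<eta>_def)
    finally have eq: "3 * \<eta> + 2 * B * (3 * \<eta>) = e / 2" .
    show "\<forall>\<^sub>F n in sequentially. dist (\<integral>\<omega>. f (x n \<omega>) \<partial>M) (\<integral>\<omega>. f (z \<omega>) \<partial>completion N) < e"
      using main[OF \<eta>] unfolding eq by eventually_elim (use e in \<open>simp add: dist_real_def\<close>)
  qed
qed

section \<open>Renewal paths\<close>

definition partial_sums :: "(nat \<Rightarrow> real) \<Rightarrow> nat \<Rightarrow> real" where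
  "partial_sums y k = (\<Sum>j<k. y j)"

definition arrivals :: "(nat \<Rightarrow> real) \<Rightarrow> real \<Rightarrow> nat" where
  "arrivals y s = Max {k. partial_sums y k \<le> s}"

text \<open>The scaled queue as a deterministic function of chain and interarrival times, so that it
  can be evaluated on any probability space. The zero path replaces it where the maximum in
  \<open>arrivals\<close> need not make sense.\<close>

definition renewal_path :: "real \<Rightarrow> real \<Rightarrow> (nat \<Rightarrow> nat) \<times> (nat \<Rightarrow> real) \<Rightarrow> real \<Rightarrow> real" where
  "renewal_path d c u = (\<lambda>t\<in>{0..}. if good_knots (partial_sums (snd u))
     then d * real (fst u (arrivals (snd u) (c * t))) else 0)"

lemma partial_sums_0[simp]: "partial_sums y 0 = 0" and partial_sums_Suc: "partial_sums y (Suc k) = partial_sums y k + y k"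
  by (simp_all add: partial_sums_def)

lemma arrivals_eqI:
  assumes y: "good_knots (partial_sums y)" and k: "partial_sums y k \<le> s" "s < partial_sums y (Suc k)"
  shows "arrivals y s = k"
proof -
  have "{k. partial_sums y k \<le> s} = {..k}"
  proof (intro equalityI subsetI)
    fix j assume "j \<in> {k. partial_sums y k \<le> s}"
    hence "partial_sums y j < partial_sums y (Suc k)" using k by simp
    thus "j \<in> {..k}" using strict_mono_less[OF good_knots_strict_mono[OF y]] by (simp add: less_Suc_eq_le)
  next
    fix j assume "j \<in> {..k}"
    hence "partial_sums y j \<le> partial_sums y k" using strict_mono_less_eq[OF good_knots_strict_mono[OF y]] by simp
    thus "j \<in> {k. partial_sums y k \<le> s}" using k by simp
  qed
  moreover have "Max {..k} = k" by (intro Max_eqI) auto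
  ultimately show ?thesis by (simp add: arrivals_def)
qed

lemma arrivals_bounds:
  assumes y: "good_knots (partial_sums y)" and s: "0 \<le> s"
  shows "partial_sums y (arrivals y s) \<le> s" "s < partial_sums y (Suc (arrivals y s))"
proof -
  obtain i where i: "partial_sums y i \<le> s" "s < partial_sums y (Suc i)" using good_knots_cell[OF y s] by blast
  thus "partial_sums y (arrivals y s) \<le> s" "s < partial_sums y (Suc (arrivals y s))"
    using arrivals_eqI[OF y i] by auto
qed

lemma renewal_path_in_cadlag:
  assumes c: "c > 0" shows "renewal_path d c u \<in> cadlag_space"
proof (cases "good_knots (partial_sums (snd u))")
  case False thus ?thesis unfolding renewal_path_def by (auto intro!: cadlag_spaceI_continuous)
next
  case True
  define B where "B = partial_sums (snd u)"
  have y: "good_knots B" using True by (simp add: B_def)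
  define g where "g t = d * real (fst u (arrivals (snd u) (c * t)))" for t
  have gk: "g t = d * real (fst u k)" if "B k \<le> c * t" "c * t < B (Suc k)" for t k
    using arrivals_eqI[OF True, of k "c * t"] that by (simp add: g_def B_def)
  have path: "renewal_path d c u = (\<lambda>t\<in>{0..}. g t)" using True by (simp add: renewal_path_def g_def)
  show ?thesis unfolding path cadlag_space_def
  proof (intro CollectI conjI allI impI)
    fix t :: real assume t: "0 \<le> t"
    obtain k where k: "B k \<le> c * t" "c * t < B (Suc k)" using good_knots_cell[OF y, of "c * t"] t c by auto
    have "t < B (Suc k) / c" using k c by (simp add: field_simps)
    hence "\<forall>\<^sub>F s in at_right t. s \<in> {t<..<B (Suc k) / c}" by (rule eventually_at_right_real)
    hence "\<forall>\<^sub>F s in at_right t. (\<lambda>t\<in>{0..}. g t) s = g t"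
    proof eventually_elim
      case (elim s)
      have "c * t \<le> c * s" using elim c by (intro mult_left_mono) auto
      hence "B k \<le> c * s" using k by linarith
      moreover have "c * s < B (Suc k)" using elim c by (simp add: field_simps)
      ultimately show ?case using gk[of k s] gk[OF k] elim t by simp
    qed
    thus "((\<lambda>t\<in>{0..}. g t) \<longlongrightarrow> (\<lambda>t\<in>{0..}. g t) t) (at_right t)"
      using t by (simp add: tendsto_eventually)
    assume t0: "0 < t"
    \<comment> \<open>For the left limit at an arrival epoch the cell that ends there is relevant,
      not the one that begins.\<close>
    have "\<exists>k. B k < c * t \<and> c * t \<le> B (Suc k)"
    proof (cases "B k = c * t")
      case True
      have "c * t > 0" using t0 c by simp
      hence "k \<noteq> 0" using True by (cases k) (auto simp: B_def)
      then obtain j where "k = Suc j" by (cases k) auto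
      moreover have "B j < B (Suc j)" using y by (simp add: good_knots_def)
      ultimately show ?thesis using True by (intro exI[of _ j]) auto
    qed (use k in \<open>auto intro!: exI[of _ k]\<close>)
    then obtain j where j: "B j < c * t" "c * t \<le> B (Suc j)" by blast
    have "B j / c < t" using j c by (simp add: field_simps)
    hence "\<forall>\<^sub>F s in at_left t. s \<in> {B j / c<..<t}" by (rule eventually_at_left_real)
    moreover have "\<forall>\<^sub>F s in at_left t. s \<in> {0<..<t}" using t0 by (rule eventually_at_left_real)
    ultimately have "\<forall>\<^sub>F s in at_left t. (\<lambda>t\<in>{0..}. g t) s = d * real (fst u j)"
    proof eventually_elim
      case (elim s)
      have "B j \<le> c * s" using elim c by (simp add: field_simps)
      moreover have "c * s < c * t" using elim c by (intro mult_strict_left_mono) auto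
      hence "c * s < B (Suc j)" using j by linarith
      ultimately show ?case using gk[of j s] elim by simp
    qed
    thus "\<exists>l. ((\<lambda>t\<in>{0..}. g t) \<longlongrightarrow> l) (at_left t)" by (intro exI) (rule tendsto_eventually)
  qed auto
qed

abbreviation queue_algebra :: "((nat \<Rightarrow> nat) \<times> (nat \<Rightarrow> real)) measure" where
  "queue_algebra \<equiv> nat_sequences \<Otimes>\<^sub>M real_sequences"

lemma measurable_queue_coordinates[measurable]:
  "(\<lambda>u. fst u i) \<in> measurable queue_algebra (count_space UNIV)" "(\<lambda>u. snd u i) \<in> borel_measurable queue_algebra"
  by (auto intro!: measurable_compose[OF measurable_fst measurable_component_singleton]
    measurable_compose[OF measurable_snd measurable_component_singleton])

lemma pred_good_partial_sums[measurable]: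
  "Measurable.pred queue_algebra (\<lambda>u. good_knots (partial_sums (snd u)))"
  unfolding good_knots_def partial_sums_def by measurable

lemma measurable_renewal_path:
  assumes c: "c > 0" shows "renewal_path d c \<in> measurable queue_algebra cadlag_measure"
proof (rule measurable_into_cadlag[OF renewal_path_in_cadlag[OF c]])
  fix t :: real assume t: "t \<ge> 0"
  define I where "I u = (if good_knots (partial_sums (snd u)) then arrivals (snd u) (c * t) else 0)" for u :: "(nat \<Rightarrow> nat) \<times> (nat \<Rightarrow> real)"
  have I: "I \<in> measurable queue_algebra (count_space UNIV)"
  proof (subst measurable_count_space_eq2_countable, intro conjI ballI)
    fix k
    have iff: "I u = k \<longleftrightarrow> (if good_knots (partial_sums (snd u)) then (\<Sum>j<k. snd u j) \<le> c * t \<and> c * t < (\<Sum>j<Suc k. snd u j) else k = 0)" for u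
    proof (cases "good_knots (partial_sums (snd u))")
      case True
      have "arrivals (snd u) (c * t) = k \<longleftrightarrow> partial_sums (snd u) k \<le> c * t \<and> c * t < partial_sums (snd u) (Suc k)"
        using arrivals_eqI[OF True, of k "c * t"] arrivals_bounds[OF True, of "c * t"] t c by auto
      thus ?thesis using True by (simp add: I_def partial_sums_def)
    qed (auto simp: I_def)
    have "I -` {k} \<inter> space queue_algebra = {u \<in> space queue_algebra. I u = k}" by blast
    also have "\<dots> = {u \<in> space queue_algebra. if good_knots (partial_sums (snd u)) then (\<Sum>j<k. snd u j) \<le> c * t \<and> c * t < (\<Sum>j<Suc k. snd u j) else k = 0}"
      by (simp only: iff)
    also have "\<dots> \<in> sets queue_algebra" by measurable
    finally show "I -` {k} \<inter> space queue_algebra \<in> sets queue_algebra" .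
  qed auto
  have "(\<lambda>u. fst u (I u)) \<in> measurable queue_algebra (count_space UNIV)"
    by (rule measurable_compose_countable[OF _ I]) measurable
  hence "(\<lambda>u. if good_knots (partial_sums (snd u)) then d * real (fst u (I u)) else 0) \<in> borel_measurable queue_algebra"
    by measurable
  also have "(\<lambda>u. if good_knots (partial_sums (snd u)) then d * real (fst u (I u)) else 0) = (\<lambda>u. renewal_path d c u t)"
    using t by (auto simp: renewal_path_def I_def)
  finally show "(\<lambda>u. renewal_path d c u t) \<in> borel_measurable queue_algebra" .
qed

lemma renewal_count_eq_arrivals:
  "renewal_count Y s \<omega> = arrivals (\<lambda>k. Y (Suc k) \<omega>) s"
proof -
  have "(\<Sum>j=1..k. Y j \<omega>) = partial_sums (\<lambda>k. Y (Suc k) \<omega>) k" for k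
    unfolding partial_sums_def by (rule sum.reindex_bij_witness[of _ Suc "\<lambda>j. j - 1"]) auto
  thus ?thesis by (simp add: renewal_count_def arrivals_def)
qed

section \<open>Inverse subordinators\<close>

text \<open>What the limit theorem uses of a path \<open>S\<close> of the subordinator and its inverse \<open>L\<close>;
  for \<open>\<alpha> + \<beta> \<ge> 1\<close> both are the identity.\<close>

definition inverse_pair :: "(real \<Rightarrow> real) \<Rightarrow> (real \<Rightarrow> real) \<Rightarrow> bool" where
  "inverse_pair S L \<longleftrightarrow> S 0 = 0 \<and> strict_mono_on {0..} S \<and> (\<forall>k::nat. \<exists>i::nat. S (real i) > real k) \<and>
     (\<forall>t\<ge>0. 0 \<le> L t \<and> (\<forall>s\<ge>0. L t \<le> s \<longleftrightarrow> t \<le> S s))"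

lemma inverse_pairD:
  assumes "inverse_pair S L"
  shows "S 0 = 0" "\<And>s t. 0 \<le> s \<Longrightarrow> s < t \<Longrightarrow> S s < S t" "\<And>s t. 0 \<le> s \<Longrightarrow> s \<le> t \<Longrightarrow> S s \<le> S t"
    "\<And>x. \<exists>i::nat. S (real i) > x" "\<And>t. 0 \<le> t \<Longrightarrow> 0 \<le> L t"
    "\<And>t s. 0 \<le> t \<Longrightarrow> 0 \<le> s \<Longrightarrow> L t \<le> s \<longleftrightarrow> t \<le> S s"
proof -
  show mono: "S s < S t" if "0 \<le> s" "s < t" for s t
    using assms that by (auto simp: inverse_pair_def strict_mono_on_def)
  show "S s \<le> S t" if "0 \<le> s" "s \<le> t" for s t
    using mono[of s t] that by (cases "s = t") auto
  show "\<exists>i::nat. S (real i) > x" for x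
  proof -
    obtain k :: nat where "real k > x" using reals_Archimedean2 by blast
    moreover have "\<exists>i::nat. S (real i) > real k" using assms unfolding inverse_pair_def by blast
    then obtain i :: nat where "S (real i) > real k" ..
    ultimately show ?thesis by (intro exI[of _ i]) simp
  qed
qed (use assms in \<open>auto simp: inverse_pair_def\<close>)

text \<open>In the setting of \<open>inverse_pair\<close> these are the points between which t -> L
  (K t) passes from one multiple of 1/m to the next.\<close>

definition grid_knots :: "real \<Rightarrow> nat \<Rightarrow> (real \<Rightarrow> real) \<Rightarrow> nat \<Rightarrow> real" where
  "grid_knots K m S i = S (real i / real m) / K"

lemma good_grid_knots:
  assumes S: "inverse_pair S L" and K: "K > 0" and m: "m > 0"
  shows "good_knots (grid_knots K m S)"
  unfolding good_knots_def
proof (intro conjI allI)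
  show "grid_knots K m S 0 = 0" using inverse_pairD(1)[OF S] by (simp add: grid_knots_def)
  show "grid_knots K m S i < grid_knots K m S (Suc i)" for i
    unfolding grid_knots_def using K m by (intro divide_strict_right_mono inverse_pairD(2)[OF S]) (auto simp: divide_strict_right_mono)
  fix k :: nat
  obtain i :: nat where "S (real i) > real k * K" using inverse_pairD(4)[OF S] by blast
  thus "\<exists>i. real k < grid_knots K m S i"
    using K m by (intro exI[of _ "i * m"]) (simp add: grid_knots_def field_simps)
qed

text \<open>The upper bound is the equivalence between L t \<le> s and t \<le> S s. For the lower
  bound, L (K t) < i/m would give S (L (K t)) < S (i/m) \<le> K t by strict monotonicity, against K
  t \<le> S (L (K t)).\<close>

lemma inverse_in_cell:
  assumes S: "inverse_pair S L" and K: "K > 0" and m: "m > 0" and t: "t \<ge> 0"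
    and i: "grid_knots K m S i \<le> t" "t < grid_knots K m S (Suc i)"
  shows "real i / real m \<le> L (K * t)" "L (K * t) \<le> real (Suc i) / real m"
proof -
  have Kt: "K * t \<ge> 0" using K t by simp
  have 1: "S (real i / real m) \<le> K * t" "K * t < S (real (Suc i) / real m)"
    using i K by (auto simp: grid_knots_def field_simps simp del: of_nat_Suc)
  show "L (K * t) \<le> real (Suc i) / real m"
    using inverse_pairD(6)[OF S Kt, of "real (Suc i) / real m"] 1 by simp
  show "real i / real m \<le> L (K * t)"
  proof (rule ccontr)
    assume "\<not> real i / real m \<le> L (K * t)"
    hence "S (L (K * t)) < S (real i / real m)"
      using inverse_pairD(2)[OF S, of "L (K * t)" "real i / real m"] inverse_pairD(5)[OF S Kt] by simp
    moreover have "K * t \<le> S (L (K * t))"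
      using inverse_pairD(6)[OF S Kt, of "L (K * t)"] inverse_pairD(5)[OF S Kt] by simp
    ultimately show False using 1 by simp
  qed
qed

text \<open>Continuity of z is a conclusion: z is a locally uniform limit of continuous polygons.
  This is what puts the limit process into the path space without a separate study of the inverse
  subordinator.\<close>

lemma poly_path_limitI:
  assumes ext: "z \<in> extensional {0..}" and good: "\<forall>\<^sub>F m in sequentially. good_knots (v m)"
    and close: "\<And>T e. T \<ge> 0 \<Longrightarrow> e > 0 \<Longrightarrow> \<forall>\<^sub>F m in sequentially. \<forall>t\<in>{0..T}. \<exists>i. v m i \<le> t \<and> t \<le> v m (Suc i) \<and>
       \<bar>z t - r m i\<bar> \<le> e \<and> \<bar>z t - r m (Suc i)\<bar> \<le> e"
  shows "limitin U_topology (\<lambda>m. poly_path (r m, v m)) z sequentially"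
proof -
  have ul: "uniform_limit {0..T} (\<lambda>m. poly_path (r m, v m)) z sequentially" if T: "T \<ge> 0" for T
  proof (rule uniform_limitI)
    fix e :: real assume e: "e > 0"
    have "\<forall>\<^sub>F m in sequentially. \<forall>t\<in>{0..T}. \<exists>i. v m i \<le> t \<and> t \<le> v m (Suc i) \<and>
       \<bar>z t - r m i\<bar> \<le> e / 2 \<and> \<bar>z t - r m (Suc i)\<bar> \<le> e / 2" using close[OF T, of "e / 2"] e by simp
    with good show "\<forall>\<^sub>F m in sequentially. \<forall>t\<in>{0..T}. dist (poly_path (r m, v m) t) (z t) < e"
    proof eventually_elim
      case (elim m)
      show ?case
      proof
        fix t assume t: "t \<in> {0..T}"
        then obtain i where i: "v m i \<le> t" "t \<le> v m (Suc i)" "\<bar>z t - r m i\<bar> \<le> e / 2" "\<bar>z t - r m (Suc i)\<bar> \<le> e / 2"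
          using elim by blast
        have "\<bar>z t - polygon (r m) (v m) t\<bar> \<le> e / 2" by (rule polygon_close[OF _ i]) (use elim in auto)
        thus "dist (poly_path (r m, v m) t) (z t) < e"
          using e elim t by (simp add: poly_path_def dist_real_def abs_minus_commute)
      qed
    qed
  qed
  have cont: "continuous_on {0..T} z" if T: "T \<ge> 0" for T
  proof (rule uniform_limit_theorem[OF _ ul[OF T]])
    have "continuous_on {0..T} (poly_path (r m, v m))" if "good_knots (v m)" for m
      by (rule continuous_on_eq[OF continuous_on_polygon[OF that]]) (use that in \<open>auto simp: poly_path_def\<close>)
    thus "\<forall>\<^sub>F m in sequentially. continuous_on {0..T} (poly_path (r m, v m))"
      using good by (auto elim: eventually_mono)
  qed simp
  have "continuous_on {0..} z"
  proof (unfold continuous_on_eq_continuous_within, rule ballI)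
    fix t :: real assume t: "t \<in> {0..}"
    have "continuous (at t within {0..t + 1}) z"
      using cont[of "t + 1"] t by (auto simp: continuous_on_eq_continuous_within)
    moreover have "at t within {0..t + 1} = at t within {0..}"
      by (rule at_within_nhd[of _ "{..<t + 1}"]) (use t in auto)
    ultimately show "continuous (at t within {0..}) z" by simp
  qed
  from cadlag_spaceI_continuous[OF this] have "z \<in> cadlag_space"
    using ext by (simp add: extensional_restrict)
  thus ?thesis using ul by (auto simp: limitin_U_topology poly_path_in_cadlag)
qed

text \<open>Throughout a cell L (K t) stays between two consecutive grid points, so the error is at
  most \<open>\<bar>c\<bar>\<close> times the mesh. The mesh 1 / (m + 1) avoids an empty grid at m =
  0.\<close>

lemma drift_limit:
  assumes S: "inverse_pair S L" and K: "K > 0" and z: "z = (\<lambda>t\<in>{0..}. c * L (K * t))"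
  shows "limitin U_topology (\<lambda>m. poly_path (\<lambda>i. c * (real i / real (Suc m)), grid_knots K (Suc m) S)) z sequentially"
proof (rule poly_path_limitI)
  show "\<forall>\<^sub>F m in sequentially. good_knots (grid_knots K (Suc m) S)"
    using good_grid_knots[OF S K] by simp
  fix T e :: real assume T: "T \<ge> 0" "e > 0"
  have "(\<lambda>m. \<bar>c\<bar> * (1 / real (Suc m))) \<longlonglongrightarrow> \<bar>c\<bar> * 0"
    by (intro tendsto_intros LIMSEQ_Suc[OF lim_1_over_n])
  hence "\<forall>\<^sub>F m in sequentially. \<bar>c\<bar> * (1 / real (Suc m)) < e" using T by (intro order_tendstoD) auto
  thus "\<forall>\<^sub>F m in sequentially. \<forall>t\<in>{0..T}. \<exists>i. grid_knots K (Suc m) S i \<le> t \<and> t \<le> grid_knots K (Suc m) S (Suc i) \<and>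
    \<bar>z t - c * (real i / real (Suc m))\<bar> \<le> e \<and> \<bar>z t - c * (real (Suc i) / real (Suc m))\<bar> \<le> e"
  proof eventually_elim
    case (elim m)
    show ?case
    proof
      fix t assume t: "t \<in> {0..T}"
      obtain i where i: "grid_knots K (Suc m) S i \<le> t" "t < grid_knots K (Suc m) S (Suc i)"
        using good_knots_cell[OF good_grid_knots[OF S K]] t by (metis atLeastAtMost_iff zero_less_Suc)
      have b: "real i / real (Suc m) \<le> L (K * t)" "L (K * t) \<le> real (Suc i) / real (Suc m)"
        using inverse_in_cell[OF S K _ _ i] t by auto
      have d: "real (Suc i) / real (Suc m) = real i / real (Suc m) + 1 / real (Suc m)" by (simp add: add_divide_distrib)
      have "\<bar>c * L (K * t) - c * (real j / real (Suc m))\<bar> \<le> e" if "j = i \<or> j = Suc i" for j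
      proof -
        have "\<bar>L (K * t) - real j / real (Suc m)\<bar> \<le> 1 / real (Suc m)" using that b d by auto
        hence "\<bar>c\<bar> * \<bar>L (K * t) - real j / real (Suc m)\<bar> \<le> \<bar>c\<bar> * (1 / real (Suc m))" by (intro mult_left_mono) auto
        thus ?thesis using elim by (simp add: abs_mult[symmetric] right_diff_distrib)
      qed
      thus "\<exists>i. grid_knots K (Suc m) S i \<le> t \<and> t \<le> grid_knots K (Suc m) S (Suc i) \<and>
        \<bar>z t - c * (real i / real (Suc m))\<bar> \<le> e \<and> \<bar>z t - c * (real (Suc i) / real (Suc m))\<bar> \<le> e"
        using i t z by (intro exI[of _ i] conjI) (auto simp del: of_nat_Suc)
    qed
  qed
qed (simp add: z)

definition reflected :: "(nat \<Rightarrow> real) \<Rightarrow> nat \<Rightarrow> real" where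
  "reflected g i = g i + max_deficit g i"

text \<open>With oscillation at most e per cell, the path and its running supremum each move by at
  most e between x and the left grid point, and by at most 2 e between x and the right one. Hence 4
  e serves for both.\<close>

lemma skorokhod_reflection_grid:
  fixes g :: "real \<Rightarrow> real" and s :: "nat \<Rightarrow> real"
  assumes s: "s 0 = 0" "mono s" and x: "s i \<le> x" "x \<le> s (Suc i)"
    and osc: "\<And>j y. j \<le> i \<Longrightarrow> s j \<le> y \<Longrightarrow> y \<le> s (Suc j) \<Longrightarrow> \<bar>g y - g (s j)\<bar> \<le> e"
  shows "\<bar>skorokhod_reflection g x - reflected (\<lambda>j. g (s j)) i\<bar> \<le> 4 * e"
    "\<bar>skorokhod_reflection g x - reflected (\<lambda>j. g (s j)) (Suc i)\<bar> \<le> 4 * e"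
proof -
  define h where "h j = g (s j)" for j
  define D where "D = (SUP y\<in>{0..x}. max (- g y) 0)"
  have x0: "0 \<le> x" using s x monoD[OF s(2), of 0 i] by simp
  have e0: "0 \<le> e" using osc[of 0 "s 0"] monoD[OF s(2), of 0 "Suc 0"] by simp
  have up: "max (- g y) 0 \<le> max_deficit h i + e" if y: "y \<in> {0..x}" for y
  proof -
    \<comment> \<open>The last grid point not beyond y, capped at i; y then lies in the cell that
      starts there.\<close>
    define j where "j = (GREATEST j. j \<le> i \<and> s j \<le> y)"
    have j: "j \<le> i \<and> s j \<le> y"
      unfolding j_def by (rule GreatestI_nat[of _ 0 i]) (use y s in auto)
    have "y \<le> s (Suc j)"
    proof (cases "j = i")
      case False
      have "\<not> (Suc j \<le> i \<and> s (Suc j) \<le> y)"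
        using Greatest_le_nat[of "\<lambda>j. j \<le> i \<and> s j \<le> y" "Suc j" i] by (auto simp: j_def)
      thus ?thesis using False j by auto
    qed (use x y in auto)
    hence "\<bar>g y - h j\<bar> \<le> e" using osc[of j y] j by (simp add: h_def)
    moreover have "- h j \<le> max_deficit h i" "0 \<le> max_deficit h i" using max_deficit_ge j by auto
    ultimately show ?thesis using e0 by linarith
  qed
  have bdd: "bdd_above ((\<lambda>y. max (- g y) 0) ` {0..x})" by (rule bdd_aboveI2[OF up])
  have D_le: "D \<le> max_deficit h i + e" unfolding D_def using x0 by (intro cSUP_least up) auto
  have D_ge: "max (- g y) 0 \<le> D" if "y \<in> {0..x}" for y
    unfolding D_def by (rule cSUP_upper[OF that bdd])
  have "s j \<in> {0..x}" if "j \<le> i" for j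
    using monoD[OF s(2), of 0 j] monoD[OF s(2) that] s x by simp
  hence "- h j \<le> D" if "j \<le> i" for j using D_ge[of "s j"] that by (simp add: h_def)
  moreover have "0 \<le> D" using D_ge[of x] x0 by simp
  ultimately have md: "max_deficit h i \<le> D" by (intro max_deficit_least) auto
  have ox: "\<bar>g x - h i\<bar> \<le> e" using osc[of i x] x by (simp add: h_def)
  have o2: "\<bar>h (Suc i) - h i\<bar> \<le> e" using osc[of i "s (Suc i)"] x by (simp add: h_def)
  have gx: "- g x \<le> D" using D_ge[of x] x0 by simp
  show "\<bar>skorokhod_reflection g x - reflected (\<lambda>j. g (s j)) i\<bar> \<le> 4 * e"
    using D_le md ox e0 unfolding skorokhod_reflection_def D_def[symmetric] reflected_def h_def[symmetric] by linarith
  show "\<bar>skorokhod_reflection g x - reflected (\<lambda>j. g (s j)) (Suc i)\<bar> \<le> 4 * e"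
    using D_le md ox o2 gx e0 unfolding skorokhod_reflection_def D_def[symmetric] reflected_def h_def[symmetric] by simp
qed

text \<open>Uniform continuity of W on a compact interval bounds the oscillation per cell by e/4,
  which matches the constant 4 of the grid comparison.\<close>

lemma reflected_limit:
  assumes S: "inverse_pair S L" and K: "K > 0" and W: "continuous_on {0..} W"
    and z: "z = (\<lambda>t\<in>{0..}. skorokhod_reflection W (L (K * t)))"
  shows "limitin U_topology (\<lambda>m. poly_path (reflected (\<lambda>i. W (real i / real (Suc m))), grid_knots K (Suc m) S)) z sequentially"
proof (rule poly_path_limitI)
  show "\<forall>\<^sub>F m in sequentially. good_knots (grid_knots K (Suc m) S)"
    using good_grid_knots[OF S K] by simp
  fix T e :: real assume T: "T \<ge> 0" "e > 0"
  \<comment> \<open>Every cell met before time T begins before R on the scale of W; the interval up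
    to R + 1 also contains the end of the last cell, whose width is at most 1.\<close>
  obtain R :: nat where R: "S (real R) > K * T" using inverse_pairD(4)[OF S] by blast
  have "uniformly_continuous_on {0..real R + 1} W"
    by (intro compact_uniformly_continuous continuous_on_subset[OF W]) auto
  then obtain d where d: "d > 0" "\<And>x y. x \<in> {0..real R + 1} \<Longrightarrow> y \<in> {0..real R + 1} \<Longrightarrow> dist x y < d \<Longrightarrow> dist (W x) (W y) < e / 4"
    using T unfolding uniformly_continuous_on_def by (metis divide_pos_pos zero_less_numeral)
  have "(\<lambda>m. 1 / real (Suc m)) \<longlonglongrightarrow> 0" by (rule LIMSEQ_Suc[OF lim_1_over_n])
  hence "\<forall>\<^sub>F m in sequentially. 1 / real (Suc m) < d" using d by (intro order_tendstoD) auto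
  thus "\<forall>\<^sub>F m in sequentially. \<forall>t\<in>{0..T}. \<exists>i. grid_knots K (Suc m) S i \<le> t \<and> t \<le> grid_knots K (Suc m) S (Suc i) \<and>
    \<bar>z t - reflected (\<lambda>i. W (real i / real (Suc m))) i\<bar> \<le> e \<and> \<bar>z t - reflected (\<lambda>i. W (real i / real (Suc m))) (Suc i)\<bar> \<le> e"
  proof eventually_elim
    case (elim m)
    define s where "s j = real j / real (Suc m)" for j
    have ds: "s (Suc j) = s j + 1 / real (Suc m)" for j by (simp add: s_def add_divide_distrib)
    have smono: "mono s" by (rule monoI) (simp add: s_def divide_right_mono)
    show ?case
    proof
      fix t assume t: "t \<in> {0..T}"
      obtain i where i: "grid_knots K (Suc m) S i \<le> t" "t < grid_knots K (Suc m) S (Suc i)"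
        using good_knots_cell[OF good_grid_knots[OF S K]] t by (metis atLeastAtMost_iff zero_less_Suc)
      have b: "s i \<le> L (K * t)" "L (K * t) \<le> s (Suc i)"
        using inverse_in_cell[OF S K _ _ i] t by (auto simp: s_def)
      have siR: "s i < real R"
      proof (rule ccontr)
        assume "\<not> s i < real R"
        hence "S (real R) \<le> S (s i)" by (intro inverse_pairD(3)[OF S]) auto
        also have "\<dots> \<le> K * t" using i(1) K by (simp add: grid_knots_def s_def field_simps)
        also have "\<dots> \<le> K * T" using t K by (intro mult_left_mono) auto
        finally show False using R by simp
      qed
      have osc: "\<bar>W y - W (s j)\<bar> \<le> e / 4" if "j \<le> i" "s j \<le> y" "y \<le> s (Suc j)" for j y
      proof -
        have "s j \<le> s i" "0 \<le> s j" using monoD[OF smono that(1)] by (auto simp: s_def)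
        moreover have "1 / real (Suc m) \<le> 1" by simp
        ultimately have "y \<in> {0..real R + 1}" "s j \<in> {0..real R + 1}"
          using that siR ds[of j] unfolding atLeastAtMost_iff by linarith+
        moreover have "dist y (s j) < d" using that ds[of j] elim by (auto simp: dist_real_def)
        ultimately have "dist (W y) (W (s j)) < e / 4" by (intro d(2))
        thus ?thesis by (simp add: dist_real_def)
      qed
      have s0: "s 0 = 0" by (simp add: s_def)
      note gr = skorokhod_reflection_grid[where g=W and s=s, OF s0 smono b osc]
      show "\<exists>i. grid_knots K (Suc m) S i \<le> t \<and> t \<le> grid_knots K (Suc m) S (Suc i) \<and>
        \<bar>z t - reflected (\<lambda>i. W (real i / real (Suc m))) i\<bar> \<le> e \<and> \<bar>z t - reflected (\<lambda>i. W (real i / real (Suc m))) (Suc i)\<bar> \<le> e"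
        using i t gr unfolding z s_def[symmetric] by (intro exI[of _ i]) auto
    qed
  qed
qed (simp add: z)

text \<open>A constant variable generates only the empty event and the whole space, so at most one
  factor in the product formula is nontrivial. Intended for the deterministic clock when \<alpha> +
  \<beta> \<ge> 1.\<close>

lemma (in prob_space) indep_vars_all_but_one_constant:
  assumes rv: "\<And>i. i \<in> I \<Longrightarrow> random_variable (M' i) (X i)"
    and const: "\<And>i. i \<in> I \<Longrightarrow> i \<noteq> i0 \<Longrightarrow> \<forall>\<omega>\<in>space M. X i \<omega> = c i"
  shows "indep_vars M' X I"
  unfolding indep_vars_def2
proof (intro conjI ballI rv indep_setsI)
  show "{X i -` A \<inter> space M |A. A \<in> sets (M' i)} \<subseteq> events" if "i \<in> I" for i
    using measurable_sets[OF rv[OF that]] by auto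
  fix A J assume J: "J \<noteq> {}" "J \<subseteq> I" "finite J" and A: "\<forall>j\<in>J. A j \<in> {X j -` A \<inter> space M |A. A \<in> sets (M' j)}"
  have A': "\<exists>B. A j = X j -` B \<inter> space M" if "j \<in> J" for j using bspec[OF A that] by auto
  have triv: "A j = {} \<or> A j = space M" if jJ: "j \<in> J" "j \<noteq> i0" for j
  proof -
    obtain B where "A j = X j -` B \<inter> space M" using A'[OF jJ(1)] by blast
    moreover have "\<forall>\<omega>\<in>space M. X j \<omega> = c j" by (rule const) (use jJ J in auto)
    ultimately show ?thesis by (cases "c j \<in> B") auto
  qed
  have sub: "A j \<subseteq> space M" if "j \<in> J" for j using A'[OF that] by auto
  show "prob (\<Inter>j\<in>J. A j) = (\<Prod>j\<in>J. prob (A j))"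
  proof (cases "\<exists>j\<in>J. A j = {}")
    case True
    hence "(\<Inter>j\<in>J. A j) = {}" by auto
    moreover obtain j where "j \<in> J" "A j = {}" using True by blast
    hence "\<exists>j\<in>J. prob (A j) = 0" by (intro bexI[of _ j]) auto
    hence "(\<Prod>j\<in>J. prob (A j)) = 0" using J by (intro prod_zero)
    ultimately show ?thesis by simp
  next
    case False
    hence sp: "A j = space M" if "j \<in> J" "j \<noteq> i0" for j using triv that by blast
    show ?thesis
    proof (cases "i0 \<in> J")
      case True
      have "A i0 \<subseteq> A j" if "j \<in> J" for j using sub[OF True] sp[OF that] by (cases "j = i0") auto
      hence "(\<Inter>j\<in>J. A j) = A i0" using True by blast
      moreover have "(\<Prod>j\<in>J. prob (A j)) = prob (A i0) * (\<Prod>j\<in>J - {i0}. prob (A j))"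
        using True J by (simp add: prod.remove)
      moreover have "(\<Prod>j\<in>J - {i0}. prob (A j)) = 1" using sp prob_space by (intro prod.neutral) auto
      ultimately show ?thesis by simp
    next
      case False
      hence "\<And>j. j \<in> J \<Longrightarrow> A j = space M" using sp by blast
      hence "(\<Inter>j\<in>J. A j) = space M" "(\<Prod>j\<in>J. prob (A j)) = 1" using J prob_space by auto
      thus ?thesis using prob_space by simp
    qed
  qed
qed

lemma (in prob_space) indep_vars_lessThan_imp_UNIV:
  assumes "\<And>k. indep_vars M' X {..<k::nat}" shows "indep_vars M' X UNIV"
  unfolding indep_vars_def2
proof (intro conjI ballI)
  show "random_variable (M' i) (X i)" for i using assms[of "Suc i"] by (auto simp: indep_vars_def2)
  show "indep_sets (\<lambda>i. {X i -` A \<inter> space M |A. A \<in> sets (M' i)}) UNIV"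
  proof (subst indep_sets_finite_index_sets, intro allI impI)
    fix J :: "nat set" assume "finite J"
    then obtain k where "J \<subseteq> {..<k}" using finite_nat_iff_bounded by blast
    thus "indep_sets (\<lambda>i. {X i -` A \<inter> space M |A. A \<in> sets (M' i)}) J"
      using assms[of k] by (auto simp: indep_vars_def2 intro: indep_sets_mono_index)
  qed
qed

lemma (in prob_space) grid_increments_distr:
  assumes X: "independent_increments M X" and m: "\<And>t. t \<ge> 0 \<Longrightarrow> X t \<in> borel_measurable M"
    and stat: "\<And>i. distr M borel (\<lambda>\<omega>. X (real (Suc i) * h) \<omega> - X (real i * h) \<omega>) = \<nu>" and h: "h \<ge> 0"
  shows "distr M real_sequences (\<lambda>\<omega> i. X (real (Suc i) * h) \<omega> - X (real i * h) \<omega>) = Pi\<^sub>M (UNIV::nat set) (\<lambda>_. \<nu>)"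
proof -
  define D where "D i \<omega> = X (real (Suc i) * h) \<omega> - X (real i * h) \<omega>" for i \<omega>
  have "indep_vars (\<lambda>_. borel) D {..<k}" for k
  proof -
    have "mono (\<lambda>i. real i * h)" using h by (intro monoI mult_right_mono) auto
    moreover have "0 \<le> real 0 * h" by simp
    ultimately have "indep_vars (\<lambda>_. borel) (\<lambda>i \<omega>. X (real (Suc i) * h) \<omega> - X (real i * h) \<omega>) {..<k}"
      using X unfolding independent_increments_def by (elim allE[of _ k] allE[of _ "\<lambda>i. real i * h"]) (elim impE)
    thus ?thesis by (simp only: D_def[abs_def])
  qed
  hence ind: "indep_vars (\<lambda>_. borel) D UNIV" by (rule indep_vars_lessThan_imp_UNIV)
  have rv: "random_variable borel (D i)" for i unfolding D_def using m h by (intro borel_measurable_diff) auto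
  have "distr M real_sequences (\<lambda>\<omega>. \<lambda>i\<in>UNIV. D i \<omega>) = Pi\<^sub>M UNIV (\<lambda>i. distr M borel (D i))"
    by (rule indep_vars_iff_distr_eq_PiM[THEN iffD1, OF _ rv ind]) simp
  thus ?thesis using stat unfolding D_def[abs_def] by (simp add: restrict_UNIV)
qed

section \<open>From subordinator paths to inverse pairs\<close>

lemma right_continuous_rational_below:
  fixes S :: "real \<Rightarrow> real"
  assumes "(S \<longlongrightarrow> S s) (at_right s)" "S s < x" "s < b"
  shows "\<exists>q\<in>\<rat>. s < q \<and> q < b \<and> S q < x" "\<exists>d>s. d \<le> b \<and> (\<forall>y. s \<le> y \<longrightarrow> y < d \<longrightarrow> S y < x)"
proof -
  have "\<forall>\<^sub>F y in at_right s. S y < x" using assms by (intro order_tendstoD)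
  then obtain d where d: "d > s" "\<And>y. s < y \<Longrightarrow> y < d \<Longrightarrow> S y < x" by (auto simp: eventually_at_right_field)
  obtain q where "q \<in> \<rat>" "s < q" "q < min d b" using Rats_dense_in_real[of s "min d b"] d assms by auto
  thus "\<exists>q\<in>\<rat>. s < q \<and> q < b \<and> S q < x" using d by auto
  have "S y < x" if "s \<le> y" "y < min d b" for y using d assms that by (cases "y = s") auto
  thus "\<exists>d>s. d \<le> b \<and> (\<forall>y. s \<le> y \<longrightarrow> y < d \<longrightarrow> S y < x)" using d assms by (intro exI[of _ "min d b"]) auto
qed

lemma right_continuous_rational_above:
  fixes S :: "real \<Rightarrow> real"
  assumes "(S \<longlongrightarrow> S s) (at_right s)" "S s > x" "s < b"
  shows "\<exists>q\<in>\<rat>. s < q \<and> q < b \<and> S q > x"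
proof -
  have "\<forall>\<^sub>F y in at_right s. S y > x" using assms by (intro order_tendstoD)
  then obtain d where d: "d > s" "\<And>y. s < y \<Longrightarrow> y < d \<Longrightarrow> S y > x" by (auto simp: eventually_at_right_field)
  obtain q where "q \<in> \<rat>" "s < q" "q < min d b" using Rats_dense_in_real[of s "min d b"] d assms by auto
  thus ?thesis using d by auto
qed

text \<open>Strict monotonicity on the rationals can hold almost surely for all pairs at once; right
  continuity extends it to all real times and makes the infimum in the definition of L
  attained.\<close>

lemma inverse_pairI:
  fixes S L :: "real \<Rightarrow> real"
  assumes S0: "S 0 = 0" and rc: "\<And>s. s \<ge> 0 \<Longrightarrow> (S \<longlongrightarrow> S s) (at_right s)"
    and mono: "\<And>p q. p \<in> \<rat> \<Longrightarrow> q \<in> \<rat> \<Longrightarrow> 0 \<le> p \<Longrightarrow> p < q \<Longrightarrow> S p < S q"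
    and unb: "\<And>k::nat. \<exists>i::nat. S (real i) > real k"
    and L: "\<And>t. t \<ge> 0 \<Longrightarrow> L t = (LEAST s. 0 \<le> s \<and> t \<le> S s)"
  shows "inverse_pair S L"
proof -
  have SM: "S s < S t" if st: "0 \<le> s" "s < t" for s t
  proof -
    obtain p where p: "p \<in> \<rat>" "s < p" "p < t" using Rats_dense_in_real[OF st(2)] by auto
    obtain q where q: "q \<in> \<rat>" "p < q" "q < t" using Rats_dense_in_real[OF p(3)] by auto
    have "S s \<le> S p"
    proof (rule ccontr)
      assume "\<not> S s \<le> S p"
      hence "S s > S p" by simp
      hence "\<exists>q\<in>\<rat>. s < q \<and> q < p \<and> S q > S p"
        by (intro right_continuous_rational_above rc) (use st p in auto)
      then obtain q' where "q' \<in> \<rat>" "s < q'" "q' < p" "S q' > S p" by blast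
      thus False using mono[of q' p] p st by auto
    qed
    moreover have "S q \<le> S t"
    proof (rule ccontr)
      assume "\<not> S q \<le> S t"
      hence "S t < S q" by simp
      hence "\<exists>q'\<in>\<rat>. t < q' \<and> q' < t + 1 \<and> S q' < S q"
        by (intro right_continuous_rational_below(1) rc) (use st in auto)
      then obtain q' where "q' \<in> \<rat>" "t < q'" "S q' < S q" by blast
      thus False using mono[of q q'] q p st by auto
    qed
    moreover have "S p < S q" using mono p q st by auto
    ultimately show ?thesis by simp
  qed
  have SM': "S s \<le> S t" if "0 \<le> s" "s \<le> t" for s t using SM[of s t] that by (cases "s = t") auto
  have LL: "0 \<le> L t \<and> (\<forall>s\<ge>0. L t \<le> s \<longleftrightarrow> t \<le> S s)" if t: "t \<ge> 0" for t
  proof -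
    define A where "A = {s. 0 \<le> s \<and> t \<le> S s}"
    obtain k :: nat where "real k > t" using reals_Archimedean2 by blast
    moreover obtain i :: nat where "S (real i) > real k" using unb by blast
    ultimately have ne: "real i \<in> A" by (simp add: A_def)
    have bdd: "bdd_below A" unfolding A_def by (rule bdd_belowI[of _ 0]) auto
    define s0 where "s0 = Inf A"
    have s0: "0 \<le> s0" unfolding s0_def
    proof (rule cInf_greatest)
      show "A \<noteq> {}" using ne by blast
    qed (simp add: A_def)
    have low: "s0 \<le> s" if "s \<in> A" for s unfolding s0_def by (rule cInf_lower[OF that bdd])
    have "t \<le> S s0"
    proof (rule ccontr)
      assume "\<not> t \<le> S s0"
      hence "\<exists>d>s0. d \<le> s0 + 1 \<and> (\<forall>y. s0 \<le> y \<longrightarrow> y < d \<longrightarrow> S y < t)"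
        by (intro right_continuous_rational_below(2) rc s0) auto
      then obtain d where d: "d > s0" "\<And>y. s0 \<le> y \<Longrightarrow> y < d \<Longrightarrow> S y < t" by blast
      have "d \<le> Inf A"
      proof (rule cInf_greatest)
        fix s assume "s \<in> A"
        thus "d \<le> s" using d low[of s] by (force simp: A_def)
      qed (use ne in auto)
      thus False using d by (simp add: s0_def)
    qed
    hence s0A: "0 \<le> s0 \<and> t \<le> S s0" using s0 by simp
    have Lt: "L t = s0" unfolding L[OF t] by (rule Least_equality) (use s0A low in \<open>auto simp: A_def\<close>)
    show ?thesis unfolding Lt
    proof (intro conjI s0 allI impI iffI)
      fix s assume "s0 \<le> s" thus "t \<le> S s" using SM'[of s0 s] s0A by simp
    next
      fix s :: real assume "0 \<le> s" "t \<le> S s" thus "s0 \<le> s" by (intro low) (simp add: A_def)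
    qed
  qed
  show ?thesis unfolding inverse_pair_def using S0 SM unb LL by (auto simp: strict_mono_on_def)
qed

text \<open>Markov's inequality bounds the probability of S h \<le> x by exp (z x - h z^a). At x = 0
  and z tending to infinity this makes increments strictly positive; at z = 1 and h tending to
  infinity it makes the path unbounded.\<close>

lemma stable_inverse_pair:
  assumes N: "prob_space N" and S: "stable_subordinator N a S" and a: "a > 0"
    and L: "AE \<omega> in N. \<forall>t\<ge>0. L t \<omega> = (LEAST s. 0 \<le> s \<and> t \<le> S s \<omega>)"
  shows "AE \<omega> in N. inverse_pair (\<lambda>s. S s \<omega>) (\<lambda>t. L t \<omega>)"
proof -
  interpret prob_space N by (rule N)
  have levy: "levy_process N S" using S by (simp add: stable_subordinator_def)
  have [measurable]: "S t \<in> borel_measurable N" if "t \<ge> 0" for t using levy that by (simp add: levy_process_def)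
  have lap: "integrable N (\<lambda>\<omega>. exp (- z * S t \<omega>))" "expectation (\<lambda>\<omega>. exp (- z * S t \<omega>)) = exp (- t * z powr a)"
    if "t \<ge> 0" "z \<ge> 0" for t z using S that by (auto simp: stable_subordinator_def)
  have bound: "prob {\<omega>\<in>space N. S h \<omega> \<le> x} \<le> exp (z * x) * exp (- h * z powr a)" if h: "h \<ge> 0" "z \<ge> 0" for h z x
  proof -
    note [measurable] = \<open>\<And>t. t \<ge> 0 \<Longrightarrow> S t \<in> borel_measurable N\<close>[OF h(1)]
    have "prob {\<omega>\<in>space N. S h \<omega> \<le> x} \<le> prob {\<omega>\<in>space N. exp (- z * S h \<omega>) \<ge> exp (- z * x)}"
      using h by (intro finite_measure_mono) (auto intro: mult_left_mono)
    also have "\<dots> \<le> expectation (\<lambda>\<omega>. exp (- z * S h \<omega>)) / exp (- z * x)"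
      by (rule integral_Markov_inequality_measure[where A="{}"]) (use lap[OF h] in auto)
    finally show ?thesis using lap[OF h] by (simp add: exp_minus divide_inverse mult.commute)
  qed
  have pos: "AE \<omega> in N. S q \<omega> - S p \<omega> > 0" if pq: "0 \<le> p" "p < q" for p q
  proof -
    define h where "h = q - p"
    have h: "h > 0" using pq by (simp add: h_def)
    have [measurable]: "S h \<in> borel_measurable N" "S q \<in> borel_measurable N" "S p \<in> borel_measurable N" using h pq levy by (auto simp: levy_process_def)
    have "prob {\<omega>\<in>space N. S h \<omega> \<le> 0} \<le> 0"
    proof (rule tendsto_lowerbound)
      show "(\<lambda>n. exp (- h * real n powr a)) \<longlonglongrightarrow> 0" using h a by real_asymp
      show "\<forall>\<^sub>F n in sequentially. prob {\<omega>\<in>space N. S h \<omega> \<le> 0} \<le> exp (- h * real n powr a)"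
        using bound[of h _ 0] h by (auto intro!: always_eventually)
    qed simp
    hence "prob {\<omega>\<in>space N. S h \<omega> \<le> 0} = 0" by (simp add: measure_le_0_iff)
    hence "AE \<omega> in N. \<not> S h \<omega> \<le> 0" by (subst (asm) prob_Collect_eq_0) auto
    hence "AE x in distr N borel (S h). x > 0" by (subst AE_distr_iff) (auto simp: not_le)
    also have "distr N borel (S h) = distr N borel (\<lambda>\<omega>. S (p + h) \<omega> - S p \<omega>)"
      using levy pq h unfolding levy_process_def by simp
    also have "p + h = q" by (simp add: h_def)
    finally show ?thesis by (subst (asm) AE_distr_iff) auto
  qed
  have "AE \<omega> in N. \<forall>p\<in>\<rat>. \<forall>q\<in>\<rat>. 0 \<le> p \<longrightarrow> p < q \<longrightarrow> S p \<omega> < S q \<omega>"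
  proof -
    have c: "countable (\<rat> :: real set)" by (rule countable_rat)
    show ?thesis
      using pos by (subst AE_ball_countable[OF c], intro ballI, subst AE_ball_countable[OF c], intro ballI)
        (auto simp: AE_all_countable)
  qed
  moreover have "AE \<omega> in N. \<forall>k::nat. \<exists>i::nat. S (real i) \<omega> > real k"
  proof (subst AE_all_countable, rule allI)
    fix k :: nat
    have meas: "{\<omega>\<in>space N. \<forall>i::nat. S (real i) \<omega> \<le> real k} \<in> events"
      using \<open>\<And>t. t \<ge> 0 \<Longrightarrow> S t \<in> borel_measurable N\<close> by (intro sets.sets_Collect_countable_All) auto
    have "prob {\<omega>\<in>space N. \<forall>i::nat. S (real i) \<omega> \<le> real k} \<le> 0"
    proof (rule tendsto_lowerbound)
      show "(\<lambda>n. exp (1 * real k) * exp (- real n * 1 powr a)) \<longlonglongrightarrow> 0" by real_asymp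
      have "prob {\<omega>\<in>space N. \<forall>i::nat. S (real i) \<omega> \<le> real k} \<le> exp (1 * real k) * exp (- real n * 1 powr a)" for n
      proof -
        have "prob {\<omega>\<in>space N. \<forall>i::nat. S (real i) \<omega> \<le> real k} \<le> prob {\<omega>\<in>space N. S (real n) \<omega> \<le> real k}"
          using \<open>\<And>t. t \<ge> 0 \<Longrightarrow> S t \<in> borel_measurable N\<close>[of "real n"] by (intro finite_measure_mono) auto
        also have "\<dots> \<le> exp (1 * real k) * exp (- real n * 1 powr a)" by (rule bound) auto
        finally show ?thesis .
      qed
      thus "\<forall>\<^sub>F n in sequentially. prob {\<omega>\<in>space N. \<forall>i::nat. S (real i) \<omega> \<le> real k} \<le> exp (1 * real k) * exp (- real n * 1 powr a)"
        by simp
    qed simp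
    hence "prob {\<omega>\<in>space N. \<forall>i::nat. S (real i) \<omega> \<le> real k} = 0" by (simp add: measure_le_0_iff)
    hence "AE \<omega> in N. \<not> (\<forall>i::nat. S (real i) \<omega> \<le> real k)" using meas by (subst (asm) prob_Collect_eq_0) auto
    thus "AE \<omega> in N. \<exists>i::nat. S (real i) \<omega> > real k" by (simp add: not_le)
  qed
  moreover have "AE \<omega> in N. S 0 \<omega> = 0" "AE \<omega> in N. sample_path S \<omega> \<in> cadlag_space"
    using levy by (auto simp: levy_process_def)
  ultimately show ?thesis using L
  proof eventually_elim
    case (elim \<omega>)
    show ?case
    proof (rule inverse_pairI)
      fix s :: real assume s: "s \<ge> 0"
      have "(sample_path S \<omega> \<longlongrightarrow> sample_path S \<omega> s) (at_right s)" using elim s by (simp add: cadlag_space_def)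
      moreover have "\<forall>\<^sub>F y in at_right s. sample_path S \<omega> y = S y \<omega>"
        using s by (auto simp: eventually_at_filter sample_path_def)
      ultimately show "((\<lambda>s. S s \<omega>) \<longlongrightarrow> S s \<omega>) (at_right s)"
        using s by (auto simp: sample_path_def elim: Lim_transform_eventually)
    qed (use elim in auto)
  qed
qed

text \<open>Recovers S s as the supremum of the rational times q with L q \<le> s. Independence is
  assumed of the Brownian motion and L, so S has to be a measurable function of the path of
  L.\<close>

definition path_inverse :: "real \<Rightarrow> (real \<Rightarrow> real) \<Rightarrow> real" where
  "path_inverse s l = real_of_ereal (SUP q\<in>{q\<in>\<rat>. 0 \<le> q}. if l q \<le> s then ereal q else 0)"

lemma path_inverse_eq:
  assumes P: "inverse_pair S L" and s: "s \<ge> 0" and l: "\<And>t. t \<ge> 0 \<Longrightarrow> l t = L t"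
  shows "path_inverse s l = S s"
proof -
  have S0: "0 \<le> S s" using inverse_pairD(3)[OF P, of 0 s] inverse_pairD(1)[OF P] s by simp
  have "(SUP q\<in>{q\<in>\<rat>. 0 \<le> q}. if l q \<le> s then ereal q else 0) = ereal (S s)"
  proof (rule SUP_eqI)
    fix q :: real assume "q \<in> {q\<in>\<rat>. 0 \<le> q}"
    thus "(if l q \<le> s then ereal q else 0) \<le> ereal (S s)"
      using inverse_pairD(6)[OF P, of q s] s S0 l[of q] by auto
  next
    fix y assume y: "\<And>q. q \<in> {q\<in>\<rat>. 0 \<le> q} \<Longrightarrow> (if l q \<le> s then ereal q else 0) \<le> y"
    show "ereal (S s) \<le> y"
    proof (rule ccontr)
      assume "\<not> ereal (S s) \<le> y"
      hence lt: "y < ereal (S s)" by simp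
      have y0: "0 \<le> y" using y[of 0] by (cases "l 0 \<le> s") (auto simp: zero_ereal_def)
      then obtain r where r: "y = ereal r" using lt by (cases y) auto
      obtain q where q: "q \<in> \<rat>" "r < q" "q < S s" using Rats_dense_in_real[of r "S s"] lt r by auto
      have "0 \<le> q" using y0 q r by simp
      hence "l q \<le> s" using inverse_pairD(6)[OF P, of q s] s q l[of q] by simp
      thus False using y[of q] q \<open>0 \<le> q\<close> r by simp
    qed
  qed
  thus ?thesis by (simp add: path_inverse_def)
qed

lemma measurable_path_inverse[measurable]: "path_inverse s \<in> borel_measurable (Pi\<^sub>M {0..} (\<lambda>_. borel))"
proof -
  have "countable {q\<in>\<rat>. 0 \<le> (q::real)}" by (rule countable_subset[OF _ countable_rat]) auto
  hence "(\<lambda>l. SUP q\<in>{q\<in>\<rat>. 0 \<le> q}. if l q \<le> s then ereal q else 0) \<in> borel_measurable (Pi\<^sub>M {0..} (\<lambda>_. borel))"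
  proof (rule borel_measurable_SUP)
    fix q :: real assume "q \<in> {q\<in>\<rat>. 0 \<le> q}"
    hence [measurable]: "(\<lambda>l. l q) \<in> borel_measurable (Pi\<^sub>M {0..} (\<lambda>_. borel))" by (intro measurable_component_singleton) auto
    show "(\<lambda>l. if l q \<le> s then ereal q else 0) \<in> borel_measurable (Pi\<^sub>M {0..} (\<lambda>_. borel))" by measurable
  qed
  thus ?thesis unfolding path_inverse_def by measurable
qed

section \<open>Block laws\<close>

lemma distr_PiM_map:
  assumes D: "prob_space D" and f[measurable]: "f \<in> measurable D T"
  shows "distr (Pi\<^sub>M UNIV (\<lambda>_. D)) (Pi\<^sub>M UNIV (\<lambda>_. T)) (\<lambda>w i. f (w i)) = Pi\<^sub>M (UNIV::nat set) (\<lambda>_. distr D T f)"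
proof -
  have fm: "(\<lambda>x. f (x (0::nat))) \<in> measurable (Pi\<^sub>M {..<1} (\<lambda>_. D)) T" by measurable
  have r: "(\<lambda>j\<in>{..<1::nat}. w (i * 1 + j)) 0 = w i" for i and w :: "nat \<Rightarrow> 'a" by simp
  have r0: "(\<lambda>j\<in>{..<1::nat}. w j) 0 = w 0" for w :: "nat \<Rightarrow> 'a" by simp
  have "distr (Pi\<^sub>M (UNIV::nat set) (\<lambda>_. D)) T (\<lambda>w. f (w 0)) = distr (distr (Pi\<^sub>M (UNIV::nat set) (\<lambda>_. D)) D (\<lambda>w. w 0)) T f"
    by (subst distr_distr) (auto simp: comp_def)
  also have "\<dots> = distr D T f" using distr_PiM_component[of "UNIV::nat set" "\<lambda>_. D" 0] D by simp
  finally show ?thesis using distr_PiM_blocks[OF D fm] unfolding r r0 by simp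
qed

text \<open>The one-dimensional Skorokhod representation is invoked once for each of the two
  increment laws. Infinite products of the two resulting spaces carry independent copies of the
  couplings, which converge in every coordinate.\<close>

lemma skorokhod_pair:
  fixes \<nu>1 \<nu>2 :: "nat \<Rightarrow> real measure"
  assumes r1: "\<And>n. real_distribution (\<nu>1 n)" "real_distribution \<mu>1" "weak_conv_m \<nu>1 \<mu>1"
    and r2: "\<And>n. real_distribution (\<nu>2 n)" "real_distribution \<mu>2" "weak_conv_m \<nu>2 \<mu>2"
  shows "\<exists>(\<Omega> :: ((nat \<Rightarrow> real) \<times> (nat \<Rightarrow> real)) measure) U U'. prob_space \<Omega> \<and>
    (\<forall>n. U n \<in> measurable \<Omega> knot_algebra) \<and> U' \<in> measurable \<Omega> knot_algebra \<and>
    (\<forall>n. distr \<Omega> knot_algebra (U n) = Pi\<^sub>M UNIV (\<lambda>_. \<nu>1 n) \<Otimes>\<^sub>M Pi\<^sub>M UNIV (\<lambda>_. \<nu>2 n)) \<and>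
    distr \<Omega> knot_algebra U' = Pi\<^sub>M UNIV (\<lambda>_. \<mu>1) \<Otimes>\<^sub>M Pi\<^sub>M UNIV (\<lambda>_. \<mu>2) \<and>
    (\<forall>\<omega>\<in>space \<Omega>. \<forall>i. (\<lambda>n. fst (U n \<omega>) i) \<longlonglongrightarrow> fst (U' \<omega>) i \<and> (\<lambda>n. snd (U n \<omega>) i) \<longlonglongrightarrow> snd (U' \<omega>) i)"
proof -
  obtain \<Omega>1 :: "real measure" and Y1 Z1 where 1: "prob_space \<Omega>1" "\<And>n. Y1 n \<in> borel_measurable \<Omega>1"
    "\<And>n. distr \<Omega>1 borel (Y1 n) = \<nu>1 n" "Z1 \<in> measurable \<Omega>1 lborel" "distr \<Omega>1 borel Z1 = \<mu>1"
    "\<And>x. x \<in> space \<Omega>1 \<Longrightarrow> (\<lambda>n. Y1 n x) \<longlonglongrightarrow> Z1 x"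
    using Skorohod[OF r1] by blast
  obtain \<Omega>2 :: "real measure" and Y2 Z2 where 2: "prob_space \<Omega>2" "\<And>n. Y2 n \<in> borel_measurable \<Omega>2"
    "\<And>n. distr \<Omega>2 borel (Y2 n) = \<nu>2 n" "Z2 \<in> measurable \<Omega>2 lborel" "distr \<Omega>2 borel Z2 = \<mu>2"
    "\<And>x. x \<in> space \<Omega>2 \<Longrightarrow> (\<lambda>n. Y2 n x) \<longlonglongrightarrow> Z2 x"
    using Skorohod[OF r2] by blast
  have [measurable]: "Z1 \<in> borel_measurable \<Omega>1" "Z2 \<in> borel_measurable \<Omega>2" using 1(4) 2(4) by auto
  note [measurable] = 1(2) 2(2)
  define P1 where "P1 = Pi\<^sub>M (UNIV::nat set) (\<lambda>_. \<Omega>1)"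
  define P2 where "P2 = Pi\<^sub>M (UNIV::nat set) (\<lambda>_. \<Omega>2)"
  interpret P1: prob_space P1 unfolding P1_def by (intro prob_space_PiM 1)
  interpret P2: prob_space P2 unfolding P2_def by (intro prob_space_PiM 2)
  interpret P: pair_prob_space P1 P2 ..
  have mp: "(\<lambda>w i. f (w i)) \<in> measurable P1 real_sequences" if "f \<in> borel_measurable \<Omega>1" for f :: "real \<Rightarrow> real"
    unfolding P1_def using that by (intro measurable_PiM_single') auto
  have mp2: "(\<lambda>w i. f (w i)) \<in> measurable P2 real_sequences" if "f \<in> borel_measurable \<Omega>2" for f :: "real \<Rightarrow> real"
    unfolding P2_def using that by (intro measurable_PiM_single') auto
  define T where "T f g = (\<lambda>(w, y). (\<lambda>i::nat. f (w i) :: real, \<lambda>i::nat. g (y i) :: real))" for f g :: "real \<Rightarrow> real"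
  have Tm: "T f g \<in> measurable (P1 \<Otimes>\<^sub>M P2) knot_algebra" if "f \<in> borel_measurable \<Omega>1" "g \<in> borel_measurable \<Omega>2" for f g
    unfolding T_def split_beta'
    by (intro measurable_Pair measurable_compose[OF measurable_fst mp[OF that(1)]] measurable_compose[OF measurable_snd mp2[OF that(2)]])
  have Td: "distr (P1 \<Otimes>\<^sub>M P2) knot_algebra (T f g) = Pi\<^sub>M UNIV (\<lambda>_. distr \<Omega>1 borel f) \<Otimes>\<^sub>M Pi\<^sub>M UNIV (\<lambda>_. distr \<Omega>2 borel g)"
    if "f \<in> borel_measurable \<Omega>1" "g \<in> borel_measurable \<Omega>2" for f g
  proof -
    interpret D2: prob_space "distr P2 real_sequences (\<lambda>w i. g (w i))"
      by (rule P2.prob_space_distr) (rule mp2[OF that(2)])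
    have "distr P1 real_sequences (\<lambda>w i. f (w i)) \<Otimes>\<^sub>M distr P2 real_sequences (\<lambda>w i. g (w i))
      = distr (P1 \<Otimes>\<^sub>M P2) knot_algebra (T f g)"
      unfolding T_def by (rule pair_measure_distr[OF mp[OF that(1)] mp2[OF that(2)]]) unfold_locales
    thus ?thesis using distr_PiM_map[OF 1(1) that(1)] distr_PiM_map[OF 2(1) that(2)] by (simp add: P1_def P2_def)
  qed
  show ?thesis
  proof (intro exI[of _ "P1 \<Otimes>\<^sub>M P2"] exI[of _ "\<lambda>n. T (Y1 n) (Y2 n)"] exI[of _ "T Z1 Z2"] conjI allI ballI)
    show "prob_space (P1 \<Otimes>\<^sub>M P2)" by unfold_locales
    fix \<omega> i assume "\<omega> \<in> space (P1 \<Otimes>\<^sub>M P2)"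
    hence "fst \<omega> i \<in> space \<Omega>1" "snd \<omega> i \<in> space \<Omega>2"
      by (auto simp: space_pair_measure P1_def P2_def space_PiM)
    thus "(\<lambda>n. fst (T (Y1 n) (Y2 n) \<omega>) i) \<longlonglongrightarrow> fst (T Z1 Z2 \<omega>) i"
      "(\<lambda>n. snd (T (Y1 n) (Y2 n) \<omega>) i) \<longlonglongrightarrow> snd (T Z1 Z2 \<omega>) i"
      using 1(6) 2(6) by (auto simp: T_def split_beta')
  qed (use Tm Td 1 2 in auto)
qed

text \<open>A common interface for the stable subordinator, with \<kappa> = \<alpha> + \<beta>, and
  for the identity, with \<kappa> = 1: i.i.d. increments along a grid and Laplace exponent
  z^\<kappa>.\<close>

locale time_changed_limit = prob_space N for N :: "'b measure" +
  fixes W S L :: "real \<Rightarrow> 'b \<Rightarrow> real" and \<kappa> :: real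
  assumes W: "standard_brownian_motion N W"
    and S_meas: "\<And>t. t \<ge> 0 \<Longrightarrow> S t \<in> borel_measurable N"
    and inverse: "AE \<omega> in N. inverse_pair (\<lambda>s. S s \<omega>) (\<lambda>t. L t \<omega>)"
    and S_increments: "\<And>h. h \<ge> 0 \<Longrightarrow> distr N real_sequences (\<lambda>\<omega> i. S (real (Suc i) * h) \<omega> - S (real i * h) \<omega>)
      = Pi\<^sub>M (UNIV::nat set) (\<lambda>_. distr N borel (S h))"
    and S_laplace: "\<And>h z. h \<ge> 0 \<Longrightarrow> z \<ge> 0 \<Longrightarrow> expectation (\<lambda>\<omega>. exp (- z * S h \<omega>)) = exp (- h * z powr \<kappa>)"
    and W_L_indep: "independent_processes N W L"
begin

lemma W_meas: "t \<ge> 0 \<Longrightarrow> W t \<in> borel_measurable N"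
  using W by (simp add: standard_brownian_motion_def)

lemma S_nonneg: "h \<ge> 0 \<Longrightarrow> AE \<omega> in N. 0 \<le> S h \<omega>"
  using inverse
proof eventually_elim
  case (elim \<omega>)
  thus ?case using inverse_pairD(1)[OF elim(2)] inverse_pairD(3)[OF elim(2), of 0 h] by simp
qed

lemma W_increments_distr:
  assumes h: "h > 0"
  shows "distr N real_sequences (\<lambda>\<omega> i. (W (real (Suc i) * h) \<omega> - W (real i * h) \<omega>) / sqrt h)
    = Pi\<^sub>M (UNIV::nat set) (\<lambda>_. std_normal_distribution)"
proof -
  define \<nu> where "\<nu> = density lborel (\<lambda>x. ennreal (normal_density 0 (sqrt h) x))"
  have dist: "distributed N lborel (\<lambda>\<omega>. W (real (Suc i) * h) \<omega> - W (real i * h) \<omega>) (normal_density 0 (sqrt h))" for i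
  proof -
    have "0 \<le> real i * h" "real i * h < real (Suc i) * h" "real (Suc i) * h - real i * h = h"
      using h by (auto simp: algebra_simps)
    thus ?thesis using W unfolding standard_brownian_motion_def by metis
  qed
  have stat: "distr N borel (\<lambda>\<omega>. W (real (Suc i) * h) \<omega> - W (real i * h) \<omega>) = \<nu>" for i
  proof -
    have "distr N borel (\<lambda>\<omega>. W (real (Suc i) * h) \<omega> - W (real i * h) \<omega>) = distr N lborel (\<lambda>\<omega>. W (real (Suc i) * h) \<omega> - W (real i * h) \<omega>)"
      by (rule distr_cong) auto
    thus ?thesis using dist[of i] by (simp add: distributed_def \<nu>_def)
  qed
  have inc: "independent_increments N W" using W by (simp add: standard_brownian_motion_def)
  note L1 = grid_increments_distr[OF inc W_meas stat less_imp_le[OF h]]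
  have m1: "(\<lambda>\<omega>. W (real (Suc i) * h) \<omega> - W (real i * h) \<omega>) \<in> borel_measurable N" for i
    using h by (intro borel_measurable_diff W_meas) auto
  have ps: "prob_space \<nu>" unfolding stat[of 0, symmetric] by (rule prob_space_distr[OF m1])
  have sets\<nu>: "sets \<nu> = sets borel" by (simp add: \<nu>_def)
  have one: "distr \<nu> borel (\<lambda>x. x / sqrt h) = std_normal_distribution"
  proof -
    have "distributed N lborel (\<lambda>x. (W (real (Suc 0) * h) x - W (real 0 * h) x - 0) / sqrt h) std_normal_density"
      using dist[of 0] normal_standard_normal_convert[of "sqrt h" "\<lambda>\<omega>. W (real (Suc 0) * h) \<omega> - W (real 0 * h) \<omega>" 0] h by simp
    hence "distr N lborel (\<lambda>x. (W (real (Suc 0) * h) x - W (real 0 * h) x) / sqrt h) = std_normal_distribution"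
      by (simp add: distributed_def)
    moreover have "distr N lborel (\<lambda>x. (W (real (Suc 0) * h) x - W (real 0 * h) x) / sqrt h) = distr N borel (\<lambda>x. (W (real (Suc 0) * h) x - W (real 0 * h) x) / sqrt h)"
      by (rule distr_cong) auto
    ultimately show ?thesis unfolding stat[of 0, symmetric]
      by (subst distr_distr[OF _ m1]) (auto simp: comp_def)
  qed
  have "distr N real_sequences (\<lambda>\<omega> i. (W (real (Suc i) * h) \<omega> - W (real i * h) \<omega>) / sqrt h)
    = distr (distr N real_sequences (\<lambda>\<omega> i. W (real (Suc i) * h) \<omega> - W (real i * h) \<omega>)) real_sequences (\<lambda>w i. w i / sqrt h)"
    by (subst distr_distr) (auto simp: comp_def simp del: of_nat_Suc intro!: measurable_PiM_single' m1)
  also have "\<dots> = distr (Pi\<^sub>M UNIV (\<lambda>_. \<nu>)) real_sequences (\<lambda>w i. w i / sqrt h)"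
    by (simp only: L1)
  also have "\<dots> = Pi\<^sub>M UNIV (\<lambda>_. distr \<nu> borel (\<lambda>x. x / sqrt h))"
    by (rule distr_PiM_map[OF ps]) (simp add: measurable_cong_sets[OF sets\<nu> refl])
  finally show ?thesis unfolding one .
qed

text \<open>Independence of W and L passes to the increments of W and S, since almost surely S is
  \<open>path_inverse\<close> applied to the path of L. Increments of W are standardised so that
  their law does not depend on the mesh.\<close>

lemma grid_law:
  assumes h: "h > 0" and K: "K > 0"
  shows "distr N knot_algebra (\<lambda>\<omega>. (\<lambda>i. (W (real (Suc i) * h) \<omega> - W (real i * h) \<omega>) / sqrt h, \<lambda>i. (S (real (Suc i) * h) \<omega> - S (real i * h) \<omega>) / K))
    = Pi\<^sub>M UNIV (\<lambda>_. std_normal_distribution) \<Otimes>\<^sub>M Pi\<^sub>M UNIV (\<lambda>_. distr N borel (\<lambda>\<omega>. S h \<omega> / K))"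
proof -
  define Wi where "Wi \<omega> = (\<lambda>i::nat. (W (real (Suc i) * h) \<omega> - W (real i * h) \<omega>) / sqrt h)" for \<omega>
  define Si where "Si \<omega> = (\<lambda>i::nat. (S (real (Suc i) * h) \<omega> - S (real i * h) \<omega>) / K)" for \<omega>
  define H1 where "H1 x = (\<lambda>i::nat. (x (real (Suc i) * h) - x (real i * h)) / sqrt h)" for x :: "real \<Rightarrow> real"
  define H2 where "H2 l = (\<lambda>i::nat. (path_inverse (real (Suc i) * h) l - path_inverse (real i * h) l) / K)" for l :: "real \<Rightarrow> real"
  have H1m: "H1 \<in> measurable (Pi\<^sub>M {0..} (\<lambda>_. borel)) real_sequences"
  proof (unfold H1_def[abs_def], rule measurable_PiM_single')
    fix i :: nat
    have comp: "(\<lambda>x. x (real i * h)) \<in> borel_measurable (Pi\<^sub>M {0..} (\<lambda>_. borel))" for i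
      using h by (intro measurable_component_singleton) auto
    show "(\<lambda>x. (x (real (Suc i) * h) - x (real i * h)) / sqrt h) \<in> borel_measurable (Pi\<^sub>M {0..} (\<lambda>_. borel))"
      by (intro borel_measurable_divide borel_measurable_diff comp borel_measurable_const)
  qed auto
  have H2m: "H2 \<in> measurable (Pi\<^sub>M {0..} (\<lambda>_. borel)) real_sequences"
    unfolding H2_def[abs_def] by (rule measurable_PiM_single') auto
  have ind: "indep_var real_sequences (H1 \<circ> sample_path W) real_sequences (H2 \<circ> sample_path L)"
    using W_L_indep unfolding independent_processes_def by (rule indep_var_compose[OF _ H1m H2m])
  have WH: "H1 \<circ> sample_path W = Wi"
    using h by (auto simp: fun_eq_iff H1_def Wi_def sample_path_def)
  have SH: "AE \<omega> in N. (H2 \<circ> sample_path L) \<omega> = Si \<omega>"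
    using inverse
  proof eventually_elim
    case (elim \<omega>)
    have "path_inverse (real i * h) (sample_path L \<omega>) = S (real i * h) \<omega>" for i
      by (rule path_inverse_eq[OF elim]) (use h in \<open>auto simp: sample_path_def\<close>)
    thus ?case by (simp add: H2_def Si_def del: of_nat_Suc)
  qed
  have Sm0: "(\<lambda>\<omega>. S (real (Suc i) * h) \<omega> - S (real i * h) \<omega>) \<in> borel_measurable N" for i
    using h by (intro borel_measurable_diff S_meas) auto
  have Sm: "Si \<in> measurable N real_sequences"
    unfolding Si_def by (intro measurable_PiM_single' borel_measurable_divide Sm0) auto
  have rvs: "random_variable real_sequences Wi" "random_variable real_sequences (H2 \<circ> sample_path L)"
    using ind unfolding WH by (auto dest: indep_var_rv1 indep_var_rv2)
  have "distr N knot_algebra (\<lambda>\<omega>. (Wi \<omega>, Si \<omega>)) = distr N knot_algebra (\<lambda>\<omega>. (Wi \<omega>, (H2 \<circ> sample_path L) \<omega>))"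
  proof (rule distr_cong_AE)
    show "AE \<omega> in N. (Wi \<omega>, Si \<omega>) = (Wi \<omega>, (H2 \<circ> sample_path L) \<omega>)" using SH by eventually_elim simp
    show "(\<lambda>\<omega>. (Wi \<omega>, Si \<omega>)) \<in> measurable N knot_algebra" by (intro measurable_Pair rvs Sm)
    show "(\<lambda>\<omega>. (Wi \<omega>, (H2 \<circ> sample_path L) \<omega>)) \<in> measurable N knot_algebra" by (intro measurable_Pair rvs)
  qed auto
  also have "\<dots> = distr N real_sequences Wi \<Otimes>\<^sub>M distr N real_sequences (H2 \<circ> sample_path L)"
    using ind unfolding WH indep_var_distribution_eq by simp
  also have "distr N real_sequences (H2 \<circ> sample_path L) = distr N real_sequences Si"
    by (rule distr_cong_AE[OF refl refl SH rvs(2) Sm])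
  also have "distr N real_sequences Wi = Pi\<^sub>M UNIV (\<lambda>_. std_normal_distribution)"
    unfolding Wi_def by (rule W_increments_distr[OF h])
  also have "distr N real_sequences Si = Pi\<^sub>M UNIV (\<lambda>_. distr N borel (\<lambda>\<omega>. S h \<omega> / K))"
  proof -
    have Shm: "S h \<in> borel_measurable N" using S_meas h by simp
    interpret Sh: prob_space "distr N borel (S h)" by (rule prob_space_distr[OF Shm])
    have "distr N real_sequences Si
      = distr (distr N real_sequences (\<lambda>\<omega> i. S (real (Suc i) * h) \<omega> - S (real i * h) \<omega>)) real_sequences (\<lambda>w i. w i / K)"
      unfolding Si_def by (subst distr_distr) (auto simp: comp_def simp del: of_nat_Suc intro!: measurable_PiM_single' Sm0)
    also have "\<dots> = distr (Pi\<^sub>M UNIV (\<lambda>_. distr N borel (S h))) real_sequences (\<lambda>w i. w i / K)"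
      using S_increments[of h] h by (simp del: of_nat_Suc)
    also have "\<dots> = Pi\<^sub>M UNIV (\<lambda>_. distr (distr N borel (S h)) borel (\<lambda>x. x / K))"
      by (rule distr_PiM_map) (unfold_locales, simp)
    also have "distr (distr N borel (S h)) borel (\<lambda>x. x / K) = distr N borel (\<lambda>\<omega>. S h \<omega> / K)"
      using Shm by (subst distr_distr) (auto simp: comp_def)
    finally show ?thesis .
  qed
  finally show ?thesis unfolding Wi_def Si_def .
qed

end

text \<open>b_n ln (1 - s_n) is squeezed between - b_n s_n - 2 b_n s_n^2 and - b_n s_n, where s_n
  tends to 0 and b_n s_n = (b_n / n) (n s_n) tends to h \<theta>.\<close>

lemma power_tendsto_exp:
  fixes s :: "nat \<Rightarrow> real" and b :: "nat \<Rightarrow> nat"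
  assumes s: "\<And>n. 0 \<le> s n" and lim: "(\<lambda>n. real n * s n) \<longlonglongrightarrow> \<theta>" and b: "(\<lambda>n. real (b n) / real n) \<longlonglongrightarrow> h"
  shows "(\<lambda>n. (1 - s n) ^ b n) \<longlonglongrightarrow> exp (- h * \<theta>)"
proof -
  have s0: "s \<longlonglongrightarrow> 0"
  proof (rule Lim_transform_eventually)
    show "(\<lambda>n. (real n * s n) * (1 / real n)) \<longlonglongrightarrow> 0"
      using tendsto_mult[OF lim lim_1_over_n] by simp
    show "\<forall>\<^sub>F n in sequentially. (real n * s n) * (1 / real n) = s n"
      using eventually_gt_at_top[of 0] by eventually_elim simp
  qed
  have bs: "(\<lambda>n. real (b n) * s n) \<longlonglongrightarrow> h * \<theta>"
  proof (rule Lim_transform_eventually[OF tendsto_mult[OF b lim]])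
    show "\<forall>\<^sub>F n in sequentially. real (b n) / real n * (real n * s n) = real (b n) * s n"
      using eventually_gt_at_top[of 0] by eventually_elim simp
  qed
  have "(\<lambda>n. real (b n) * ln (1 - s n)) \<longlonglongrightarrow> - (h * \<theta>)"
  proof (rule tendsto_sandwich)
    have small: "\<forall>\<^sub>F n in sequentially. s n < 1/2" using s0 by (intro order_tendstoD) auto
    show "\<forall>\<^sub>F n in sequentially. real (b n) * ln (1 - s n) \<le> - (real (b n) * s n)"
      using small
    proof eventually_elim
      case (elim n)
      have "ln (1 - s n) \<le> - s n" using ln_le_minus_one[of "1 - s n"] elim by simp
      from mult_left_mono[OF this, of "real (b n)"] show ?case by simp
    qed
    show "\<forall>\<^sub>F n in sequentially. - (real (b n) * s n) - 2 * (real (b n) * s n) * s n \<le> real (b n) * ln (1 - s n)"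
      using small
    proof eventually_elim
      case (elim n)
      have "- s n - 2 * (s n)\<^sup>2 \<le> ln (1 - s n)" using ln_one_minus_pos_lower_bound[of "s n"] elim s by simp
      from mult_left_mono[OF this, of "real (b n)"] show ?case by (simp add: algebra_simps power2_eq_square)
    qed
    have "(\<lambda>n. - (real (b n) * s n) - 2 * (real (b n) * s n) * s n) \<longlonglongrightarrow> - (h * \<theta>) - 2 * (h * \<theta>) * 0"
      by (intro tendsto_intros bs s0)
    thus "(\<lambda>n. - (real (b n) * s n) - 2 * (real (b n) * s n) * s n) \<longlonglongrightarrow> - (h * \<theta>)" by simp
    show "(\<lambda>n. - (real (b n) * s n)) \<longlonglongrightarrow> - (h * \<theta>)" by (intro tendsto_intros bs)
  qed
  hence "(\<lambda>n. exp (real (b n) * ln (1 - s n))) \<longlonglongrightarrow> exp (- (h * \<theta>))" by (intro tendsto_intros)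
  moreover have "\<forall>\<^sub>F n in sequentially. exp (real (b n) * ln (1 - s n)) = (1 - s n) ^ b n"
  proof -
    have "\<forall>\<^sub>F n in sequentially. s n < 1" using s0 by (intro order_tendstoD) auto
    thus ?thesis by eventually_elim (simp add: exp_of_nat_mult)
  qed
  ultimately have "(\<lambda>n. (1 - s n) ^ b n) \<longlonglongrightarrow> exp (- (h * \<theta>))" by (rule Lim_transform_eventually)
  thus ?thesis by simp
qed

text \<open>The additional 1 keeps blocks nonempty and guarantees that m R blocks contain at least R
  n steps.\<close>

definition block_size :: "nat \<Rightarrow> nat \<Rightarrow> nat" where "block_size m n = n div m + 1"

lemma block_size_bounds:
  assumes "m > 0" shows "real n / real m \<le> real (block_size m n)" "real (block_size m n) \<le> real n / real m + 1"
proof -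
  have "real (n div m) = real_of_int \<lfloor>real n / real m\<rfloor>" by (simp add: floor_divide_of_nat_eq)
  moreover have "real_of_int \<lfloor>real n / real m\<rfloor> \<le> real n / real m" "real n / real m < real_of_int \<lfloor>real n / real m\<rfloor> + 1"
    by linarith+
  ultimately show "real n / real m \<le> real (block_size m n)" "real (block_size m n) \<le> real n / real m + 1"
    unfolding block_size_def of_nat_add of_nat_1 by linarith+
qed

lemma block_size_limit:
  assumes "m > 0"
  shows "(\<lambda>n. real (block_size m n) / real n) \<longlonglongrightarrow> 1 / real m" "filterlim (block_size m) at_top sequentially"
proof -
  show "(\<lambda>n. real (block_size m n) / real n) \<longlonglongrightarrow> 1 / real m"
  proof (rule tendsto_sandwich)
    show "\<forall>\<^sub>F n in sequentially. 1 / real m \<le> real (block_size m n) / real n"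
      using eventually_gt_at_top[of 0]
      by eventually_elim (use block_size_bounds(1)[OF assms] assms in \<open>simp add: field_simps\<close>)
    show "\<forall>\<^sub>F n in sequentially. real (block_size m n) / real n \<le> 1 / real m + 1 / real n"
      using eventually_gt_at_top[of 0]
    proof eventually_elim
      case (elim n)
      have "real (block_size m n) / real n \<le> (real n / real m + 1) / real n"
        using block_size_bounds(2)[OF assms, of n] by (intro divide_right_mono) auto
      thus ?case using elim by (simp add: add_divide_distrib)
    qed
    have "(\<lambda>n. 1 / real m + 1 / real n) \<longlonglongrightarrow> 1 / real m + 0" by (intro tendsto_intros lim_1_over_n)
    thus "(\<lambda>n. 1 / real m + 1 / real n) \<longlonglongrightarrow> 1 / real m" by simp
  qed simp
  show "filterlim (block_size m) at_top sequentially"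
    unfolding filterlim_at_top
  proof
    fix Z :: nat
    have "Z \<le> block_size m n" if "Z * m \<le> n" for n
      using div_le_mono[OF that, of m] assms by (simp add: block_size_def)
    thus "\<forall>\<^sub>F n in sequentially. Z \<le> block_size m n" by (auto simp: eventually_sequentially)
  qed
qed

lemma (in pair_prob_space) measure_fst_pred:
  assumes "Measurable.pred M1 P" shows "\<P>(x in M1 \<Otimes>\<^sub>M M2. P (fst x)) = \<P>(x in M1. P x)"
proof -
  have "{x \<in> space M1. P x} \<in> sets M1" using assms by (simp add: pred_def)
  moreover have "{x \<in> space (M1 \<Otimes>\<^sub>M M2). P (fst x)} = {x \<in> space M1. P x} \<times> space M2"
    by (auto simp: space_pair_measure)
  ultimately show ?thesis by (simp add: measure_def M2.emeasure_pair_measure_Times M2.emeasure_space_1)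
qed

lemma (in pair_prob_space) measure_snd_pred:
  assumes "Measurable.pred M2 P" shows "\<P>(x in M1 \<Otimes>\<^sub>M M2. P (snd x)) = \<P>(x in M2. P x)"
proof -
  have "{x \<in> space M2. P x} \<in> sets M2" using assms by (simp add: pred_def)
  moreover have "{x \<in> space (M1 \<Otimes>\<^sub>M M2). P (snd x)} = space M1 \<times> {x \<in> space M2. P x}"
    by (auto simp: space_pair_measure)
  ultimately show ?thesis by (simp add: measure_def M2.emeasure_pair_measure_Times M1.emeasure_space_1)
qed

text \<open>Fair signs have mean 0 and variance 1; weak convergence of the full sequence passes to
  the block lengths because these tend to infinity.\<close>

lemma weak_conv_block_normal:
  assumes b: "filterlim b at_top sequentially"
  shows "weak_conv_m (\<lambda>n. distr (coin_space (1/2)) borel (\<lambda>w. walk w (b n) / sqrt (real (b n)))) std_normal_distribution"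
proof -
  interpret prob_space "coin_space (1/2)" by (rule prob_space_coin_space)
  define X where "X i w = (if w i then 1 else -1 :: real)" for i :: nat and w :: "nat \<Rightarrow> bool"
  have [measurable]: "X i \<in> borel_measurable (coin_space (1/2))" for i unfolding X_def by measurable
  have ind: "indep_vars (\<lambda>_. borel) X UNIV"
    using indep_vars_compose2[OF indep_vars_coin, of "\<lambda>_ b. if b then 1 else -1 :: real" "\<lambda>_. borel"]
    by (simp add: X_def[abs_def])
  have Xi: "X i = (\<lambda>w. 2 * indicator {w. w i} w - 1)" for i by (auto simp: X_def)
  have "{w. w i} \<in> sets (coin_space (1/2))" for i
    using measurable_sets[OF measurable_coin[of i "1/2"], of "{True}"] by (simp add: vimage_def)
  hence ii: "integrable (coin_space (1/2)) (indicator {w. w i} :: _ \<Rightarrow> real)" for i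
    by (intro integrable_real_indicator) (auto simp: emeasure_eq_measure)
  have EX: "expectation (X i) = 0" for i
    unfolding Xi using ii[of i] prob_coin(1)[of "1/2" i] prob_space by simp
  have X2: "(X i w)\<^sup>2 = 1" for i w by (simp add: X_def)
  have "distr (coin_space (1/2)) borel (X i) = distr (measure_pmf (bernoulli_pmf (1/2))) borel (\<lambda>b. if b then 1 else -1)" for i
    unfolding distr_coin[of "1/2" i, symmetric] by (subst distr_distr) (auto simp: comp_def X_def[abs_def])
  hence "weak_conv_m (\<lambda>n. distr (coin_space (1/2)) borel (\<lambda>x. (\<Sum>i<n. X i x) / sqrt (real n * 1\<^sup>2))) std_normal_distribution"
    using prob_space by (intro central_limit_theorem_zero_mean[OF ind EX]) (auto simp: X2 EX)
  hence "weak_conv_m (\<lambda>n. distr (coin_space (1/2)) borel (\<lambda>w. walk w n / sqrt (real n))) std_normal_distribution"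
    by (simp add: walk_def[abs_def] X_def)
  thus ?thesis unfolding weak_conv_m_def weak_conv_def
    by (auto intro: filterlim_compose[OF _ b])
qed

lemma max_deficit_scale: "0 \<le> d \<Longrightarrow> max_deficit (\<lambda>j. d * g j) k = d * max_deficit g k"
  by (induction k) (auto simp: max_mult_distrib_left)

lemma reflected_scale: "0 \<le> d \<Longrightarrow> reflected (\<lambda>j. d * g j) k = d * reflected g k"
  by (simp add: reflected_def max_deficit_scale algebra_simps)

lemma coin_chain_reflected: "\<bar>real (coin_chain w k) - reflected (walk w) k\<bar> \<le> 2"
  using coin_chain_reflection[where w=w and k=k] by (simp add: reflected_def)

text \<open>The discrete twin of \<open>skorokhod_reflection_grid\<close>, with block ends as grid
  points and the same constant 4.\<close>

lemma reflected_block: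
  fixes g :: "nat \<Rightarrow> real"
  assumes k: "i * b \<le> k" "k \<le> Suc i * b" and b: "b > 0"
    and osc: "\<And>j l. j \<le> i \<Longrightarrow> l \<le> b \<Longrightarrow> \<bar>g (j * b + l) - g (j * b)\<bar> \<le> e"
  shows "\<bar>reflected g k - reflected (\<lambda>j. g (j * b)) i\<bar> \<le> 4 * e"
    "\<bar>reflected g k - reflected (\<lambda>j. g (j * b)) (Suc i)\<bar> \<le> 4 * e"
proof -
  define h where "h j = g (j * b)" for j
  have e0: "0 \<le> e" using osc[of 0 0] by simp
  have near: "\<bar>g l - h (min i (l div b))\<bar> \<le> e" if "l \<le> k" for l
  proof (cases "l div b \<le> i")
    case True
    have "l = (l div b) * b + l mod b" by simp
    thus ?thesis using osc[OF True, of "l mod b"] b True by (simp add: h_def min_absorb2)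
  next
    case False
    hence "Suc i * b \<le> l div b * b" by (intro mult_le_mono1) simp
    also have "\<dots> \<le> l" by simp
    finally have "l = i * b + b" using that k by simp
    thus ?thesis using osc[of i b] False by (simp add: h_def min_def)
  qed
  have up: "max_deficit g k \<le> max_deficit h i + e"
  proof (rule max_deficit_least)
    show "0 \<le> max_deficit h i + e" using max_deficit_ge(2)[of h i] e0 by simp
    fix l assume "l \<le> k"
    from near[OF this] max_deficit_ge(1)[of "min i (l div b)" i h] show "- g l \<le> max_deficit h i + e" by simp
  qed
  have low: "max_deficit h i \<le> max_deficit g k"
  proof (rule max_deficit_least[OF max_deficit_ge(2)])
    fix j assume "j \<le> i"
    hence "j * b \<le> k" using k(1) mult_le_mono1[of j i b] by linarith
    thus "- h j \<le> max_deficit g k" unfolding h_def by (rule max_deficit_ge(1))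
  qed
  have ox: "\<bar>g k - h i\<bar> \<le> e" using osc[of i "k - i * b"] k by (simp add: h_def)
  have o2: "\<bar>h (Suc i) - h i\<bar> \<le> e" using osc[of i b] by (simp add: h_def add.commute)
  have gk: "- g k \<le> max_deficit g k" by (rule max_deficit_ge(1)) simp
  show "\<bar>reflected g k - reflected (\<lambda>j. g (j * b)) i\<bar> \<le> 4 * e"
    using up low ox e0 unfolding reflected_def h_def[symmetric] by linarith
  show "\<bar>reflected g k - reflected (\<lambda>j. g (j * b)) (Suc i)\<bar> \<le> 4 * e"
    using up low ox o2 gk e0 unfolding reflected_def h_def[symmetric] by simp
qed

text \<open>The queue on a concrete product space: coins drive the chain, \<mu> is the common law of
  the interarrival times, c n stands for n m_n. Positivity of \<mu> makes the epochs increase; their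
  scaling limit comes from \<open>exponent\<close>.\<close>

locale canonical_queue =
  fixes p :: real and \<mu> :: "real measure" and c :: "nat \<Rightarrow> real" and K \<kappa> :: real
  assumes p: "0 \<le> p" "p \<le> 1" and \<mu>: "real_distribution \<mu>" and pos: "AE x in \<mu>. x > 0"
    and c: "\<And>n. c n > 0" and K: "K > 0" and \<kappa>: "\<kappa> > 0"
    and exponent: "\<And>z. z > 0 \<Longrightarrow> (\<lambda>n. real n * (1 - (\<integral>x. exp (- (z / c n) * x) \<partial>\<mu>))) \<longlonglongrightarrow> (z / K) powr \<kappa>"
begin

abbreviation "coins \<equiv> coin_space p"
abbreviation "jumps \<equiv> Pi\<^sub>M (UNIV::nat set) (\<lambda>_. \<mu>)"
abbreviation "canonical \<equiv> coins \<Otimes>\<^sub>M jumps"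

sublocale mu: real_distribution \<mu> by (rule \<mu>)
sublocale C: prob_space coins by (rule prob_space_coin_space)
sublocale J: prob_space jumps by (intro prob_space_PiM) unfold_locales
sublocale P: pair_prob_space coins jumps ..

lemma mu_UNIV[simp]: "measure \<mu> UNIV = 1" using mu.prob_space by simp

lemma space_jumps[simp]: "space jumps = UNIV" by (simp add: space_PiM)

lemma measurable_jump[measurable]: "(\<lambda>y. y i) \<in> borel_measurable jumps"
  using measurable_component_singleton[of i UNIV "\<lambda>_. \<mu>"] by simp

lemma measurable_partial_sums[measurable]: "(\<lambda>y. partial_sums y k) \<in> borel_measurable jumps"
  unfolding partial_sums_def by measurable

lemma nonneg: "AE x in \<mu>. x \<ge> 0" using pos by eventually_elim simp

lemma laplace_partial_sums:
  assumes "z \<ge> 0"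
  shows "J.expectation (\<lambda>y. exp (- z * partial_sums y k)) = (\<integral>x. exp (- z * x) \<partial>\<mu>) ^ k"
    "integrable jumps (\<lambda>y. exp (- z * partial_sums y k))"
  using laplace_iid_sum[OF \<mu> nonneg assms, of k] by (simp_all add: partial_sums_def)

lemma laplace_bounds:
  assumes "z \<ge> 0" shows "0 \<le> (\<integral>x. exp (- z * x) \<partial>\<mu>)" "(\<integral>x. exp (- z * x) \<partial>\<mu>) \<le> 1" "integrable \<mu> (\<lambda>x. exp (- z * x))"
proof -
  show i: "integrable \<mu> (\<lambda>x. exp (- z * x))"
    by (rule mu.integrable_const_bound[where B=1]) (use nonneg assms in \<open>auto elim!: eventually_mono\<close>)
  show "0 \<le> (\<integral>x. exp (- z * x) \<partial>\<mu>)" by (intro integral_nonneg_AE) auto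
  have "(\<integral>x. exp (- z * x) \<partial>\<mu>) \<le> (\<integral>x. 1 \<partial>\<mu>)"
    by (rule integral_mono_AE[OF i]) (use nonneg assms in \<open>auto elim!: eventually_mono\<close>)
  thus "(\<integral>x. exp (- z * x) \<partial>\<mu>) \<le> 1" by (simp add: mu.prob_space)
qed

text \<open>A Chernoff bound: Markov's inequality for the exponential of the negative sum, whose
  mean is a power. A small sum is the event that many arrivals occur early.\<close>

lemma partial_sums_lower_tail:
  "J.prob {y. partial_sums y k \<le> x} \<le> exp (z * x) * (\<integral>t. exp (- z * t) \<partial>\<mu>) ^ k" if z: "z \<ge> 0"
proof -
  have "J.prob {y\<in>space jumps. partial_sums y k \<le> x} \<le> J.prob {y\<in>space jumps. exp (- z * partial_sums y k) \<ge> exp (- z * x)}"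
  proof (rule J.finite_measure_mono)
    show "{y\<in>space jumps. partial_sums y k \<le> x} \<subseteq> {y\<in>space jumps. exp (- z * partial_sums y k) \<ge> exp (- z * x)}"
      using z by (auto intro: mult_left_mono)
  qed measurable
  also have "\<dots> \<le> J.expectation (\<lambda>y. exp (- z * partial_sums y k)) / exp (- z * x)"
    by (rule integral_Markov_inequality_measure[where A="{}"]) (use laplace_partial_sums[OF z] in auto)
  finally show ?thesis using laplace_partial_sums[OF z] by (simp add: exp_minus divide_inverse mult.commute)
qed

lemma laplace_less_1: "(\<integral>x. exp (- 1 * x) \<partial>\<mu>) < 1"
proof (rule ccontr)
  note b = laplace_bounds[of 1]
  assume "\<not> ?thesis"
  hence "(\<integral>x. exp (- 1 * x) \<partial>\<mu>) = 1" using b by simp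
  hence "(\<integral>x. 1 - exp (- 1 * x) \<partial>\<mu>) = 0" using b by (simp add: mu.prob_space)
  moreover have "AE x in \<mu>. 0 \<le> 1 - exp (- 1 * x)" using nonneg by eventually_elim simp
  ultimately have "AE x in \<mu>. 1 - exp (- 1 * x) = 0"
    using b by (subst (asm) integral_nonneg_eq_0_iff_AE) auto
  hence "AE x in \<mu>. False" using pos by eventually_elim simp
  thus False by simp
qed

text \<open>Unboundedness follows from the Chernoff bound at z = 1, since the Laplace transform of
  \<mu> at 1 is below 1 and its powers tend to 0.\<close>

lemma AE_good_partial_sums: "AE y in jumps. good_knots (partial_sums y)"
proof -
  have "AE y in jumps. \<forall>i. y i > 0"
  proof (subst AE_all_countable, rule allI)
    fix i show "AE y in jumps. y i > 0"
      by (rule AE_PiM_component[of UNIV "\<lambda>_. \<mu>" i "\<lambda>x. x > 0"]) (use pos mu.prob_space_axioms in auto)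
  qed
  moreover have "AE y in jumps. \<forall>k::nat. \<exists>i. partial_sums y i > real k"
  proof (subst AE_all_countable, rule allI)
    fix k :: nat
    have "J.prob {y\<in>space jumps. \<forall>i. partial_sums y i \<le> real k} \<le> 0"
    proof (rule tendsto_lowerbound)
      have "(\<lambda>n. exp (1 * real k) * (\<integral>t. exp (- 1 * t) \<partial>\<mu>) ^ n) \<longlonglongrightarrow> exp (1 * real k) * 0"
        by (intro tendsto_intros LIMSEQ_power_zero) (use laplace_less_1 laplace_bounds(1)[of 1] in auto)
      thus "(\<lambda>n. exp (1 * real k) * (\<integral>t. exp (- 1 * t) \<partial>\<mu>) ^ n) \<longlonglongrightarrow> 0" by simp
      have "J.prob {y\<in>space jumps. \<forall>i. partial_sums y i \<le> real k} \<le> exp (1 * real k) * (\<integral>t. exp (- 1 * t) \<partial>\<mu>) ^ n" for n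
      proof -
        have "{y\<in>space jumps. partial_sums y n \<le> real k} \<in> sets jumps" by measurable
        hence "J.prob {y\<in>space jumps. \<forall>i. partial_sums y i \<le> real k} \<le> J.prob {y. partial_sums y n \<le> real k}"
          by (intro J.finite_measure_mono) auto
        also have "\<dots> \<le> exp (1 * real k) * (\<integral>t. exp (- 1 * t) \<partial>\<mu>) ^ n" by (rule partial_sums_lower_tail) simp
        finally show ?thesis .
      qed
      thus "\<forall>\<^sub>F n in sequentially. J.prob {y\<in>space jumps. \<forall>i. partial_sums y i \<le> real k} \<le> exp (1 * real k) * (\<integral>t. exp (- 1 * t) \<partial>\<mu>) ^ n"
        by (intro always_eventually allI)
    qed simp
    hence "J.prob {y\<in>space jumps. \<forall>i. partial_sums y i \<le> real k} = 0" by (simp add: measure_le_0_iff)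
    moreover have "{y\<in>space jumps. \<forall>i. partial_sums y i \<le> real k} \<in> J.events" by measurable
    ultimately have "AE y in jumps. \<not> (\<forall>i. partial_sums y i \<le> real k)"
      by (simp only: J.prob_Collect_eq_0)
    thus "AE y in jumps. \<exists>i. partial_sums y i > real k" by (simp add: not_le)
  qed
  ultimately show ?thesis
    by eventually_elim (auto simp: good_knots_def partial_sums_Suc)
qed

lemma laplace_power_limit:
  assumes m: "m > 0" and z: "z \<ge> 0"
  shows "(\<lambda>n. (\<integral>x. exp (- (z / c n) * x) \<partial>\<mu>) ^ block_size m n) \<longlonglongrightarrow> exp (- (1 / real m) * (z / K) powr \<kappa>)"
proof (cases "z = 0")
  case True
  thus ?thesis using \<kappa> by (simp add: mu.prob_space)
next
  case False
  have "(\<lambda>n. (1 - (1 - (\<integral>x. exp (- (z / c n) * x) \<partial>\<mu>))) ^ block_size m n) \<longlonglongrightarrow> exp (- (1 / real m) * (z / K) powr \<kappa>)"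
    by (rule power_tendsto_exp[OF _ exponent block_size_limit(1)[OF m]])
      (use False z laplace_bounds(2)[of "z / c _"] c in \<open>auto simp: less_imp_le\<close>)
  thus ?thesis by simp
qed

lemma weak_conv_block_jumps:
  assumes m: "m > 0" and \<nu>: "real_distribution \<nu>" "AE x in \<nu>. 0 \<le> x"
    and lap: "\<And>z. z \<ge> 0 \<Longrightarrow> (\<integral>x. exp (- z * x) \<partial>\<nu>) = exp (- (1 / real m) * (z / K) powr \<kappa>)"
  shows "weak_conv_m (\<lambda>n. distr jumps borel (\<lambda>y. partial_sums y (block_size m n) / c n)) \<nu>"
proof (rule laplace_weak_conv[OF _ \<nu>(1) _ \<nu>(2)])
  show "real_distribution (distr jumps borel (\<lambda>y. partial_sums y (block_size m n) / c n))" for n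
    by (rule J.real_distribution_distr) measurable
  show "AE x in distr jumps borel (\<lambda>y. partial_sums y (block_size m n) / c n). 0 \<le> x" for n
  proof -
    have "AE y in jumps. 0 \<le> partial_sums y (block_size m n) / c n"
      using AE_good_partial_sums by eventually_elim (rule divide_nonneg_pos[OF good_knots_nonneg c])
    thus ?thesis by (subst AE_distr_iff) auto
  qed
  fix k :: nat
  have "(\<integral>x. exp (- real k * x) \<partial>distr jumps borel (\<lambda>y. partial_sums y (block_size m n) / c n))
      = (\<integral>x. exp (- (real k / c n) * x) \<partial>\<mu>) ^ block_size m n" for n
    using laplace_partial_sums(1)[of "real k / c n" "block_size m n"] c[of n]
    by (subst integral_distr) (auto simp: less_imp_le)
  thus "(\<lambda>n. \<integral>x. exp (- real k * x) \<partial>distr jumps borel (\<lambda>y. partial_sums y (block_size m n) / c n))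
      \<longlonglongrightarrow> (\<integral>x. exp (- real k * x) \<partial>\<nu>)"
    using laplace_power_limit[OF m, of "real k"] lap[of "real k"] by simp
qed

text \<open>Supplies a number of blocks that outlasts time T, with R independent of m. The Chernoff
  bound at z = 1 / c n tends to exp (T - R q), because each of the m R blocks contributes exp (-
  q/m) in the limit; R is chosen to make this small.\<close>

lemma arrivals_tail:
  assumes \<epsilon>: "\<epsilon> > 0" and T: "T \<ge> 0"
  shows "\<exists>R::nat. R > 0 \<and> (\<forall>m>0. \<forall>\<^sub>F n in sequentially. J.prob {y. partial_sums y (m * R * block_size m n) \<le> c n * T} \<le> \<epsilon>)"
proof -
  define q where "q = (1 / K) powr \<kappa>"
  have q: "q > 0" using K by (simp add: q_def)
  have "(\<lambda>R. exp T * exp (- real R * q)) \<longlonglongrightarrow> 0" using q by real_asymp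
  hence "\<forall>\<^sub>F R in sequentially. exp T * exp (- real R * q) < \<epsilon>" using \<epsilon> by (intro order_tendstoD) auto
  then obtain R0 :: nat where R0: "\<And>R. R \<ge> R0 \<Longrightarrow> exp T * exp (- real R * q) < \<epsilon>"
    unfolding eventually_sequentially by blast
  define R where "R = Suc R0"
  have R: "R > 0" "exp T * exp (- real R * q) < \<epsilon>" using R0[of R] by (simp_all add: R_def)
  have "\<forall>\<^sub>F n in sequentially. J.prob {y. partial_sums y (m * R * block_size m n) \<le> c n * T} \<le> \<epsilon>" if m: "m > 0" for m
  proof -
    have "(\<lambda>n. exp T * ((\<integral>x. exp (- (1 / c n) * x) \<partial>\<mu>) ^ block_size m n) ^ (m * R)) \<longlonglongrightarrow> exp T * (exp (- (1 / real m) * (1 / K) powr \<kappa>)) ^ (m * R)"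
      by (intro tendsto_intros laplace_power_limit m) simp
    also have "(exp (- (1 / real m) * (1 / K) powr \<kappa>)) ^ (m * R) = exp (- real R * q)"
      using m by (simp add: q_def flip: exp_of_nat_mult)
    finally have "\<forall>\<^sub>F n in sequentially. exp T * ((\<integral>x. exp (- (1 / c n) * x) \<partial>\<mu>) ^ block_size m n) ^ (m * R) < \<epsilon>"
      using R by (intro order_tendstoD) auto
    thus ?thesis
    proof eventually_elim
      case (elim n)
      have "J.prob {y. partial_sums y (m * R * block_size m n) \<le> c n * T} \<le> exp ((1 / c n) * (c n * T)) * (\<integral>t. exp (- (1 / c n) * t) \<partial>\<mu>) ^ (m * R * block_size m n)"
        by (rule partial_sums_lower_tail) (use c[of n] in auto)
      also have "\<dots> = exp T * ((\<integral>x. exp (- (1 / c n) * x) \<partial>\<mu>) ^ block_size m n) ^ (m * R)"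
        using c[of n] by (simp add: power_mult[symmetric] mult.commute)
      finally show ?case using elim by simp
    qed
  qed
  thus ?thesis using R(1) by blast
qed

text \<open>\<open>\<phi>\<close> is the block functional on the first b coordinates, as the block
  decomposition requires; \<open>\<psi>\<close> is the same functional on whole sequences, which is
  easier to state and use.\<close>

lemma block_law:
  fixes \<phi> :: "(nat \<Rightarrow> bool) \<Rightarrow> real"
  assumes \<phi>: "\<phi> \<in> borel_measurable (Pi\<^sub>M {..<b} (\<lambda>_. measure_pmf (bernoulli_pmf p)))"
    and eq: "\<And>w. \<phi> (\<lambda>j\<in>{..<b}. w j) = \<psi> w"
  shows "distr canonical knot_algebra (\<lambda>x. (\<lambda>i. \<psi> (\<lambda>j. fst x (i * b + j)), \<lambda>i. (partial_sums (snd x) (Suc i * b) - partial_sums (snd x) (i * b)) / d))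
    = Pi\<^sub>M UNIV (\<lambda>_. distr coins borel \<psi>) \<Otimes>\<^sub>M Pi\<^sub>M UNIV (\<lambda>_. distr jumps borel (\<lambda>y. partial_sums y b / d))"
proof -
  have s: "partial_sums y (Suc i * b) - partial_sums y (i * b) = (\<Sum>j<b. y (i * b + j))" for y i
  proof -
    have "partial_sums y (n + b) - partial_sums y n = (\<Sum>j<b. y (n + j))" for n
      by (induction b) (auto simp: partial_sums_Suc)
    from this[of "i * b"] show ?thesis by (simp add: add.commute)
  qed
  have gm: "(\<lambda>y. (\<Sum>j<b. y j) / d) \<in> borel_measurable (Pi\<^sub>M {..<b} (\<lambda>_. \<mu>))"
  proof -
    have "(\<lambda>y. y j) \<in> borel_measurable (Pi\<^sub>M {..<b} (\<lambda>_. \<mu>))" if "j < b" for j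
    proof -
      have "(\<lambda>y. y j) \<in> measurable (Pi\<^sub>M {..<b} (\<lambda>_. \<mu>)) \<mu>"
        by (rule measurable_component_singleton) (use that in simp)
      thus ?thesis by (simp only: measurable_cong_sets[OF refl mu.events_eq_borel])
    qed
    thus ?thesis by (intro borel_measurable_divide borel_measurable_sum) auto
  qed
  define A where "A w = (\<lambda>i. \<psi> (\<lambda>j. w (i * b + j)))" for w :: "nat \<Rightarrow> bool"
  define B where "B y = (\<lambda>i. (partial_sums y (Suc i * b) - partial_sums y (i * b)) / d)" for y
  have A1: "A w = (\<lambda>i. \<phi> (\<lambda>j\<in>{..<b}. w (i * b + j)))" for w
    unfolding A_def eq[symmetric] ..
  have B1: "B y = (\<lambda>i. (\<Sum>j<b. (\<lambda>j\<in>{..<b}. y (i * b + j)) j) / d)" for y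
    unfolding B_def s by (intro ext arg_cong2[where f="(/)"] sum.cong) auto
  have distA: "distr coins real_sequences A = Pi\<^sub>M UNIV (\<lambda>_. distr coins borel \<psi>)"
    using distr_PiM_blocks[OF prob_space_measure_pmf \<phi>] unfolding A1[abs_def] coin_space_def eq by (simp only:)
  have distB: "distr jumps real_sequences B = Pi\<^sub>M UNIV (\<lambda>_. distr jumps borel (\<lambda>y. partial_sums y b / d))"
  proof -
    have "(\<Sum>j<b. (\<lambda>j\<in>{..<b}. w j) j) / d = partial_sums w b / d" for w :: "nat \<Rightarrow> real"
      unfolding partial_sums_def by (intro arg_cong2[where f="(/)"] sum.cong) auto
    thus ?thesis using distr_PiM_blocks[OF mu.prob_space_axioms gm] unfolding B1[abs_def] by (simp only:)
  qed
  have Am: "A \<in> measurable coins real_sequences"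
    unfolding A1[abs_def]
  proof (rule measurable_PiM_single')
    fix i
    have "(\<lambda>w. \<lambda>j\<in>{..<b}. w (i * b + j)) \<in> measurable coins (Pi\<^sub>M {..<b} (\<lambda>_. measure_pmf (bernoulli_pmf p)))"
      unfolding coin_space_def by (rule measurable_restrict, rule measurable_component_singleton) simp
    thus "(\<lambda>w. \<phi> (\<lambda>j\<in>{..<b}. w (i * b + j))) \<in> borel_measurable coins" by (rule measurable_compose[OF _ \<phi>])
  qed auto
  have Bm: "B \<in> measurable jumps real_sequences"
    unfolding B_def[abs_def] by (rule measurable_PiM_single') auto
  interpret D: prob_space "distr jumps real_sequences B" by (rule J.prob_space_distr[OF Bm])
  have "distr coins real_sequences A \<Otimes>\<^sub>M distr jumps real_sequences B = distr canonical knot_algebra (\<lambda>(w, y). (A w, B y))"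
    by (rule pair_measure_distr[OF Am Bm]) unfold_locales
  thus ?thesis unfolding distA distB A_def B_def by (simp add: split_beta' del: mult_Suc)
qed

end

section \<open>Supercritical and critical regimes\<close>

text \<open>Pushes the coupling of the increments through the maps \<Psi>. Since \<Psi> varies with
  n, continuity has to be asked in the joint form \<open>cont\<close>: convergent arguments give
  convergent images under the whole sequence of maps.\<close>

lemma representation_of_images:
  fixes V u :: "nat \<Rightarrow> 'm \<Rightarrow> (nat \<Rightarrow> real) \<times> (nat \<Rightarrow> real)" and V' u' :: "'b \<Rightarrow> (nat \<Rightarrow> real) \<times> (nat \<Rightarrow> real)"
  assumes r1: "\<And>n. real_distribution (\<nu>1 n)" "real_distribution \<mu>1" "weak_conv_m \<nu>1 \<mu>1"
    and r2: "\<And>n. real_distribution (\<nu>2 n)" "real_distribution \<mu>2" "weak_conv_m \<nu>2 \<mu>2"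
    and V: "\<And>n. V n \<in> measurable M knot_algebra"
      "\<And>n. distr M knot_algebra (V n) = Pi\<^sub>M UNIV (\<lambda>_. \<nu>1 n) \<Otimes>\<^sub>M Pi\<^sub>M UNIV (\<lambda>_. \<nu>2 n)"
    and V': "V' \<in> measurable N knot_algebra" "distr N knot_algebra V' = Pi\<^sub>M UNIV (\<lambda>_. \<mu>1) \<Otimes>\<^sub>M Pi\<^sub>M UNIV (\<lambda>_. \<mu>2)"
    and \<Psi>: "\<And>n. \<Psi> n \<in> measurable knot_algebra knot_algebra" "\<Psi>' \<in> measurable knot_algebra knot_algebra"
    and cont: "\<And>x x' i. (\<And>i. (\<lambda>n. fst (x n) i) \<longlonglongrightarrow> fst x' i) \<Longrightarrow> (\<And>i. (\<lambda>n. snd (x n) i) \<longlonglongrightarrow> snd x' i) \<Longrightarrow>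
      (\<lambda>n. fst (\<Psi> n (x n)) i) \<longlonglongrightarrow> fst (\<Psi>' x') i \<and> (\<lambda>n. snd (\<Psi> n (x n)) i) \<longlonglongrightarrow> snd (\<Psi>' x') i"
    and u: "\<forall>\<^sub>F n in sequentially. \<forall>\<omega>\<in>space M. u n \<omega> = \<Psi> n (V n \<omega>)" and u': "\<And>\<omega>. u' \<omega> = \<Psi>' (V' \<omega>)"
  shows "\<exists>(\<Omega> :: ((nat \<Rightarrow> real) \<times> (nat \<Rightarrow> real)) measure) U U'. prob_space \<Omega> \<and> (\<forall>n. U n \<in> measurable \<Omega> knot_algebra) \<and>
       U' \<in> measurable \<Omega> knot_algebra \<and>
       (\<forall>\<^sub>F n in sequentially. distr \<Omega> knot_algebra (U n) = distr M knot_algebra (u n)) \<and>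
       distr \<Omega> knot_algebra U' = distr N knot_algebra u' \<and>
       (AE \<omega> in \<Omega>. \<forall>i. (\<lambda>n. fst (U n \<omega>) i) \<longlonglongrightarrow> fst (U' \<omega>) i \<and> (\<lambda>n. snd (U n \<omega>) i) \<longlonglongrightarrow> snd (U' \<omega>) i)"
proof -
  obtain \<Omega> :: "((nat \<Rightarrow> real) \<times> (nat \<Rightarrow> real)) measure" and U U' where R: "prob_space \<Omega>"
    "\<And>n. U n \<in> measurable \<Omega> knot_algebra" "U' \<in> measurable \<Omega> knot_algebra"
    "\<And>n. distr \<Omega> knot_algebra (U n) = Pi\<^sub>M UNIV (\<lambda>_. \<nu>1 n) \<Otimes>\<^sub>M Pi\<^sub>M UNIV (\<lambda>_. \<nu>2 n)"
    "distr \<Omega> knot_algebra U' = Pi\<^sub>M UNIV (\<lambda>_. \<mu>1) \<Otimes>\<^sub>M Pi\<^sub>M UNIV (\<lambda>_. \<mu>2)"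
    "\<And>\<omega>. \<omega> \<in> space \<Omega> \<Longrightarrow> \<forall>i. (\<lambda>n. fst (U n \<omega>) i) \<longlonglongrightarrow> fst (U' \<omega>) i \<and> (\<lambda>n. snd (U n \<omega>) i) \<longlonglongrightarrow> snd (U' \<omega>) i"
    using skorokhod_pair[OF r1 r2] by blast
  show ?thesis
  proof (intro exI[of _ \<Omega>] exI[of _ "\<lambda>n \<omega>. \<Psi> n (U n \<omega>)"] exI[of _ "\<lambda>\<omega>. \<Psi>' (U' \<omega>)"] conjI allI)
    show "(\<lambda>\<omega>. \<Psi> n (U n \<omega>)) \<in> measurable \<Omega> knot_algebra" for n by (rule measurable_compose[OF R(2) \<Psi>(1)])
    show "(\<lambda>\<omega>. \<Psi>' (U' \<omega>)) \<in> measurable \<Omega> knot_algebra" by (rule measurable_compose[OF R(3) \<Psi>(2)])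
    show "\<forall>\<^sub>F n in sequentially. distr \<Omega> knot_algebra (\<lambda>\<omega>. \<Psi> n (U n \<omega>)) = distr M knot_algebra (u n)"
      using u
    proof eventually_elim
      case (elim n)
      have "distr \<Omega> knot_algebra (\<lambda>\<omega>. \<Psi> n (U n \<omega>)) = distr (distr \<Omega> knot_algebra (U n)) knot_algebra (\<Psi> n)"
        by (subst distr_distr[OF \<Psi>(1) R(2)]) (simp add: comp_def)
      also have "\<dots> = distr (distr M knot_algebra (V n)) knot_algebra (\<Psi> n)" by (simp only: R(4) V(2))
      also have "\<dots> = distr M knot_algebra (\<lambda>\<omega>. \<Psi> n (V n \<omega>))"
        by (subst distr_distr[OF \<Psi>(1) V(1)]) (simp add: comp_def)
      also have "\<dots> = distr M knot_algebra (u n)" by (rule distr_cong) (use elim in auto)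
      finally show ?case .
    qed
    have "distr \<Omega> knot_algebra (\<lambda>\<omega>. \<Psi>' (U' \<omega>)) = distr (distr \<Omega> knot_algebra U') knot_algebra \<Psi>'"
      by (subst distr_distr[OF \<Psi>(2) R(3)]) (simp add: comp_def)
    also have "\<dots> = distr (distr N knot_algebra V') knot_algebra \<Psi>'" by (simp only: R(5) V'(2))
    also have "\<dots> = distr N knot_algebra u'"
      by (subst distr_distr[OF \<Psi>(2) V'(1)]) (simp add: comp_def ext[of u' "\<lambda>\<omega>. \<Psi>' (V' \<omega>)", OF u'])
    finally show "distr \<Omega> knot_algebra (\<lambda>\<omega>. \<Psi>' (U' \<omega>)) = distr N knot_algebra u'" .
    show "AE \<omega> in \<Omega>. \<forall>i. (\<lambda>n. fst (\<Psi> n (U n \<omega>)) i) \<longlonglongrightarrow> fst (\<Psi>' (U' \<omega>)) i \<and> (\<lambda>n. snd (\<Psi> n (U n \<omega>)) i) \<longlonglongrightarrow> snd (\<Psi>' (U' \<omega>)) i"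
    proof (intro AE_I2 allI)
      fix \<omega> i assume "\<omega> \<in> space \<Omega>"
      from R(6)[OF this] show "(\<lambda>n. fst (\<Psi> n (U n \<omega>)) i) \<longlonglongrightarrow> fst (\<Psi>' (U' \<omega>)) i \<and> (\<lambda>n. snd (\<Psi> n (U n \<omega>)) i) \<longlonglongrightarrow> snd (\<Psi>' (U' \<omega>)) i"
        by (intro cont[of "\<lambda>n. U n \<omega>" "U' \<omega>" i]) blast+
    qed
  qed (rule R(1))
qed

section \<open>Comparison of the queue with its polygon\<close>

lemma good_knots_sub:
  assumes y: "good_knots v" and b: "b > 0" and c: "(c::real) > 0"
  shows "good_knots (\<lambda>i. v (i * b) / c)"
  unfolding good_knots_def
proof (intro conjI allI)
  note sm = good_knots_strict_mono[OF y]
  show "v (0 * b) / c = 0" using y by (simp add: good_knots_def)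
  show "v (i * b) / c < v (Suc i * b) / c" for i
    using c b strict_monoD[OF sm, of "i * b" "Suc i * b"] by (simp add: divide_strict_right_mono)
  fix k :: nat
  obtain i where i: "v i > real k * c" using good_knots_unbounded[OF y] by blast
  have "i \<le> i * b" using b by simp
  hence "v i \<le> v (i * b)" using strict_mono_less_eq[OF sm] by simp
  hence "real k * c < v (i * b)" using i by simp
  thus "\<exists>i. v (i * b) / c > real k" using c by (intro exI[of _ i]) (simp add: field_simps)
qed

text \<open>If k arrivals have occurred by time c t, then k lies in block i = k div b and t lies
  between the rescaled epochs of the two ends of that block. It is thus enough to compare the chain
  inside the block with the heights at its ends; the I blocks reach beyond T.\<close>

lemma renewal_polygon_close:
  assumes y: "good_knots (partial_sums y)" and b: "b > 0" and c: "c > 0"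
    and I: "partial_sums y (I * b) > c * T"
    and close: "\<And>k i. i < I \<Longrightarrow> i * b \<le> k \<Longrightarrow> k \<le> Suc i * b \<Longrightarrow> \<bar>d * real (a k) - r i\<bar> \<le> e \<and> \<bar>d * real (a k) - r (Suc i)\<bar> \<le> e"
    and t: "t \<in> {0..T}"
  shows "\<bar>renewal_path d c (a, y) t - poly_path (r, \<lambda>i. partial_sums y (i * b) / c) t\<bar> \<le> e"
proof -
  define k where "k = arrivals y (c * t)"
  define i where "i = k div b"
  have ct: "0 \<le> c * t" using t c by simp
  note k = arrivals_bounds[OF y ct, folded k_def]
  note sm = good_knots_strict_mono[OF y]
  have ik: "i * b \<le> k" "k < Suc i * b"
  proof -
    show "i * b \<le> k" by (simp add: i_def)
    have "k mod b < b" using b by simp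
    moreover have "k = i * b + k mod b" by (simp add: i_def)
    ultimately show "k < Suc i * b" by simp
  qed
  have l: "partial_sums y (i * b) \<le> c * t" using ik k strict_mono_less_eq[OF sm, of "i * b" k] by simp
  have u: "c * t \<le> partial_sums y (Suc i * b)" using ik k strict_mono_less_eq[OF sm, of "Suc k" "Suc i * b"] by simp
  have "c * t \<le> c * T" using t c by (intro mult_left_mono) auto
  hence "partial_sums y (i * b) < partial_sums y (I * b)" using l I by linarith
  hence iI: "i < I" using strict_mono_less[OF sm] b by simp
  have x: "renewal_path d c (a, y) t = d * real (a k)" using t y by (simp add: renewal_path_def k_def)
  have g: "good_knots (\<lambda>i. partial_sums y (i * b) / c)" by (rule good_knots_sub[OF y b c])
  have "\<bar>d * real (a k) - polygon r (\<lambda>i. partial_sums y (i * b) / c) t\<bar> \<le> e"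
  proof (rule polygon_close[OF g])
    show "partial_sums y (i * b) / c \<le> t" "t \<le> partial_sums y (Suc i * b) / c"
      using l u c by (auto simp: field_simps)
    show "\<bar>d * real (a k) - r i\<bar> \<le> e" "\<bar>d * real (a k) - r (Suc i)\<bar> \<le> e"
      using close[OF iI ik(1)] ik(2) by auto
  qed
  thus ?thesis using t g by (simp add: x poly_path_def)
qed

lemma max_deficit_tendsto:
  assumes "\<And>j. (\<lambda>n. g n j) \<longlonglongrightarrow> g' j"
  shows "(\<lambda>n. max_deficit (g n) i) \<longlonglongrightarrow> max_deficit g' i"
  by (induction i) (auto intro!: tendsto_intros assms)

lemma reflected_tendsto:
  assumes "\<And>j. (\<lambda>n. g n j) \<longlonglongrightarrow> g' j" shows "(\<lambda>n. reflected (g n) i) \<longlonglongrightarrow> reflected g' i"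
  unfolding reflected_def by (intro tendsto_intros assms max_deficit_tendsto)

lemma max_deficit_measurable:
  assumes "\<And>j. (\<lambda>x. g x j) \<in> borel_measurable M" shows "(\<lambda>x. max_deficit (g x) i) \<in> borel_measurable M"
  using assms by (induction i) (auto intro!: borel_measurable_max)

lemma reflected_measurable:
  assumes "\<And>j. (\<lambda>x. g x j) \<in> borel_measurable M" shows "(\<lambda>x. reflected (g x) i) \<in> borel_measurable M"
  unfolding reflected_def by (intro borel_measurable_add max_deficit_measurable assms)

lemma partial_sums_telescope: "partial_sums (\<lambda>i. (g (Suc i) - g i) / d) k = (g k - g 0) / d" for d :: real
  unfolding partial_sums_def by (simp add: sum_divide_distrib[symmetric] sum_lessThan_telescope)

context canonical_queue
begin

definition queue_path :: "real \<Rightarrow> nat \<Rightarrow> (nat \<Rightarrow> bool) \<times> (nat \<Rightarrow> real) \<Rightarrow> real \<Rightarrow> real" where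
  "queue_path d n x = renewal_path d (c n) (coin_chain (fst x), snd x)"

lemma measurable_chain_jumps: "(\<lambda>x. (coin_chain (fst x), snd x)) \<in> measurable canonical queue_algebra"
proof (rule measurable_Pair)
  have "(\<lambda>w. coin_chain w) \<in> measurable coins nat_sequences"
    by (rule measurable_PiM_single') auto
  thus "(\<lambda>x. coin_chain (fst x)) \<in> measurable canonical nat_sequences"
    by (rule measurable_compose[OF measurable_fst])
  have "(\<lambda>y. y) \<in> measurable jumps real_sequences"
    by (rule measurable_PiM_single'[where f="\<lambda>i y. y i"]) auto
  thus "(\<lambda>x. snd x) \<in> measurable canonical real_sequences"
    by (rule measurable_compose[OF measurable_snd])
qed

lemma measurable_queue_path: "queue_path d n \<in> measurable canonical cadlag_measure"
  unfolding queue_path_def[abs_def] by (rule measurable_compose[OF measurable_chain_jumps measurable_renewal_path[OF c]])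

lemma AE_canonical_good: "AE x in canonical. good_knots (partial_sums (snd x))"
proof -
  have gm: "Measurable.pred jumps (\<lambda>y. good_knots (partial_sums y))"
    unfolding good_knots_def by measurable
  have "J.prob {y\<in>space jumps. \<not> good_knots (partial_sums y)} = 0"
  proof (subst J.prob_Collect_eq_0)
    show "{y\<in>space jumps. \<not> good_knots (partial_sums y)} \<in> J.events" using gm by measurable
  qed (use AE_good_partial_sums in simp)
  hence "P.prob {x\<in>space canonical. \<not> good_knots (partial_sums (snd x))} = 0"
    using P.measure_snd_pred[of "\<lambda>y. \<not> good_knots (partial_sums y)"] gm by simp
  moreover have "{x\<in>space canonical. \<not> good_knots (partial_sums (snd x))} \<in> P.events"
    using measurable_compose[OF measurable_snd gm] by measurable
  ultimately show ?thesis by (simp add: P.prob_Collect_eq_0)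
qed

text \<open>Collects in one event of the product space a good event for the coins and enough blocks
  to cover the time horizon; each exception gets half of \<epsilon>, bad knots are null.\<close>

lemma approximation_event:
  assumes A: "Measurable.pred coins A" "C.prob {w. \<not> A w} \<le> \<epsilon> / 2"
    and B: "J.prob {y. partial_sums y k \<le> x} \<le> \<epsilon> / 2"
  shows "\<exists>E\<in>sets canonical. P.prob E \<ge> 1 - \<epsilon> \<and> (\<forall>x'\<in>E. A (fst x') \<and> good_knots (partial_sums (snd x')) \<and> partial_sums (snd x') k > x)"
proof -
  note [measurable] = A(1)
  have gm[measurable]: "Measurable.pred jumps (\<lambda>y. good_knots (partial_sums y))"
    unfolding good_knots_def by measurable
  define E where "E = {x' \<in> space canonical. A (fst x') \<and> good_knots (partial_sums (snd x')) \<and> partial_sums (snd x') k > x}"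
  have mE: "E \<in> sets canonical" unfolding E_def by measurable
  have pA: "P.prob {x' \<in> space canonical. \<not> A (fst x')} \<le> \<epsilon> / 2"
    using P.measure_fst_pred[of "\<lambda>w. \<not> A w"] A by simp
  have pB: "P.prob {x' \<in> space canonical. partial_sums (snd x') k \<le> x} \<le> \<epsilon> / 2"
    using P.measure_snd_pred[of "\<lambda>y. partial_sums y k \<le> x"] B by simp
  have pG: "P.prob {x' \<in> space canonical. \<not> good_knots (partial_sums (snd x'))} = 0"
    by (subst P.prob_Collect_eq_0) (use AE_canonical_good in auto)
  have "space canonical - E \<subseteq> ({x' \<in> space canonical. \<not> A (fst x')} \<union> {x' \<in> space canonical. partial_sums (snd x') k \<le> x}) \<union> {x' \<in> space canonical. \<not> good_knots (partial_sums (snd x'))}"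
    by (auto simp: E_def)
  hence "P.prob (space canonical - E) \<le> P.prob (({x' \<in> space canonical. \<not> A (fst x')} \<union> {x' \<in> space canonical. partial_sums (snd x') k \<le> x}) \<union> {x' \<in> space canonical. \<not> good_knots (partial_sums (snd x'))})"
    by (rule P.finite_measure_mono) measurable
  also have "\<dots> \<le> (P.prob {x' \<in> space canonical. \<not> A (fst x')} + P.prob {x' \<in> space canonical. partial_sums (snd x') k \<le> x}) + P.prob {x' \<in> space canonical. \<not> good_knots (partial_sums (snd x'))}"
    by (intro order_trans[OF measure_Un_le] add_right_mono measure_Un_le) measurable
  finally have "P.prob (space canonical - E) \<le> \<epsilon>" using pA pB pG by simp
  hence "P.prob E \<ge> 1 - \<epsilon>" using mE by (simp add: P.prob_compl)
  thus ?thesis using mE by (intro bexI[of _ E]) (auto simp: E_def)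
qed

lemma distr_chain_jumps:
  "distr canonical queue_algebra (\<lambda>x. (coin_chain (fst x), snd x)) = distr coins nat_sequences coin_chain \<Otimes>\<^sub>M jumps"
proof -
  have cm: "coin_chain \<in> measurable coins nat_sequences"
    by (rule measurable_PiM_single'[where f="\<lambda>i w. coin_chain w i"]) auto
  have sj: "sets real_sequences = sets jumps" by (intro sets_PiM_cong) auto
  have jm: "(\<lambda>y. y) \<in> measurable jumps real_sequences" by (rule measurable_ident_sets) (rule sj[symmetric])
  have "distr coins nat_sequences coin_chain \<Otimes>\<^sub>M distr jumps real_sequences (\<lambda>y. y)
    = distr canonical queue_algebra (\<lambda>(w, y). (coin_chain w, y))"
    by (rule pair_measure_distr[OF cm jm]) (intro prob_space_imp_sigma_finite J.prob_space_distr jm)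
  thus ?thesis by (simp add: distr_id2[OF sj] split_beta')
qed

end

locale queue_limit = canonical_queue p \<mu> c K \<kappa> + time_changed_limit N W S L \<kappa>
  for p \<mu> c K \<kappa> and N :: "'b measure" and W S L
begin

text \<open>Both regimes are instances of one statement: \<open>\<psi>\<close> extracts the relevant functional of a block of coins,
  \<open>R\<close> turns the block functionals into the heights of the polygon over the renewal epochs of the block ends.\<close>

lemma polygonal_convergence:
  fixes \<phi> \<psi> :: "nat \<Rightarrow> nat \<Rightarrow> (nat \<Rightarrow> bool) \<Rightarrow> real" and R :: "nat \<Rightarrow> nat \<Rightarrow> (nat \<Rightarrow> real) \<Rightarrow> nat \<Rightarrow> real"
    and w' :: "nat \<Rightarrow> 'b \<Rightarrow> nat \<Rightarrow> real"
  defines "b \<equiv> \<lambda>m n. block_size (Suc m) n"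
  assumes \<phi>: "\<And>m n. \<phi> m n \<in> borel_measurable (Pi\<^sub>M {..<b m n} (\<lambda>_. measure_pmf (bernoulli_pmf p)))"
      "\<And>m n w. \<phi> m n (\<lambda>j\<in>{..<b m n}. w j) = \<psi> m n w"
    and \<mu>1: "real_distribution \<mu>1" "\<And>m. weak_conv_m (\<lambda>n. distr coins borel (\<psi> m n)) \<mu>1"
    and w': "\<And>m i. (\<lambda>\<omega>. w' m \<omega> i) \<in> borel_measurable N"
      "\<And>m. distr N knot_algebra (\<lambda>\<omega>. (w' m \<omega>, \<lambda>i. (S (real (Suc i) * (1 / real (Suc m))) \<omega> - S (real i * (1 / real (Suc m))) \<omega>) / K))
         = Pi\<^sub>M UNIV (\<lambda>_. \<mu>1) \<Otimes>\<^sub>M Pi\<^sub>M UNIV (\<lambda>_. distr N borel (\<lambda>\<omega>. S (1 / real (Suc m)) \<omega> / K))"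
    and R: "\<And>m n i. (\<lambda>x. R m n x i) \<in> borel_measurable real_sequences" "\<And>m i. (\<lambda>x. R' m x i) \<in> borel_measurable real_sequences"
      "\<And>m x x' i. (\<And>i. (\<lambda>n. x n i) \<longlonglongrightarrow> x' i) \<Longrightarrow> (\<lambda>n. R m n (x n) i) \<longlonglongrightarrow> R' m x' i"
    and lim: "AE \<omega> in N. limitin U_topology (\<lambda>m. poly_path (R' m (w' m \<omega>), grid_knots K (Suc m) (\<lambda>s. S s \<omega>))) (z \<omega>) sequentially"
    and approx: "\<And>\<epsilon> T. \<epsilon> > 0 \<Longrightarrow> T \<ge> 0 \<Longrightarrow> \<exists>m0. \<forall>m\<ge>m0. \<forall>\<^sub>F n in sequentially. \<exists>E\<in>sets canonical. P.prob E \<ge> 1 - \<epsilon> \<and>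
       (\<forall>x\<in>E. \<forall>t\<in>{0..T}. \<bar>queue_path (d n) n x t - poly_path (R m n (\<lambda>i. \<psi> m n (\<lambda>j. fst x (i * b m n + j))), \<lambda>i. partial_sums (snd x) (i * b m n) / c n) t\<bar> \<le> \<epsilon>)"
    and f: "continuous_map U_topology euclideanreal f" "f \<in> borel_measurable cadlag_measure" "bounded (f ` cadlag_space)"
  shows "(\<lambda>n. \<integral>x. f (queue_path (d n) n x) \<partial>canonical) \<longlonglongrightarrow> (\<integral>\<omega>. f (z \<omega>) \<partial>completion N)"
proof -
  \<comment> \<open>\<open>V\<close> holds the independent block data, \<open>u\<close> the heights
    and knots computed from them by \<open>\<Psi>\<close>: the knots are partial sums of the block
    durations. The primed versions do the same for the limit process.\<close>
  define V where "V m n = (\<lambda>x. (\<lambda>i. \<psi> m n (\<lambda>j. fst x (i * b m n + j)), \<lambda>i. (partial_sums (snd x) (Suc i * b m n) - partial_sums (snd x) (i * b m n)) / c n))"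
    for m n and x :: "(nat \<Rightarrow> bool) \<times> (nat \<Rightarrow> real)"
  define u where "u m n = (\<lambda>x. (R m n (\<lambda>i. \<psi> m n (\<lambda>j. fst x (i * b m n + j))), \<lambda>i. partial_sums (snd x) (i * b m n) / c n))"
    for m n and x :: "(nat \<Rightarrow> bool) \<times> (nat \<Rightarrow> real)"
  define V' where "V' m = (\<lambda>\<omega>. (w' m \<omega>, \<lambda>i. (S (real (Suc i) * (1 / real (Suc m))) \<omega> - S (real i * (1 / real (Suc m))) \<omega>) / K))" for m
  define \<Psi> where "\<Psi> m n = (\<lambda>x. (R m n (fst x), partial_sums (snd x)))" for m n and x :: "(nat \<Rightarrow> real) \<times> (nat \<Rightarrow> real)"
  define \<Psi>' where "\<Psi>' m = (\<lambda>x. (R' m (fst x), partial_sums (snd x)))" for m and x :: "(nat \<Rightarrow> real) \<times> (nat \<Rightarrow> real)"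
  define u' where "u' m \<omega> = \<Psi>' m (V' m \<omega>)" for m \<omega>
  have b0: "b m n > 0" for m n by (simp add: b_def block_size_def)
  have psm: "(\<lambda>x. partial_sums (snd x)) \<in> measurable knot_algebra real_sequences"
    unfolding partial_sums_def[abs_def] by (rule measurable_PiM_single') auto
  have \<Psi>m: "\<Psi> m n \<in> measurable knot_algebra knot_algebra" for m n
    unfolding \<Psi>_def by (intro measurable_Pair psm measurable_PiM_single' measurable_compose[OF measurable_fst R(1)]) auto
  have \<Psi>'m: "\<Psi>' m \<in> measurable knot_algebra knot_algebra" for m
    unfolding \<Psi>'_def by (intro measurable_Pair psm measurable_PiM_single' measurable_compose[OF measurable_fst R(2)]) auto
  have \<psi>eq: "\<psi> m n (\<lambda>j. w (i * b m n + j)) = \<phi> m n (\<lambda>j\<in>{..<b m n}. w (i * b m n + j))" for m n w i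
    by (rule \<phi>(2)[symmetric])
  have \<psi>m: "(\<lambda>w. \<psi> m n (\<lambda>j. w (i * b m n + j))) \<in> borel_measurable coins" for m n i
    unfolding \<psi>eq
  proof (rule measurable_compose[OF _ \<phi>(1)])
    show "(\<lambda>w. \<lambda>j\<in>{..<b m n}. w (i * b m n + j)) \<in> measurable coins (Pi\<^sub>M {..<b m n} (\<lambda>_. measure_pmf (bernoulli_pmf p)))"
      unfolding coin_space_def by (rule measurable_restrict, rule measurable_component_singleton) simp
  qed
  have Vm: "V m n \<in> measurable canonical knot_algebra" for m n
    unfolding V_def
  proof (intro measurable_Pair measurable_PiM_single')
    show "(\<lambda>x. \<psi> m n (\<lambda>j. fst x (i * b m n + j))) \<in> borel_measurable canonical" for i
      by (rule measurable_compose[OF measurable_fst \<psi>m])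
    show "(\<lambda>x. (partial_sums (snd x) (Suc i * b m n) - partial_sums (snd x) (i * b m n)) / c n) \<in> borel_measurable canonical" for i
      by (intro borel_measurable_divide borel_measurable_diff measurable_compose[OF measurable_snd measurable_partial_sums]) auto
  qed auto
  have uV: "u m n x = \<Psi> m n (V m n x)" for m n x
  proof -
    have "partial_sums (\<lambda>i. (partial_sums y (Suc i * b m n) - partial_sums y (i * b m n)) / c n) = (\<lambda>i. partial_sums y (i * b m n) / c n)" for y
    proof
      fix k
      show "partial_sums (\<lambda>i. (partial_sums y (Suc i * b m n) - partial_sums y (i * b m n)) / c n) k = partial_sums y (k * b m n) / c n"
        using partial_sums_telescope[of "\<lambda>i. partial_sums y (i * b m n)" "c n" k] by simp
    qed
    thus ?thesis by (simp add: u_def \<Psi>_def V_def del: mult_Suc)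
  qed
  have V'm: "V' m \<in> measurable N knot_algebra" for m
    unfolding V'_def
    by (intro measurable_Pair measurable_PiM_single' w'(1) borel_measurable_divide borel_measurable_diff S_meas) auto
  \<comment> \<open>Summing the increments gives S minus its initial value; S 0 = 0 holds only
    almost surely, so the grid knots appear off a null set.\<close>
  have u'eq: "AE \<omega> in N. inverse_pair (\<lambda>s. S s \<omega>) (\<lambda>t. L t \<omega>) \<and> (\<forall>m. u' m \<omega> = (R' m (w' m \<omega>), grid_knots K (Suc m) (\<lambda>s. S s \<omega>)))"
    using inverse
  proof eventually_elim
    case (elim \<omega>)
    have "partial_sums (\<lambda>i. (S (real (Suc i) * (1 / real (Suc m))) \<omega> - S (real i * (1 / real (Suc m))) \<omega>) / K) k = grid_knots K (Suc m) (\<lambda>s. S s \<omega>) k" for m k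
      using partial_sums_telescope[of "\<lambda>i. S (real i * (1 / real (Suc m))) \<omega>" K k] inverse_pairD(1)[OF elim]
      by (simp add: grid_knots_def del: of_nat_Suc)
    thus ?case using elim by (auto simp: u'_def \<Psi>'_def V'_def simp del: of_nat_Suc)
  qed
  have gu: "AE x in canonical. good_knots (snd (u m n x))" for m n
    using AE_canonical_good by eventually_elim (simp add: u_def good_knots_sub b0 c)
  have gu': "AE \<omega> in N. good_knots (snd (u' m \<omega>))" for m
    using u'eq by eventually_elim (auto intro: good_grid_knots K)
  have lim': "AE \<omega> in N. limitin U_topology (\<lambda>m. poly_path (u' m \<omega>)) (z \<omega>) sequentially"
    using lim u'eq by eventually_elim simp
  have rd2: "real_distribution (distr N borel (\<lambda>\<omega>. S (1 / real (Suc m)) \<omega> / K))" for m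
    by (rule real_distribution_distr, rule borel_measurable_divide[OF S_meas]) auto
  have wc2: "weak_conv_m (\<lambda>n. distr jumps borel (\<lambda>y. partial_sums y (b m n) / c n)) (distr N borel (\<lambda>\<omega>. S (1 / real (Suc m)) \<omega> / K))" for m
    unfolding b_def
  proof (rule weak_conv_block_jumps[OF _ rd2])
    have Sm: "(\<lambda>\<omega>. S (1 / real (Suc m)) \<omega> / K) \<in> borel_measurable N" by (rule borel_measurable_divide[OF S_meas]) auto
    have "AE \<omega> in N. 0 \<le> S (1 / real (Suc m)) \<omega> / K"
      using S_nonneg[of "1 / real (Suc m)"] K by (auto elim: eventually_mono)
    thus "AE x in distr N borel (\<lambda>\<omega>. S (1 / real (Suc m)) \<omega> / K). 0 \<le> x" using Sm by (subst AE_distr_iff) auto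
    fix z :: real assume z: "z \<ge> 0"
    have "(\<integral>x. exp (- z * x) \<partial>distr N borel (\<lambda>\<omega>. S (1 / real (Suc m)) \<omega> / K)) = expectation (\<lambda>\<omega>. exp (- (z / K) * S (1 / real (Suc m)) \<omega>))"
      using Sm by (subst integral_distr) auto
    also have "\<dots> = exp (- (1 / real (Suc m)) * (z / K) powr \<kappa>)" using z K by (intro S_laplace) auto
    finally show "(\<integral>x. exp (- z * x) \<partial>distr N borel (\<lambda>\<omega>. S (1 / real (Suc m)) \<omega> / K)) = exp (- (1 / real (Suc m)) * (z / K) powr \<kappa>)" .
  qed simp
  have \<psi>m0: "\<psi> m n \<in> borel_measurable coins" for m n using \<psi>m[of m n 0] by simp
  have rep: "\<exists>(\<Omega> :: ((nat \<Rightarrow> real) \<times> (nat \<Rightarrow> real)) measure) U U'. prob_space \<Omega> \<and> (\<forall>n. U n \<in> measurable \<Omega> knot_algebra) \<and>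
       U' \<in> measurable \<Omega> knot_algebra \<and>
       (\<forall>\<^sub>F n in sequentially. distr \<Omega> knot_algebra (U n) = distr canonical knot_algebra (u m n)) \<and>
       distr \<Omega> knot_algebra U' = distr N knot_algebra (u' m) \<and>
       (AE \<omega> in \<Omega>. \<forall>i. (\<lambda>n. fst (U n \<omega>) i) \<longlonglongrightarrow> fst (U' \<omega>) i \<and> (\<lambda>n. snd (U n \<omega>) i) \<longlonglongrightarrow> snd (U' \<omega>) i)" for m
  proof (rule representation_of_images[OF _ \<mu>1 _ rd2 wc2 Vm _ V'm _ \<Psi>m \<Psi>'m])
    show "real_distribution (distr coins borel (\<psi> m n))" for n by (rule C.real_distribution_distr[OF \<psi>m0])
    show "real_distribution (distr jumps borel (\<lambda>y. partial_sums y (b m n) / c n))" for n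
      by (rule J.real_distribution_distr) measurable
    show "distr canonical knot_algebra (V m n) = Pi\<^sub>M UNIV (\<lambda>_. distr coins borel (\<psi> m n)) \<Otimes>\<^sub>M Pi\<^sub>M UNIV (\<lambda>_. distr jumps borel (\<lambda>y. partial_sums y (b m n) / c n))" for n
      unfolding V_def by (rule block_law[OF \<phi>])
    show "distr N knot_algebra (V' m) = Pi\<^sub>M UNIV (\<lambda>_. \<mu>1) \<Otimes>\<^sub>M Pi\<^sub>M UNIV (\<lambda>_. distr N borel (\<lambda>\<omega>. S (1 / real (Suc m)) \<omega> / K))"
      unfolding V'_def by (rule w'(2))
    show "\<forall>\<^sub>F n in sequentially. \<forall>\<omega>\<in>space canonical. u m n \<omega> = \<Psi> m n (V m n \<omega>)" by (simp add: uV)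
    show "u' m \<omega> = \<Psi>' m (V' m \<omega>)" for \<omega> by (simp add: u'_def)
    fix x :: "nat \<Rightarrow> (nat \<Rightarrow> real) \<times> (nat \<Rightarrow> real)" and x' i
    assume x: "\<And>i. (\<lambda>n. fst (x n) i) \<longlonglongrightarrow> fst x' i" "\<And>i. (\<lambda>n. snd (x n) i) \<longlonglongrightarrow> snd x' i"
    show "(\<lambda>n. fst (\<Psi> m n (x n)) i) \<longlonglongrightarrow> fst (\<Psi>' m x') i \<and> (\<lambda>n. snd (\<Psi> m n (x n)) i) \<longlonglongrightarrow> snd (\<Psi>' m x') i"
      unfolding \<Psi>_def \<Psi>'_def fst_conv snd_conv partial_sums_def by (intro conjI R(3) tendsto_sum x)
  qed
  show ?thesis
  proof (rule polygonal_approximation_criterion[OF P.prob_space_axioms prob_space_axioms measurable_queue_path _ _ _ gu' lim' rep _ f])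
    show "u m n \<in> measurable canonical knot_algebra" for m n
      using measurable_compose[OF Vm \<Psi>m, of m n m n] by (simp add: uV[symmetric])
    show "u' m \<in> measurable N knot_algebra" for m
      unfolding u'_def[abs_def] by (rule measurable_compose[OF V'm \<Psi>'m])
    show "\<forall>\<^sub>F n in sequentially. AE \<omega> in canonical. good_knots (snd (u m n \<omega>))" for m using gu by simp
  qed (use approx in \<open>simp add: u_def\<close>)
qed

end

text \<open>If the walk stays within e n of a nonnegative drift, its running deficit is at most e n,
  so the chain stays within 2 e n + 2 of the drift. What remains is rounding: a block has between
  n/m and n/m + 1 steps, which separates k/n from the grid points by at most 1/m + I/n.\<close>

lemma coin_chain_drift_close:
  assumes \<rho>: "0 \<le> \<rho>" "\<rho> \<le> 1" and n: "n > 0" and m: "m > 0" and i: "i < I"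
    and k: "i * block_size m n \<le> k" "k \<le> Suc i * block_size m n"
    and walk: "\<And>j. j \<le> I * block_size m n \<Longrightarrow> \<bar>walk w j - \<rho> * real j\<bar> \<le> e * real n"
  shows "\<bar>1 / real n * real (coin_chain w k) - \<rho> * (real i / real m)\<bar> \<le> 2 * e + 2 / real n + 1 / real m + real I / real n \<and>
    \<bar>1 / real n * real (coin_chain w k) - \<rho> * (real (Suc i) / real m)\<bar> \<le> 2 * e + 2 / real n + 1 / real m + real I / real n"
proof -
  define b where "b = block_size m n"
  have kI: "k \<le> I * b" using k(2) i mult_le_mono1[of "Suc i" I b] by (simp add: b_def)
  have e: "0 \<le> e * real n" using walk[of 0] by simp
  have "max_deficit (walk w) k \<le> e * real n"
  proof (rule max_deficit_least[OF e])
    fix j assume j: "j \<le> k"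
    have "0 \<le> \<rho> * real j" using \<rho> by simp
    thus "- walk w j \<le> e * real n" using walk[of j] j kI unfolding b_def by linarith
  qed
  hence "\<bar>real (coin_chain w k) - \<rho> * real k\<bar> \<le> 2 * (e * real n) + 2"
    using coin_chain_reflection[where w=w and k=k] max_deficit_ge(2)[of "walk w" k] walk[of k] kI unfolding b_def by linarith
  hence "\<bar>real (coin_chain w k) - \<rho> * real k\<bar> / real n \<le> (2 * (e * real n) + 2) / real n"
    by (rule divide_right_mono) simp
  moreover have "\<bar>real (coin_chain w k) - \<rho> * real k\<bar> / real n = \<bar>1 / real n * real (coin_chain w k) - \<rho> * (real k / real n)\<bar>"
    using n by (simp add: diff_divide_distrib[symmetric] abs_divide)
  moreover have "(2 * (e * real n) + 2) / real n = 2 * e + 2 / real n" using n by (simp add: add_divide_distrib)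
  ultimately have 1: "\<bar>1 / real n * real (coin_chain w k) - \<rho> * (real k / real n)\<bar> \<le> 2 * e + 2 / real n" by simp
  have "real i * (real n / real m) \<le> real i * real b"
    using block_size_bounds(1)[OF m, of n] by (intro mult_left_mono) (auto simp: b_def)
  also have "\<dots> \<le> real k" using k(1) by (simp add: b_def flip: of_nat_mult)
  finally have l: "real i / real m \<le> real k / real n" using n m by (simp add: field_simps)
  have "real k \<le> real (Suc i * b)" using k(2) unfolding b_def by (simp only: of_nat_le_iff)
  also have "\<dots> = real (Suc i) * real b" by (rule of_nat_mult)
  also have "\<dots> \<le> real (Suc i) * (real n / real m + 1)"
    using block_size_bounds(2)[OF m, of n] by (intro mult_left_mono) (auto simp: b_def)
  finally have "real k / real n \<le> real (Suc i) * (real n / real m + 1) / real n" by (rule divide_right_mono) simp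
  also have "\<dots> = real (Suc i) / real m + real (Suc i) / real n" using n by (simp add: field_simps)
  also have "\<dots> \<le> real (Suc i) / real m + real I / real n"
    using i by (intro add_left_mono divide_right_mono) auto
  finally have u: "real k / real n \<le> real (Suc i) / real m + real I / real n" .
  have s: "real (Suc i) / real m = real i / real m + 1 / real m" by (simp add: add_divide_distrib)
  have p: "0 \<le> real I / real n" "0 \<le> 1 / real m" by auto
  have "\<bar>real k / real n - real i / real m\<bar> \<le> 1 / real m + real I / real n"
    "\<bar>real k / real n - real (Suc i) / real m\<bar> \<le> 1 / real m + real I / real n"
    using l u p unfolding s by linarith+
  moreover have "\<bar>\<rho> * x\<bar> \<le> \<bar>x\<bar>" for x using \<rho> mult_right_mono[of \<rho> 1 "\<bar>x\<bar>"] by (simp add: abs_mult)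
  ultimately have "\<bar>\<rho> * (real k / real n - real i / real m)\<bar> \<le> 1 / real m + real I / real n"
    "\<bar>\<rho> * (real k / real n - real (Suc i) / real m)\<bar> \<le> 1 / real m + real I / real n" by (meson order_trans)+
  thus ?thesis using 1 unfolding right_diff_distrib by linarith
qed

context queue_limit
begin

text \<open>The admissible deviation is of order n, far above the fluctuations of the walk, so a
  single maximal inequality from time 0 over all blocks suffices.\<close>

lemma drift_approximation:
  fixes T :: real
  assumes ph: "1 / 2 \<le> p" and \<epsilon>: "\<epsilon> > 0" and T: "T \<ge> 0"
  shows "\<exists>m0. \<forall>m\<ge>m0. \<forall>\<^sub>F n in sequentially. \<exists>E\<in>sets canonical. P.prob E \<ge> 1 - \<epsilon> \<and>
       (\<forall>x\<in>E. \<forall>t\<in>{0..T}. \<bar>queue_path (1 / real n) n x t - poly_path (\<lambda>i. (2 * p - 1) * (real i / real (Suc m)), \<lambda>i. partial_sums (snd x) (i * block_size (Suc m) n) / c n) t\<bar> \<le> \<epsilon>)"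
proof -
  have "\<epsilon> / 2 > 0" using \<epsilon> by simp
  from arrivals_tail[OF this T] obtain R :: nat where R: "R > 0"
    "\<And>m. m > 0 \<Longrightarrow> \<forall>\<^sub>F n in sequentially. J.prob {y. partial_sums y (m * R * block_size m n) \<le> c n * T} \<le> \<epsilon> / 2" by blast
  \<comment> \<open>2 e takes \<epsilon>/4; the mesh and the terms 2/n + I/n take less than
    \<epsilon>/4 each.\<close>
  define e where "e = \<epsilon> / 8"
  \<comment> \<open>At most 2 n R steps are involved, so 4 \<theta>^2 times their number is at most
    \<theta> e n / 2, half of the gain \<theta> e n. The cap 1/2 is required by the maximal
    inequality.\<close>
  define \<theta> where "\<theta> = min (1 / 2) (e / (16 * real R))"
  have e: "e > 0" using \<epsilon> by (simp add: e_def)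
  have \<theta>: "0 < \<theta>" "\<theta> \<le> 1 / 2" "\<theta> \<le> e / (16 * real R)" using e R by (auto simp: \<theta>_def)
  have "(\<lambda>m. 1 / real (Suc m)) \<longlonglongrightarrow> 0" by (rule LIMSEQ_Suc[OF lim_1_over_n])
  hence "\<forall>\<^sub>F m in sequentially. 1 / real (Suc m) < \<epsilon> / 4" using \<epsilon> by (intro order_tendstoD) auto
  then obtain m0 where m0: "\<And>m. m \<ge> m0 \<Longrightarrow> 1 / real (Suc m) < \<epsilon> / 4" unfolding eventually_sequentially by blast
  show ?thesis
  proof (intro exI[of _ m0] allI impI)
    fix m assume m: "m \<ge> m0"
    define I where "I = Suc m * R"
    have "(\<lambda>n. 2 / real n + real I / real n) \<longlonglongrightarrow> 0" by real_asymp
    hence ev1: "\<forall>\<^sub>F n in sequentially. 2 / real n + real I / real n < \<epsilon> / 4" using \<epsilon> by (intro order_tendstoD) auto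
    have "(\<lambda>n. 2 * exp (- (\<theta> * e / 2) * real n)) \<longlonglongrightarrow> 0"
      using \<theta>(1) e by real_asymp
    from order_tendstoD(2)[OF this, of "\<epsilon> / 2"]
    have ev2: "\<forall>\<^sub>F n in sequentially. 2 * exp (- (\<theta> * e / 2) * real n) < \<epsilon> / 2" using \<epsilon> by simp
    show "\<forall>\<^sub>F n in sequentially. \<exists>E\<in>sets canonical. P.prob E \<ge> 1 - \<epsilon> \<and>
       (\<forall>x\<in>E. \<forall>t\<in>{0..T}. \<bar>queue_path (1 / real n) n x t - poly_path (\<lambda>i. (2 * p - 1) * (real i / real (Suc m)), \<lambda>i. partial_sums (snd x) (i * block_size (Suc m) n) / c n) t\<bar> \<le> \<epsilon>)"
      using ev1 ev2 R(2)[OF zero_less_Suc[of m]] eventually_ge_at_top[of "Suc m"]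
    proof eventually_elim
      case (elim n)
      define b where "b = block_size (Suc m) n"
      define A where "A w \<longleftrightarrow> \<not> (\<exists>j\<le>I * b. \<bar>walk w (0 + j) - walk w 0 - (2 * p - 1) * real j\<bar> \<ge> e * real n)" for w
      have n: "n > 0" using elim by simp
      have Ib: "real (I * b) \<le> 2 * real n * real R"
      proof -
        have "real b * real (Suc m) \<le> (real n / real (Suc m) + 1) * real (Suc m)"
          using block_size_bounds(2)[OF zero_less_Suc, of m n] by (intro mult_right_mono) (auto simp: b_def)
        also have "\<dots> = real n + real (Suc m)" by (simp add: field_simps)
        also have "\<dots> \<le> 2 * real n" using elim(4) by linarith
        finally have "real b * real (Suc m) * real R \<le> 2 * real n * real R" by (intro mult_right_mono) auto
        thus ?thesis by (simp only: I_def of_nat_mult mult_ac)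
      qed
      have Am: "Measurable.pred coins A" unfolding A_def by measurable
      have "C.prob {w. \<not> A w} \<le> 2 * exp (- \<theta> * (e * real n) + 4 * \<theta>\<^sup>2 * real (I * b))"
        using walk_maximal_inequality[OF p less_imp_le[OF \<theta>(1)] \<theta>(2), where b="I * b" and s=0 and x="e * real n"] by (simp add: A_def)
      also have "4 * \<theta>\<^sup>2 * real (I * b) \<le> 4 * \<theta>\<^sup>2 * (2 * real n * real R)" using Ib by (intro mult_left_mono) auto
      also have "\<dots> = 8 * \<theta> * (\<theta> * real R) * real n" by (simp add: power2_eq_square)
      also have "\<theta> * real R \<le> e / 16" using \<theta>(3) R by (simp add: field_simps)
      hence "8 * \<theta> * (\<theta> * real R) * real n \<le> 8 * \<theta> * (e / 16) * real n"
        using \<theta>(1) by (intro mult_right_mono mult_left_mono) auto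
      also have "- \<theta> * (e * real n) + 8 * \<theta> * (e / 16) * real n = - (\<theta> * e / 2) * real n" by simp
      finally have "C.prob {w. \<not> A w} \<le> 2 * exp (- (\<theta> * e / 2) * real n)" by simp
      hence pA: "C.prob {w. \<not> A w} \<le> \<epsilon> / 2" using elim by simp
      have pB: "J.prob {y. partial_sums y (I * b) \<le> c n * T} \<le> \<epsilon> / 2" using elim by (simp only: I_def b_def)
      obtain E where E: "E \<in> sets canonical" "P.prob E \<ge> 1 - \<epsilon>"
        "\<And>x. x \<in> E \<Longrightarrow> A (fst x) \<and> good_knots (partial_sums (snd x)) \<and> partial_sums (snd x) (I * b) > c n * T"
        using approximation_event[OF Am pA pB] by blast
      show ?case
      proof (rule bexI[OF _ E(1)], intro conjI E(2) ballI)
        fix x t assume x: "x \<in> E" and t: "t \<in> {0..T}"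
        note Ex = E(3)[OF x]
        have w: "\<bar>walk (fst x) j - (2 * p - 1) * real j\<bar> \<le> e * real n" if "j \<le> I * block_size (Suc m) n" for j
          using Ex that unfolding A_def b_def by (simp add: not_le) (metis less_imp_le not_le)
        have tot: "2 * e + 2 / real n + 1 / real (Suc m) + real I / real n \<le> \<epsilon>"
          using elim(1) m0[OF m] \<epsilon> unfolding e_def by linarith
        show "\<bar>queue_path (1 / real n) n x t - poly_path (\<lambda>i. (2 * p - 1) * (real i / real (Suc m)), \<lambda>i. partial_sums (snd x) (i * block_size (Suc m) n) / c n) t\<bar> \<le> \<epsilon>"
          unfolding queue_path_def b_def[symmetric]
        proof (rule renewal_polygon_close[OF _ _ c _ _ t])
          fix k i assume ik: "i < I" "i * b \<le> k" "k \<le> Suc i * b"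
          show "\<bar>1 / real n * real (coin_chain (fst x) k) - (2 * p - 1) * (real i / real (Suc m))\<bar> \<le> \<epsilon> \<and>
            \<bar>1 / real n * real (coin_chain (fst x) k) - (2 * p - 1) * (real (Suc i) / real (Suc m))\<bar> \<le> \<epsilon>"
            using coin_chain_drift_close[where \<rho>="2 * p - 1", OF _ _ n zero_less_Suc ik[unfolded b_def] w] ph p tot
            by (auto intro: order_trans[OF _ tot])
        qed (use Ex in \<open>auto simp: b_def block_size_def\<close>)
      qed
    qed
  qed
qed

text \<open>The heights are deterministic in this regime, so the coin functional is constantly 0
  with the point mass at 0 as its limit law; all randomness sits in the knots.\<close>

lemma drift_convergence:
  assumes ph: "1 / 2 \<le> p"
    and f: "continuous_map U_topology euclideanreal f" "f \<in> borel_measurable cadlag_measure" "bounded (f ` cadlag_space)"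
  shows "(\<lambda>n. \<integral>x. f (queue_path (1 / real n) n x) \<partial>canonical) \<longlonglongrightarrow> (\<integral>\<omega>. f (\<lambda>t\<in>{0..}. (2 * p - 1) * L (K * t) \<omega>) \<partial>completion N)"
proof (rule polygonal_convergence[where \<phi>="\<lambda>_ _ _. 0" and \<psi>="\<lambda>_ _ _. 0" and ?\<mu>1.0="return borel 0" and w'="\<lambda>_ _ _. 0"
      and R="\<lambda>m n x i. (2 * p - 1) * (real i / real (Suc m))" and R'="\<lambda>m x i. (2 * p - 1) * (real i / real (Suc m))"])
  interpret r: prob_space "return borel (0::real)" by (rule prob_space_return) simp
  show "real_distribution (return borel 0)" by unfold_locales simp
  have dc: "distr coins borel (\<lambda>_. 0) = return borel (0::real)" by (rule C.distr_const) simp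
  show "weak_conv_m (\<lambda>n. distr coins borel (\<lambda>_. 0)) (return borel 0)"
    unfolding dc weak_conv_m_def weak_conv_def by simp
  fix m :: nat
  define h where "h = 1 / real (Suc m)"
  have h: "h > 0" by (simp add: h_def)
  define Z where "Z = (\<lambda>\<omega> i. (S (real (Suc i) * h) \<omega> - S (real i * h) \<omega>) / K)"
  define G where "G = (\<lambda>\<omega>. ((\<lambda>i. (W (real (Suc i) * h) \<omega> - W (real i * h) \<omega>) / sqrt h), Z \<omega>))"
  define \<nu> where "\<nu> = Pi\<^sub>M (UNIV::nat set) (\<lambda>_. distr N borel (\<lambda>\<omega>. S h \<omega> / K))"
  have sh: "(\<lambda>\<omega>. S h \<omega> / K) \<in> borel_measurable N" by (rule borel_measurable_divide[OF S_meas]) (use h in auto)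
  interpret std: prob_space std_normal_distribution using prob_space_normal_density[of 1 0] by simp
  interpret \<nu>: prob_space \<nu> unfolding \<nu>_def by (intro prob_space_PiM prob_space_distr sh)
  have gl: "distr N knot_algebra G = Pi\<^sub>M (UNIV::nat set) (\<lambda>_. std_normal_distribution) \<Otimes>\<^sub>M \<nu>"
    unfolding G_def Z_def \<nu>_def by (rule grid_law[OF h K])
  have Gm: "G \<in> measurable N knot_algebra" unfolding G_def Z_def
    using h by (intro measurable_Pair measurable_PiM_single' borel_measurable_divide borel_measurable_diff W_meas S_meas) auto
  have zm: "(\<lambda>x. ((\<lambda>_::nat. 0::real), snd x)) \<in> measurable knot_algebra knot_algebra"
    by (intro measurable_Pair measurable_snd measurable_PiM_single') auto
  \<comment> \<open>The law of the increments of S is obtained from \<open>grid_law\<close> by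
    overwriting its Brownian component with zeros.\<close>
  have "distr N knot_algebra (\<lambda>\<omega>. ((\<lambda>_::nat. 0::real), Z \<omega>)) = distr (distr N knot_algebra G) knot_algebra (\<lambda>x. ((\<lambda>_::nat. 0::real), snd x))"
    by (subst distr_distr[OF zm Gm]) (simp add: comp_def G_def)
  also have "\<dots> = distr (Pi\<^sub>M (UNIV::nat set) (\<lambda>_. std_normal_distribution) \<Otimes>\<^sub>M \<nu>) knot_algebra (\<lambda>(x, y). ((\<lambda>_::nat. 0::real), y))"
    by (simp add: gl split_beta')
  also have "\<dots> = distr (Pi\<^sub>M (UNIV::nat set) (\<lambda>_. std_normal_distribution)) real_sequences (\<lambda>w _. 0) \<Otimes>\<^sub>M distr \<nu> real_sequences (\<lambda>y. y)"
  proof (rule pair_measure_distr[symmetric])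
    show "(\<lambda>y. y) \<in> measurable \<nu> real_sequences" unfolding \<nu>_def
      by (rule measurable_ident_sets) (intro sets_PiM_cong, auto)
    thus "sigma_finite_measure (distr \<nu> real_sequences (\<lambda>y. y))"
      by (intro prob_space_imp_sigma_finite \<nu>.prob_space_distr)
  qed (auto intro!: measurable_PiM_single')
  also have "distr (Pi\<^sub>M (UNIV::nat set) (\<lambda>_. std_normal_distribution)) real_sequences (\<lambda>w (i::nat). 0::real) = Pi\<^sub>M UNIV (\<lambda>_. return borel 0)"
    using distr_PiM_map[OF std.prob_space_axioms, of "\<lambda>_. 0::real" borel] by (simp add: std.distr_const)
  also have "distr \<nu> real_sequences (\<lambda>y. y) = \<nu>"
    by (rule distr_id2) (simp add: \<nu>_def, intro sets_PiM_cong, auto)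
  finally show "distr N knot_algebra (\<lambda>\<omega>. ((\<lambda>_::nat. 0::real), \<lambda>i. (S (real (Suc i) * (1 / real (Suc m))) \<omega> - S (real i * (1 / real (Suc m))) \<omega>) / K))
    = Pi\<^sub>M UNIV (\<lambda>_. return borel 0) \<Otimes>\<^sub>M Pi\<^sub>M UNIV (\<lambda>_. distr N borel (\<lambda>\<omega>. S (1 / real (Suc m)) \<omega> / K))"
    unfolding Z_def \<nu>_def h_def .
next
  show "AE \<omega> in N. limitin U_topology (\<lambda>m. poly_path (\<lambda>i. (2 * p - 1) * (real i / real (Suc m)), grid_knots K (Suc m) (\<lambda>s. S s \<omega>)))
     (\<lambda>t\<in>{0..}. (2 * p - 1) * L (K * t) \<omega>) sequentially"
    using inverse by eventually_elim (rule drift_limit[OF _ K refl])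
qed (use f drift_approximation[OF ph] in auto)

end

section \<open>The critical regime\<close>

lemma partial_sums_block_walk: "partial_sums (\<lambda>i. walk (\<lambda>j. w (i * b + j)) b / x) k = walk w (k * b) / x"
proof -
  have "walk w (k * b + l) = walk w (k * b) + walk (\<lambda>j. w (k * b + j)) l" for k l
    by (induction l) (auto simp: walk_Suc)
  hence "walk w (Suc k * b) = walk w (k * b) + walk (\<lambda>j. w (k * b + j)) b" for k by (simp add: add.commute)
  thus ?thesis by (induction k) (auto simp: partial_sums_Suc add_divide_distrib simp del: mult_Suc)
qed

text \<open>The reflected walk at k and at either block end differ by at most 4 e sqrt n, and
  passing from the chain to the reflected walk costs at most 2. The block sums are divided by sqrt b
  and rescaled by sqrt (b/n), which leaves the walk over sqrt n.\<close>

lemma coin_chain_reflected_close: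
  assumes n: "n > 0" and b: "b > 0" and i: "i < I" and k: "i * b \<le> k" "k \<le> Suc i * b"
    and osc: "\<And>j l. j < I \<Longrightarrow> l \<le> b \<Longrightarrow> \<bar>walk w (j * b + l) - walk w (j * b)\<bar> \<le> e * sqrt (real n)"
    and r: "r = reflected (\<lambda>i. sqrt (real b / real n) * partial_sums (\<lambda>i. walk (\<lambda>j. w (i * b + j)) b / sqrt (real b)) i)"
  shows "\<bar>1 / sqrt (real n) * real (coin_chain w k) - r i\<bar> \<le> 4 * e + 2 / sqrt (real n) \<and>
    \<bar>1 / sqrt (real n) * real (coin_chain w k) - r (Suc i)\<bar> \<le> 4 * e + 2 / sqrt (real n)"
proof -
  define g where "g j = walk w (j * b)" for j
  have "r = reflected (\<lambda>i. 1 / sqrt (real n) * g i)"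
    unfolding r partial_sums_block_walk g_def using b n by (simp add: real_sqrt_divide)
  hence r': "r l = 1 / sqrt (real n) * reflected g l" for l
    using reflected_scale[of "1 / sqrt (real n)" g l] by simp
  have close: "\<bar>1 / sqrt (real n) * real (coin_chain w k) - 1 / sqrt (real n) * reflected g l\<bar> \<le> 4 * e + 2 / sqrt (real n)"
    if "\<bar>reflected (walk w) k - reflected g l\<bar> \<le> 4 * (e * sqrt (real n))" for l
  proof -
    have "\<bar>real (coin_chain w k) - reflected g l\<bar> \<le> 4 * (e * sqrt (real n)) + 2"
      using that coin_chain_reflected[of w k] by linarith
    hence "\<bar>real (coin_chain w k) - reflected g l\<bar> / sqrt (real n) \<le> (4 * (e * sqrt (real n)) + 2) / sqrt (real n)"
      by (rule divide_right_mono) simp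
    thus ?thesis using n by (simp add: diff_divide_distrib[symmetric] abs_divide add_divide_distrib)
  qed
  note rb = reflected_block[OF k b, of "walk w" "e * sqrt (real n)", folded g_def]
  show ?thesis unfolding r' using close rb osc i unfolding g_def by simp
qed

context queue_limit
begin

text \<open>Tolerance and fluctuations are both of order sqrt n, so smallness must come from short
  blocks. One block oscillates by e sqrt n with probability at most 2 exp (- e^2 (m + 1) / 32), and
  the union bound over (m + 1) R blocks still tends to 0 as m grows.\<close>

lemma critical_approximation:
  fixes T :: real
  assumes ph: "p = 1 / 2" and \<epsilon>: "\<epsilon> > 0" and T: "T \<ge> 0"
  shows "\<exists>m0. \<forall>m\<ge>m0. \<forall>\<^sub>F n in sequentially. \<exists>E\<in>sets canonical. P.prob E \<ge> 1 - \<epsilon> \<and>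
       (\<forall>x\<in>E. \<forall>t\<in>{0..T}. \<bar>queue_path (1 / sqrt (real n)) n x t
         - poly_path (reflected (\<lambda>i. sqrt (real (block_size (Suc m) n) / real n) *
             partial_sums (\<lambda>i. walk (\<lambda>j. fst x (i * block_size (Suc m) n + j)) (block_size (Suc m) n) / sqrt (real (block_size (Suc m) n))) i),
           \<lambda>i. partial_sums (snd x) (i * block_size (Suc m) n) / c n) t\<bar> \<le> \<epsilon>)"
proof -
  have "\<epsilon> / 2 > 0" using \<epsilon> by simp
  from arrivals_tail[OF this T] obtain R :: nat where R: "R > 0"
    "\<And>m. m > 0 \<Longrightarrow> \<forall>\<^sub>F n in sequentially. J.prob {y. partial_sums y (m * R * block_size m n) \<le> c n * T} \<le> \<epsilon> / 2" by blast
  define e where "e = \<epsilon> / 8"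
  have e: "e > 0" using \<epsilon> by (simp add: e_def)
  have "(\<lambda>m. 2 * real R * (real (Suc m) * exp (- (e\<^sup>2 / 32) * real (Suc m)))) \<longlonglongrightarrow> 2 * real R * 0"
    by (intro tendsto_mult tendsto_const) (use e in real_asymp)
  hence "\<forall>\<^sub>F m in sequentially. 2 * real R * (real (Suc m) * exp (- (e\<^sup>2 / 32) * real (Suc m))) < \<epsilon> / 2"
    using \<epsilon> by (auto dest: order_tendstoD(2)[where a="\<epsilon> / 2"])
  then obtain m0 where m0: "\<And>m. m \<ge> m0 \<Longrightarrow> 2 * real R * (real (Suc m) * exp (- (e\<^sup>2 / 32) * real (Suc m))) < \<epsilon> / 2"
    unfolding eventually_sequentially by blast
  show ?thesis
  proof (intro exI[of _ m0] allI impI)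
    fix m assume m: "m \<ge> m0"
    define I where "I = Suc m * R"
    have "(\<lambda>n. 2 / sqrt (real n)) \<longlonglongrightarrow> 0" by real_asymp
    hence ev1: "\<forall>\<^sub>F n in sequentially. 2 / sqrt (real n) < \<epsilon> / 2" using \<epsilon> by (auto dest: order_tendstoD(2)[where a="\<epsilon> / 2"])
    have "(\<lambda>n. e * real (Suc m) / 16 * (1 / sqrt (real n))) \<longlonglongrightarrow> e * real (Suc m) / 16 * 0"
      by (intro tendsto_mult tendsto_const) real_asymp
    hence ev2: "\<forall>\<^sub>F n in sequentially. e * real (Suc m) / 16 * (1 / sqrt (real n)) < 1 / 2" by (auto dest: order_tendstoD(2)[where a="1 / 2"])
    show "\<forall>\<^sub>F n in sequentially. \<exists>E\<in>sets canonical. P.prob E \<ge> 1 - \<epsilon> \<and>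
       (\<forall>x\<in>E. \<forall>t\<in>{0..T}. \<bar>queue_path (1 / sqrt (real n)) n x t
         - poly_path (reflected (\<lambda>i. sqrt (real (block_size (Suc m) n) / real n) *
             partial_sums (\<lambda>i. walk (\<lambda>j. fst x (i * block_size (Suc m) n + j)) (block_size (Suc m) n) / sqrt (real (block_size (Suc m) n))) i),
           \<lambda>i. partial_sums (snd x) (i * block_size (Suc m) n) / c n) t\<bar> \<le> \<epsilon>)"
      using ev1 ev2 R(2)[OF zero_less_Suc[of m]] eventually_ge_at_top[of "Suc m"]
    proof eventually_elim
      case (elim n)
      define b where "b = block_size (Suc m) n"
      \<comment> \<open>The minimiser of - \<theta> e sqrt n + 4 \<theta>^2 b for b at its upper
        bound 2 n / (m + 1).\<close>
      define \<theta> where "\<theta> = e * real (Suc m) / 16 * (1 / sqrt (real n))"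
      define X where "X i = {w. \<exists>j\<le>b. \<bar>walk w (i * b + j) - walk w (i * b) - (2 * p - 1) * real j\<bar> \<ge> e * sqrt (real n)}" for i
      define A where "A w \<longleftrightarrow> \<not> (\<exists>i<I. \<exists>j\<le>b. \<bar>walk w (i * b + j) - walk w (i * b) - (2 * p - 1) * real j\<bar> \<ge> e * sqrt (real n))" for w
      have n: "n > 0" using elim by simp
      have b: "b > 0" by (simp add: b_def block_size_def)
      have \<theta>: "0 \<le> \<theta>" "\<theta> \<le> 1 / 2" using elim(2) e unfolding \<theta>_def by auto
      have bb: "real b * real (Suc m) \<le> 2 * real n"
      proof -
        have "real b * real (Suc m) \<le> (real n / real (Suc m) + 1) * real (Suc m)"
          using block_size_bounds(2)[OF zero_less_Suc, of m n] by (intro mult_right_mono) (auto simp: b_def)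
        also have "\<dots> = real n + real (Suc m)" by (simp add: field_simps)
        also have "\<dots> \<le> 2 * real n" using elim(4) by linarith
        finally show ?thesis .
      qed
      have Am: "Measurable.pred coins A" unfolding A_def by measurable
      have Xm: "X i \<in> sets coins" for i
      proof -
        have "{w \<in> space coins. \<exists>j\<le>b. \<bar>walk w (i * b + j) - walk w (i * b) - (2 * p - 1) * real j\<bar> \<ge> e * sqrt (real n)} \<in> sets coins" by measurable
        thus ?thesis by (simp add: X_def)
      qed
      have th1: "\<theta> * (e * sqrt (real n)) = e\<^sup>2 * real (Suc m) / 16" using n by (simp add: \<theta>_def power2_eq_square)
      have "4 * \<theta>\<^sup>2 * real b = e\<^sup>2 * real (Suc m) / 64 * (real b * real (Suc m) / real n)"
        using n by (simp add: \<theta>_def power_mult_distrib power_divide) (simp add: power2_eq_square field_simps)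
      also have "\<dots> \<le> e\<^sup>2 * real (Suc m) / 64 * (2 * real n / real n)"
        using bb by (intro mult_left_mono divide_right_mono) auto
      also have "\<dots> = e\<^sup>2 * real (Suc m) / 32" using n by simp
      finally have th2: "- \<theta> * (e * sqrt (real n)) + 4 * \<theta>\<^sup>2 * real b \<le> - (e\<^sup>2 / 32) * real (Suc m)"
        using th1 by simp
      have pX: "C.prob (X i) \<le> 2 * exp (- (e\<^sup>2 / 32) * real (Suc m))" for i
      proof -
        have "C.prob (X i) \<le> 2 * exp (- \<theta> * (e * sqrt (real n)) + 4 * \<theta>\<^sup>2 * real b)"
          using walk_maximal_inequality[OF p \<theta>, where b=b and s="i * b" and x="e * sqrt (real n)"] by (simp add: X_def)
        also have "\<dots> \<le> 2 * exp (- (e\<^sup>2 / 32) * real (Suc m))" using th2 by simp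
        finally show ?thesis .
      qed
      have "{w. \<not> A w} = (\<Union>i<I. X i)" by (auto simp: A_def X_def)
      hence "C.prob {w. \<not> A w} \<le> (\<Sum>i<I. C.prob (X i))"
        using Xm by (simp, intro C.finite_measure_subadditive_finite) auto
      also have "\<dots> \<le> (\<Sum>i<I. 2 * exp (- (e\<^sup>2 / 32) * real (Suc m)))" by (rule sum_mono) (rule pX)
      also have "\<dots> = 2 * real R * (real (Suc m) * exp (- (e\<^sup>2 / 32) * real (Suc m)))"
        unfolding I_def by (simp only: sum_constant card_lessThan of_nat_mult mult_ac)
      finally have pA: "C.prob {w. \<not> A w} \<le> \<epsilon> / 2" using m0[OF m] by simp
      have pB: "J.prob {y. partial_sums y (I * b) \<le> c n * T} \<le> \<epsilon> / 2" using elim by (simp only: I_def b_def)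
      obtain E where E: "E \<in> sets canonical" "P.prob E \<ge> 1 - \<epsilon>"
        "\<And>x. x \<in> E \<Longrightarrow> A (fst x) \<and> good_knots (partial_sums (snd x)) \<and> partial_sums (snd x) (I * b) > c n * T"
        using approximation_event[OF Am pA pB] by blast
      show ?case unfolding b_def[symmetric]
      proof (rule bexI[OF _ E(1)], intro conjI E(2) ballI)
        fix x t assume x: "x \<in> E" and t: "t \<in> {0..T}"
        note Ex = E(3)[OF x]
        have w: "\<bar>walk (fst x) (j * b + l) - walk (fst x) (j * b)\<bar> \<le> e * sqrt (real n)" if "j < I" "l \<le> b" for j l
          using Ex that ph unfolding A_def by (simp add: not_le) (metis less_imp_le not_le)
        have tot: "4 * e + 2 / sqrt (real n) \<le> \<epsilon>" using elim(1) \<epsilon> unfolding e_def by linarith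
        show "\<bar>queue_path (1 / sqrt (real n)) n x t
         - poly_path (reflected (\<lambda>i. sqrt (real b / real n) *
             partial_sums (\<lambda>i. walk (\<lambda>j. fst x (i * b + j)) b / sqrt (real b)) i), \<lambda>i. partial_sums (snd x) (i * b) / c n) t\<bar> \<le> \<epsilon>"
          unfolding queue_path_def
        proof (rule renewal_polygon_close[OF _ b c _ _ t])
          fix k i assume ik: "i < I" "i * b \<le> k" "k \<le> Suc i * b"
          show "\<bar>1 / sqrt (real n) * real (coin_chain (fst x) k) - reflected (\<lambda>i. sqrt (real b / real n) *
             partial_sums (\<lambda>i. walk (\<lambda>j. fst x (i * b + j)) b / sqrt (real b)) i) i\<bar> \<le> \<epsilon> \<and>
            \<bar>1 / sqrt (real n) * real (coin_chain (fst x) k) - reflected (\<lambda>i. sqrt (real b / real n) *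
             partial_sums (\<lambda>i. walk (\<lambda>j. fst x (i * b + j)) b / sqrt (real b)) i) (Suc i)\<bar> \<le> \<epsilon>"
            using coin_chain_reflected_close[OF n b ik w refl] by (auto intro: order_trans[OF _ tot])
        qed (use Ex in auto)
      qed
    qed
  qed
qed

text \<open>The block functional is normalised to have a standard normal limit for every mesh; the
  factor sqrt (b/n), which tends to sqrt (1 / (m + 1)), restores the scale, and the limiting block
  sums telescope to W on the grid.\<close>

lemma critical_convergence:
  assumes ph: "p = 1 / 2"
    and f: "continuous_map U_topology euclideanreal f" "f \<in> borel_measurable cadlag_measure" "bounded (f ` cadlag_space)"
  shows "(\<lambda>n. \<integral>x. f (queue_path (1 / sqrt (real n)) n x) \<partial>canonical) \<longlonglongrightarrow>
    (\<integral>\<omega>. f (\<lambda>t\<in>{0..}. skorokhod_reflection (\<lambda>s. W s \<omega>) (L (K * t) \<omega>)) \<partial>completion N)"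
proof (rule polygonal_convergence[where
      \<phi>="\<lambda>m n w. walk w (block_size (Suc m) n) / sqrt (real (block_size (Suc m) n))" and
      \<psi>="\<lambda>m n w. walk w (block_size (Suc m) n) / sqrt (real (block_size (Suc m) n))" and ?\<mu>1.0="std_normal_distribution"
      and w'="\<lambda>m \<omega> i. (W (real (Suc i) * (1 / real (Suc m))) \<omega> - W (real i * (1 / real (Suc m))) \<omega>) / sqrt (1 / real (Suc m))"
      and R="\<lambda>m n x. reflected (\<lambda>i. sqrt (real (block_size (Suc m) n) / real n) * partial_sums x i)"
      and R'="\<lambda>m x. reflected (\<lambda>i. sqrt (1 / real (Suc m)) * partial_sums x i)"])
  show "(\<lambda>w. walk w (block_size (Suc m) n) / sqrt (real (block_size (Suc m) n)))
      \<in> borel_measurable (Pi\<^sub>M {..<block_size (Suc m) n} (\<lambda>_. measure_pmf (bernoulli_pmf p)))" for m n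
  proof -
    have "(\<lambda>w. if w j then 1 else -1 :: real) \<in> borel_measurable (Pi\<^sub>M {..<b} (\<lambda>_. measure_pmf (bernoulli_pmf p)))" if "j < b" for j b :: nat
      by (rule measurable_compose[OF measurable_component_singleton, where g="\<lambda>b. if b then 1 else -1"]) (use that in auto)
    thus ?thesis unfolding walk_def by (intro borel_measurable_divide borel_measurable_sum borel_measurable_const) auto
  qed
  show "walk (\<lambda>j\<in>{..<block_size (Suc m) n}. w j) (block_size (Suc m) n) / sqrt (real (block_size (Suc m) n))
      = walk w (block_size (Suc m) n) / sqrt (real (block_size (Suc m) n))" for m n w
    unfolding walk_def by (intro arg_cong2[where f="(/)"] sum.cong) auto
  show "real_distribution std_normal_distribution" by (rule real_dist_normal_dist)
  show "weak_conv_m (\<lambda>n. distr coins borel (\<lambda>w. walk w (block_size (Suc m) n) / sqrt (real (block_size (Suc m) n)))) std_normal_distribution" for m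
    unfolding ph by (rule weak_conv_block_normal[OF block_size_limit(2)]) simp
  show "(\<lambda>\<omega>. (W (real (Suc i) * (1 / real (Suc m))) \<omega> - W (real i * (1 / real (Suc m))) \<omega>) / sqrt (1 / real (Suc m))) \<in> borel_measurable N" for m i
    by (intro borel_measurable_divide borel_measurable_diff W_meas borel_measurable_const) auto
  have ps: "(\<lambda>x. partial_sums x i) \<in> borel_measurable real_sequences" for i unfolding partial_sums_def by measurable
  show "(\<lambda>x. reflected (\<lambda>i. sqrt (real (block_size (Suc m) n) / real n) * partial_sums x i) i) \<in> borel_measurable real_sequences" for m n i
    by (intro reflected_measurable borel_measurable_times ps borel_measurable_const)
  show "(\<lambda>x. reflected (\<lambda>i. sqrt (1 / real (Suc m)) * partial_sums x i) i) \<in> borel_measurable real_sequences" for m i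
    by (intro reflected_measurable borel_measurable_times ps borel_measurable_const)
  show "(\<lambda>n. reflected (\<lambda>i. sqrt (real (block_size (Suc m) n) / real n) * partial_sums (x n) i) i)
       \<longlonglongrightarrow> reflected (\<lambda>i. sqrt (1 / real (Suc m)) * partial_sums x' i) i"
    if "\<And>i. (\<lambda>n. x n i) \<longlonglongrightarrow> x' i" for m x x' i
    unfolding partial_sums_def by (intro reflected_tendsto tendsto_mult tendsto_real_sqrt block_size_limit(1) tendsto_sum that) simp
  show "AE \<omega> in N. limitin U_topology (\<lambda>m. poly_path (reflected (\<lambda>i. sqrt (1 / real (Suc m)) *
        partial_sums (\<lambda>i. (W (real (Suc i) * (1 / real (Suc m))) \<omega> - W (real i * (1 / real (Suc m))) \<omega>) / sqrt (1 / real (Suc m))) i),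
        grid_knots K (Suc m) (\<lambda>s. S s \<omega>)))
     (\<lambda>t\<in>{0..}. skorokhod_reflection (\<lambda>s. W s \<omega>) (L (K * t) \<omega>)) sequentially"
  proof -
    have "AE \<omega> in N. W 0 \<omega> = 0" "AE \<omega> in N. continuous_on {0..} (\<lambda>t. W t \<omega>)"
      using W by (auto simp: standard_brownian_motion_def)
    thus ?thesis using inverse
    proof eventually_elim
      case (elim \<omega>)
      have "(\<lambda>i. sqrt (1 / real (Suc m)) *
        partial_sums (\<lambda>i. (W (real (Suc i) * (1 / real (Suc m))) \<omega> - W (real i * (1 / real (Suc m))) \<omega>) / sqrt (1 / real (Suc m))) i)
        = (\<lambda>i. W (real i / real (Suc m)) \<omega>)" for m
        unfolding partial_sums_telescope[of "\<lambda>i. W (real i * (1 / real (Suc m))) \<omega>"] using elim(1) by (simp del: of_nat_Suc)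
      thus ?case using reflected_limit[OF elim(3) K elim(2) refl] by (simp del: of_nat_Suc)
    qed
  qed
  show "distr N knot_algebra (\<lambda>\<omega>. (\<lambda>i. (W (real (Suc i) * (1 / real (Suc m))) \<omega> - W (real i * (1 / real (Suc m))) \<omega>) / sqrt (1 / real (Suc m)),
       \<lambda>i. (S (real (Suc i) * (1 / real (Suc m))) \<omega> - S (real i * (1 / real (Suc m))) \<omega>) / K))
     = Pi\<^sub>M UNIV (\<lambda>_. std_normal_distribution) \<Otimes>\<^sub>M Pi\<^sub>M UNIV (\<lambda>_. distr N borel (\<lambda>\<omega>. S (1 / real (Suc m)) \<omega> / K))" for m
    by (rule grid_law[OF _ K]) simp
qed (erule (1) critical_approximation[OF ph], fact f(1), fact f(2), fact f(3))

end

section \<open>Subcritical regime\<close>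

text \<open>A geometric drift condition for the function x^i. Off 0 a step multiplies it on average
  by p x + (1 - p) / x. The choice x = 2 (1 - p) > 1 makes the second term 1/2, and then 1 - \<phi>
  = 2 (1/2 - p)^2 > 0. The means satisfy E_(k+1) \<le> x + \<phi> E_k, so they stay below 1 + x / (1
  - \<phi>).\<close>

lemma coin_chain_exponential_moment:
  fixes p :: real
  assumes p: "0 \<le> p" "p < 1 / 2"
  defines "x \<equiv> 2 * (1 - p)" and "\<phi> \<equiv> 2 * p * (1 - p) + 1 / 2"
  shows "integrable (coin_space p) (\<lambda>w. x ^ coin_chain w k)" "(\<integral>w. x ^ coin_chain w k \<partial>coin_space p) \<le> 1 + x / (1 - \<phi>)"
proof -
  interpret prob_space "coin_space p" by (rule prob_space_coin_space)
  have x: "x > 1" using p by (simp add: x_def)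
  have "0 < (1 / 2 - p)\<^sup>2" using p by simp
  hence \<phi>: "\<phi> < 1" by (simp add: \<phi>_def power2_eq_square algebra_simps)
  have "0 \<le> p * (1 - p)" using p by simp
  hence \<phi>0: "0 < \<phi>" by (simp add: \<phi>_def)
  have le: "coin_chain w k \<le> k" for w k by (induction k) auto
  show int: "integrable (coin_space p) (\<lambda>w. x ^ coin_chain w k)" for k
    by (rule integrable_const_bound[where B="x ^ k"]) (use x le in \<open>auto intro!: power_increasing\<close>)
  define g where "g b = (if b then x else 1 / x)" for b
  have "1 / x \<le> x" using x by (intro order_trans[of "1 / x" 1 x]) auto
  hence gx: "norm (g b) \<le> x" for b using x by (simp add: g_def)
  have gi: "integrable (coin_space p) (\<lambda>w. g (w k))" for k
    by (rule integrable_const_bound[where B=x]) (use gx in auto)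
  have Eg: "expectation (\<lambda>w. g (w k)) = \<phi>" for k
  proof -
    have "expectation (\<lambda>w. g (w k)) = (\<integral>b. g b \<partial>distr (coin_space p) (count_space UNIV) (\<lambda>w. w k))"
      by (subst integral_distr) auto
    also have "\<dots> = p * x + (1 - p) / x" unfolding distr_coin using p by (simp add: g_def)
    also have "(1 - p) / x = 1 / 2" using p by (simp add: x_def)
    also have "p * x + 1 / 2 = \<phi>" by (simp add: x_def \<phi>_def)
    finally show ?thesis .
  qed
  \<comment> \<open>From 0 the chain moves to 1 whatever the toss, and the additive term is x^1;
    elsewhere the power is multiplied by x or by 1/x.\<close>
  have step: "x ^ coin_chain w (Suc k) \<le> x + x ^ coin_chain w k * g (w k)" for w k
  proof (cases "coin_chain w k")
    case (Suc l)
    thus ?thesis using x by (simp add: g_def)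
  qed (use x in \<open>simp add: g_def\<close>)
  show "(\<integral>w. x ^ coin_chain w k \<partial>coin_space p) \<le> 1 + x / (1 - \<phi>)"
  proof (induction k)
    case 0
    show ?case using x \<phi> prob_space by simp
  next
    case (Suc k)
    have ccong: "coin_chain (\<lambda>i\<in>{..<k}. w i) k = coin_chain w k" for w by (rule coin_chain_cong) auto
    have "indep_var borel (\<lambda>w. x ^ coin_chain (\<lambda>i\<in>{..<k}. w i) k) borel (\<lambda>w. g (w k))"
      by (rule indep_var_past_present[OF indep_vars_coin]) (auto intro: measurable_compose[OF measurable_coin_chain_PiM[OF order_refl]])
    hence ind: "indep_var borel (\<lambda>w. x ^ coin_chain w k) borel (\<lambda>w. g (w k))" unfolding ccong .
    note prod = indep_var_lebesgue_integral[OF ind int gi] indep_var_integrable[OF ind int gi]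
    have "expectation (\<lambda>w. x ^ coin_chain w (Suc k)) \<le> expectation (\<lambda>w. x + x ^ coin_chain w k * g (w k))"
      by (rule integral_mono[OF int _ step]) (use prod in auto)
    also have "\<dots> = x + expectation (\<lambda>w. x ^ coin_chain w k) * \<phi>" using prod Eg prob_space by simp
    also have "\<dots> \<le> x + (1 + x / (1 - \<phi>)) * \<phi>" using Suc \<phi>0 by (intro add_left_mono mult_right_mono) auto
    also have "\<dots> = \<phi> + x / (1 - \<phi>)" using \<phi> by (simp add: field_simps)
    finally show ?case using \<phi> by simp
  qed
qed

lemma coin_chain_tail:
  assumes p: "0 \<le> p" "p < 1 / 2"
  shows "\<exists>C x. C > 0 \<and> x > 1 \<and> (\<forall>k a. measure (coin_space p) {w. real (coin_chain w k) \<ge> a} \<le> C * x powr (- a))"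
proof -
  interpret prob_space "coin_space p" by (rule prob_space_coin_space)
  define x where "x = 2 * (1 - p)"
  define \<phi> where "\<phi> = 2 * p * (1 - p) + 1 / 2"
  have x: "x > 1" using p by (simp add: x_def)
  have "0 < (1 / 2 - p)\<^sup>2" using p by simp
  hence \<phi>: "\<phi> < 1" by (simp add: \<phi>_def power2_eq_square algebra_simps)
  note mom = coin_chain_exponential_moment[OF p, folded x_def \<phi>_def]
  have "measure (coin_space p) {w. real (coin_chain w k) \<ge> a} \<le> (1 + x / (1 - \<phi>)) * x powr (- a)" for k a
  proof -
    have "prob {w\<in>space (coin_space p). real (coin_chain w k) \<ge> a} \<le> prob {w\<in>space (coin_space p). x ^ coin_chain w k \<ge> x powr a}"
    proof (rule finite_measure_mono)
      show "{w\<in>space (coin_space p). real (coin_chain w k) \<ge> a} \<subseteq> {w\<in>space (coin_space p). x ^ coin_chain w k \<ge> x powr a}"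
        using x by (auto simp: powr_realpow[symmetric])
    qed measurable
    also have "\<dots> \<le> expectation (\<lambda>w. x ^ coin_chain w k) / x powr a"
      by (rule integral_Markov_inequality_measure[where A="{}"]) (use x mom in auto)
    also have "\<dots> \<le> (1 + x / (1 - \<phi>)) / x powr a" using mom(2) by (rule divide_right_mono) simp
    finally show ?thesis using x by (simp add: powr_minus divide_inverse)
  qed
  moreover have "1 + x / (1 - \<phi>) > 0" using x \<phi> by (intro add_pos_pos divide_pos_pos) auto
  ultimately show ?thesis using x by blast
qed

lemma summable_stretched_exponential:
  assumes "C > 0" "x > 1" "e > 0" "\<delta> > 0"
  shows "summable (\<lambda>n. real (n ^ Suc A) * (C * x powr (- (e * real n powr \<delta>))))"
proof -
  have l: "ln x > 0" using assms by simp
  have "(\<lambda>n. real n powr real (A + 3) * (C * exp (- (e * ln x * real n powr \<delta>)))) \<longlonglongrightarrow> 0"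
    using assms l by real_asymp
  hence "\<forall>\<^sub>F n in sequentially. real n powr real (A + 3) * (C * exp (- (e * ln x * real n powr \<delta>))) < 1"
    by (rule order_tendstoD) simp
  hence "\<forall>\<^sub>F n in sequentially. norm (real (n ^ Suc A) * (C * x powr (- (e * real n powr \<delta>)))) \<le> 1 / real n ^ 2"
    using eventually_gt_at_top[of 0]
  proof eventually_elim
    case (elim n)
    have "x powr (- (e * real n powr \<delta>)) = exp (- (e * ln x * real n powr \<delta>))"
      using assms by (simp add: powr_def mult_ac)
    moreover have "real n powr real (A + 3) = real (n ^ Suc A) * real n ^ 2"
      using elim by (simp only: powr_realpow) (simp add: power_add power2_eq_square power3_eq_cube)
    ultimately show ?case using elim assms by (simp add: field_simps)
  qed
  thus ?thesis by (rule summable_comparison_test_ev) (simp add: inverse_power_summable flip: inverse_eq_divide)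
qed

lemma summable_superexponential:
  assumes \<rho>: "0 < \<rho>" "\<rho> < (1::real)"
  shows "summable (\<lambda>n. exp (D * real n ^ A) * \<rho> ^ (n ^ Suc A))"
proof -
  define s where "s = - ln \<rho>"
  have s: "s > 0" using \<rho> by (simp add: s_def)
  have "\<forall>\<^sub>F n in sequentially. real n > 2 * D / s" by real_asymp
  hence "\<forall>\<^sub>F n in sequentially. norm (exp (D * real n ^ A) * \<rho> ^ (n ^ Suc A)) \<le> exp (- s / 2) ^ n"
    using eventually_gt_at_top[of 0]
  proof eventually_elim
    case (elim n)
    have "\<rho> = exp (- s)" using \<rho> by (simp add: s_def)
    hence "exp (D * real n ^ A) * \<rho> ^ (n ^ Suc A) = exp (real n ^ A * (D - s * real n))"
      by (simp add: exp_of_nat_mult[symmetric] exp_add[symmetric] algebra_simps)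
    moreover have "real n ^ A * (D - s * real n) \<le> 1 * (- (s / 2) * real n)"
    proof -
      have *: "D - s * real n \<le> - (s / 2) * real n" using elim s by (simp add: field_simps)
      have "real n ^ A * (D - s * real n) \<le> real n ^ A * (- (s / 2) * real n)" using * by (intro mult_left_mono) auto
      also have "\<dots> \<le> 1 * (- (s / 2) * real n)" using elim s by (intro mult_right_mono_neg) auto
      finally show ?thesis .
    qed
    ultimately show ?case by (simp add: exp_of_nat_mult[symmetric] mult_ac)
  qed
  thus ?thesis by (rule summable_comparison_test_ev) (use s in \<open>auto intro!: summable_geometric\<close>)
qed

text \<open>Since c_n grows at most like n^A, more than n^(A + 1) arrivals before c_n T have
  superexponentially small probability. Among that many steps the chain exceeds e n^\<delta> with a
  stretched exponentially small probability. Both bounds are summable, and the levels 1 / (i + 1)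
  with integer horizons leave only countably many exceptional events.\<close>

lemma (in prob_space) scaled_queue_vanishes:
  fixes q :: "nat \<Rightarrow> 'a \<Rightarrow> nat" and y :: "nat \<Rightarrow> 'a \<Rightarrow> real"
  assumes q[measurable]: "\<And>k. q k \<in> measurable M (count_space UNIV)" and y[measurable]: "\<And>k. y k \<in> borel_measurable M"
    and good: "AE \<omega> in M. good_knots (partial_sums (\<lambda>k. y k \<omega>))"
    and C: "C > 0" "x > 1" "\<And>k a. \<P>(\<omega> in M. real (q k \<omega>) \<ge> a) \<le> C * x powr (- a)"
    and \<rho>: "0 < \<rho>" "\<rho> < 1" "\<And>k t. \<P>(\<omega> in M. partial_sums (\<lambda>k. y k \<omega>) k \<le> t) \<le> exp t * \<rho> ^ k"
    and c: "\<forall>\<^sub>F n in sequentially. c n > 0" "\<And>n. c n \<le> D * real n ^ A" and \<delta>: "\<delta> > 0"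
  shows "AE \<omega> in M. \<forall>T\<ge>0. (\<lambda>n. SUP t\<in>{0..T}. ereal (real n powr (- \<delta>) * real (q (arrivals (\<lambda>k. y k \<omega>) (c n * t)) \<omega>))) \<longlonglongrightarrow> 0"
proof -
  have [measurable]: "(\<lambda>\<omega>. partial_sums (\<lambda>k. y k \<omega>) i) \<in> borel_measurable M" for i unfolding partial_sums_def by measurable
  define e where "e i = 1 / real (Suc i)" for i
  have e: "e i > 0" for i by (simp add: e_def)
  define X where "X i T n = {\<omega>\<in>space M. (\<exists>k<n ^ Suc A. real (q k \<omega>) \<ge> e i * real n powr \<delta>) \<or>
      partial_sums (\<lambda>k. y k \<omega>) (n ^ Suc A) \<le> c n * real T}" for i T n :: nat
  have Xm[measurable]: "X i T n \<in> sets M" for i T n unfolding X_def by measurable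
  have "AE \<omega> in M. \<forall>i T. \<forall>\<^sub>F n in sequentially. \<omega> \<in> space M - X i T n"
  proof (subst AE_all_countable, rule allI, subst AE_all_countable, rule allI, rule borel_cantelli_AE1)
    fix i T :: nat
    have bound: "prob (X i T n) \<le> real (n ^ Suc A) * (C * x powr (- (e i * real n powr \<delta>))) + exp ((D * real T) * real n ^ A) * \<rho> ^ (n ^ Suc A)" for n
    proof -
      have "X i T n = (\<Union>k<n ^ Suc A. {\<omega>\<in>space M. real (q k \<omega>) \<ge> e i * real n powr \<delta>}) \<union>
         {\<omega>\<in>space M. partial_sums (\<lambda>k. y k \<omega>) (n ^ Suc A) \<le> c n * real T}" by (auto simp: X_def)
      hence "prob (X i T n) \<le> prob (\<Union>k<n ^ Suc A. {\<omega>\<in>space M. real (q k \<omega>) \<ge> e i * real n powr \<delta>}) +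
         prob {\<omega>\<in>space M. partial_sums (\<lambda>k. y k \<omega>) (n ^ Suc A) \<le> c n * real T}"
        by (simp only:) (intro measure_Un_le, measurable)
      also have "prob (\<Union>k<n ^ Suc A. {\<omega>\<in>space M. real (q k \<omega>) \<ge> e i * real n powr \<delta>}) \<le> (\<Sum>k<n ^ Suc A. prob {\<omega>\<in>space M. real (q k \<omega>) \<ge> e i * real n powr \<delta>})"
        by (intro finite_measure_subadditive_finite) auto
      also have "\<dots> \<le> (\<Sum>k<n ^ Suc A. C * x powr (- (e i * real n powr \<delta>)))" by (intro sum_mono C)
      also have "\<dots> = real (n ^ Suc A) * (C * x powr (- (e i * real n powr \<delta>)))" by (simp only: sum_constant card_lessThan)
      also have "prob {\<omega>\<in>space M. partial_sums (\<lambda>k. y k \<omega>) (n ^ Suc A) \<le> c n * real T} \<le> exp (c n * real T) * \<rho> ^ (n ^ Suc A)" by (rule \<rho>)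
      also have "\<dots> \<le> exp ((D * real T) * real n ^ A) * \<rho> ^ (n ^ Suc A)"
        using mult_right_mono[OF c(2)[of n], of "real T"] \<rho> by (intro mult_right_mono) (auto simp: mult_ac)
      finally show ?thesis by simp
    qed
    show "summable (\<lambda>n. prob (X i T n))"
    proof (rule summable_comparison_test)
      show "summable (\<lambda>n. real (n ^ Suc A) * (C * x powr (- (e i * real n powr \<delta>))) + exp ((D * real T) * real n ^ A) * \<rho> ^ (n ^ Suc A))"
        by (intro summable_add summable_stretched_exponential summable_superexponential C \<rho> e \<delta>)
    qed (use bound in auto)
  qed (auto simp: emeasure_eq_measure)
  thus ?thesis using good
  proof eventually_elim
    case (elim \<omega>)
    show ?case
    proof (intro allI impI)
      fix T :: real assume T: "T \<ge> 0"
      define H where "H n = (SUP t\<in>{0..T}. ereal (real n powr (- \<delta>) * real (q (arrivals (\<lambda>k. y k \<omega>) (c n * t)) \<omega>)))" for n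
      obtain T' :: nat where T': "T \<le> real T'" using real_arch_simple by blast
      have H0: "0 \<le> H n" for n unfolding H_def
        by (rule SUP_upper2[of 0]) (use T in auto)
      have Hle: "\<forall>\<^sub>F n in sequentially. H n \<le> ereal (e i)" for i
        using elim(1)[rule_format, of i T'] c(1) eventually_gt_at_top[of 0]
      proof eventually_elim
        case (elim n)
        note n = elim
        show ?case unfolding H_def
        proof (rule SUP_least)
          fix t assume t: "t \<in> {0..T}"
          define k where "k = arrivals (\<lambda>k. y k \<omega>) (c n * t)"
          have g: "good_knots (partial_sums (\<lambda>k. y k \<omega>))" by fact
          have ct: "0 \<le> c n * t" "c n * t \<le> c n * real T'" using t n T' by (auto intro: mult_left_mono)
          have "partial_sums (\<lambda>k. y k \<omega>) k \<le> c n * t" unfolding k_def by (rule arrivals_bounds(1)[OF g ct(1)])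
          also have "\<not> partial_sums (\<lambda>k. y k \<omega>) (n ^ Suc A) \<le> c n * real T'" using n by (auto simp: X_def)
          hence "c n * t < partial_sums (\<lambda>k. y k \<omega>) (n ^ Suc A)" using ct by linarith
          finally have "k < n ^ Suc A" using strict_mono_less[OF good_knots_strict_mono[OF g]] by simp
          hence "real (q k \<omega>) < e i * real n powr \<delta>" using n unfolding X_def by (auto simp: not_le)
          hence "real n powr (- \<delta>) * real (q k \<omega>) \<le> real n powr (- \<delta>) * (e i * real n powr \<delta>)" by (intro mult_left_mono) auto
          also have "\<dots> = e i" using n by (simp add: powr_minus field_simps)
          finally show "ereal (real n powr (- \<delta>) * real (q (arrivals (\<lambda>k. y k \<omega>) (c n * t)) \<omega>)) \<le> ereal (e i)"
            by (simp add: k_def)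
        qed
      qed
      have "H \<longlonglongrightarrow> 0"
      proof (rule order_tendstoI)
        fix a :: ereal assume "a < 0"
        thus "\<forall>\<^sub>F n in sequentially. a < H n" using H0 by (intro always_eventually allI) (rule less_le_trans)
      next
        fix a :: ereal assume a: "0 < a"
        have "\<exists>i. ereal (e i) < a"
        proof (cases a)
          case (real r)
          then obtain i where "inverse (real (Suc i)) < r" using a reals_Archimedean by auto
          thus ?thesis using real by (auto simp: e_def inverse_eq_divide)
        qed (use a in auto)
        then obtain i where "ereal (e i) < a" by blast
        thus "\<forall>\<^sub>F n in sequentially. H n < a" using Hle[of i] by (auto elim: eventually_mono)
      qed
      thus "(\<lambda>n. SUP t\<in>{0..T}. ereal (real n powr (- \<delta>) * real (q (arrivals (\<lambda>k. y k \<omega>) (c n * t)) \<omega>))) \<longlonglongrightarrow> 0"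
        by (simp only: H_def[abs_def])
    qed
  qed
qed

section \<open>Queue and limit processes\<close>

lemma (in prob_space) distr_eq_by_tails:
  fixes X Z :: "'a \<Rightarrow> real"
  assumes X: "X \<in> borel_measurable M" and Z: "Z \<in> borel_measurable M"
    and pos: "AE \<omega> in M. 0 \<le> X \<omega>" "AE \<omega> in M. 0 \<le> Z \<omega>"
    and eq: "\<And>t. t \<ge> 0 \<Longrightarrow> \<P>(\<omega> in M. X \<omega> > t) = \<P>(\<omega> in M. Z \<omega> > t)"
  shows "distr M borel X = distr M borel Z"
proof (rule cdf_unique)
  show "real_distribution (distr M borel X)" "real_distribution (distr M borel Z)"
    using X Z by (auto intro: real_distribution_distr)
  have cdf: "cdf (distr M borel V) t = (if t \<ge> 0 then 1 - \<P>(\<omega> in M. V \<omega> > t) else 0)"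
    if V: "V \<in> borel_measurable M" "AE \<omega> in M. 0 \<le> V \<omega>" for V t
  proof -
    note [measurable] = V(1)
    have c: "cdf (distr M borel V) t = \<P>(\<omega> in M. V \<omega> \<le> t)"
      by (simp add: cdf_def measure_distr vimage_def Int_def conj_commute)
    have "\<P>(\<omega> in M. V \<omega> \<le> t) = 1 - \<P>(\<omega> in M. V \<omega> > t)"
      using prob_neg[of "\<lambda>\<omega>. V \<omega> > t"] by (simp add: not_less)
    moreover have "\<P>(\<omega> in M. V \<omega> \<le> t) = 0" if "t < 0"
    proof (subst prob_Collect_eq_0)
      show "AE \<omega> in M. \<not> V \<omega> \<le> t" using V(2) by eventually_elim (use that in simp)
    qed measurable
    ultimately show ?thesis using c by simp
  qed
  show "cdf (distr M borel X) = cdf (distr M borel Z)"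
    using cdf[OF X pos(1)] cdf[OF Z pos(2)] eq by (intro ext) simp
qed

text \<open>Makes the given space interchangeable with the canonical one: the joint law of the chain
  and the interarrival times is the product of the coin chain law and an i.i.d. law.\<close>

lemma (in prob_space) queue_law:
  fixes q :: "nat \<Rightarrow> 'a \<Rightarrow> nat" and Y :: "nat \<Rightarrow> 'a \<Rightarrow> real"
  assumes queue: "fast_renewal_ML_queue M \<alpha> \<beta> lam mu p q Y" and p: "0 \<le> p" "p \<le> 1"
  shows "q k \<in> measurable M (count_space UNIV)" "k \<ge> 1 \<Longrightarrow> Y k \<in> borel_measurable M"
    "(\<lambda>\<omega>. (\<lambda>k. q k \<omega>, \<lambda>k. Y (Suc k) \<omega>)) \<in> measurable M queue_algebra"
    "distr M queue_algebra (\<lambda>\<omega>. (\<lambda>k. q k \<omega>, \<lambda>k. Y (Suc k) \<omega>)) =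
     distr (coin_space p) nat_sequences coin_chain \<Otimes>\<^sub>M Pi\<^sub>M UNIV (\<lambda>_. distr M borel (Y 1))"
proof -
  have q: "markov_chain M q (queue_transition p)" "AE \<omega> in M. q 0 \<omega> = 0"
    and ind: "indep_vars (\<lambda>_. borel) Y {1..}"
    and tail: "\<And>k t. k \<ge> 1 \<Longrightarrow> t \<ge> 0 \<Longrightarrow> \<P>(\<omega> in M. Y k \<omega> > t) =
        mittag_leffler \<alpha> (- lam * t powr \<alpha>) * mittag_leffler \<beta> (- mu * t powr \<beta>)"
    and qY: "indep_var (Pi\<^sub>M UNIV (\<lambda>_. count_space UNIV)) (\<lambda>\<omega> k. real (q k \<omega>)) (Pi\<^sub>M {1..} (\<lambda>_. borel)) (\<lambda>\<omega>. \<lambda>k\<in>{1..}. Y k \<omega>)"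
    using queue unfolding fast_renewal_ML_queue_def by auto
  show qm: "q k \<in> measurable M (count_space UNIV)" for k using q by (simp add: markov_chain_def)
  show Ym: "Y k \<in> borel_measurable M" if "k \<ge> 1" for k using ind that by (auto simp: indep_vars_def2)
  show "(\<lambda>\<omega>. (\<lambda>k. q k \<omega>, \<lambda>k. Y (Suc k) \<omega>)) \<in> measurable M queue_algebra"
    using qm Ym by (intro measurable_Pair measurable_PiM_single') auto
  have pos: "AE \<omega> in M. 0 \<le> Y k \<omega>" if k: "k \<ge> 1" for k
  proof -
    note [measurable] = Ym[OF k]
    have "\<P>(\<omega> in M. Y k \<omega> > 0) = 1" using tail[OF k, of 0] by (simp add: mittag_leffler_0)
    hence "AE \<omega> in M. Y k \<omega> > 0" by (subst (asm) prob_Collect_eq_1) auto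
    thus ?thesis by eventually_elim simp
  qed
  have id: "distr M borel (Y (Suc k)) = distr M borel (Y 1)" for k
    by (rule distr_eq_by_tails) (use Ym pos tail in auto)
  \<comment> \<open>Interarrival times are numbered from 1 in the queue and from 0 on the canonical
    space.\<close>
  define sh where "sh y = (\<lambda>k. y (Suc k))" for y :: "nat \<Rightarrow> real"
  have shm: "sh \<in> measurable (Pi\<^sub>M {1..} (\<lambda>_. borel)) real_sequences"
    unfolding sh_def by (intro measurable_PiM_single' measurable_component_singleton) auto
  have she: "sh \<circ> (\<lambda>\<omega>. \<lambda>k\<in>{1..}. Y k \<omega>) = (\<lambda>\<omega> k. Y (Suc k) \<omega>)" by (simp add: fun_eq_iff sh_def)
  have Yrm: "(\<lambda>\<omega>. \<lambda>k\<in>{1..}. Y k \<omega>) \<in> measurable M (Pi\<^sub>M {1..} (\<lambda>_. borel))"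
    using qY by (rule indep_var_rv2)
  have "distr M (Pi\<^sub>M {1..} (\<lambda>_. borel)) (\<lambda>\<omega>. \<lambda>k\<in>{1..}. Y k \<omega>) = Pi\<^sub>M {1..} (\<lambda>k. distr M borel (Y k))"
    using ind Ym by (subst (asm) indep_vars_iff_distr_eq_PiM') auto
  hence "distr M real_sequences (sh \<circ> (\<lambda>\<omega>. \<lambda>k\<in>{1..}. Y k \<omega>)) = distr (Pi\<^sub>M {1..} (\<lambda>k. distr M borel (Y k))) real_sequences sh"
    by (subst distr_distr[OF shm Yrm, symmetric]) (simp only:)
  also have "\<dots> = distr (Pi\<^sub>M {1..} (\<lambda>k. distr M borel (Y k))) (Pi\<^sub>M UNIV (\<lambda>k. distr M borel (Y (Suc k)))) (\<lambda>\<omega>. \<lambda>n\<in>UNIV. \<omega> (Suc n))"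
    by (rule distr_cong) (auto simp: sh_def intro!: sets_PiM_cong)
  also have "\<dots> = Pi\<^sub>M UNIV (\<lambda>k. distr M borel (Y (Suc k)))"
    by (rule distr_PiM_reindex) (use Ym in \<open>auto intro: prob_space_distr\<close>)
  finally have Yd: "distr M real_sequences (\<lambda>\<omega> k. Y (Suc k) \<omega>) = Pi\<^sub>M UNIV (\<lambda>_. distr M borel (Y 1))"
    unfolding she id .
  define A where "A = Pi\<^sub>M (UNIV::nat set) (\<lambda>_. count_space (UNIV::real set))"
  define B where "B = Pi\<^sub>M {1::nat..} (\<lambda>_. borel :: real measure)"
  define X where "X = (\<lambda>\<omega> k. real (q k \<omega>))"
  define Z where "Z = (\<lambda>\<omega>. \<lambda>k\<in>{1..}. Y k \<omega>)"
  \<comment> \<open>\<open>indep_var\<close> takes two variables of one type, so independence is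
    stated for the chain embedded into the reals by \<open>real\<close>; \<open>bk\<close> undoes
    the embedding and is measurable on the discrete product.\<close>
  define bk where "bk x = (\<lambda>k. nat \<lfloor>x k\<rfloor>)" for x :: "nat \<Rightarrow> real"
  have XZ: "X \<in> measurable M A" "Z \<in> measurable M B" "distr M A X \<Otimes>\<^sub>M distr M B Z = distr M (A \<Otimes>\<^sub>M B) (\<lambda>\<omega>. (X \<omega>, Z \<omega>))"
    using qY unfolding indep_var_distribution_eq A_def B_def X_def Z_def by auto
  have bkm: "bk \<in> measurable A nat_sequences"
    unfolding bk_def A_def
    by (intro measurable_PiM_single' measurable_compose[OF measurable_component_singleton, where g="\<lambda>r. nat \<lfloor>r\<rfloor>"]) auto
  have bkX: "bk \<circ> X = (\<lambda>\<omega> k. q k \<omega>)" by (simp add: fun_eq_iff bk_def X_def)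
  note shm' = shm[folded B_def] and she' = she[folded Z_def]
  interpret Z: prob_space "distr M B Z" by (rule prob_space_distr[OF XZ(2)])
  have bs: "(\<lambda>(x, y). (bk x, sh y)) \<in> measurable (A \<Otimes>\<^sub>M B) queue_algebra"
    unfolding split_beta' by (intro measurable_Pair measurable_compose[OF measurable_fst bkm] measurable_compose[OF measurable_snd shm'])
  have "distr M queue_algebra (\<lambda>\<omega>. (\<lambda>k. q k \<omega>, \<lambda>k. Y (Suc k) \<omega>)) = distr M queue_algebra (\<lambda>\<omega>. ((bk \<circ> X) \<omega>, (sh \<circ> Z) \<omega>))"
    by (simp only: bkX she')
  also have "\<dots> = distr (distr M (A \<Otimes>\<^sub>M B) (\<lambda>\<omega>. (X \<omega>, Z \<omega>))) queue_algebra (\<lambda>(x, y). (bk x, sh y))"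
    by (subst distr_distr[OF bs measurable_Pair[OF XZ(1,2)]]) (simp add: comp_def)
  also have "\<dots> = distr (distr M A X) nat_sequences bk \<Otimes>\<^sub>M distr (distr M B Z) real_sequences sh"
    unfolding XZ(3)[symmetric]
    by (rule pair_measure_distr[symmetric]) (use bkm shm' in \<open>auto intro!: prob_space_imp_sigma_finite Z.prob_space_distr\<close>)
  also have "distr (distr M A X) nat_sequences bk = distr (coin_space p) nat_sequences coin_chain"
    unfolding distr_distr[OF bkm XZ(1)] bkX by (rule distr_queue_chain[OF prob_space_axioms q p])
  also have "distr (distr M B Z) real_sequences sh = Pi\<^sub>M UNIV (\<lambda>_. distr M borel (Y 1))"
    unfolding distr_distr[OF shm' XZ(2)] she' by (rule Yd)
  finally show "distr M queue_algebra (\<lambda>\<omega>. (\<lambda>k. q k \<omega>, \<lambda>k. Y (Suc k) \<omega>)) =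
     distr (coin_space p) nat_sequences coin_chain \<Otimes>\<^sub>M Pi\<^sub>M UNIV (\<lambda>_. distr M borel (Y 1))" .
qed

text \<open>The process agrees with the everywhere measurable path V only off a null set, so
  measurability and integrals are transferred through the completion.\<close>

lemma (in prob_space) almost_cadlag_variable:
  fixes f :: "(real \<Rightarrow> real) \<Rightarrow> real"
  assumes V: "V \<in> measurable M cadlag_measure" and eq: "AE \<omega> in M. sample_path X \<omega> = V \<omega>"
  shows "cadlag_process M X"
    "f \<in> borel_measurable cadlag_measure \<Longrightarrow> (\<integral>\<omega>. f (sample_path X \<omega>) \<partial>completion M) = (\<integral>\<omega>. f (V \<omega>) \<partial>M)"
proof -
  show "cadlag_process M X" unfolding cadlag_process_def
  proof (intro conjI allI impI)
    show "AE \<omega> in M. sample_path X \<omega> \<in> cadlag_space"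
      using eq AE_space by eventually_elim (use measurable_space[OF V] in \<open>simp add: space_cadlag_measure\<close>)
    fix t :: real assume t: "t \<ge> 0"
    have "(\<lambda>x. x t) \<in> borel_measurable cadlag_measure"
      unfolding cadlag_measure_def using t by (intro measurable_restrict_space1 measurable_component_singleton) simp
    hence Vt: "(\<lambda>\<omega>. V \<omega> t) \<in> borel_measurable M" by (rule measurable_compose[OF V])
    have "AE \<omega> in M. X t \<omega> = V \<omega> t"
      using eq by eventually_elim (use t in \<open>auto simp: sample_path_def fun_eq_iff dest: spec[of _ t]\<close>)
    thus "X t \<in> borel_measurable (completion M)" by (rule AE_eq_borel_measurable_completion[OF _ Vt])
  qed
  assume f: "f \<in> borel_measurable cadlag_measure"
  have fV: "(\<lambda>\<omega>. f (V \<omega>)) \<in> borel_measurable M" by (rule measurable_compose[OF V f])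
  have ae: "AE \<omega> in M. f (sample_path X \<omega>) = f (V \<omega>)" using eq by eventually_elim simp
  have "(\<integral>\<omega>. f (sample_path X \<omega>) \<partial>completion M) = (\<integral>\<omega>. f (V \<omega>) \<partial>completion M)"
    by (rule integral_cong_AE[OF AE_eq_borel_measurable_completion[OF ae fV] measurable_completion[OF fV] AE_completion[OF ae]])
  thus "(\<integral>\<omega>. f (sample_path X \<omega>) \<partial>completion M) = (\<integral>\<omega>. f (V \<omega>) \<partial>M)" by (simp add: integral_completion[OF fV])
qed

text \<open>Each coordinate of the limit is almost everywhere a limit of measurable polygon
  coordinates. This spares a direct proof that the reflection composed with L is measurable.\<close>

lemma cadlag_process_limit:
  assumes v: "\<And>m. v m \<in> measurable N knot_algebra"
    and lim: "AE \<omega> in N. limitin U_topology (\<lambda>m. poly_path (v m \<omega>)) (sample_path X \<omega>) sequentially"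
  shows "cadlag_process N X"
  unfolding cadlag_process_def
proof (intro conjI allI impI)
  show "AE \<omega> in N. sample_path X \<omega> \<in> cadlag_space"
    using lim by eventually_elim (simp add: limitin_U_topology)
  fix t :: real assume t: "t \<ge> 0"
  have "(\<lambda>x. x t) \<in> borel_measurable cadlag_measure"
    unfolding cadlag_measure_def using t by (intro measurable_restrict_space1 measurable_component_singleton) simp
  hence vt: "(\<lambda>\<omega>. poly_path (v m \<omega>) t) \<in> borel_measurable N" for m
    by (rule measurable_compose[OF measurable_compose[OF v measurable_poly_path]])
  have "AE \<omega> in N. X t \<omega> = lim (\<lambda>m. poly_path (v m \<omega>) t)"
    using lim
  proof eventually_elim
    case (elim \<omega>)
    hence "uniform_limit {0..t} (\<lambda>m. poly_path (v m \<omega>)) (sample_path X \<omega>) sequentially"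
      using t by (simp add: limitin_U_topology)
    hence "(\<lambda>m. poly_path (v m \<omega>) t) \<longlonglongrightarrow> sample_path X \<omega> t" by (rule tendsto_uniform_limitI) (use t in simp)
    thus ?case using t by (simp add: limI sample_path_def)
  qed
  thus "X t \<in> borel_measurable (completion N)"
    by (rule AE_eq_borel_measurable_completion) (intro borel_measurable_lim_metric vt)
qed

context queue_limit
begin

lemma measurable_grid_knots: "(\<lambda>\<omega>. grid_knots K (Suc m) (\<lambda>s. S s \<omega>)) \<in> measurable N real_sequences"
  unfolding grid_knots_def by (intro measurable_PiM_single' borel_measurable_divide S_meas borel_measurable_const) auto

lemma cadlag_drift: "cadlag_process N (\<lambda>t \<omega>. d * L (K * t) \<omega>)"
proof (rule cadlag_process_limit)
  show "AE \<omega> in N. limitin U_topology (\<lambda>m. poly_path (\<lambda>i. d * (real i / real (Suc m)), grid_knots K (Suc m) (\<lambda>s. S s \<omega>)))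
     (sample_path (\<lambda>t \<omega>. d * L (K * t) \<omega>) \<omega>) sequentially"
    using inverse by eventually_elim (rule drift_limit[OF _ K], auto simp: sample_path_def)
qed (intro measurable_Pair measurable_grid_knots measurable_const, simp add: space_PiM)

lemma cadlag_reflected: "cadlag_process N (\<lambda>t \<omega>. skorokhod_reflection (\<lambda>s. W s \<omega>) (L (K * t) \<omega>))"
proof (rule cadlag_process_limit)
  have "AE \<omega> in N. continuous_on {0..} (\<lambda>t. W t \<omega>)" using W by (auto simp: standard_brownian_motion_def)
  thus "AE \<omega> in N. limitin U_topology (\<lambda>m. poly_path (reflected (\<lambda>i. W (real i / real (Suc m)) \<omega>), grid_knots K (Suc m) (\<lambda>s. S s \<omega>)))
     (sample_path (\<lambda>t \<omega>. skorokhod_reflection (\<lambda>s. W s \<omega>) (L (K * t) \<omega>)) \<omega>) sequentially"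
    using inverse by eventually_elim (rule reflected_limit[OF _ K], auto simp: sample_path_def)
qed (intro measurable_Pair measurable_grid_knots measurable_PiM_single' reflected_measurable W_meas, auto)

end

section \<open>The two kinds of clock\<close>

lemma (in prob_space) time_changed_limit_stable:
  assumes W: "standard_brownian_motion M W" and a: "0 < a" "a < 1"
    and L: "inverse_stable_subordinator M a L" and ind: "independent_processes M W L"
  shows "\<exists>S. time_changed_limit M W S L a"
proof -
  obtain S where S: "stable_subordinator M a S" "AE \<omega> in M. \<forall>t\<ge>0. L t \<omega> = (LEAST s. 0 \<le> s \<and> t \<le> S s \<omega>)"
    using L unfolding inverse_stable_subordinator_def by blast
  have levy: "levy_process M S" using S by (simp add: stable_subordinator_def)
  have Sm: "t \<ge> 0 \<Longrightarrow> S t \<in> borel_measurable M" for t using levy by (simp add: levy_process_def)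
  have "time_changed_limit M W S L a"
  proof
    show "AE \<omega> in M. inverse_pair (\<lambda>s. S s \<omega>) (\<lambda>t. L t \<omega>)"
      by (rule stable_inverse_pair[OF prob_space_axioms S(1) a(1) S(2)])
    fix h z :: real assume h: "0 \<le> h"
    show "distr M real_sequences (\<lambda>\<omega> i. S (real (Suc i) * h) \<omega> - S (real i * h) \<omega>) = Pi\<^sub>M UNIV (\<lambda>_. distr M borel (S h))"
    proof (rule grid_increments_distr[OF _ Sm _ h])
      show "independent_increments M S" using levy by (simp add: levy_process_def)
      show "distr M borel (\<lambda>\<omega>. S (real (Suc i) * h) \<omega> - S (real i * h) \<omega>) = distr M borel (S h)" for i
      proof -
        have "distr M borel (\<lambda>\<omega>. S (real i * h + h) \<omega> - S (real i * h) \<omega>) = distr M borel (S h)"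
          using levy h unfolding levy_process_def by (meson mult_nonneg_nonneg of_nat_0_le_iff)
        thus ?thesis by (simp add: algebra_simps)
      qed
    qed
    show "z \<ge> 0 \<Longrightarrow> expectation (\<lambda>\<omega>. exp (- z * S h \<omega>)) = exp (- h * z powr a)"
      using S(1) h by (auto simp: stable_subordinator_def)
  qed (use W Sm ind in auto)
  thus ?thesis by blast
qed

lemma (in prob_space) time_changed_limit_identity:
  assumes W: "standard_brownian_motion M W" and L: "\<And>t \<omega>. t \<ge> 0 \<Longrightarrow> \<omega> \<in> space M \<Longrightarrow> L t \<omega> = t"
  shows "time_changed_limit M W (\<lambda>t _. t) L 1"
proof
  have Wm: "t \<ge> 0 \<Longrightarrow> W t \<in> borel_measurable M" for t using W by (simp add: standard_brownian_motion_def)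
  have Lm: "t \<ge> 0 \<Longrightarrow> L t \<in> borel_measurable M" for t
    using L by (subst measurable_cong[where g="\<lambda>_. t"]) auto
  show "independent_processes M W L" unfolding independent_processes_def indep_var_def
  proof (rule indep_vars_all_but_one_constant[where ?i0.0=True and c="\<lambda>_. \<lambda>t\<in>{0..}. t"])
    show "random_variable (case_bool (Pi\<^sub>M {0..} (\<lambda>_. borel)) (Pi\<^sub>M {0..} (\<lambda>_. borel)) b) (case_bool (sample_path W) (sample_path L) b)" for b
      using Wm Lm by (cases b) (auto simp: sample_path_def[abs_def] intro!: measurable_restrict)
    show "b \<noteq> True \<Longrightarrow> \<forall>\<omega>\<in>space M. case_bool (sample_path W) (sample_path L) b \<omega> = (\<lambda>t\<in>{0..}. t)" for b
      using L by (cases b) (auto simp: sample_path_def restrict_def)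
  qed
  show "AE \<omega> in M. inverse_pair (\<lambda>s. s) (\<lambda>t. L t \<omega>)"
  proof (rule AE_I2)
    fix \<omega> assume "\<omega> \<in> space M"
    hence "L t \<omega> = t" if "t \<ge> 0" for t using L that by simp
    thus "inverse_pair (\<lambda>s. s) (\<lambda>t. L t \<omega>)"
      unfolding inverse_pair_def by (auto simp: strict_mono_on_def intro!: exI[of _ "Suc _"])
  qed
  fix h z :: real assume h: "h \<ge> 0"
  show "distr M real_sequences (\<lambda>\<omega> i. real (Suc i) * h - real i * h) = Pi\<^sub>M UNIV (\<lambda>_. distr M borel (\<lambda>_. h))"
  proof (rule grid_increments_distr[OF _ _ _ h])
    show "independent_increments M (\<lambda>t _. t)" unfolding independent_increments_def
      by (intro allI impI indep_vars_all_but_one_constant[where ?i0.0=0 and c="\<lambda>i. _ (Suc i) - _ i"]) auto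
  qed (simp_all add: algebra_simps)
  show "z \<ge> 0 \<Longrightarrow> expectation (\<lambda>\<omega>. exp (- z * h)) = exp (- h * z powr 1)"
    using prob_space by (simp add: mult.commute)
qed (use W in auto)

theorem theorem3p3:
  fixes \<alpha> \<beta> lam mu p :: real
    and P :: "'c measure" and X1 X2 :: "'c \<Rightarrow> real"
    and M :: "'a measure" and q :: "nat \<Rightarrow> 'a \<Rightarrow> nat" and Y :: "nat \<Rightarrow> 'a \<Rightarrow> real"
    and N :: "'b measure" and W L :: "real \<Rightarrow> 'b \<Rightarrow> real"
  assumes orders: "0 < \<alpha>" "\<alpha> < 1" "0 < \<beta>" "\<beta> < 1"
    and rates: "0 < lam" "0 < mu"
    and X: "prob_space P" "mittag_leffler_distributed P X1 \<alpha> lam" "mittag_leffler_distributed P X2 \<beta> mu"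
           "prob_space.indep_var P borel X1 borel X2"
    and p: "p = \<P>(\<omega> in P. X1 \<omega> < X2 \<omega>)"
    and queue: "prob_space M" "fast_renewal_ML_queue M \<alpha> \<beta> lam mu p q Y"
    and W: "prob_space N" "standard_brownian_motion N W"
    and L_less: "\<alpha> + \<beta> < 1 \<Longrightarrow>
           inverse_stable_subordinator N (\<alpha> + \<beta>) L \<and> independent_processes N W L"
    and L_ge: "\<alpha> + \<beta> \<ge> 1 \<Longrightarrow> \<forall>t\<ge>0. \<forall>\<omega>\<in>space N. L t \<omega> = t"
  defines "Q \<equiv> scaled_queue M \<alpha> \<beta> lam mu q Y"
    and "K \<equiv> limit_rate M \<alpha> \<beta> lam mu Y"
  shows "(p > 1 / 2 \<longrightarrow>
            converges_in_distribution_U M (Q 1) N (\<lambda>t \<omega>. (2 * p - 1) * L (K * t) \<omega>)) \<and>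
         (p = 1 / 2 \<longrightarrow>
            converges_in_distribution_U M (Q (1 / 2)) N
              (\<lambda>t \<omega>. skorokhod_reflection (\<lambda>s. W s \<omega>) (L (K * t) \<omega>))) \<and>
         (p < 1 / 2 \<longrightarrow>
            (\<forall>\<delta>>0. AE \<omega> in M. \<forall>T\<ge>0.
               (\<lambda>n. SUP t\<in>{0..T}. ereal (Q \<delta> n t \<omega>)) \<longlonglongrightarrow> 0))"
proof -
  interpret M: prob_space M by (rule queue)
  interpret N: prob_space N by (rule W)
  interpret P: prob_space P by (rule X)
  have p01: "0 \<le> p" "p \<le> 1" by (simp_all add: p)
  note law = M.queue_law[OF queue(2) p01]
  have Y1[measurable]: "Y 1 \<in> borel_measurable M" by (rule law(2)) simp
  hence [measurable]: "Y (Suc 0) \<in> borel_measurable M" by simp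
  define c where "c n = real n * time_scale M \<alpha> \<beta> lam mu Y n" for n
  have tail: "\<P>(\<omega> in M. Y 1 \<omega> > t) = mittag_leffler \<alpha> (- lam * t powr \<alpha>) * mittag_leffler \<beta> (- mu * t powr \<beta>)"
    if "t \<ge> 0" for t using queue(2) that unfolding fast_renewal_ML_queue_def by blast
  have exponent: "AE \<omega> in M. Y 1 \<omega> > 0" "K > 0" "\<forall>\<^sub>F n in sequentially. c n > 0"
    "\<And>z. z > 0 \<Longrightarrow> (\<lambda>n. real n * (1 - M.expectation (\<lambda>\<omega>. exp (- (z / c n) * Y 1 \<omega>)))) \<longlonglongrightarrow> (z / K) powr min 1 (\<alpha> + \<beta>)"
    "\<exists>D A. \<forall>n. c n \<le> D * real n ^ A"
    using M.interarrival_laplace_exponent[where Y=Y, OF X(1-3) orders rates Y1 tail] unfolding K_def c_def by blast+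
  \<comment> \<open>c n may fail to be positive for small n, and c 0 = 0; the canonical queue asks
    for positivity at every index, and finitely many patched values leave the limits
    unchanged.\<close>
  define c' where "c' n = (if c n > 0 then c n else 1)" for n
  define \<kappa> where "\<kappa> = min 1 (\<alpha> + \<beta>)"
  define \<mu> where "\<mu> = distr M borel (Y 1)"
  interpret C: canonical_queue p \<mu> c' K \<kappa>
  proof (rule canonical_queue.intro)
    show "real_distribution \<mu>" unfolding \<mu>_def by (rule M.real_distribution_distr[OF Y1])
    show "AE x in \<mu>. x > 0" unfolding \<mu>_def using exponent(1) by (subst AE_distr_iff) auto
    show "c' n > 0" for n by (simp add: c'_def)
    show "\<kappa> > 0" using orders by (simp add: \<kappa>_def)
    fix z :: real assume z: "z > 0"
    have "\<forall>\<^sub>F n in sequentially. real n * (1 - M.expectation (\<lambda>\<omega>. exp (- (z / c n) * Y 1 \<omega>)))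
        = real n * (1 - (\<integral>x. exp (- (z / c' n) * x) \<partial>\<mu>))"
      using exponent(3) by eventually_elim (simp add: \<mu>_def c'_def integral_distr)
    thus "(\<lambda>n. real n * (1 - (\<integral>x. exp (- (z / c' n) * x) \<partial>\<mu>))) \<longlonglongrightarrow> (z / K) powr \<kappa>"
      by (rule Lim_transform_eventually[OF exponent(4)[OF z, folded \<kappa>_def]])
  qed (use p01 exponent(2) in auto)
  define U where "U \<omega> = (\<lambda>k. q k \<omega>, \<lambda>k. Y (Suc k) \<omega>)" for \<omega>
  have U: "U \<in> measurable M queue_algebra" using law(3) by (simp add: U_def[abs_def])
  have lawU: "distr M queue_algebra U = distr C.canonical queue_algebra (\<lambda>x. (coin_chain (fst x), snd x))"
    unfolding C.distr_chain_jumps unfolding U_def[abs_def] \<mu>_def by (rule law(4))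
  \<comment> \<open>Tail bounds proved on the product space are carried to the given space through
    the common law of \<open>U\<close>.\<close>
  have transfer: "M.prob {\<omega>\<in>space M. R (U \<omega>)} = C.P.prob {x\<in>space C.canonical. R (coin_chain (fst x), snd x)}"
    if R: "Measurable.pred queue_algebra R" for R
  proof -
    define S where "S = {u\<in>space queue_algebra. R u}"
    have S: "S \<in> sets queue_algebra" unfolding S_def using R by (rule predE)
    have "{\<omega>\<in>space M. R (U \<omega>)} = U -` S \<inter> space M" using measurable_space[OF U] by (auto simp: S_def)
    hence "M.prob {\<omega>\<in>space M. R (U \<omega>)} = measure (distr M queue_algebra U) S" by (simp add: measure_distr[OF U S])
    also have "\<dots> = C.P.prob ((\<lambda>x. (coin_chain (fst x), snd x)) -` S \<inter> space C.canonical)"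
      unfolding lawU by (rule measure_distr[OF C.measurable_chain_jumps S])
    also have "(\<lambda>x. (coin_chain (fst x), snd x)) -` S \<inter> space C.canonical = {x\<in>space C.canonical. R (coin_chain (fst x), snd x)}"
      using measurable_space[OF C.measurable_chain_jumps] by (auto simp: S_def)
    finally show ?thesis .
  qed
  have good: "AE \<omega> in M. good_knots (partial_sums (\<lambda>k. Y (Suc k) \<omega>))"
  proof -
    have "AE u in distr C.canonical queue_algebra (\<lambda>x. (coin_chain (fst x), snd x)). good_knots (partial_sums (snd u))"
      using C.AE_canonical_good by (subst AE_distr_iff[OF C.measurable_chain_jumps]) auto
    thus ?thesis unfolding lawU[symmetric] by (subst (asm) AE_distr_iff[OF U]) (auto simp: U_def)
  qed
  have Qeq: "Q \<delta> n t \<omega> = real n powr (- \<delta>) * real (q (arrivals (\<lambda>k. Y (Suc k) \<omega>) (c n * t)) \<omega>)" for \<delta> n t \<omega>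
    by (simp add: Q_def scaled_queue_def queue_length_def renewal_count_eq_arrivals c_def)
  have path: "AE \<omega> in M. sample_path (Q \<delta> n) \<omega> = renewal_path (real n powr (- \<delta>)) (c n) (U \<omega>)" for \<delta> n
    using good by eventually_elim (auto simp: sample_path_def renewal_path_def U_def Qeq)
  have converges: "converges_in_distribution_U M (Q \<delta>) N Z"
    if d: "\<And>n. d n = real n powr (- \<delta>)" and Z: "cadlag_process N Z"
      and lim: "\<And>f. continuous_map U_topology euclideanreal f \<Longrightarrow> f \<in> borel_measurable cadlag_measure \<Longrightarrow> bounded (f ` cadlag_space) \<Longrightarrow>
        (\<lambda>n. \<integral>x. f (C.queue_path (d n) n x) \<partial>C.canonical) \<longlonglongrightarrow> (\<integral>\<omega>. f (sample_path Z \<omega>) \<partial>completion N)"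
    for \<delta> d Z
    unfolding converges_in_distribution_U_def
  proof (intro conjI allI impI Z)
    have V: "(\<lambda>\<omega>. renewal_path (real n powr (- \<delta>)) (c n) (U \<omega>)) \<in> measurable M cadlag_measure" if "c n > 0" for n
      by (rule measurable_compose[OF U measurable_renewal_path[OF that]])
    show "\<forall>\<^sub>F n in sequentially. cadlag_process M (Q \<delta> n)"
      using exponent(3) by eventually_elim (rule M.almost_cadlag_variable(1)[OF V path])
    fix f :: "(real \<Rightarrow> real) \<Rightarrow> real"
    assume f: "continuous_map U_topology euclideanreal f" "f \<in> borel_measurable cadlag_measure" "bounded (f ` cadlag_space)"
    have "\<forall>\<^sub>F n in sequentially. (\<integral>x. f (C.queue_path (d n) n x) \<partial>C.canonical) = (\<integral>\<omega>. f (sample_path (Q \<delta> n) \<omega>) \<partial>completion M)"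
      using exponent(3)
    proof eventually_elim
      case (elim n)
      have fr: "(\<lambda>u. f (renewal_path (d n) (c n) u)) \<in> borel_measurable queue_algebra"
        by (rule measurable_compose[OF measurable_renewal_path[OF elim] f(2)])
      have "(\<integral>\<omega>. f (sample_path (Q \<delta> n) \<omega>) \<partial>completion M) = (\<integral>\<omega>. f (renewal_path (d n) (c n) (U \<omega>)) \<partial>M)"
        using M.almost_cadlag_variable(2)[OF V[OF elim] path f(2)] by (simp add: d)
      also have "\<dots> = (\<integral>u. f (renewal_path (d n) (c n) u) \<partial>distr M queue_algebra U)" by (rule integral_distr[OF U fr, symmetric])
      also have "\<dots> = (\<integral>x. f (renewal_path (d n) (c n) (coin_chain (fst x), snd x)) \<partial>C.canonical)"
        unfolding lawU by (rule integral_distr[OF C.measurable_chain_jumps fr])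
      finally show ?case using elim by (simp add: C.queue_path_def c'_def)
    qed
    thus "(\<lambda>n. \<integral>\<omega>. f (sample_path (Q \<delta> n) \<omega>) \<partial>completion M) \<longlonglongrightarrow> (\<integral>\<omega>. f (sample_path Z \<omega>) \<partial>completion N)"
      by (rule Lim_transform_eventually[OF lim[OF f]])
  qed
  have "\<exists>S. time_changed_limit N W S L \<kappa>"
  proof (cases "\<alpha> + \<beta> < 1")
    case True
    thus ?thesis using N.time_changed_limit_stable[OF W(2) _ True] L_less orders by (auto simp: \<kappa>_def)
  next
    case False
    thus ?thesis using N.time_changed_limit_identity[OF W(2), of L] L_ge by (auto simp: \<kappa>_def)
  qed
  then obtain S where "time_changed_limit N W S L \<kappa>" ..
  then interpret T: time_changed_limit N W S L \<kappa> .
  interpret QL: queue_limit p \<mu> c' K \<kappa> N W S L ..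
  show ?thesis
  proof (intro conjI impI allI)
    assume ph: "p > 1 / 2"
    show "converges_in_distribution_U M (Q 1) N (\<lambda>t \<omega>. (2 * p - 1) * L (K * t) \<omega>)"
    proof (rule converges[OF _ QL.cadlag_drift])
      show "(\<lambda>n. \<integral>x. f (C.queue_path (1 / real n) n x) \<partial>C.canonical) \<longlonglongrightarrow>
          (\<integral>\<omega>. f (sample_path (\<lambda>t \<omega>. (2 * p - 1) * L (K * t) \<omega>) \<omega>) \<partial>completion N)"
        if "continuous_map U_topology euclideanreal f" "f \<in> borel_measurable cadlag_measure" "bounded (f ` cadlag_space)" for f
        unfolding sample_path_def by (rule QL.drift_convergence[OF less_imp_le[OF ph] that])
    qed (simp add: powr_minus_divide)
  next
    assume ph: "p = 1 / 2"
    show "converges_in_distribution_U M (Q (1 / 2)) N (\<lambda>t \<omega>. skorokhod_reflection (\<lambda>s. W s \<omega>) (L (K * t) \<omega>))"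
    proof (rule converges[OF _ QL.cadlag_reflected])
      show "(\<lambda>n. \<integral>x. f (C.queue_path (1 / sqrt (real n)) n x) \<partial>C.canonical) \<longlonglongrightarrow>
          (\<integral>\<omega>. f (sample_path (\<lambda>t \<omega>. skorokhod_reflection (\<lambda>s. W s \<omega>) (L (K * t) \<omega>)) \<omega>) \<partial>completion N)"
        if "continuous_map U_topology euclideanreal f" "f \<in> borel_measurable cadlag_measure" "bounded (f ` cadlag_space)" for f
        unfolding sample_path_def by (rule QL.critical_convergence[OF ph that])
    qed (simp add: powr_minus_divide powr_half_sqrt)
  next
    fix \<delta> :: real assume ph: "p < 1 / 2" and \<delta>: "\<delta> > 0"
    obtain C x where C: "C > 0" "x > 1" "\<And>k a. measure (coin_space p) {w. real (coin_chain w k) \<ge> a} \<le> C * x powr (- a)"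
      using coin_chain_tail[OF p01(1) ph] by blast
    obtain D A where DA: "\<And>n. c n \<le> D * real n ^ A" using exponent(5) by blast
    \<comment> \<open>The maximum with 1/2 secures 0 < \<rho>; enlarging the Laplace value only
      weakens the Chernoff bound.\<close>
    define \<rho> where "\<rho> = max (1 / 2) (\<integral>t. exp (- 1 * t) \<partial>\<mu>)"
    have "AE \<omega> in M. \<forall>T\<ge>0. (\<lambda>n. SUP t\<in>{0..T}. ereal (real n powr (- \<delta>) * real (q (arrivals (\<lambda>k. Y (Suc k) \<omega>) (c n * t)) \<omega>))) \<longlonglongrightarrow> 0"
    proof (rule M.scaled_queue_vanishes[OF law(1) law(2) good C(1,2) _ _ _ _ exponent(3) DA \<delta>])
      show "M.prob {\<omega>\<in>space M. a \<le> real (q k \<omega>)} \<le> C * x powr (- a)" for k a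
        using transfer[of "\<lambda>u. a \<le> real (fst u k)"] C.P.measure_fst_pred[of "\<lambda>w. a \<le> real (coin_chain w k)"] C(3)
        by (simp add: U_def)
      show "0 < \<rho>" "\<rho> < 1" using C.laplace_less_1 by (auto simp: \<rho>_def)
      show "M.prob {\<omega>\<in>space M. partial_sums (\<lambda>k. Y (Suc k) \<omega>) k \<le> t} \<le> exp t * \<rho> ^ k" for k t
      proof -
        have "Measurable.pred queue_algebra (\<lambda>u. partial_sums (snd u) k \<le> t)" unfolding partial_sums_def by measurable
        from transfer[OF this] C.P.measure_snd_pred[of "\<lambda>y. partial_sums y k \<le> t"]
        have "M.prob {\<omega>\<in>space M. partial_sums (\<lambda>k. Y (Suc k) \<omega>) k \<le> t} = C.J.prob {y. partial_sums y k \<le> t}"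
          by (simp add: U_def)
        also have "\<dots> \<le> exp (1 * t) * (\<integral>t. exp (- 1 * t) \<partial>\<mu>) ^ k" by (rule C.partial_sums_lower_tail) simp
        also have "\<dots> \<le> exp t * \<rho> ^ k"
          using C.laplace_bounds(1)[of 1] by (auto simp: \<rho>_def intro!: power_mono)
        finally show ?thesis .
      qed
    qed auto
    thus "AE \<omega> in M. \<forall>T\<ge>0. (\<lambda>n. SUP t\<in>{0..T}. ereal (Q \<delta> n t \<omega>)) \<longlonglongrightarrow> 0" by (simp only: Qeq)
  qed
qed

end
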